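(* Let $k$ be a number field of degree $d>1$ with ring of integers $\mathfrak{o}$. Let $\mathfrak{n}\subset\mathfrak{o}$ be a nonzero ideal, and let $m\in\{1,\dotsc,d\}$. For any $m$-element subsets $X\subset\mathfrak{n}$ and $S\subset\Sigma$, the rational integer $$\prod_{g\in G}{\det}^2(\sigma(x))^{\sigma\in gS}_{x\in X}$$ is divisible by $$\Delta_{\mathrm{tame}}^{|G|\max\left(0,\frac{2m}{d}-1\right)}\,[\mathfrak{o}:\mathfrak{n}]^{|G|\frac{2m}{d}}.$$ If $G$ is $2$-homogeneous, then the exponent of $\Delta_{\mathrm{tame}}$ can be improved to $|G|\frac{m(m-1)}{d(d-1)}$; that is, the product is then divisible by $\Delta_{\mathrm{tame}}^{|G|\frac{m(m-1)}{d(d-1)}}[\mathfrak{o}:\mathfrak{n}]^{|G|\frac{2m}{d}}$.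
   Context: $\Sigma=\mathrm{Hom}(k,\overline{\mathbb{Q}})$ is the set of $d$ embeddings of $k$ into $\overline{\mathbb{Q}}$. $K$ is the compositum of the fields $\sigma(k)$ for $\sigma\in\Sigma$ (a finite Galois extension of $\mathbb{Q}$), and $G=\mathrm{Gal}(K/\mathbb{Q})$, which acts transitively and faithfully on $\Sigma$ by composition; $gS=\{g\circ\sigma:\sigma\in S\}$. $G$ is called $2$-homogeneous if it acts transitively on the set of $2$-element subsets of $\Sigma$. For finite sets $T\subset\Sigma$ and $X\subset k$ of equal size, $(\sigma(x))^{\sigma\in T}_{x\in X}$ is the square matrix with rows indexed by $\sigma\in T$ and columns indexed by $x\in X$; its determinant is defined only up to sign (no ordering of $T$ and $X$ is specified), but its square ${\det}^2(\sigma(x))^{\sigma\in T}_{x\in X}$ is well defined. For a nonzero prime ideal $\mathfrak{p}\subset\mathfrak{o}$ dividing a rational prime $p$, let $f_{\mathfrak{p}}$ be the inertia degree of $k_{\mathfrak{p}}/\mathbb{Q}_p$. The tame discriminant is the positive integer $$\Delta_{\mathrm{tame}}:=\prod_p p^{d-f_p}\quad\text{with}\quad f_p:=\sum_{\mathfrak{p}\mid p}f_{\mathfrak{p}},$$ where $p$ runs over the rational primes (only ramified primes contribute nontrivially). All exponents in the claim are nonnegative integers. Divisibility is in $\mathbb{Z}$ (zero is divisible by every integer). *)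

theory Defs
  imports
    "HOL-Algebra.Embedded_Algebras"
    "HOL-Algebra.Generated_Fields"
    "HOL-Algebra.QuotRing"
    "HOL-Algebra.Algebraic_Closure_Type"
    "HOL-Computational_Algebra.Primes"
    "Jordan_Normal_Form.Determinant"
begin

(* otherwise X is unusable as a variable name *)
no_notation var (\<open>X\<index>\<close>)

section \<open>Number fields and their rings of integers\<close>

definition number_field :: "'k::field_char_0 itself \<Rightarrow> bool" where
  "number_field _ \<longleftrightarrow> (\<exists>B::'k set. finite B \<and> module.span (\<lambda>q x. of_rat q * x) B = UNIV)"

definition field_degree :: "'k::field_char_0 itself \<Rightarrow> nat" where
  "field_degree _ = vector_space.dim (\<lambda>q x. of_rat q * x) (UNIV :: 'k set)"

definition ring_of_integers :: "'k::field_char_0 ring" where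
  "ring_of_integers = ring_of_type_algebra\<lparr>carrier := {x. algebraic_int x}\<rparr>"

definition ideal_index :: "'k::field_char_0 set \<Rightarrow> nat" where
  "ideal_index I = card (a_rcosets\<^bsub>ring_of_integers\<^esub> I)"


section \<open>The tame discriminant\<close>

definition primes_above :: "nat \<Rightarrow> 'k::field_char_0 set set" where
  "primes_above p = {P. primeideal P ring_of_integers \<and> of_nat p \<in> P}"

text \<open>
  The inertia degree of \<open>P\<close> is the degree of its residue field over the image of the
  integers, which is the prime field. (The residue field of the completion at \<open>P\<close>
  is canonically the same.)
\<close>

definition inertia_degree :: "'k::field_char_0 set \<Rightarrow> nat" where
  "inertia_degree P =
     (let F = ring_of_integers Quot P
      in ring.dim F (range (\<lambda>z::int. P +>\<^bsub>ring_of_integers\<^esub> of_int z)) (carrier F))"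

definition inertia_sum :: "'k::field_char_0 itself \<Rightarrow> nat \<Rightarrow> nat" where
  "inertia_sum _ p = (\<Sum>P\<in>(primes_above p :: 'k set set). inertia_degree P)"

text \<open>
  The product is restricted to the finitely many primes (a subset of the ramified ones) whose
  factor can differ from \<open>1\<close>, because a product over an infinite index set is \<open>1\<close> by convention.
  The subtraction does not truncate, since \<open>inertia_sum\<close> never exceeds the degree.
\<close>

definition tame_discriminant :: "'k::field_char_0 itself \<Rightarrow> nat" where
  "tame_discriminant k =
     (\<Prod>p | prime p \<and> inertia_sum k p \<noteq> field_degree k. p ^ (field_degree k - inertia_sum k p))"


section \<open>Embeddings and the Galois group\<close>

definition embeddings :: "('k::field_char_0 \<Rightarrow> rat alg_closure) set" where
  "embeddings = Ring.ring_hom ring_of_type_algebra ring_of_type_algebra"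

definition compositum :: "'k::field_char_0 itself \<Rightarrow> rat alg_closure set" where
  "compositum _ =
     generate_field ring_of_type_algebra (\<Union>\<sigma>\<in>(embeddings :: ('k \<Rightarrow> rat alg_closure) set). range \<sigma>)"

text \<open>
  Automorphisms of the compositum are represented by extensional functions (equal to
  \<^const>\<open>undefined\<close> off the compositum), so that each automorphism is counted once.
\<close>

definition galois_group :: "'k::field_char_0 itself \<Rightarrow> (rat alg_closure \<Rightarrow> rat alg_closure) set" where
  "galois_group k =
     (let K = ring_of_type_algebra\<lparr>carrier := compositum k\<rparr>
      in {g \<in> ring_iso K K \<inter> extensional (compositum k). \<forall>q\<in>\<rat>. g q = q})"

definition act :: "(rat alg_closure \<Rightarrow> rat alg_closure) \<Rightarrow>
    ('k::field_char_0 \<Rightarrow> rat alg_closure) set \<Rightarrow> ('k \<Rightarrow> rat alg_closure) set" where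
  "act g S = (\<lambda>\<sigma>. g \<circ> \<sigma>) ` S"

definition two_homogeneous :: "'k::field_char_0 itself \<Rightarrow> bool" where
  "two_homogeneous k \<longleftrightarrow>
     (\<forall>A B. A \<subseteq> (embeddings :: ('k \<Rightarrow> rat alg_closure) set) \<and> card A = 2 \<and>
            B \<subseteq> embeddings \<and> card B = 2 \<longrightarrow> (\<exists>g\<in>galois_group k. act g A = B))"


section \<open>Squared determinants\<close>

definition embedding_matrix :: "('a \<Rightarrow> 'b) list \<Rightarrow> 'a list \<Rightarrow> 'b mat" where
  "embedding_matrix ts xs = mat (length ts) (length xs) (\<lambda>(i, j). (ts ! i) (xs ! j))"

definition det_sq :: "('a \<Rightarrow> 'b::comm_ring_1) set \<Rightarrow> 'a set \<Rightarrow> 'b" where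
  "det_sq T X =
     (THE D. \<exists>ts xs. distinct ts \<and> set ts = T \<and> distinct xs \<and> set xs = X \<and>
                     D = (det (embedding_matrix ts xs))\<^sup>2)"

lemma det_embedding_matrix_permute:
  fixes ts :: "('a \<Rightarrow> 'b::comm_ring_1) list"
  assumes "mset ts' = mset ts" "length ts = length xs"
  shows "(det (embedding_matrix ts' xs))\<^sup>2 = (det (embedding_matrix ts xs))\<^sup>2"
proof -
  obtain p where p: "p permutes {..<length ts}" "permute_list p ts = ts'"
    using mset_eq_permutation[OF assms(1)] by blast
  define n where "n = length ts"
  have p': "p permutes {0..<n}" using p(1) by (simp add: n_def lessThan_atLeast0)
  have A: "embedding_matrix ts xs \<in> carrier_mat n n"
    using assms by (simp add: embedding_matrix_def n_def)
  have lt: "p i < n" if "i < n" for i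
    using permutes_in_image[OF p'] that by simp
  have nth: "ts' ! i = ts ! p i" if "i < n" for i
    using p that permute_list_nth[OF p(1)] by (simp add: n_def)
  have len: "length ts' = n" "length xs = n"
    using mset_eq_length[OF assms(1)] assms(2) by (simp_all add: n_def)
  have "embedding_matrix ts' xs = mat n n (\<lambda>(i, j). embedding_matrix ts xs $$ (p i, j))"
    by (rule eq_matI) (auto simp: embedding_matrix_def len nth lt n_def[symmetric])
  then have "det (embedding_matrix ts' xs) = signof p * det (embedding_matrix ts xs)"
    using det_permute_rows[OF A p'] by simp
  moreover have "(signof p :: 'b)\<^sup>2 = 1"
    by (cases p rule: sign_cases) simp_all
  ultimately show ?thesis by (simp add: power_mult_distrib)
qed

lemma det_embedding_matrix_transpose:
  fixes ts :: "('a \<Rightarrow> 'b::comm_ring_1) list"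
  assumes "length ts = length xs"
  shows "det (embedding_matrix (map (\<lambda>x t. t x) xs) ts) = det (embedding_matrix ts xs)"
proof -
  have A: "embedding_matrix ts xs \<in> carrier_mat (length ts) (length ts)"
    using assms by (simp add: embedding_matrix_def)
  have "embedding_matrix (map (\<lambda>x t. t x) xs) ts = transpose_mat (embedding_matrix ts xs)"
    by (rule eq_matI) (auto simp: embedding_matrix_def assms)
  then show ?thesis using det_transpose[OF A] by simp
qed

lemma det_sq_eq:
  fixes ts :: "('a \<Rightarrow> 'b::comm_ring_1) list"
  assumes "distinct ts" "distinct xs" "length ts = length xs"
  shows "det_sq (set ts) (set xs) = (det (embedding_matrix ts xs))\<^sup>2"
  unfolding det_sq_def
proof (rule the_equality)
  fix D
  assume "\<exists>ts' xs'. distinct ts' \<and> set ts' = set ts \<and> distinct xs' \<and> set xs' = set xs \<and>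
            D = (det (embedding_matrix ts' xs'))\<^sup>2"
  then obtain ts' xs' where *: "mset ts' = mset ts" "mset xs' = mset xs"
      "D = (det (embedding_matrix ts' xs'))\<^sup>2"
    using assms by (metis set_eq_iff_mset_eq_distinct)
  have len: "length ts' = length ts" "length xs' = length xs"
    using * by (metis mset_eq_length)+
  have "D = (det (embedding_matrix ts xs'))\<^sup>2"
    using det_embedding_matrix_permute[of ts' ts xs'] * len assms by simp
  also have "\<dots> = (det (embedding_matrix (map (\<lambda>x t. t x) xs') ts))\<^sup>2"
    using det_embedding_matrix_transpose[of ts xs'] len assms by simp
  also have "\<dots> = (det (embedding_matrix (map (\<lambda>x t. t x) xs) ts))\<^sup>2"
    by (rule det_embedding_matrix_permute) (use * assms in simp_all)
  also have "\<dots> = (det (embedding_matrix ts xs))\<^sup>2"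
    using det_embedding_matrix_transpose[of ts xs] assms by simp
  finally show "D = (det (embedding_matrix ts xs))\<^sup>2" .
qed (use assms in blast)

end

theory Submission
  imports Defs "Jordan_Normal_Form.Char_Poly" "HOL-Algebra.Sylow"
begin

text \<open>
  Fix a prime \<open>p\<close> and a valuation ring of the algebraic numbers above it. Every embedding \<open>\<sigma>\<close> then lies
  above a prime \<open>\<pp>\<close> of \<open>k\<close>, and there are \<open>e f\<close> embeddings above \<open>\<pp>\<close>, where \<open>e\<close> and \<open>f\<close> are the ramification
  index and the inertia degree. They fall into at most \<open>f\<close> classes of embeddings that agree modulo the
  maximal ideal. Locally \<open>\<nn>\<close> is generated by some \<open>y\<close>, so that the factors \<open>\<sigma>(y)\<close> can be extracted from
  the rows of the determinant; they account for the power of \<open>[\<oo>:\<nn>]\<close>. The remaining entries \<open>\<sigma>(x)\<close> have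
  expansions in powers of \<open>\<sigma>(w)\<close>, for a uniformizer \<open>w\<close>, whose coefficients depend only on the class of \<open>\<sigma>\<close>
  (up to a high power of \<open>p\<close>). By multilinearity \<open>t\<close> rows of one class contribute at least
  \<open>0 + 1 + \<dots> + (t - 1) = t(t - 1)/2\<close> powers of \<open>w\<close>.

  It remains to average over the Galois group. In general \<open>t(t - 1) \<ge> (e - 1)(2t - e)\<close>, which is linear in
  \<open>t\<close>, so that transitivity determines the average of the right-hand side. If the group is
  2-homogeneous, the average of \<open>t(t - 1)/2\<close> itself is the proportion of pairs within a class, and the
  same inequality applied to the sizes \<open>t\<close> of the classes above \<open>\<pp>\<close>, which add up to \<open>e f\<close>, bounds
  the number of these pairs from below.
\<close>

subsection \<open>Rational polynomials and primitive elements\<close>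

text \<open>The determinants live in \<open>rat alg_closure\<close>, so one valuation ring
  \<open>V\<close> there is kept fixed and the embeddings vary; the primes of \<open>'k\<close>
  above p appear as the different preimages of its maximal ideal. The obstacle is that
  \<open>V\<close> is neither discrete nor complete. Values are therefore compared through
  divisibility in \<open>V\<close>, in fractions with the common denominator \<open>EE\<close>, and
  expansions are cut off modulo a power of p fixed in advance by the bound to be proved. In a
  complete ring Teichmueller representatives would serve as digits that congruent embeddings send to
  the same value. Here p^N-th powers imitate them, since p-th powers sharpen a congruence modulo the
  maximal ideal into one modulo a high power of p. This treats wild and tame ramification alike,
  which is why every prime enters through e - 1. Counts such as e f come from squeezing: vectors
  independent modulo p are compared with the degree, and embeddings with the linear conditions on
  their relations. Every p has its own \<open>V\<close>; the results are combined through
  multiplicities, after the product has been recognized as an integer.\<close>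

interpretation of_rat_poly_hom: map_poly_inj_idom_hom "of_rat :: rat \<Rightarrow> 'a::field_char_0" ..

text \<open>Polynomials keep rational coefficients and are evaluated in any field of characteristic
  zero, so that the same polynomial can be tested in \<open>'k\<close> and in
  \<open>rat alg_closure\<close>.\<close>

definition rpoly :: "rat poly \<Rightarrow> 'a::field_char_0 \<Rightarrow> 'a" where
  "rpoly p x = poly (map_poly of_rat p) x"

lemma rpoly_simps [simp]:
  "rpoly 0 x = 0" "rpoly 1 x = 1" "rpoly (p + q) x = rpoly p x + rpoly q x"
  "rpoly (p - q) x = rpoly p x - rpoly q x" "rpoly (p * q) x = rpoly p x * rpoly q x"
  "rpoly (- p) x = - rpoly p x" "rpoly (pCons a p) x = of_rat a + x * rpoly p x"
  "rpoly (Polynomial.monom a n) x = of_rat a * x ^ n" "rpoly (Polynomial.smult a p) x = of_rat a * rpoly p x"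
  by (simp_all add: rpoly_def of_rat_poly_hom.hom_add of_rat_poly_hom.hom_minus of_rat_poly_hom.hom_mult
      of_rat_poly_hom.hom_uminus of_rat_hom.map_poly_pCons_hom of_rat_hom.map_poly_hom_smult poly_monom)

lemma rpoly_altdef: "rpoly p x = (\<Sum>i\<le>Polynomial.degree p. of_rat (Polynomial.coeff p i) * x ^ i)"
  by (simp add: rpoly_def poly_altdef degree_map_poly coeff_map_poly)

lemma rpoly_mod: assumes "rpoly f x = 0" shows "rpoly (g mod f) x = rpoly g x"
proof -
  have "rpoly g x = rpoly (g div f * f + g mod f) x" by simp
  thus ?thesis unfolding rpoly_simps using assms by simp
qed

section \<open>Subfields of a field and their embeddings\<close>

definition subfld :: "'a::field set \<Rightarrow> bool" where
  "subfld K \<longleftrightarrow> 1 \<in> K \<and> (\<forall>x\<in>K. \<forall>y\<in>K. x - y \<in> K \<and> x * y \<in> K) \<and> (\<forall>x\<in>K. inverse x \<in> K)"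

lemma subfldD:
  assumes "subfld K"
  shows "1 \<in> K" "0 \<in> K" "x \<in> K \<Longrightarrow> y \<in> K \<Longrightarrow> x - y \<in> K" "x \<in> K \<Longrightarrow> y \<in> K \<Longrightarrow> x * y \<in> K"
    "x \<in> K \<Longrightarrow> inverse x \<in> K" "x \<in> K \<Longrightarrow> - x \<in> K" "x \<in> K \<Longrightarrow> y \<in> K \<Longrightarrow> x + y \<in> K"
    "x \<in> K \<Longrightarrow> y \<in> K \<Longrightarrow> x / y \<in> K"
proof -
  show 1: "1 \<in> K" "x \<in> K \<Longrightarrow> y \<in> K \<Longrightarrow> x - y \<in> K" "x \<in> K \<Longrightarrow> y \<in> K \<Longrightarrow> x * y \<in> K"
    "x \<in> K \<Longrightarrow> inverse x \<in> K" for x y using assms by (auto simp: subfld_def)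
  show 0: "0 \<in> K" using 1(2)[OF 1(1) 1(1)] by simp
  show 2: "x \<in> K \<Longrightarrow> - x \<in> K" for x using 1(2)[OF 0] by fastforce
  show "x \<in> K \<Longrightarrow> y \<in> K \<Longrightarrow> x + y \<in> K" using 1(2)[of x "-y"] 2 by simp
  show "x \<in> K \<Longrightarrow> y \<in> K \<Longrightarrow> x / y \<in> K" using 1(3)[of x "inverse y"] 1(4) by (simp add: divide_inverse)
qed

lemma subfld_power: "subfld K \<Longrightarrow> x \<in> K \<Longrightarrow> x ^ n \<in> K"
  by (induction n) (auto simp: subfldD)

lemma subfld_sum: "subfld K \<Longrightarrow> (\<And>i. i \<in> I \<Longrightarrow> f i \<in> K) \<Longrightarrow> (\<Sum>i\<in>I. f i) \<in> K"
  by (induction I rule: infinite_finite_induct) (auto simp: subfldD)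

lemma subfld_prod: "subfld K \<Longrightarrow> (\<And>i. i \<in> I \<Longrightarrow> f i \<in> K) \<Longrightarrow> (\<Prod>i\<in>I. f i) \<in> K"
  by (induction I rule: infinite_finite_induct) (auto simp: subfldD)

lemma subfld_of_int: "subfld K \<Longrightarrow> of_int n \<in> K"
  by (induction n rule: int_induct[of _ 0]) (auto simp: subfldD)

lemma subfld_of_rat: fixes K :: "'a::field_char_0 set" shows "subfld K \<Longrightarrow> of_rat q \<in> K"
  by (cases q) (simp add: of_rat_rat subfldD subfld_of_int)

lemma subfld_rpoly: "subfld K \<Longrightarrow> x \<in> K \<Longrightarrow> rpoly p x \<in> K"
  by (induction p) (auto simp: subfldD subfld_of_rat)

text \<open>Values of \<open>h\<close> outside \<open>K\<close> are left free. The equation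
  \<open>h 1 = 1\<close> excludes the zero map, so that \<open>h\<close> is injective on a
  subfield.\<close>

definition emb_on :: "'a::field set \<Rightarrow> ('a \<Rightarrow> 'b::field) \<Rightarrow> bool" where
  "emb_on K h \<longleftrightarrow> h 1 = 1 \<and> (\<forall>x\<in>K. \<forall>y\<in>K. h (x + y) = h x + h y \<and> h (x * y) = h x * h y)"

context
  fixes K :: "'a::field set" and h :: "'a \<Rightarrow> 'b::field"
  assumes K: "subfld K" and h: "emb_on K h"
begin

lemma emb_on_simps:
  shows "h 1 = 1" "h 0 = 0" "x \<in> K \<Longrightarrow> y \<in> K \<Longrightarrow> h (x + y) = h x + h y"
    "x \<in> K \<Longrightarrow> y \<in> K \<Longrightarrow> h (x * y) = h x * h y" "x \<in> K \<Longrightarrow> h (- x) = - h x"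
    "x \<in> K \<Longrightarrow> y \<in> K \<Longrightarrow> h (x - y) = h x - h y" "x \<in> K \<Longrightarrow> h (inverse x) = inverse (h x)"
    "x \<in> K \<Longrightarrow> h x = 0 \<longleftrightarrow> x = 0"
proof -
  show 1: "h 1 = 1" "x \<in> K \<Longrightarrow> y \<in> K \<Longrightarrow> h (x + y) = h x + h y"
    "x \<in> K \<Longrightarrow> y \<in> K \<Longrightarrow> h (x * y) = h x * h y" for x y using h by (auto simp: emb_on_def)
  show 0: "h 0 = 0" using 1(2)[of 0 0] subfldD(2)[OF K] by (metis add_cancel_right_right add_0)
  show m: "x \<in> K \<Longrightarrow> h (- x) = - h x" for x
    using 1(2)[of x "-x"] 0 subfldD[OF K] by (simp add: eq_neg_iff_add_eq_0 add.commute)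
  show "x \<in> K \<Longrightarrow> y \<in> K \<Longrightarrow> h (x - y) = h x - h y" using 1(2)[of x "-y"] m subfldD[OF K] by simp
  show "x \<in> K \<Longrightarrow> h x = 0 \<longleftrightarrow> x = 0"
    using 1(3)[of x "inverse x"] 0 1(1) subfldD(5)[OF K] by (metis mult_zero_left right_inverse zero_neq_one)
  show "x \<in> K \<Longrightarrow> h (inverse x) = inverse (h x)"
    using 1(3)[of x "inverse x"] 0 1(1) subfldD(5)[OF K] by (cases "x = 0") (auto simp: inverse_unique)
qed

lemma emb_on_inj: "inj_on h K"
  using emb_on_simps(6,8) subfldD(3)[OF K] by (metis inj_onI right_minus_eq)

lemma emb_on_power: "x \<in> K \<Longrightarrow> h (x ^ n) = h x ^ n"
  by (induction n) (auto simp: emb_on_simps subfld_power[OF K])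

lemma emb_on_sum: "(\<And>i. i \<in> I \<Longrightarrow> f i \<in> K) \<Longrightarrow> h (\<Sum>i\<in>I. f i) = (\<Sum>i\<in>I. h (f i))"
  by (induction I rule: infinite_finite_induct) (auto simp: emb_on_simps subfld_sum[OF K])

lemma emb_on_prod: "(\<And>i. i \<in> I \<Longrightarrow> f i \<in> K) \<Longrightarrow> h (\<Prod>i\<in>I. f i) = (\<Prod>i\<in>I. h (f i))"
  by (induction I rule: infinite_finite_induct) (auto simp: emb_on_simps subfld_prod[OF K])

lemma emb_on_of_int: "h (of_int n) = of_int n"
  by (induction n rule: int_induct[of _ 0]) (auto simp: emb_on_simps subfldD[OF K] subfld_of_int[OF K])

lemma emb_on_of_nat: "h (of_nat n) = of_nat n"
  using emb_on_of_int[of "int n"] by simp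

end

context
  fixes K :: "'a::field_char_0 set" and h :: "'a \<Rightarrow> 'b::field_char_0"
  assumes K: "subfld K" and h: "emb_on K h"
begin

lemma emb_on_of_rat: "h (of_rat q) = of_rat q"
  by (cases q) (simp add: of_rat_rat divide_inverse emb_on_simps[OF K h] emb_on_of_int[OF K h]
      subfldD[OF K] subfld_of_int[OF K])

lemma emb_on_rpoly: "x \<in> K \<Longrightarrow> h (rpoly p x) = rpoly p (h x)"
  by (induction p)
    (auto simp: emb_on_simps[OF K h] emb_on_of_rat subfld_of_rat[OF K] subfldD[OF K] subfld_rpoly[OF K])

end

section \<open>Minimal polynomials and conjugate roots\<close>

definition minpoly_of :: "rat poly \<Rightarrow> 'a::field_char_0 \<Rightarrow> bool" where
  "minpoly_of f x \<longleftrightarrow> Polynomial.lead_coeff f = 1 \<and> rpoly f x = 0 \<and> (\<forall>g. rpoly g x = 0 \<longrightarrow> f dvd g)"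

lemma minpoly_of_iff: "minpoly_of f x \<Longrightarrow> rpoly g x = 0 \<longleftrightarrow> f dvd g"
  unfolding minpoly_of_def by (metis dvdE mult_zero_left rpoly_simps(5))

lemma minpoly_of_nonzero: "minpoly_of f x \<Longrightarrow> f \<noteq> 0"
  by (auto simp: minpoly_of_def)

lemma minpoly_of_degree_pos: "minpoly_of f x \<Longrightarrow> Polynomial.degree f > 0"
  by (rule ccontr) (auto simp: minpoly_of_def elim!: degree_eq_zeroE)

lemma algebraic_iff_rpoly: "algebraic (x::'a::field_char_0) \<longleftrightarrow> (\<exists>p. p \<noteq> 0 \<and> rpoly p x = 0)"
proof
  assume "algebraic x"
  then obtain q where q: "\<forall>i. Polynomial.coeff q i \<in> \<int>" "q \<noteq> 0" "poly q x = 0"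
    by (auto elim: algebraicE)
  have "\<forall>i. \<exists>n. Polynomial.coeff q i = of_int n" using q(1) by (auto elim!: Ints_cases)
  then obtain c where c: "\<And>i. Polynomial.coeff q i = of_int (c i)" by metis
  define p :: "rat poly" where "p = map_poly (\<lambda>y. if y = 0 then 0 else of_int (SOME n. y = of_int n)) q"
  have *: "(SOME n. (of_int m :: 'a) = of_int n) = m" for m by auto
  have "map_poly of_rat p = q"
    by (rule poly_eqI) (auto simp: p_def coeff_map_poly c *)
  with q show "\<exists>p. p \<noteq> 0 \<and> rpoly p x = 0" unfolding rpoly_def by (metis map_poly_0)
next
  assume "\<exists>p. p \<noteq> 0 \<and> rpoly p x = 0"
  then obtain p where p: "p \<noteq> 0" "rpoly p x = 0" by blast
  show "algebraic x" unfolding algebraic_altdef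
    by (rule exI[of _ "map_poly of_rat p"]) (use p in \<open>auto simp: rpoly_def coeff_map_poly map_poly_eq_0_iff\<close>)
qed

lemma minpoly_of_exists:
  assumes "algebraic (x::'a::field_char_0)" shows "\<exists>f. minpoly_of f x"
proof -
  define n where "n = (LEAST n. \<exists>f. f \<noteq> 0 \<and> rpoly f x = 0 \<and> Polynomial.degree f = n)"
  have "\<exists>n f. f \<noteq> 0 \<and> rpoly f x = 0 \<and> Polynomial.degree f = n" using assms algebraic_iff_rpoly by blast
  from LeastI_ex[OF this] obtain f where f: "f \<noteq> 0" "rpoly f x = 0" "Polynomial.degree f = n"
    unfolding n_def by auto
  have min: "Polynomial.degree g \<ge> n" if "g \<noteq> 0" "rpoly g x = 0" for g
    unfolding n_def by (rule Least_le) (use that in auto)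
  define f' where "f' = Polynomial.smult (inverse (Polynomial.lead_coeff f)) f"
  have "f' dvd g" if g: "rpoly g x = 0" for g
  proof -
    have "rpoly (g mod f) x = 0" using g f(2) by (simp add: rpoly_mod)
    moreover have "g mod f = 0 \<or> Polynomial.degree (g mod f) < n"
      using degree_mod_less[OF f(1), of g] f(3) by auto
    ultimately have "g mod f = 0" using min[of "g mod f"] by force
    thus ?thesis using f(1) unfolding f'_def by (auto intro: smult_dvd)
  qed
  thus ?thesis using f unfolding minpoly_of_def by (intro exI[of _ f']) (auto simp: f'_def)
qed

text \<open>With \<open>h\<close> the gcd of \<open>f\<close> and a polynomial \<open>g\<close>
  vanishing at \<open>r\<close>, write \<open>f = h * f'\<close>. Either \<open>h\<close> vanishes
  at \<open>x\<close>, and \<open>f\<close> divides \<open>h\<close> and hence \<open>g\<close>; or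
  \<open>f'\<close> does, and then \<open>f\<close> divides \<open>f'\<close>, so that
  \<open>h\<close> is a nonzero constant, against \<open>h\<close> vanishing at
  \<open>r\<close>.\<close>

lemma minpoly_of_root:
  assumes f: "minpoly_of f (x::'a::field_char_0)" and r: "rpoly f (r::'b::field_char_0) = 0"
  shows "minpoly_of f r"
proof -
  have "f dvd g" if g: "rpoly g r = 0" for g
  proof -
    define h where "h = gcd f g"
    obtain a b where ab: "a * f + b * g = h" unfolding h_def by (metis bezout_coefficients_fst_snd)
    have hr: "rpoly h r = 0" using ab r g by (metis add.right_neutral mult_zero_right rpoly_simps(3,5))
    obtain f' where f': "f = h * f'" by (metis h_def gcd_dvd1 dvdE)
    have "rpoly h x = 0 \<or> rpoly f' x = 0" using f f' by (auto simp: minpoly_of_def)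
    thus ?thesis
    proof
      assume "rpoly h x = 0"
      thus ?thesis using f minpoly_of_iff h_def gcd_dvd2 dvd_trans by metis
    next
      assume "rpoly f' x = 0"
      hence "h * f' dvd f'" using f minpoly_of_iff f' by metis
      moreover have "f' \<noteq> 0" using f' minpoly_of_nonzero[OF f] by auto
      ultimately have "h dvd 1" by (metis dvd_times_right_cancel_iff mult_1)
      then obtain c where "h = [:c:]" "c \<noteq> 0" by (metis is_unit_poly_iff dvd_field_iff zero_neq_one not_is_unit_0)
      with hr show ?thesis by simp
    qed
  qed
  thus ?thesis using f r by (simp add: minpoly_of_def)
qed

text \<open>A double root would have \<open>f\<close> as its minimal polynomial and also annihilate
  the derivative, which is nonzero of smaller degree in characteristic zero.\<close>

lemma minpoly_of_rsquarefree:
  assumes f: "minpoly_of f (x::'a::field_char_0)"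
  shows "rsquarefree (map_poly of_rat f :: 'b::field_char_0 poly)"
  unfolding rsquarefree_roots
proof (intro allI notI, elim conjE)
  fix a :: 'b assume a: "poly (map_poly of_rat f) a = 0" "poly (pderiv (map_poly of_rat f)) a = 0"
  have "minpoly_of f a" using minpoly_of_root[OF f] a(1) by (simp add: rpoly_def)
  moreover have "rpoly (pderiv f) a = 0" using a(2) by (simp add: rpoly_def hom_distribs)
  ultimately have "f dvd pderiv f" unfolding minpoly_of_def by blast
  moreover have f0: "Polynomial.degree f > 0" using minpoly_of_degree_pos[OF f] .
  moreover have "pderiv f \<noteq> 0" using f0 by (simp add: pderiv_eq_0_iff)
  ultimately have "Polynomial.degree f \<le> Polynomial.degree f - 1"
    using dvd_imp_degree_le[of f "pderiv f"] by (simp add: degree_pderiv)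
  thus False using f0 by simp
qed

lemma card_roots_rsquarefree:
  fixes F :: "'b::{alg_closed_field,field_char_0} poly"
  assumes "rsquarefree F" shows "card {r. poly F r = 0} = Polynomial.degree F"
proof -
  have F0: "F \<noteq> 0" using assms by (simp add: rsquarefree_def)
  obtain A where A: "size A = Polynomial.degree F" "F = Polynomial.smult (Polynomial.lead_coeff F) (\<Prod>x\<in>#A. [:-x, 1:])"
    using alg_closed_imp_factorization[OF F0] by blast
  have "proots F = proots (\<Prod>x\<in>#A. [:-x, 1:])" using F0 by (subst A(2)) simp
  also have "\<dots> = A"
  proof (induction A)
    case (add x A)
    have "[:-x, 1:] \<noteq> 0" "(\<Prod>x\<in>#A. [:-x, 1:]) \<noteq> 0" by (auto simp: prod_mset_zero_iff)
    from proots_mult[OF this] show ?case unfolding add by (simp del: mult_pCons_left)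
  qed simp
  finally have pr: "proots F = A" .
  have "count A r = (if r \<in># A then 1 else 0)" for r
    using assms pr count_proots[OF F0, of r] unfolding rsquarefree_def
    by (metis count_eq_zero_iff)
  hence "size A = card (set_mset A)" by (simp add: size_multiset_overloaded_eq)
  thus ?thesis using A(1) pr F0 set_count_proots[OF F0] by simp
qed

lemma card_roots_minpoly:
  assumes "minpoly_of f (x::'a::field_char_0)"
  shows "card {r::'b::{alg_closed_field,field_char_0}. rpoly f r = 0} = Polynomial.degree f"
  using card_roots_rsquarefree[OF minpoly_of_rsquarefree[OF assms, where 'b='b]] by (simp add: rpoly_def)

section \<open>Linear relations over the rationals\<close>

interpretation rat_vs: vector_space "\<lambda>(q::rat) (x::'a::field_char_0). of_rat q * x"
  by unfold_locales (auto simp: algebra_simps of_rat_add of_rat_mult)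

lemma span_mult_closed:
  assumes "\<And>a b. a \<in> A \<Longrightarrow> b \<in> B \<Longrightarrow> a * b \<in> rat_vs.span C" "x \<in> rat_vs.span A" "y \<in> rat_vs.span B"
  shows "(x::'a::field_char_0) * y \<in> rat_vs.span C"
proof -
  have "a * y \<in> rat_vs.span C" if "a \<in> A" for a
    using assms(3)
  proof (induction rule: rat_vs.span_induct_alt)
    case (step c b z)
    have "of_rat c * (a * b) + a * z \<in> rat_vs.span C"
      by (intro rat_vs.span_add rat_vs.span_scale step assms(1) that)
    thus ?case by (simp add: algebra_simps)
  qed (simp add: rat_vs.span_zero)
  note * = this
  from assms(2) show ?thesis
  proof (induction rule: rat_vs.span_induct_alt)
    case (step c b z)
    have "of_rat c * (b * y) + z * y \<in> rat_vs.span C"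
      by (intro rat_vs.span_add rat_vs.span_scale step *)
    thus ?case by (simp add: algebra_simps)
  qed (simp add: rat_vs.span_zero)
qed

text \<open>The vectors form a family, not a set: two equal members already give a relation with
  coefficients 1 and -1. This is the form that \<open>rank_bound\<close> needs, where
  \<open>v\<close> may take a value twice.\<close>

lemma rat_relation:
  fixes v :: "'i \<Rightarrow> 'a::field_char_0"
  assumes "finite I" "finite B" "\<And>i. i \<in> I \<Longrightarrow> v i \<in> rat_vs.span B" "card I > card B"
  obtains q where "(\<Sum>i\<in>I. of_rat (q i) * v i) = 0" "\<exists>i\<in>I. q i \<noteq> 0"
proof (cases "inj_on v I")
  case True
  have "rat_vs.dependent (v ` I)"
    using rat_vs.independent_span_bound[OF assms(2), of "v ` I"] assms True card_image[OF True] by fastforce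
  then obtain S u where S: "finite S" "S \<subseteq> v ` I" "(\<Sum>w\<in>S. of_rat (u w) * w) = 0" "\<exists>w\<in>S. u w \<noteq> 0"
    unfolding rat_vs.dependent_explicit by auto
  define q where "q i = (if v i \<in> S then u (v i) else 0)" for i
  have "(\<Sum>i\<in>I. of_rat (q i) * v i) = (\<Sum>w\<in>v ` I. if w \<in> S then of_rat (u w) * w else 0)"
    by (subst sum.reindex[OF True]) (auto simp: q_def intro!: sum.cong)
  also have "\<dots> = (\<Sum>w\<in>S. of_rat (u w) * w)"
    using S(2) assms(1) by (simp add: sum.If_cases Int_absorb1)
  finally show ?thesis using S by (intro that[of q]) (auto simp: q_def)
next
  case False
  then obtain i j where ij: "i \<in> I" "j \<in> I" "i \<noteq> j" "v i = v j" by (auto simp: inj_on_def)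
  define q :: "'i \<Rightarrow> rat" where "q k = (if k = i then 1 else if k = j then -1 else 0)" for k
  have "(\<Sum>k\<in>I. of_rat (q k) * v k) = (\<Sum>k\<in>I. (if k = i then v i else 0) - (if k = j then v i else 0))"
    using ij by (intro sum.cong) (auto simp: q_def)
  also have "\<dots> = 0" using ij assms(1) by (simp add: sum_subtractf)
  finally show ?thesis using ij by (intro that[of q]) (auto simp: q_def)
qed

lemma algebraic_if_powers_in_span:
  assumes "finite B" "\<And>i. (x::'a::field_char_0) ^ i \<in> rat_vs.span B"
  shows "algebraic x"
proof -
  obtain q where q: "(\<Sum>i\<in>{..card B}. of_rat (q i) * x ^ i) = 0" "\<exists>i\<in>{..card B}. q i \<noteq> 0"
    by (rule rat_relation[of "{..card B}" B "\<lambda>i. x ^ i"]) (use assms in auto)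
  define p where "p = (\<Sum>i\<le>card B. Polynomial.monom (q i) i)"
  have "rpoly p x = (\<Sum>i\<in>{..card B}. rpoly (Polynomial.monom (q i) i) x)" unfolding p_def
    by (induction "{..card B}" rule: infinite_finite_induct) (auto simp: rpoly_def hom_distribs poly_sum)
  hence "rpoly p x = 0" using q by simp
  moreover have "Polynomial.coeff p i = q i" if "i \<le> card B" for i
    unfolding p_def using that by (simp add: coeff_sum)
  ultimately show ?thesis using q(2) algebraic_iff_rpoly by (metis atMost_iff coeff_0)
qed

lemma span_powers:
  assumes "minpoly_of f (x::'a::field_char_0)"
  shows "rpoly p x \<in> rat_vs.span ((\<lambda>i. x ^ i) ` {..<Polynomial.degree f})"
proof -
  have f: "f \<noteq> 0" "rpoly f x = 0" "Polynomial.degree f > 0"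
    using minpoly_of_nonzero[OF assms] minpoly_of_degree_pos[OF assms] assms by (auto simp: minpoly_of_def)
  have "rpoly p x = rpoly (p mod f) x" using f(2) by (simp add: rpoly_mod)
  also have "\<dots> = (\<Sum>i\<le>Polynomial.degree (p mod f). of_rat (Polynomial.coeff (p mod f) i) * x ^ i)"
    by (rule rpoly_altdef)
  also have "\<dots> \<in> rat_vs.span ((\<lambda>i. x ^ i) ` {..<Polynomial.degree f})"
    using degree_mod_less'[OF f(1), of p] f(3)
    by (intro rat_vs.span_sum rat_vs.span_scale rat_vs.span_base) (force)
  finally show ?thesis .
qed

text \<open>The finitely many products of powers of \<open>a\<close> and \<open>b\<close> below the
  degrees of their minimal polynomials span a space that contains every power of
  \<open>a + t b\<close>.\<close>

lemma algebraic_add_smult: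
  assumes "algebraic (a::'a::field_char_0)" "algebraic b"
  shows "algebraic (a + of_rat t * b)"
proof -
  obtain f g where f: "minpoly_of f a" and g: "minpoly_of g b" using minpoly_of_exists assms by metis
  define C where "C = (\<lambda>(i, j). a ^ i * b ^ j) ` ({..<Polynomial.degree f} \<times> {..<Polynomial.degree g})"
  have *: "a ^ i * b ^ j \<in> rat_vs.span C" for i j
  proof (rule span_mult_closed)
    show "a ^ i \<in> rat_vs.span ((\<lambda>i. a ^ i) ` {..<Polynomial.degree f})"
      using span_powers[OF f, of "Polynomial.monom 1 i"] by simp
    show "b ^ j \<in> rat_vs.span ((\<lambda>i. b ^ i) ` {..<Polynomial.degree g})"
      using span_powers[OF g, of "Polynomial.monom 1 j"] by simp
  qed (auto simp: C_def intro!: rat_vs.span_base)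
  show ?thesis
  proof (rule algebraic_if_powers_in_span[of C])
    show "finite C" by (simp add: C_def)
    fix n
    have "(a + of_rat t * b) ^ n = (\<Sum>k\<le>n. of_rat (of_nat (n choose k) * t ^ (n - k)) * (a ^ k * b ^ (n - k)))"
      unfolding binomial_ring by (intro sum.cong) (auto simp: of_rat_mult of_rat_power power_mult_distrib)
    also have "\<dots> \<in> rat_vs.span C" by (intro rat_vs.span_sum rat_vs.span_scale *)
    finally show "(a + of_rat t * b) ^ n \<in> rat_vs.span C" .
  qed
qed

section \<open>Simple extensions and primitive elements\<close>

definition Qadj :: "'a::field_char_0 \<Rightarrow> 'a set" where
  "Qadj x = range (\<lambda>p. rpoly p x)"

lemma Qadj_mem: "x \<in> Qadj x" "rpoly p x \<in> Qadj x"
  unfolding Qadj_def using rpoly_simps(8)[of 1 1 x] by (metis mult_1 of_rat_1 power_one_right rangeI)+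

text \<open>Bezout for the minimal polynomial and the polynomial to be inverted yields the inverse;
  as in \<open>minpoly_of_root\<close>, their gcd is a nonzero constant.\<close>

lemma subfld_Qadj:
  assumes "algebraic (x::'a::field_char_0)" shows "subfld (Qadj x)"
proof -
  obtain f where f: "minpoly_of f x" using minpoly_of_exists[OF assms] by blast
  have inv: "inverse (rpoly g x) \<in> Qadj x" if "rpoly g x \<noteq> 0" for g
  proof -
    define h where "h = gcd f g"
    obtain a b where ab: "a * f + b * g = h" unfolding h_def by (metis bezout_coefficients_fst_snd)
    obtain f' where f': "f = h * f'" by (metis h_def gcd_dvd1 dvdE)
    have hx: "rpoly h x \<noteq> 0" using that f minpoly_of_iff h_def by (metis gcd_dvd2 dvd_trans)
    hence "rpoly f' x = 0" using f f' by (auto simp: minpoly_of_def)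
    hence "h * f' dvd f'" using f minpoly_of_iff f' by metis
    moreover have "f' \<noteq> 0" using f' minpoly_of_nonzero[OF f] by auto
    ultimately have "h dvd 1" by (metis dvd_times_right_cancel_iff mult_1)
    then obtain c where c: "h = [:c:]" "c \<noteq> 0" by (metis is_unit_poly_iff dvd_field_iff zero_neq_one not_is_unit_0)
    have "rpoly b x * rpoly g x = of_rat c"
      using arg_cong[OF ab, of "\<lambda>p. rpoly p x"] f c by (simp add: minpoly_of_def)
    hence "rpoly (Polynomial.smult (inverse c) b) x * rpoly g x = of_rat (inverse c * c)"
      by (simp add: mult.assoc of_rat_mult)
    hence "inverse (rpoly g x) = rpoly (Polynomial.smult (inverse c) b) x"
      using c that by (intro inverse_unique) (simp add: mult.commute)
    thus ?thesis using Qadj_mem(2) by metis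
  qed
  show ?thesis unfolding subfld_def
  proof (intro conjI ballI)
    show "1 \<in> Qadj x" using Qadj_mem(2)[of 1 x] by simp
    fix u v assume "u \<in> Qadj x" "v \<in> Qadj x"
    then obtain p q where pq: "u = rpoly p x" "v = rpoly q x" by (auto simp: Qadj_def)
    show "u - v \<in> Qadj x" "u * v \<in> Qadj x"
      using Qadj_mem(2)[of "p - q" x] Qadj_mem(2)[of "p * q" x] pq by simp_all
  next
    fix u assume "u \<in> Qadj x"
    then obtain p where p: "u = rpoly p x" by (auto simp: Qadj_def)
    show "inverse u \<in> Qadj x" using inv[of p] p Qadj_mem(2)[of 0 x] by (cases "u = 0") auto
  qed
qed

lemma Qadj_least: "subfld K \<Longrightarrow> x \<in> K \<Longrightarrow> Qadj x \<subseteq> K"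
  by (auto simp: Qadj_def subfld_rpoly)

text \<open>The polynomial of least degree over \<open>K\<close> that vanishes at \<open>b\<close> divides \<open>F\<close> and \<open>G\<close>, hence is linear.\<close>

lemma common_root_in_subfield:
  fixes b :: "'a::{alg_closed_field,field_char_0}"
  assumes K: "subfld K" and G: "rsquarefree G" "\<And>i. Polynomial.coeff G i \<in> K" "poly G b = 0"
    and F: "\<And>i. Polynomial.coeff F i \<in> K" "poly F b = 0"
    and only: "\<And>r. poly F r = 0 \<Longrightarrow> poly G r = 0 \<Longrightarrow> r = b"
  shows "b \<in> K"
proof -
  let ?P = "\<lambda>u. (\<forall>i. Polynomial.coeff u i \<in> K) \<and> poly u b = 0"
  have G0: "G \<noteq> 0" using G(1) by (simp add: rsquarefree_def)
  define n where "n = (LEAST n. \<exists>u. ?P u \<and> u \<noteq> 0 \<and> Polynomial.degree u = n)"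
  have "\<exists>n u. ?P u \<and> u \<noteq> 0 \<and> Polynomial.degree u = n" using G G0 by blast
  from LeastI_ex[OF this] obtain h where h: "?P h" "h \<noteq> 0" "Polynomial.degree h = n"
    unfolding n_def by auto
  have min: "Polynomial.degree u \<ge> n" if "?P u" "u \<noteq> 0" for u
    unfolding n_def by (rule Least_le) (use that in auto)
  have dvd: "h dvd u" if "?P u" for u
    using that
  proof (induction "Polynomial.degree u" arbitrary: u rule: less_induct)
    case less
    show ?case
    proof (cases "u = 0")
      case False
      define c where "c = Polynomial.lead_coeff u / Polynomial.lead_coeff h"
      define k where "k = Polynomial.degree u - n"
      define w where "w = Polynomial.monom c k * h"
      have nk: "n + k = Polynomial.degree u" using min[of u] less False by (simp add: k_def)
      have c0: "c \<noteq> 0" using False h(2) unfolding c_def by (metis divide_eq_0_iff leading_coeff_0_iff)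
      have "c \<in> K" unfolding c_def using less.prems h(1) by (intro subfldD(8)[OF K]) auto
      hence w1: "?P (u - w)" using less.prems h(1) subfldD[OF K]
        by (auto simp: w_def coeff_monom_mult poly_monom)
      have degw: "Polynomial.degree w = Polynomial.degree u" 
        using c0 h nk by (simp add: w_def degree_mult_eq degree_monom_eq)
      have "Polynomial.lead_coeff w = Polynomial.lead_coeff u"
        unfolding w_def lead_coeff_mult lead_coeff_monom using h(2) by (simp add: c_def)
      hence "u = w \<or> Polynomial.degree (u - w) < Polynomial.degree u" using degw
        by (metis coeff_diff degree_diff_le eq_iff_diff_eq_0 leading_coeff_0_iff order_le_imp_less_or_eq order_refl)
      moreover have "h dvd w" by (simp add: w_def)
      ultimately show ?thesis using less.hyps[OF _ w1] by (metis dvd_diffD1 dvd_diff dvd_diff_commute diff_add_cancel dvd_add)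
    qed simp
  qed
  have hF: "h dvd F" and hG: "h dvd G" using dvd F G by blast+
  have hb: "r = b" if "poly h r = 0" for r
    using hF hG that only by (metis dvdE mult_zero_left poly_mult)
  have "rsquarefree h" unfolding rsquarefree_roots
  proof (intro allI notI)
    fix a assume a: "poly h a = 0 \<and> poly (pderiv h) a = 0"
    obtain q where "G = h * q" using hG by blast
    hence "poly G a = 0 \<and> poly (pderiv G) a = 0" using a by (simp add: pderiv_mult)
    thus False using G(1) rsquarefree_roots by blast
  qed
  hence "Polynomial.degree h = card {r. poly h r = 0}" by (simp add: card_roots_rsquarefree)
  also have "{r. poly h r = 0} = {b}" using hb h(1) by auto
  finally have d1: "Polynomial.degree h = 1" by simp
  define u v where "u = Polynomial.coeff h 0" and "v = Polynomial.coeff h 1"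
  have "h = [:u, v:]"
    by (rule poly_eqI) (use d1 in \<open>auto simp: u_def v_def coeff_pCons coeff_eq_0 split: nat.splits\<close>)
  moreover have "v \<noteq> 0" using h(2) d1 unfolding v_def by (metis leading_coeff_0_iff)
  ultimately have uv: "h = [:u, v:]" "v \<noteq> 0" .
  have "u \<in> K" "v \<in> K" using h(1) uv by (metis coeff_pCons_0, metis coeff_pCons_0 coeff_pCons_Suc)
  moreover have "b = - u / v" using h(1) uv by (simp add: field_simps eq_neg_iff_add_eq_0)
  ultimately show "b \<in> K" using subfldD[OF K] by simp
qed

text \<open>For \<open>c = a + t b\<close> the polynomials \<open>g\<close> and
  \<open>f(c - t X)\<close> both vanish at \<open>b\<close>. A second common root \<open>b'\<close>
  would give a conjugate \<open>a'\<close> of \<open>a\<close> with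
  \<open>t = (a' - a) / (b - b')\<close>, and only finitely many values of \<open>t\<close> are of
  that form.\<close>

lemma primitive_pair:
  fixes a b :: "'a::{alg_closed_field,field_char_0}"
  assumes "algebraic a" "algebraic b"
  obtains t where "a \<in> Qadj (a + of_rat t * b)" "b \<in> Qadj (a + of_rat t * b)"
proof -
  obtain f g where f: "minpoly_of f a" and g: "minpoly_of g b" using minpoly_of_exists assms by metis
  let ?A = "{r::'a. rpoly f r = 0}" and ?B = "{r::'a. rpoly g r = 0}"
  have nz: "(map_poly of_rat f :: 'a poly) \<noteq> 0" "(map_poly of_rat g :: 'a poly) \<noteq> 0"
    using minpoly_of_nonzero[OF f] minpoly_of_nonzero[OF g] by simp_all
  have fin: "finite ?A" "finite ?B"
    unfolding rpoly_def by (rule poly_roots_finite[OF nz(1)], rule poly_roots_finite[OF nz(2)])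
  define Z where "Z = (\<lambda>(a', b'). (a' - a) / (b - b')) ` (?A \<times> ?B)"
  have "finite Z" using fin by (simp add: Z_def)
  hence "\<exists>t::rat. of_rat t \<notin> Z"
    using finite_subset[of "range (of_rat :: rat \<Rightarrow> 'a)" Z]
    by (auto simp: inj_on_def finite_image_iff infinite_UNIV_char_0)
  then obtain t :: rat where t: "of_rat t \<notin> Z" by blast
  define c where "c = a + of_rat t * b"
  have alg: "algebraic c" unfolding c_def by (rule algebraic_add_smult[OF assms])
  note K = subfld_Qadj[OF alg]
  have bK: "b \<in> Qadj c"
  proof (rule common_root_in_subfield[OF K minpoly_of_rsquarefree[OF g]])
    show "Polynomial.coeff (map_poly of_rat g) i \<in> Qadj c" for i by (simp add: subfld_of_rat[OF K])
    show "poly (map_poly of_rat g) b = 0" using g by (simp add: minpoly_of_def rpoly_def)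
    let ?F = "map_poly of_rat f \<circ>\<^sub>p [:c, - of_rat t:]"
    show "Polynomial.coeff ?F i \<in> Qadj c" for i
      by (rule coeff_pcompose_semiring_closed)
        (auto simp: coeff_pCons subfldD[OF K] subfld_of_rat[OF K] Qadj_mem split: nat.splits)
    show "poly ?F b = 0" using f by (simp add: poly_pcompose minpoly_of_def rpoly_def c_def)
    fix r assume r: "poly ?F r = 0" "poly (map_poly of_rat g) r = 0"
    show "r = b"
    proof (rule ccontr)
      assume "r \<noteq> b"
      have "c - of_rat t * r \<in> ?A" "r \<in> ?B" using r by (simp_all add: poly_pcompose rpoly_def mult.commute)
      moreover have "(c - of_rat t * r - a) / (b - r) = of_rat t" using \<open>r \<noteq> b\<close> by (simp add: c_def field_simps)
      ultimately have "of_rat t \<in> Z" unfolding Z_def by (metis (mono_tags, lifting) case_prod_conv image_eqI mem_Sigma_iff)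
      thus False using t by blast
    qed
  qed
  have "a = c - of_rat t * b" by (simp add: c_def)
  hence "a \<in> Qadj c" using bK subfldD[OF K] subfld_of_rat[OF K] Qadj_mem(1) by metis
  with bK show ?thesis using that c_def by blast
qed

text \<open>The last clause places the primitive element in every subfield containing
  \<open>A\<close>. It is what brings \<open>c\<close> back into the image of \<open>'k\<close> in
  its algebraic closure, and into the compositum, when the theorem is applied there.\<close>

theorem primitive_element:
  fixes A :: "'a::{alg_closed_field,field_char_0} set"
  assumes "finite A" "\<And>a. a \<in> A \<Longrightarrow> algebraic a"
  shows "\<exists>c. algebraic c \<and> A \<subseteq> Qadj c \<and> (\<forall>F. subfld F \<and> A \<subseteq> F \<longrightarrow> c \<in> F)"
  using assms
proof (induction A rule: finite_induct)
  case empty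
  show ?case by (intro exI[of _ 0]) (auto simp: subfldD)
next
  case (insert a A)
  then obtain c where c: "algebraic c" "A \<subseteq> Qadj c" "\<forall>F. subfld F \<and> A \<subseteq> F \<longrightarrow> c \<in> F" by auto
  have a: "algebraic a" using insert by simp
  obtain t where t: "c \<in> Qadj (c + of_rat t * a)" "a \<in> Qadj (c + of_rat t * a)"
    using primitive_pair[OF c(1) a] .
  have alg: "algebraic (c + of_rat t * a)" by (rule algebraic_add_smult[OF c(1) a])
  have "Qadj c \<subseteq> Qadj (c + of_rat t * a)" by (rule Qadj_least[OF subfld_Qadj[OF alg] t(1)])
  thus ?case using c t alg
    by (intro exI[of _ "c + of_rat t * a"]) (auto simp: subfldD subfld_of_rat)
qed

subsection \<open>Embeddings and the Galois group\<close>

lemma subfld_UNIV: "subfld UNIV"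
  by (simp add: subfld_def)

lemma embeddings_iff: "\<sigma> \<in> embeddings \<longleftrightarrow> emb_on UNIV \<sigma>"
  unfolding embeddings_def Ring.ring_hom_def emb_on_def ring_of_type_algebra_def by auto

lemma emb_on_to_ac: "emb_on UNIV to_ac"
  by (simp add: emb_on_def)

context
  fixes \<sigma> :: "'k::field_char_0 \<Rightarrow> rat alg_closure"
  assumes \<sigma>: "\<sigma> \<in> embeddings"
begin

lemma embedding_emb_on: "emb_on UNIV \<sigma>"
  using \<sigma> by (simp add: embeddings_iff)

lemma embedding_simps:
  "\<sigma> 1 = 1" "\<sigma> 0 = 0" "\<sigma> (x + y) = \<sigma> x + \<sigma> y" "\<sigma> (x * y) = \<sigma> x * \<sigma> y" "\<sigma> (- x) = - \<sigma> x"
  "\<sigma> (x - y) = \<sigma> x - \<sigma> y" "\<sigma> (inverse x) = inverse (\<sigma> x)" "\<sigma> x = 0 \<longleftrightarrow> x = 0" "\<sigma> (x / y) = \<sigma> x / \<sigma> y"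
  "\<sigma> (x ^ n) = \<sigma> x ^ n" "\<sigma> (of_int i) = of_int i" "\<sigma> (of_nat n) = of_nat n" "\<sigma> (of_rat q) = of_rat q"
  "\<sigma> (rpoly p x) = rpoly p (\<sigma> x)"
  by (simp_all add: emb_on_simps[OF subfld_UNIV embedding_emb_on] emb_on_power[OF subfld_UNIV embedding_emb_on]
      emb_on_of_int[OF subfld_UNIV embedding_emb_on] emb_on_of_nat[OF subfld_UNIV embedding_emb_on]
      emb_on_of_rat[OF subfld_UNIV embedding_emb_on] emb_on_rpoly[OF subfld_UNIV embedding_emb_on] divide_inverse)

lemma embedding_sum: "\<sigma> (\<Sum>i\<in>I. f i) = (\<Sum>i\<in>I. \<sigma> (f i))"
  by (simp add: emb_on_sum[OF subfld_UNIV embedding_emb_on])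

end

lemma algebraic_qbar: "algebraic (x :: rat alg_closure)"
proof -
  obtain p :: "rat poly" where p: "p \<noteq> 0" "poly (map_poly to_ac p) x = 0" by (rule alg_closure_algebraic)
  have "to_ac q = of_rat q" for q :: rat
  proof -
    have "emb_on UNIV (to_ac :: rat \<Rightarrow> rat alg_closure)" by (rule emb_on_to_ac)
    from emb_on_of_rat[OF subfld_UNIV this, of q] show ?thesis by (simp add: of_rat_eq_id)
  qed
  hence "(to_ac :: rat \<Rightarrow> _) = of_rat" by (rule ext)
  hence "rpoly p x = 0" using p(2) by (simp add: rpoly_def)
  thus ?thesis using p algebraic_iff_rpoly by blast
qed

text \<open>Sending p(x) to p(r) is well defined: two representations of one element differ by a
  multiple of \<open>f\<close>, which vanishes at \<open>r\<close>. \<open>SOME\<close> picks a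
  representation.\<close>

lemma hom_of_root:
  assumes f: "minpoly_of f (x::'a::field_char_0)" and r: "rpoly f (r::'b::field_char_0) = 0"
  obtains h where "emb_on (Qadj x) h" "\<And>p. h (rpoly p x) = rpoly p r"
proof -
  define h where "h z = rpoly (SOME p. z = rpoly p x) r" for z
  have h: "h (rpoly p x) = rpoly p r" for p
  proof -
    define q where "q = (SOME q. rpoly p x = rpoly q x)"
    have "rpoly p x = rpoly q x" unfolding q_def by (rule someI_ex) blast
    hence "f dvd q - p" using minpoly_of_iff[OF f, of "q - p"] by simp
    then obtain u where "q - p = f * u" ..
    hence "rpoly (q - p) r = 0" using r by simp
    thus ?thesis by (simp add: h_def q_def)
  qed
  have "emb_on (Qadj x) h" unfolding emb_on_def Qadj_def
  proof (intro conjI ballI; (elim imageE)?)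
    show "h 1 = 1" using h[of 1] by simp
    fix u v p q assume "u = rpoly p x" "v = rpoly q x"
    thus "h (u + v) = h u + h v" "h (u * v) = h u * h v" using h[of "p + q"] h[of "p * q"] by (simp_all add: h)
  qed
  thus ?thesis using h that by blast
qed

lemma of_rat_poly_exists:
  fixes F :: "'a::field_char_0 poly"
  assumes "\<And>i. Polynomial.coeff F i \<in> range of_rat"
  obtains f where "map_poly of_rat f = F"
proof -
  define iv :: "'a \<Rightarrow> rat" where "iv = inv_into UNIV of_rat"
  have iv: "iv (of_rat q) = q" for q by (simp add: iv_def inv_f_f inj_on_def)
  have "map_poly of_rat (map_poly iv F) = F"
  proof (rule poly_eqI)
    fix i obtain q where "Polynomial.coeff F i = of_rat q" using assms by blast
    thus "Polynomial.coeff (map_poly of_rat (map_poly iv F)) i = Polynomial.coeff F i"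
      using iv[of 0] by (simp add: coeff_map_poly iv)
  qed
  thus ?thesis using that by blast
qed

lemma emb_on_coeff_prod:
  assumes K: "subfld K" and h: "emb_on K h" and "finite A" "\<And>i. i \<in> A \<Longrightarrow> a i \<in> K"
  shows "Polynomial.coeff (\<Prod>i\<in>A. [:- a i, 1:]) n \<in> K \<and>
    h (Polynomial.coeff (\<Prod>i\<in>A. [:- a i, 1:]) n) = Polynomial.coeff (\<Prod>i\<in>A. [:- h (a i), 1:]) n"
  using assms(3,4)
proof (induction A arbitrary: n rule: finite_induct)
  case empty
  show ?case by (simp add: subfldD[OF K] emb_on_simps[OF K h])
next
  case (insert j A)
  have c: "Polynomial.coeff ([:- u, 1:] * p) n = - u * Polynomial.coeff p n + (case n of 0 \<Rightarrow> 0 | Suc m \<Rightarrow> Polynomial.coeff p m)"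
    for u :: "'z::comm_ring_1" and p n
    by (simp add: coeff_pCons split: nat.splits)
  have j: "a j \<in> K" using insert by blast
  show ?case unfolding prod.insert[OF insert(1,2)] c
    using insert.IH[of n] insert.IH[of "n - 1"] insert.prems j
    by (cases n) (auto simp: subfldD[OF K] emb_on_simps[OF K h] simp del: mult_minus_left)
qed

text \<open>Moving one value of \<open>f\<close> to another injects the fibre of the first into that
  of the second, so all fibres have the same size. Here \<open>f\<close> is an orbit map; the lemma
  serves both for embeddings and for their 2-element subsets.\<close>

lemma orbit_count:
  assumes "finite G" "finite \<Omega>" "\<And>g. g \<in> G \<Longrightarrow> f g \<in> \<Omega>"
    and tr: "\<And>y z. y \<in> \<Omega> \<Longrightarrow> z \<in> \<Omega> \<Longrightarrow> \<exists>\<phi>. inj_on \<phi> G \<and> (\<forall>g\<in>G. f g = y \<longrightarrow> \<phi> g \<in> G \<and> f (\<phi> g) = z)"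
    and y: "y \<in> \<Omega>"
  shows "card {g \<in> G. f g = y} * card \<Omega> = card G"
proof -
  have le: "card {g \<in> G. f g = u} \<le> card {g \<in> G. f g = v}" if uv: "u \<in> \<Omega>" "v \<in> \<Omega>" for u v
  proof -
    obtain \<phi> where "inj_on \<phi> G" "\<forall>g\<in>G. f g = u \<longrightarrow> \<phi> g \<in> G \<and> f (\<phi> g) = v" using tr[OF uv] by blast
    thus ?thesis using assms(1)
      by (intro card_inj_on_le[of \<phi>]) (auto intro: inj_on_subset)
  qed
  have "card G = (\<Sum>u\<in>\<Omega>. card {g \<in> G. f g = u})"
    using assms(1-3) sum.group[of G \<Omega> f "\<lambda>_. 1::nat"] by (simp add: image_subset_iff)
  also have "\<dots> = (\<Sum>u\<in>\<Omega>. card {g \<in> G. f g = y})"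
    using le y by (intro sum.cong) (auto intro: antisym)
  finally show ?thesis by simp
qed

section \<open>The embeddings and the compositum of a number field\<close>

locale number_fld =
  fixes ty :: "'k::field_char_0 itself"
  assumes number_field: "number_field ty"
begin

abbreviation Sig :: "('k \<Rightarrow> rat alg_closure) set" where "Sig \<equiv> embeddings"
abbreviation d :: nat where "d \<equiv> field_degree ty"
abbreviation Kc :: "rat alg_closure set" where "Kc \<equiv> compositum ty"
abbreviation G :: "(rat alg_closure \<Rightarrow> rat alg_closure) set" where "G \<equiv> galois_group ty"

lemma finite_span: obtains B :: "'k set" where "finite B" "rat_vs.span B = UNIV"
  using number_field unfolding number_field_def by blast

lemma algebraic_elem: "algebraic (x::'k)"
  using finite_span algebraic_if_powers_in_span by (metis UNIV_I)

text \<open>\<open>primitive_element\<close> speaks of an algebraically closed field, so the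
  spanning set is moved to the algebraic closure of \<open>'k\<close>. The image of
  \<open>'k\<close> is a subfield there, and the primitive element found belongs to it.\<close>

lemma primitive_exists: "\<exists>\<theta>::'k. Qadj \<theta> = UNIV"
proof -
  obtain B :: "'k set" where B: "finite B" "rat_vs.span B = UNIV" by (rule finite_span)
  have alg: "algebraic a" if a: "a \<in> to_ac ` B" for a
  proof -
    obtain x where x: "a = to_ac x" using a by blast
    obtain p where "p \<noteq> 0" "rpoly p x = 0" using algebraic_elem[of x] algebraic_iff_rpoly by blast
    thus ?thesis using emb_on_rpoly[OF subfld_UNIV emb_on_to_ac, of x p] x algebraic_iff_rpoly[of a] by auto
  qed
  have "finite (to_ac ` B)" using B(1) by simp
  from primitive_element[OF this alg] obtain c
    where c: "to_ac ` B \<subseteq> Qadj c" "\<forall>F. subfld F \<and> to_ac ` B \<subseteq> F \<longrightarrow> c \<in> F" by blast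
  have "subfld (range to_ac :: 'k alg_closure set)" unfolding subfld_def
    by (auto simp flip: to_ac_diff to_ac_mult to_ac_inverse to_ac_1 simp del: to_ac_1 to_ac_diff to_ac_mult to_ac_inverse)
  hence "c \<in> range to_ac" using c(2) by blast
  then obtain \<theta> :: 'k where \<theta>: "c = to_ac \<theta>" by blast
  note K = subfld_Qadj[OF algebraic_elem[of \<theta>]]
  have "x \<in> Qadj \<theta>" if "x \<in> B" for x
  proof -
    have "to_ac x \<in> Qadj (to_ac \<theta>)" using c(1) that \<theta> by blast
    then obtain p where "to_ac x = rpoly p (to_ac \<theta>)" unfolding Qadj_def by blast
    also have "\<dots> = to_ac (rpoly p \<theta>)" using emb_on_rpoly[OF subfld_UNIV emb_on_to_ac, of \<theta> p] by simp
    finally show ?thesis by (auto simp: Qadj_def)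
  qed
  moreover have "rat_vs.subspace (Qadj \<theta>)"
    by (intro rat_vs.subspaceI) (simp_all add: subfldD[OF K] subfld_of_rat[OF K])
  ultimately have "rat_vs.span B \<subseteq> Qadj \<theta>" by (intro rat_vs.span_minimal) auto
  thus ?thesis using B(2) by blast
qed

definition \<theta> :: 'k where "\<theta> = (SOME t. Qadj t = UNIV)"

lemma Qadj_\<theta>: "Qadj \<theta> = UNIV"
  unfolding \<theta>_def by (rule someI_ex[OF primitive_exists])

lemma rpoly_\<theta>: obtains p where "x = rpoly p \<theta>"
  using Qadj_\<theta> by (auto simp: Qadj_def)

lemma degree_minpoly:
  assumes f: "minpoly_of f \<theta>" shows "Polynomial.degree f = d"
proof -
  let ?n = "Polynomial.degree f" let ?B = "(\<lambda>i. \<theta> ^ i) ` {..<?n}"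
  have zero: "\<forall>i<?n. q i = 0" if q: "(\<Sum>i<?n. of_rat (q i) * \<theta> ^ i) = 0" for q :: "nat \<Rightarrow> rat"
  proof -
    define p where "p = (\<Sum>i<?n. Polynomial.monom (q i) i)"
    have cp: "Polynomial.coeff p i = (if i < ?n then q i else 0)" for i by (simp add: p_def coeff_sum)
    have "rpoly p \<theta> = (\<Sum>i<?n. rpoly (Polynomial.monom (q i) i) \<theta>)"
      unfolding p_def by (induction "{..<?n}" rule: infinite_finite_induct) (auto simp: rpoly_def hom_distribs poly_sum)
    hence "f dvd p" using q f by (simp add: minpoly_of_def)
    moreover have "p = 0 \<or> Polynomial.degree p < ?n"
      using cp by (metis leading_coeff_0_iff)
    ultimately have "p = 0" using dvd_imp_degree_le[of f p] by force
    thus ?thesis using cp by (metis coeff_0)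
  qed
  have inj: "inj_on (\<lambda>i. \<theta> ^ i) {..<?n}"
  proof (rule inj_onI, rule ccontr)
    fix i j assume ij: "i \<in> {..<?n}" "j \<in> {..<?n}" "\<theta> ^ i = \<theta> ^ j" "i \<noteq> j"
    have "(\<Sum>k<?n. of_rat ((if k = i then 1 else 0) - (if k = j then 1 else 0)) * \<theta> ^ k)
        = (\<Sum>k<?n. (if k = i then \<theta> ^ i else 0) - (if k = j then \<theta> ^ j else 0))"
      using ij by (intro sum.cong) (auto simp: of_rat_minus)
    also have "\<dots> = 0" using ij by (simp add: sum_subtractf)
    finally show False using zero ij by fastforce
  qed
  have "rat_vs.independent ?B"
  proof (rule rat_vs.independent_if_scalars_zero)
    fix u x assume s: "(\<Sum>x\<in>?B. of_rat (u x) * x) = 0" and x: "x \<in> ?B"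
    have "(\<Sum>i<?n. of_rat (u (\<theta> ^ i)) * \<theta> ^ i) = 0" using s by (simp add: sum.reindex[OF inj])
    from zero[OF this] x show "u x = 0" by auto
  qed simp
  moreover have "x \<in> rat_vs.span ?B" for x using span_powers[OF f] rpoly_\<theta>[of x] by metis
  ultimately have "rat_vs.dim (UNIV :: 'k set) = card ?B" by (intro rat_vs.dim_unique[of ?B]) auto
  thus ?thesis using card_image[OF inj] by (simp add: field_degree_def)
qed

lemma d_pos: "d > 0"
  using degree_minpoly minpoly_of_degree_pos minpoly_of_exists[OF algebraic_elem] by metis

text \<open>More than d vectors satisfy a rational relation; once denominators are cleared, its
  coefficients could be divided by p for ever, so they would vanish. Through this lemma the degree
  bounds the length of chains of values, the size of residue bases and the sum of the e f.\<close>

lemma rank_bound: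
  fixes v :: "'i \<Rightarrow> 'k"
  assumes p: "p > (1::int)" and I: "finite I"
    and rel: "\<And>c i. (\<Sum>i\<in>I. of_int (c i) * v i) = 0 \<Longrightarrow> i \<in> I \<Longrightarrow> p dvd c i"
  shows "card I \<le> d"
proof (rule ccontr)
  assume n: "\<not> card I \<le> d"
  obtain f where f: "minpoly_of f \<theta>" using minpoly_of_exists[OF algebraic_elem] by blast
  let ?B = "(\<lambda>i. \<theta> ^ i) ` {..<Polynomial.degree f}"
  have "card ?B \<le> d" using degree_minpoly[OF f] card_image_le[of "{..<Polynomial.degree f}" "\<lambda>i. \<theta> ^ i"] by simp
  hence "card I > card ?B" using n by simp
  moreover have "v i \<in> rat_vs.span ?B" for i using span_powers[OF f] rpoly_\<theta>[of "v i"] by metis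
  ultimately obtain q where q: "(\<Sum>i\<in>I. of_rat (q i) * v i) = 0" "\<exists>i\<in>I. q i \<noteq> 0"
    using rat_relation[OF I, of ?B v] by blast
  define D where "D = (\<Prod>i\<in>I. snd (quotient_of (q i)))"
  have D: "D \<noteq> 0" unfolding D_def using I by (metis prod_zero_iff quotient_of_denom_pos' less_irrefl)
  have "\<exists>c::int. of_int D * q i = of_int c" if "i \<in> I" for i
  proof -
    obtain a b where ab: "quotient_of (q i) = (a, b)" by fastforce
    have "D = b * (\<Prod>j\<in>I - {i}. snd (quotient_of (q j)))"
      unfolding D_def using I that ab by (simp add: prod.remove)
    hence "of_int D * q i = of_int (a * (\<Prod>j\<in>I - {i}. snd (quotient_of (q j))))"
      using quotient_of_div[OF ab] quotient_of_denom_pos[OF ab] by simp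
    thus ?thesis by blast
  qed
  then obtain c :: "'i \<Rightarrow> int" where c: "\<And>i. i \<in> I \<Longrightarrow> of_int D * q i = of_int (c i)" by metis
  have "of_int (c i) = (of_int D * of_rat (q i) :: 'k)" if "i \<in> I" for i
    using arg_cong[OF c[OF that], of "of_rat :: rat \<Rightarrow> 'k"] by (simp add: of_rat_mult)
  hence "(\<Sum>i\<in>I. of_int (c i) * v i) = of_int D * (\<Sum>i\<in>I. of_rat (q i) * v i)"
    by (simp add: sum_distrib_left mult.assoc)
  hence c0: "(\<Sum>i\<in>I. of_int (c i) * v i) = 0" using q by simp
  have all: "\<forall>i\<in>I. p ^ k dvd c i" for k
  proof (induction k)
    case (Suc k)
    have p0: "p ^ k \<noteq> 0" using p by simp
    have "(of_int (p ^ k) :: 'k) * (\<Sum>i\<in>I. of_int (c i div p ^ k) * v i) = (\<Sum>i\<in>I. of_int (c i) * v i)"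
      unfolding sum_distrib_left mult.assoc[symmetric] of_int_mult[symmetric] using Suc
      by (intro sum.cong) auto
    hence "(\<Sum>i\<in>I. of_int (c i div p ^ k) * v i) = 0" 
      using c0 p0 unfolding c0 mult_eq_0_iff of_int_eq_0_iff by blast
    hence "\<forall>i\<in>I. p dvd c i div p ^ k" using rel[of "\<lambda>i. c i div p ^ k"] by blast
    thus ?case using Suc p0 by (auto simp: dvd_div_iff_mult mult.commute)
  qed simp
  obtain i where i: "i \<in> I" "q i \<noteq> 0" using q by blast
  have ci: "c i \<noteq> 0" using c[OF i(1)] D i(2) by (metis mult_eq_0_iff of_int_eq_0_iff)
  \<comment> \<open>The exponent is chosen because p^n exceeds n, while a nonzero \<open>c i\<close>
    cannot be smaller in absolute value than one of its divisors.\<close>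
  have "p ^ nat \<bar>c i\<bar> \<le> \<bar>c i\<bar>" using dvd_imp_le_int[OF ci, of "p ^ nat \<bar>c i\<bar>"] all[of "nat \<bar>c i\<bar>"] i(1) p by simp
  moreover have "\<bar>c i\<bar> < 2 ^ nat \<bar>c i\<bar>" using of_nat_less_two_power[of "nat \<bar>c i\<bar>", where 'a=int] by simp
  moreover have "(2::int) ^ nat \<bar>c i\<bar> \<le> p ^ nat \<bar>c i\<bar>" using p by (intro power_mono) auto
  ultimately show False by linarith
qed

lemma embedding_eqI:
  assumes "\<sigma> \<in> Sig" "\<tau> \<in> Sig" "\<sigma> \<theta> = \<tau> \<theta>" shows "\<sigma> = \<tau>"
proof
  fix x obtain p where "x = rpoly p \<theta>" by (rule rpoly_\<theta>)
  thus "\<sigma> x = \<tau> x" using assms by (simp add: embedding_simps)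
qed

text \<open>An embedding is determined by the image of \<open>\<theta>\<close>, and every root of
  the minimal polynomial of \<open>\<theta>\<close> occurs as such an image.\<close>

lemma card_Sig: "card Sig = d" and finite_Sig: "finite Sig"
proof -
  obtain f where f: "minpoly_of f \<theta>" using minpoly_of_exists[OF algebraic_elem] by blast
  have "(\<lambda>\<sigma>. \<sigma> \<theta>) ` Sig = {r. rpoly f r = 0}"
  proof (intro Set.set_eqI iffI)
    fix r assume "r \<in> {r::rat alg_closure. rpoly f r = 0}"
    then obtain h where h: "emb_on (Qadj \<theta>) h" "\<And>p. h (rpoly p \<theta>) = rpoly p r" using hom_of_root[OF f] by blast
    have "h \<theta> = r" using h(2)[of "Polynomial.monom 1 1"] by simp
    thus "r \<in> (\<lambda>\<sigma>. \<sigma> \<theta>) ` Sig" using h(1) unfolding Qadj_\<theta> embeddings_iff[symmetric] by blast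
  next
    fix r assume "r \<in> (\<lambda>\<sigma>. \<sigma> \<theta>) ` Sig"
    then obtain \<sigma> where s: "\<sigma> \<in> Sig" "r = \<sigma> \<theta>" by blast
    have "\<sigma> (rpoly f \<theta>) = 0" using f s(1) by (simp add: minpoly_of_def embedding_simps)
    thus "r \<in> {r. rpoly f r = 0}" using s by (simp add: embedding_simps)
  qed
  moreover have "inj_on (\<lambda>\<sigma>. \<sigma> \<theta>) Sig" by (rule inj_onI) (rule embedding_eqI)
  ultimately have "bij_betw (\<lambda>\<sigma>. \<sigma> \<theta>) Sig {r. rpoly f r = 0}" by (simp add: bij_betw_def)
  from bij_betw_same_card[OF this] show "card Sig = d"
    using card_roots_minpoly[OF f, where 'b="rat alg_closure"] degree_minpoly[OF f] by simp
  thus "finite Sig" using d_pos by (metis card.infinite less_irrefl)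
qed

lemma ring_of_type_a_inv: "\<ominus>\<^bsub>ring_of_type_algebra\<^esub> (x::'b::field) = - x"
proof -
  interpret R: ring "ring_of_type_algebra :: 'b ring" by (rule ring_from_type_algebra)
  show ?thesis by (rule R.minus_equality) (simp_all add: ring_of_type_algebra_def)
qed

lemma ring_of_type_m_inv: "x \<noteq> 0 \<Longrightarrow> inv\<^bsub>ring_of_type_algebra\<^esub> (x::'b::field) = inverse x"
proof -
  interpret R: cring "ring_of_type_algebra :: 'b ring" by (rule cring_from_type_algebra)
  show "x \<noteq> 0 \<Longrightarrow> ?thesis" by (rule R.comm_inv_char) (simp_all add: ring_of_type_algebra_def)
qed

lemma subfld_Kc: "subfld Kc"
proof -
  let ?R = "ring_of_type_algebra :: rat alg_closure ring"
  let ?H = "\<Union>\<sigma>\<in>Sig. range \<sigma>"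
  have o: "\<one>\<^bsub>?R\<^esub> = 1" "\<zero>\<^bsub>?R\<^esub> = 0" "\<And>x y. x \<oplus>\<^bsub>?R\<^esub> y = x + y" "\<And>x y. x \<otimes>\<^bsub>?R\<^esub> y = x * y"
    by (simp_all add: ring_of_type_algebra_def)
  have one: "1 \<in> generate_field ?R ?H" using generate_field.one[of ?R ?H] o by simp
  have neg: "- x \<in> generate_field ?R ?H" if "x \<in> generate_field ?R ?H" for x
    using generate_field.a_inv[OF that] by (simp add: ring_of_type_a_inv)
  have add: "x + y \<in> generate_field ?R ?H" if "x \<in> generate_field ?R ?H" "y \<in> generate_field ?R ?H" for x y
    using generate_field.eng_add[OF that] by (simp add: o)
  have mul: "x * y \<in> generate_field ?R ?H" if "x \<in> generate_field ?R ?H" "y \<in> generate_field ?R ?H" for x y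
    using generate_field.eng_mult[OF that] by (simp add: o)
  have inv: "inverse x \<in> generate_field ?R ?H" if "x \<in> generate_field ?R ?H" for x
    using generate_field.m_inv[OF that] that by (cases "x = 0") (simp_all add: o ring_of_type_m_inv)
  show ?thesis unfolding subfld_def compositum_def
    using one add[OF _ neg] mul inv by auto
qed

lemma embedding_in_Kc: "\<sigma> \<in> Sig \<Longrightarrow> \<sigma> x \<in> Kc"
  unfolding compositum_def by (rule generate_field.incl) auto

lemma Kc_least:
  assumes F: "subfld F" and "\<And>\<sigma> x. \<sigma> \<in> Sig \<Longrightarrow> \<sigma> x \<in> F" shows "Kc \<subseteq> F"
proof
  let ?R = "ring_of_type_algebra :: rat alg_closure ring"
  have o: "\<one>\<^bsub>?R\<^esub> = 1" "\<zero>\<^bsub>?R\<^esub> = 0" "\<And>x y. x \<oplus>\<^bsub>?R\<^esub> y = x + y" "\<And>x y. x \<otimes>\<^bsub>?R\<^esub> y = x * y"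
    by (simp_all add: ring_of_type_algebra_def)
  fix x assume "x \<in> Kc"
  hence "x \<in> generate_field ?R (\<Union>\<sigma>\<in>Sig. range \<sigma>)" by (simp add: compositum_def)
  thus "x \<in> F"
    by induction (use assms(2) in \<open>auto simp: o ring_of_type_a_inv ring_of_type_m_inv subfldD[OF F]\<close>)
qed

section \<open>The Galois group and its action on the embeddings\<close>

lemma galois_group_iff: "g \<in> G \<longleftrightarrow> g \<in> extensional Kc \<and> emb_on Kc g \<and> bij_betw g Kc Kc"
proof -
  let ?K = "ring_of_type_algebra\<lparr>carrier := Kc\<rparr>"
  have sel: "carrier ?K = Kc" "\<one>\<^bsub>?K\<^esub> = 1" "x \<oplus>\<^bsub>?K\<^esub> y = x + y" "x \<otimes>\<^bsub>?K\<^esub> y = x * y" for x y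
    by (simp_all add: ring_of_type_algebra_def)
  have q: "\<forall>q\<in>\<rat>. g q = q" if "emb_on Kc g"
    using emb_on_of_rat[OF subfld_Kc that] by (metis Rats_cases)
  have "g \<in> ring_iso ?K ?K \<longleftrightarrow> emb_on Kc g \<and> bij_betw g Kc Kc"
    unfolding ring_iso_def Ring.ring_hom_def emb_on_def mem_Collect_eq sel
    using bij_betw_imp_funcset[of g Kc Kc] by blast
  thus ?thesis unfolding galois_group_def Let_def using q by blast
qed

lemma galD:
  assumes "g \<in> G"
  shows "emb_on Kc g" "x \<in> Kc \<Longrightarrow> g x \<in> Kc" "inj_on g Kc" "g ` Kc = Kc" "g \<in> extensional Kc"
  using assms by (auto simp: galois_group_iff bij_betw_def)

lemma gal_comp_embedding: 
  assumes "emb_on Kc g" "\<sigma> \<in> Sig" shows "g \<circ> \<sigma> \<in> Sig"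
  using assms embedding_in_Kc[OF assms(2)]
  by (simp add: embeddings_iff emb_on_def)

lemma gal_extI: "g \<in> G \<Longrightarrow> h \<in> G \<Longrightarrow> (\<And>x. x \<in> Kc \<Longrightarrow> g x = h x) \<Longrightarrow> g = h"
  by (rule extensionalityI[OF galD(5) galD(5)]) auto

lemma gal_compose:
  assumes "g \<in> G" "h \<in> G" shows "compose Kc g h \<in> G"
proof -
  note K = subfld_Kc
  have "bij_betw (g \<circ> h) Kc Kc"
    using assms unfolding galois_group_iff by (intro bij_betw_trans[of h Kc Kc g Kc]) simp_all
  hence "bij_betw (compose Kc g h) Kc Kc"
    by (subst bij_betw_cong[of Kc _ "g \<circ> h"]) (simp_all add: compose_eq)
  moreover have "emb_on Kc (compose Kc g h)"
    using galD[OF assms(1)] galD[OF assms(2)] subfldD[OF K]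
    by (simp add: emb_on_def compose_eq)
  ultimately show ?thesis by (simp add: galois_group_iff compose_extensional)
qed

lemma gal_id: "restrict id Kc \<in> G"
  using subfldD[OF subfld_Kc]
  by (simp add: galois_group_iff emb_on_def bij_betw_def inj_on_def)

text \<open>This is normality of the compositum. Composition with \<open>g\<close> is injective on
  the finite set of embeddings, hence permutes it, so \<open>g\<close> maps the set of generators of
  the compositum onto itself.\<close>

lemma gal_if_emb:
  assumes g: "emb_on Kc g" shows "restrict g Kc \<in> G"
proof -
  note K = subfld_Kc
  note e = emb_on_simps[OF K g]
  have "subfld {z \<in> Kc. g z \<in> Kc}"
    unfolding subfld_def using subfldD[OF K] by (auto simp: e)
  hence "Kc \<subseteq> {z \<in> Kc. g z \<in> Kc}"
    by (rule Kc_least) (use gal_comp_embedding[OF g] embedding_in_Kc in \<open>fastforce simp: comp_def\<close>)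
  hence sub: "g ` Kc \<subseteq> Kc" by blast
  have inj: "inj_on g Kc" by (rule emb_on_inj[OF K g])
  have "inj_on (\<lambda>\<sigma>. g \<circ> \<sigma>) Sig"
    by (rule inj_onI, rule ext) (metis comp_apply embedding_in_Kc inj inj_onD)
  hence surj: "(\<lambda>\<sigma>. g \<circ> \<sigma>) ` Sig = Sig"
    using gal_comp_embedding[OF g] finite_Sig by (intro endo_inj_surj) auto
  have "subfld (g ` Kc)" unfolding subfld_def
  proof (intro conjI ballI; (elim imageE)?)
    show "1 \<in> g ` Kc" using e(1) subfldD(1)[OF K] by (metis imageI)
    fix x y u v assume uv: "x = g u" "u \<in> Kc" "y = g v" "v \<in> Kc"
    show "x - y \<in> g ` Kc" "x * y \<in> g ` Kc"
      using e(4,6)[of u v] uv subfldD[OF K] by (metis imageI)+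
  next
    fix x u assume "x = g u" "u \<in> Kc"
    thus "inverse x \<in> g ` Kc" using e(7)[of u] subfldD(5)[OF K] by (metis imageI)
  qed
  hence "Kc \<subseteq> g ` Kc"
  proof (rule Kc_least)
    fix \<sigma> x assume "\<sigma> \<in> Sig"
    then obtain \<tau> where "\<tau> \<in> Sig" "\<sigma> = g \<circ> \<tau>" using surj by blast
    thus "\<sigma> x \<in> g ` Kc" using embedding_in_Kc by simp
  qed
  hence "bij_betw g Kc Kc" using sub inj by (auto simp: bij_betw_def)
  thus ?thesis using g subfldD[OF K] by (simp add: galois_group_iff emb_on_def bij_betw_cong[of Kc "restrict g Kc" g])
qed

lemma Kc_primitive: "\<exists>\<eta>. Qadj \<eta> = Kc"
proof -
  have "finite ((\<lambda>\<sigma>. \<sigma> \<theta>) ` Sig)" using finite_Sig by simp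
  from primitive_element[OF this algebraic_qbar] obtain c where c: "(\<lambda>\<sigma>. \<sigma> \<theta>) ` Sig \<subseteq> Qadj c"
    "\<forall>F. subfld F \<and> (\<lambda>\<sigma>. \<sigma> \<theta>) ` Sig \<subseteq> F \<longrightarrow> c \<in> F" by blast
  have "c \<in> Kc" using c(2) subfld_Kc embedding_in_Kc by blast
  hence "Qadj c \<subseteq> Kc" by (rule Qadj_least[OF subfld_Kc])
  moreover have K: "subfld (Qadj c)" by (rule subfld_Qadj[OF algebraic_qbar])
  have "Kc \<subseteq> Qadj c"
  proof (rule Kc_least[OF K])
    fix \<sigma> x assume s: "\<sigma> \<in> Sig"
    obtain p where "x = rpoly p \<theta>" by (rule rpoly_\<theta>)
    thus "\<sigma> x \<in> Qadj c" using s c(1) subfld_rpoly[OF K] by (auto simp: embedding_simps)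
  qed
  ultimately show ?thesis by blast
qed

text \<open>For the fixed field, write \<open>z\<close> as a polynomial \<open>p\<close> of degree
  below that of the minimal polynomial \<open>f\<close> of a primitive element. Every root of
  \<open>f\<close> is the image of that element under an automorphism, so \<open>p\<close> takes the
  value \<open>z\<close> at all of them, too many for a polynomial of this degree unless it is
  constant.\<close>

lemma finite_G: "finite G" and gal_fixed: "z \<in> Kc \<Longrightarrow> (\<And>g. g \<in> G \<Longrightarrow> g z = z) \<Longrightarrow> z \<in> range of_rat"
proof -
  obtain \<eta> where \<eta>: "Qadj \<eta> = Kc" using Kc_primitive by blast
  hence \<eta>K: "\<eta> \<in> Kc" using Qadj_mem by blast
  obtain f where f: "minpoly_of f \<eta>" using minpoly_of_exists[OF algebraic_qbar] by blast
  let ?r = "{r :: rat alg_closure. rpoly f r = 0}"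
  have cr: "card ?r = Polynomial.degree f" by (rule card_roots_minpoly[OF f])
  hence fr: "finite ?r" using minpoly_of_degree_pos[OF f] by (metis card.infinite less_irrefl)
  have "inj_on (\<lambda>g. g \<eta>) G"
  proof (rule inj_onI, rule gal_extI)
    fix g h x assume gh: "g \<in> G" "h \<in> G" "g \<eta> = h \<eta>" "x \<in> Kc"
    then obtain p where "x = rpoly p \<eta>" using \<eta> by (auto simp: Qadj_def)
    thus "g x = h x" using gh(3) emb_on_rpoly[OF subfld_Kc galD(1)[OF gh(1)] \<eta>K]
      emb_on_rpoly[OF subfld_Kc galD(1)[OF gh(2)] \<eta>K] by simp
  qed
  moreover have "(\<lambda>g. g \<eta>) ` G \<subseteq> ?r"
  proof safe
    fix g assume g: "g \<in> G"
    show "rpoly f (g \<eta>) = 0" using emb_on_rpoly[OF subfld_Kc galD(1)[OF g] \<eta>K, of f] f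
      emb_on_simps(2)[OF subfld_Kc galD(1)[OF g]] by (simp add: minpoly_of_def)
  qed
  ultimately show "finite G" using fr by (meson inj_on_finite)
  assume z: "z \<in> Kc" and fix_z: "\<And>g. g \<in> G \<Longrightarrow> g z = z"
  obtain p0 where "z = rpoly p0 \<eta>" using z \<eta> by (auto simp: Qadj_def)
  hence zp: "z = rpoly (p0 mod f) \<eta>" using f by (simp add: rpoly_mod minpoly_of_def)
  define p where "p = p0 mod f"
  have eq: "rpoly p r = z" if r: "rpoly f r = 0" for r
  proof -
    obtain h where h: "emb_on (Qadj \<eta>) h" "\<And>p. h (rpoly p \<eta>) = rpoly p r" using hom_of_root[OF f r] by blast
    have "restrict h Kc z = z" using fix_z[OF gal_if_emb] h(1) \<eta> by simp
    thus ?thesis using h(2) zp z by (simp add: p_def)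
  qed
  let ?P = "map_poly of_rat p - [:z:]"
  have "Polynomial.degree p < Polynomial.degree f"
    using degree_mod_less'[of f p0] minpoly_of_nonzero[OF f] minpoly_of_degree_pos[OF f]
    by (cases "p = 0") (auto simp: p_def)
  hence deg: "Polynomial.degree ?P < Polynomial.degree f"
    using degree_diff_le[of "map_poly of_rat p :: rat alg_closure poly" "Polynomial.degree p" "[:z:]"] by simp
  have "?P = 0"
  proof (rule ccontr)
    assume nz: "?P \<noteq> 0"
    have "?r \<subseteq> {r. poly ?P r = 0}" using eq by (auto simp: rpoly_def)
    hence "card ?r \<le> card {r. poly ?P r = 0}" using poly_roots_finite[OF nz] by (intro card_mono)
    also have "\<dots> \<le> Polynomial.degree ?P" using card_poly_roots_bound[OF nz] .
    finally show False using deg cr by simp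
  qed
  hence "map_poly of_rat p = [:z:]" by simp
  from arg_cong[OF this, of "\<lambda>q. Polynomial.coeff q 0"] have "of_rat (Polynomial.coeff p 0) = z" by simp
  thus "z \<in> range of_rat" by blast
qed

lemma card_G_pos: "card G > 0"
  using gal_id finite_G by (auto simp: card_gt_0_iff)

lemma gal_stable_rational_poly:
  assumes "finite A" "\<And>i. i \<in> A \<Longrightarrow> a i \<in> Kc"
    and st: "\<And>g. g \<in> G \<Longrightarrow> \<exists>\<pi>. bij_betw \<pi> A A \<and> (\<forall>i\<in>A. g (a i) = a (\<pi> i))"
  obtains f where "map_poly of_rat f = (\<Prod>i\<in>A. [:- a i, 1:])"
proof -
  let ?F = "\<Prod>i\<in>A. [:- a i, 1:]"
  have "Polynomial.coeff ?F n \<in> range of_rat" for n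
  proof (rule gal_fixed)
    show "Polynomial.coeff ?F n \<in> Kc"
      using emb_on_coeff_prod[OF subfld_Kc galD(1)[OF gal_id] assms(1), of a, OF assms(2)] by blast
    fix g assume g: "g \<in> G"
    obtain \<pi> where pi: "bij_betw \<pi> A A" "\<forall>i\<in>A. g (a i) = a (\<pi> i)" using st[OF g] by blast
    have "g (Polynomial.coeff ?F n) = Polynomial.coeff (\<Prod>i\<in>A. [:- g (a i), 1:]) n"
      using emb_on_coeff_prod[OF subfld_Kc galD(1)[OF g] assms(1), of a, OF assms(2)] by blast
    also have "(\<Prod>i\<in>A. [:- g (a i), 1:]) = (\<Prod>i\<in>A. [:- a (\<pi> i), 1:])" using pi by (intro prod.cong) auto
    also have "\<dots> = ?F" by (rule prod.reindex_bij_betw[OF pi(1)])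
    finally show "g (Polynomial.coeff ?F n) = Polynomial.coeff ?F n" .
  qed
  thus ?thesis using of_rat_poly_exists that by blast
qed

lemma gal_comp_bij:
  assumes g: "g \<in> G" and A: "A \<subseteq> Sig" "\<And>\<sigma>. \<sigma> \<in> A \<Longrightarrow> g \<circ> \<sigma> \<in> A"
  shows "bij_betw (\<lambda>\<sigma>. g \<circ> \<sigma>) A A"
proof -
  have "inj_on (\<lambda>\<sigma>. g \<circ> \<sigma>) A"
    by (rule inj_onI, rule ext) (metis A(1) comp_apply embedding_in_Kc galD(3)[OF g] inj_onD subsetD)
  moreover from this have "(\<lambda>\<sigma>. g \<circ> \<sigma>) ` A = A"
    using A finite_subset[OF A(1) finite_Sig] by (intro endo_inj_surj) auto
  ultimately show ?thesis by (simp add: bij_betw_def)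
qed

text \<open>The product of \<open>X - \<rho> \<theta>\<close> over the orbit of
  \<open>\<sigma>\<close> has rational coefficients. It vanishes at \<open>\<theta>\<close>, hence
  at \<open>\<tau> \<theta>\<close>, so \<open>\<tau>\<close> is in the orbit.\<close>

lemma gal_transitive:
  assumes s: "\<sigma> \<in> Sig" and t: "\<tau> \<in> Sig" shows "\<exists>g\<in>G. g \<circ> \<sigma> = \<tau>"
proof -
  define A where "A = (\<lambda>g. g \<circ> \<sigma>) ` G"
  have A: "A \<subseteq> Sig" unfolding A_def using gal_comp_embedding[OF galD(1)] s by blast
  have st: "g \<circ> \<rho> \<in> A" if gG: "g \<in> G" and rA: "\<rho> \<in> A" for g \<rho>
  proof -
    obtain h where h: "h \<in> G" "\<rho> = h \<circ> \<sigma>" using rA by (auto simp: A_def)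
    have "g \<circ> \<rho> = compose Kc g h \<circ> \<sigma>" using h s by (auto simp: compose_eq embedding_in_Kc)
    thus ?thesis unfolding A_def using gal_compose[OF gG h(1)] by blast
  qed
  have "restrict id Kc \<circ> \<sigma> = \<sigma>" using embedding_in_Kc[OF s] by auto
  hence sA: "\<sigma> \<in> A" unfolding A_def using gal_id by (metis imageI)
  have finA: "finite A" using finite_subset[OF A finite_Sig] .
  obtain f where f: "map_poly of_rat f = (\<Prod>\<rho>\<in>A. [:- \<rho> \<theta>, 1:])"
  proof (rule gal_stable_rational_poly[of A "\<lambda>\<rho>. \<rho> \<theta>"])
    fix g assume g: "g \<in> G"
    show "\<exists>\<pi>. bij_betw \<pi> A A \<and> (\<forall>\<rho>\<in>A. g (\<rho> \<theta>) = \<pi> \<rho> \<theta>)"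
      using gal_comp_bij[OF g A st[OF g]] by (intro exI[of _ "\<lambda>\<sigma>. g \<circ> \<sigma>"]) auto
  qed (use A embedding_in_Kc finA in auto)
  have rf: "rpoly f r = 0 \<longleftrightarrow> (\<exists>\<rho>\<in>A. r = \<rho> \<theta>)" for r
    using finA by (auto simp: rpoly_def f poly_prod)
  have "\<sigma> (rpoly f \<theta>) = 0" using rf sA s by (auto simp: embedding_simps)
  hence "rpoly f \<theta> = 0" using embedding_simps(8)[OF s] by blast
  hence "rpoly f (\<tau> \<theta>) = 0" using embedding_simps(2,14)[OF t] by metis
  then obtain \<rho> where "\<rho> \<in> A" "\<tau> \<theta> = \<rho> \<theta>" using rf by blast
  hence "\<tau> \<in> A" using embedding_eqI[OF t, of \<rho>] A by auto
  thus ?thesis by (auto simp: A_def)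
qed

lemma charpoly:
  obtains f where "map_poly of_rat f = (\<Prod>\<sigma>\<in>Sig. [:- \<sigma> x, 1:])" "rpoly f x = 0"
proof -
  obtain f where f: "map_poly of_rat f = (\<Prod>\<sigma>\<in>Sig. [:- \<sigma> x, 1:])"
  proof (rule gal_stable_rational_poly[of Sig "\<lambda>\<rho>. \<rho> x"])
    fix g assume g: "g \<in> G"
    show "\<exists>\<pi>. bij_betw \<pi> Sig Sig \<and> (\<forall>\<rho>\<in>Sig. g (\<rho> x) = \<pi> \<rho> x)"
      using gal_comp_bij[OF g subset_refl gal_comp_embedding[OF galD(1)[OF g]]] by (intro exI[of _ "\<lambda>\<sigma>. g \<circ> \<sigma>"]) auto
  qed (use embedding_in_Kc finite_Sig in auto)
  have "Sig \<noteq> {}" using card_Sig d_pos by auto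
  then obtain \<sigma> where s: "\<sigma> \<in> Sig" by blast
  have "rpoly f (\<sigma> x) = 0" using s finite_Sig by (auto simp: rpoly_def f poly_prod)
  hence "rpoly f x = 0" using embedding_simps(8,14)[OF s] by metis
  thus ?thesis using f that by blast
qed

lemma gal_compose_inj: "h \<in> G \<Longrightarrow> inj_on (compose Kc h) G"
  by (rule inj_onI, rule gal_extI) (metis compose_eq galD(2,3) inj_onD)+

text \<open>Written as a product, the count also exhibits d as a divisor of the order of the group;
  this makes the exponents of the theorem natural numbers.\<close>

lemma gal_count:
  assumes s: "\<sigma> \<in> Sig" and t: "\<tau> \<in> Sig" shows "card {g \<in> G. g \<circ> \<sigma> = \<tau>} * d = card G"
  unfolding card_Sig[symmetric]
proof (rule orbit_count[OF finite_G finite_Sig _ _ t])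
  fix y z assume "y \<in> Sig" "z \<in> Sig"
  then obtain h where h: "h \<in> G" "h \<circ> y = z" using gal_transitive by blast
  have "compose Kc h g \<circ> \<sigma> = z" if "g \<circ> \<sigma> = y" for g
    using that h(2) s by (auto simp: compose_eq embedding_in_Kc)
  thus "\<exists>\<phi>. inj_on \<phi> G \<and> (\<forall>g\<in>G. g \<circ> \<sigma> = y \<longrightarrow> \<phi> g \<in> G \<and> \<phi> g \<circ> \<sigma> = z)"
    using gal_compose_inj[OF h(1)] gal_compose[OF h(1)] by blast
qed (use s gal_comp_embedding[OF galD(1)] in blast)

lemma act_compose: "A \<subseteq> Sig \<Longrightarrow> act (compose Kc h g) A = act h (act g A)"
  unfolding act_def image_image by (intro image_cong) (auto simp: compose_eq embedding_in_Kc subset_iff)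

lemma card_act: 
  assumes "g \<in> G" "A \<subseteq> Sig" shows "card (act g A) = card A" "act g A \<subseteq> Sig" "inj_on (\<lambda>\<sigma>. g \<circ> \<sigma>) A"
proof -
  show 1: "inj_on (\<lambda>\<sigma>. g \<circ> \<sigma>) A"
    by (rule inj_onI, rule ext) (metis assms(2) comp_apply embedding_in_Kc galD(3)[OF assms(1)] inj_onD subsetD)
  show "card (act g A) = card A" unfolding act_def by (rule card_image[OF 1])
  show "act g A \<subseteq> Sig" unfolding act_def using gal_comp_embedding[OF galD(1)[OF assms(1)]] assms(2) by blast
qed

lemma gal_count_pairs:
  assumes th: "two_homogeneous ty" and A: "A \<subseteq> Sig" "card A = 2" and B: "B \<subseteq> Sig" "card B = 2"
  shows "card {g \<in> G. act g A = B} * (d choose 2) = card G"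
proof -
  let ?W = "{B. B \<subseteq> Sig \<and> card B = 2}"
  have "card {g \<in> G. act g A = B} * card ?W = card G"
  proof (rule orbit_count[OF finite_G])
    show "finite ?W" using finite_Sig by simp
    show "B \<in> ?W" using B by simp
    show "act g A \<in> ?W" if "g \<in> G" for g using card_act[OF that A(1)] A(2) by simp
    fix y z assume "y \<in> ?W" "z \<in> ?W"
    then obtain h where h: "h \<in> G" "act h y = z" using th unfolding two_homogeneous_def by blast
    have "act (compose Kc h g) A = z" if "act g A = y" for g using act_compose[OF A(1)] that h(2) by simp
    thus "\<exists>\<phi>. inj_on \<phi> G \<and> (\<forall>g\<in>G. act g A = y \<longrightarrow> \<phi> g \<in> G \<and> act (\<phi> g) A = z)"
      using gal_compose_inj[OF h(1)] gal_compose[OF h(1)] by blast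
  qed
  thus ?thesis using n_subsets[OF finite_Sig, of 2] card_Sig by simp
qed

lemma gal_norm_rational:
  assumes z: "z \<in> Kc" shows "(\<Prod>g\<in>G. g z) \<in> range of_rat"
proof (rule gal_fixed)
  show "(\<Prod>g\<in>G. g z) \<in> Kc" using galD(2) z by (intro subfld_prod[OF subfld_Kc]) auto
  fix h assume h: "h \<in> G"
  have "h (\<Prod>g\<in>G. g z) = (\<Prod>g\<in>G. h (g z))"
    using galD(2) z by (intro emb_on_prod[OF subfld_Kc galD(1)[OF h]]) auto
  also have "\<dots> = (\<Prod>g\<in>G. compose Kc h g z)" using z by (simp add: compose_eq)
  also have "\<dots> = (\<Prod>g\<in>G. g z)"
  proof (rule prod.reindex_bij_betw)
    have "compose Kc h ` G = G"
      using gal_compose_inj[OF h] gal_compose[OF h] finite_G by (intro endo_inj_surj) auto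
    thus "bij_betw (compose Kc h) G G" using gal_compose_inj[OF h] by (simp add: bij_betw_def)
  qed
  finally show "h (\<Prod>g\<in>G. g z) = (\<Prod>g\<in>G. g z)" .
qed

end

subsection \<open>Valuation rings above a prime\<close>

definition vsubring :: "'a::field set \<Rightarrow> bool" where
  "vsubring V \<longleftrightarrow> 1 \<in> V \<and> (\<forall>x\<in>V. \<forall>y\<in>V. x - y \<in> V \<and> x * y \<in> V)"

lemma vsubringD:
  assumes "vsubring V"
  shows "1 \<in> V" "0 \<in> V" "x \<in> V \<Longrightarrow> y \<in> V \<Longrightarrow> x - y \<in> V" "x \<in> V \<Longrightarrow> y \<in> V \<Longrightarrow> x * y \<in> V"
    "x \<in> V \<Longrightarrow> - x \<in> V" "x \<in> V \<Longrightarrow> y \<in> V \<Longrightarrow> x + y \<in> V"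
proof -
  show 1: "1 \<in> V" "x \<in> V \<Longrightarrow> y \<in> V \<Longrightarrow> x - y \<in> V" "x \<in> V \<Longrightarrow> y \<in> V \<Longrightarrow> x * y \<in> V"
    for x y using assms by (auto simp: vsubring_def)
  show 0: "0 \<in> V" using 1(2)[OF 1(1) 1(1)] by simp
  show 2: "x \<in> V \<Longrightarrow> - x \<in> V" for x using 1(2)[OF 0] by fastforce
  show "x \<in> V \<Longrightarrow> y \<in> V \<Longrightarrow> x + y \<in> V" using 1(2)[of x "-y"] 2 by simp
qed

lemma vsubring_power: "vsubring V \<Longrightarrow> x \<in> V \<Longrightarrow> x ^ n \<in> V"
  by (induction n) (auto simp: vsubringD)

lemma vsubring_sum: "vsubring V \<Longrightarrow> (\<And>i. i \<in> I \<Longrightarrow> f i \<in> V) \<Longrightarrow> (\<Sum>i\<in>I. f i) \<in> V"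
  by (induction I rule: infinite_finite_induct) (auto simp: vsubringD)

lemma vsubring_prod: "vsubring V \<Longrightarrow> (\<And>i. i \<in> I \<Longrightarrow> f i \<in> V) \<Longrightarrow> (\<Prod>i\<in>I. f i) \<in> V"
  by (induction I rule: infinite_finite_induct) (auto simp: vsubringD)

lemma vsubring_of_int: "vsubring V \<Longrightarrow> of_int n \<in> V"
  by (induction n rule: int_induct[of _ 0]) (auto simp: vsubringD)

lemma vsubring_of_nat: "vsubring V \<Longrightarrow> of_nat n \<in> V"
  using vsubring_of_int[of V "int n"] by simp

definition vadjoin :: "'a::field set \<Rightarrow> 'a \<Rightarrow> 'a set" where
  "vadjoin V x = {poly q x | q. \<forall>i. Polynomial.coeff q i \<in> V}"

lemma vsubring_vadjoin:
  assumes V: "vsubring V"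
  shows "vsubring (vadjoin V x)" "V \<subseteq> vadjoin V x" "x \<in> vadjoin V x"
proof -
  have mem: "poly q x \<in> vadjoin V x" if "\<forall>i. Polynomial.coeff q i \<in> V" for q
    using that by (auto simp: vadjoin_def)
  show "vsubring (vadjoin V x)" unfolding vsubring_def
  proof (intro conjI ballI)
    show "1 \<in> vadjoin V x" using mem[of 1] vsubringD[OF V] by (simp add: coeff_1)
    fix a b assume "a \<in> vadjoin V x" "b \<in> vadjoin V x"
    then obtain q r where q: "a = poly q x" "\<forall>i. Polynomial.coeff q i \<in> V"
      and r: "b = poly r x" "\<forall>i. Polynomial.coeff r i \<in> V" unfolding vadjoin_def by blast
    show "a - b \<in> vadjoin V x" using mem[of "q - r"] q r vsubringD[OF V] by simp
    have "\<forall>i. Polynomial.coeff (q * r) i \<in> V"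
      unfolding coeff_mult using q r vsubringD(4)[OF V] by (auto intro!: vsubring_sum[OF V])
    thus "a * b \<in> vadjoin V x" using mem[of "q * r"] q r by simp
  qed
  show "V \<subseteq> vadjoin V x"
  proof
    fix a assume "a \<in> V"
    thus "a \<in> vadjoin V x" using mem[of "[:a:]"] vsubringD[OF V] by (simp add: coeff_pCons split: nat.splits)
  qed
  show "x \<in> vadjoin V x" using mem[of "[:0, 1:]"] vsubringD[OF V] by (simp add: coeff_pCons split: nat.splits)
qed

text \<open>The last assumption says that the valuation has rank one.\<close>

locale valuation =
  fixes p :: nat and V :: "'a::field_char_0 set"
  assumes prime_p: "prime p" and V: "vsubring V" and p_inv: "inverse (of_nat p) \<notin> V"
    and V_total: "x \<notin> V \<Longrightarrow> inverse x \<in> V"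
    and V_rank1: "x \<in> V \<Longrightarrow> inverse x \<notin> V \<Longrightarrow> \<exists>n. x ^ n / of_nat p \<in> V"

text \<open>A subring that is maximal among those not containing \<open>1/p\<close> has the required properties.\<close>

theorem valuation_exists:
  assumes prime: "prime p" shows "\<exists>V :: 'a::field_char_0 set. valuation p V"
proof -
  let ?P = "of_nat p :: 'a"
  have P0: "?P \<noteq> 0" using prime by auto
  define A :: "'a set set" where "A = {V. vsubring V \<and> inverse ?P \<notin> V}"
  have "vsubring (range of_int :: 'a set)" unfolding vsubring_def
  proof (intro conjI ballI)
    show "(1::'a) \<in> range of_int" by (rule range_eqI[of _ _ 1]) simp
    fix x y :: 'a assume "x \<in> range of_int" "y \<in> range of_int"
    then obtain i j where "x = of_int i" "y = of_int j" by blast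
    thus "x - y \<in> range of_int" "x * y \<in> range of_int"
      by (auto intro: range_eqI[of _ _ "i - j"] range_eqI[of _ _ "i * j"])
  qed
  moreover have "inverse ?P \<notin> range of_int"
  proof
    assume "inverse ?P \<in> range of_int"
    then obtain n where "inverse ?P = of_int n" by blast
    hence "of_int (n * int p) = (of_int 1 :: 'a)" using P0 by (simp add: field_simps)
    hence "n * int p = 1" unfolding of_int_eq_iff .
    hence "int p dvd 1" by (metis dvd_triv_right)
    thus False using prime by simp
  qed
  ultimately have "A \<noteq> {}" by (auto simp: A_def)
  moreover have "\<Union>C \<in> A" if C: "C \<noteq> {}" "subset.chain A C" for C
  proof -
    have CA: "C \<subseteq> A" and tot: "\<And>X Y. X \<in> C \<Longrightarrow> Y \<in> C \<Longrightarrow> X \<subseteq> Y \<or> Y \<subseteq> X"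
      using C(2) by (auto simp: subset_chain_def)
    have "vsubring (\<Union>C)" unfolding vsubring_def
    proof (intro conjI ballI)
      show "1 \<in> \<Union>C" using C(1) CA vsubringD(1) by (fastforce simp: A_def)
      fix x y assume "x \<in> \<Union>C" "y \<in> \<Union>C"
      then obtain X Y where XY: "X \<in> C" "Y \<in> C" "x \<in> X" "y \<in> Y" by blast
      have "\<exists>Z\<in>C. x \<in> Z \<and> y \<in> Z" using tot[OF XY(1,2)] XY by blast
      then obtain Z where Z: "Z \<in> C" "x \<in> Z" "y \<in> Z" by blast
      hence "vsubring Z" using CA by (auto simp: A_def)
      thus "x - y \<in> \<Union>C" "x * y \<in> \<Union>C" using Z vsubringD(3,4) by blast+
    qed
    moreover have "inverse ?P \<notin> \<Union>C" using CA by (auto simp: A_def)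
    ultimately show ?thesis by (simp add: A_def)
  qed
  ultimately obtain V where VA: "V \<in> A" and max: "\<And>X. X \<in> A \<Longrightarrow> V \<subseteq> X \<Longrightarrow> X = V"
    using subset_Zorn_nonempty[of A] by blast
  have V: "vsubring V" and pV: "inverse ?P \<notin> V" using VA by (auto simp: A_def)
  note vs = vsubringD[OF V] vsubring_power[OF V] vsubring_of_nat[OF V]
  \<comment> \<open>Maximality of \<open>V\<close>: adjoining an element outside \<open>V\<close>
    brings in 1/p, as a polynomial in that element.\<close>
  have adj: "\<exists>a n. (\<forall>i. a i \<in> V) \<and> (\<Sum>i\<le>n. a i * x ^ i) = inverse ?P" if x: "x \<notin> V" for x
  proof -
    have "vadjoin V x \<notin> A" using max[of "vadjoin V x"] vsubring_vadjoin[OF V, of x] x by auto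
    hence "inverse ?P \<in> vadjoin V x" using vsubring_vadjoin(1)[OF V, of x] by (auto simp: A_def)
    then obtain q where q: "inverse ?P = poly q x" "\<forall>i. Polynomial.coeff q i \<in> V" unfolding vadjoin_def by blast
    thus ?thesis by (intro exI[of _ "Polynomial.coeff q"] exI[of _ "Polynomial.degree q"]) (simp add: poly_altdef)
  qed
  have shift: "\<exists>c\<in>V. c = x ^ n / ?P" if x: "x \<noteq> 0" "x \<in> V" and a: "\<forall>i. a i \<in> V" "(\<Sum>i\<le>n. a i * inverse x ^ i) = inverse ?P"
    for a n x
  proof -
    have "x ^ n / ?P = (\<Sum>i\<le>n. a i * inverse x ^ i) * x ^ n" by (simp add: a(2) divide_inverse)
    also have "\<dots> = (\<Sum>i\<le>n. a i * x ^ (n - i))"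
      unfolding sum_distrib_right using x(1) by (intro sum.cong) (auto simp: power_diff field_simps)
    also have "\<dots> \<in> V" using a(1) x(2) by (intro vsubring_sum[OF V] vs(4) vs(7)) auto
    finally show ?thesis by blast
  qed
  have pow: "\<exists>c\<in>V. (1 - ?P * a) ^ n = 1 - ?P * c" if "a \<in> V" for a n
  proof (induction n)
    case 0 show ?case using vs(2) by (intro bexI[of _ 0]) auto
  next
    case (Suc n)
    then obtain c where c: "c \<in> V" "(1 - ?P * a) ^ n = 1 - ?P * c" by blast
    have "(1 - ?P * a) ^ Suc n = 1 - ?P * (a + c - ?P * a * c)"
      unfolding power_Suc c(2) by (simp add: algebra_simps)
    moreover have "a + c - ?P * a * c \<in> V" using c(1) that vs(3,4,6,8) by simp
    ultimately show ?case by blast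
  qed
  \<comment> \<open>Elements congruent to 1 modulo p are units. Otherwise \<open>adj\<close> for the
    inverse of u gives u^n / p in \<open>V\<close>, while u^n is 1 minus a multiple of p; together
    they put 1/p into \<open>V\<close>.\<close>
  have unit: "inverse (1 - ?P * a) \<in> V" if a: "a \<in> V" for a
  proof (rule ccontr)
    let ?u = "1 - ?P * a"
    assume n: "inverse ?u \<notin> V"
    have u0: "?u \<noteq> 0" using n vs(2) by auto
    have uV: "?u \<in> V" using vs a by auto
    obtain b n where b: "\<forall>i. b i \<in> V" "(\<Sum>i\<le>n. b i * inverse ?u ^ i) = inverse ?P" using adj[OF n] by blast
    obtain c where c: "c \<in> V" "c = ?u ^ n / ?P" using shift[OF u0 uV b] by blast
    obtain c' where c': "c' \<in> V" "?u ^ n = 1 - ?P * c'" using pow[OF a] by blast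
    have "inverse ?P = c + c'" using c c' P0 by (simp add: field_simps)
    thus False using pV vs(6) c c' by simp
  qed
  \<comment> \<open>\<open>D x n\<close> records that 1/p is a polynomial of degree at most n in x;
    totality is proved by descent on this n.\<close>
  define D where "D x n \<longleftrightarrow> (\<exists>a. (\<forall>i. a i \<in> V) \<and> (\<Sum>i\<le>n. a i * x ^ i) = inverse ?P)" for x n
  have D0: "\<not> D x 0" for x using pV unfolding D_def by (auto, metis)
  \<comment> \<open>The expression in 1/x, divided by the unit 1 - p r(0), becomes an equation that
    writes 1 in negative powers of x. Multiplied by the leading term of the longer expression, it
    replaces that term by lower powers of x.\<close>
  have red: "D x m" if x: "x \<noteq> 0" and Dx: "D x (Suc m)" and Dy: "D (inverse x) k" and k: "k \<le> Suc m" for x m k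
  proof -
    obtain a where a: "\<And>i. a i \<in> V" "(\<Sum>i\<le>Suc m. a i * x ^ i) = inverse ?P" using Dx by (auto simp: D_def)
    obtain r where r: "\<And>i. r i \<in> V" "(\<Sum>i\<le>k. r i * inverse x ^ i) = inverse ?P" using Dy by (auto simp: D_def)
    define u where "u = 1 - ?P * r 0"
    have iu: "inverse u \<in> V" unfolding u_def by (rule unit[OF r(1)])
    have u0: "u \<noteq> 0"
    proof
      assume "u = 0"
      hence "inverse ?P = r 0" using P0 by (simp add: u_def field_simps)
      thus False using pV r(1) by simp
    qed
    have "{..k} = insert 0 {1..k}" by auto
    hence "(\<Sum>i\<le>k. r i * inverse x ^ i) = r 0 + (\<Sum>i=1..k. r i * inverse x ^ i)" by simp
    hence "u = ?P * (\<Sum>i=1..k. r i * inverse x ^ i)" using r(2) P0 by (simp add: u_def field_simps)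
    hence one: "1 = (\<Sum>i=1..k. ?P * (inverse u * r i) * inverse x ^ i)"
      using u0 by (simp add: sum_distrib_left[symmetric] mult.assoc mult.left_commute[of _ "inverse u"])
    define a' where "a' i = a i + (if Suc m - i \<le> k then ?P * (inverse u * r (Suc m - i)) * a (Suc m) else 0)" for i
    have "(\<Sum>i\<le>m. (if Suc m - i \<le> k then ?P * (inverse u * r (Suc m - i)) * a (Suc m) else 0) * x ^ i)
      = (\<Sum>i\<in>{i. i \<le> m \<and> Suc m - i \<le> k}. ?P * (inverse u * r (Suc m - i)) * a (Suc m) * x ^ i)"
      by (rule sum.mono_neutral_cong_right) auto
    also have "\<dots> = (\<Sum>j=1..k. ?P * (inverse u * r j) * a (Suc m) * x ^ (Suc m - j))"
      by (rule sum.reindex_bij_witness[of _ "\<lambda>j. Suc m - j" "\<lambda>i. Suc m - i"]) (use k in auto)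
    also have "\<dots> = (\<Sum>j=1..k. (?P * (inverse u * r j) * inverse x ^ j) * (a (Suc m) * x ^ Suc m))"
      using k x by (intro sum.cong) (auto simp: power_diff field_simps simp del: power_Suc)
    also have "\<dots> = a (Suc m) * x ^ Suc m" by (subst sum_distrib_right[symmetric], subst one[symmetric]) simp
    finally have "(\<Sum>i\<le>m. a' i * x ^ i) = inverse ?P"
      unfolding a'_def distrib_right sum.distrib using a(2) by simp
    moreover have "a' i \<in> V" for i unfolding a'_def using a r iu vs by auto
    ultimately show ?thesis by (auto simp: D_def)
  qed
  have total: "inverse x \<in> V" if x: "x \<notin> V" for x
  proof (rule ccontr)
    assume y: "inverse x \<notin> V"
    have x0: "x \<noteq> 0" using x vs(2) by auto
    have ex: "\<exists>n. D x n" "\<exists>n. D (inverse x) n" using adj[OF x] adj[OF y] by (auto simp: D_def)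
    define n where "n = (LEAST n. D x n)"
    define k where "k = (LEAST n. D (inverse x) n)"
    have n: "D x n" and k: "D (inverse x) k" unfolding n_def k_def using ex by (auto intro: LeastI_ex)
    have nl: "\<And>j. D x j \<Longrightarrow> n \<le> j" and kl: "\<And>j. D (inverse x) j \<Longrightarrow> k \<le> j"
      unfolding n_def k_def by (auto intro: Least_le)
    obtain n' where n': "n = Suc n'" using n D0 by (cases n) auto
    obtain k' where k': "k = Suc k'" using k D0 by (cases k) auto
    show False
    proof (cases "k \<le> n")
      case True
      thus False using red[OF x0, of n' k] n k nl[of n'] n' by auto
    next
      case False
      thus False using red[of "inverse x" k' n] x0 n k kl[of k'] k' by auto
    qed
  qed
  have rank: "\<exists>n. x ^ n / ?P \<in> V" if x: "x \<in> V" "inverse x \<notin> V" for x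
  proof -
    obtain b n where b: "\<forall>i. b i \<in> V" "(\<Sum>i\<le>n. b i * inverse x ^ i) = inverse ?P" using adj[OF x(2)] by blast
    have "x \<noteq> 0" using x vs(2) by auto
    from shift[OF this x(1) b] show ?thesis by blast
  qed
  have "valuation p V" by unfold_locales (use prime V pV total rank in auto)
  thus ?thesis by blast
qed

text \<open>After powers of the variable are split off, the constant term of an integer polynomial
  vanishing at \<open>x\<close> is nonzero, and it is \<open>x\<close> times a polynomial in
  \<open>x\<close>.\<close>

lemma algebraic_divides_integer:
  fixes x :: "'a::field_char_0"
  assumes alg: "algebraic x" and x0: "x \<noteq> 0"
  obtains c :: int and q where "c \<noteq> 0" "\<And>i. Polynomial.coeff q i \<in> \<int>" "of_int c = x * poly q x"
proof -
  have "\<exists>q. q \<noteq> 0 \<and> (\<forall>i. Polynomial.coeff q i \<in> \<int>) \<and> poly q x = 0 \<and> Polynomial.coeff q 0 \<noteq> 0"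
    if "q \<noteq> 0" "\<forall>i. Polynomial.coeff q i \<in> \<int>" "poly q x = 0" for q
    using that
  proof (induction q)
    case (pCons a q)
    show ?case
    proof (cases "a = 0")
      case True
      have "\<forall>i. Polynomial.coeff q i \<in> \<int>" using pCons.prems(2) by (metis coeff_pCons_Suc)
      thus ?thesis using pCons.IH pCons.prems True x0 by auto
    next
      case False
      thus ?thesis using pCons.prems by (intro exI[of _ "pCons a q"]) auto
    qed
  qed simp
  then obtain q where q: "\<forall>i. Polynomial.coeff q i \<in> \<int>" "poly q x = 0" "Polynomial.coeff q 0 \<noteq> 0"
    using alg by (elim algebraicE) blast
  obtain a q' where aq: "q = pCons a q'" by (cases q)
  obtain c where c: "a = of_int c" using q(1) aq by (metis coeff_pCons_0 Ints_cases)
  show ?thesis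
  proof (rule that[of c "- q'"])
    show "c \<noteq> 0" using q(3) aq c by auto
    show "Polynomial.coeff (- q') i \<in> \<int>" for i using q(1) aq by (metis coeff_pCons_Suc coeff_minus Ints_minus)
    show "of_int c = x * poly (- q') x" using q(2) aq c by (simp add: eq_neg_iff_add_eq_0)
  qed
qed

section \<open>Divisibility and congruences in the valuation ring\<close>

context valuation
begin

abbreviation P :: 'a where "P \<equiv> of_nat p"

text \<open>The maximal ideal of nonunits. Zero is listed separately since
  \<open>inverse 0 = 0\<close> belongs to \<open>V\<close>.\<close>

definition M :: "'a set" where "M = {x \<in> V. x = 0 \<or> inverse x \<notin> V}"

lemmas V_closed = vsubringD[OF V] vsubring_power[OF V] vsubring_sum[OF V] vsubring_prod[OF V]
  vsubring_of_int[OF V] vsubring_of_nat[OF V]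

lemma P_nonzero: "P \<noteq> 0"
  using prime_p by auto

lemma M_subset: "x \<in> M \<Longrightarrow> x \<in> V"
  by (simp add: M_def)

lemma unit_inverse: "x \<in> V \<Longrightarrow> x \<notin> M \<Longrightarrow> inverse x \<in> V" "x \<notin> M \<Longrightarrow> x \<noteq> 0"
  using V_closed(2) by (auto simp: M_def)

lemma one_notin_M: "1 \<notin> M" and zero_in_M: "0 \<in> M"
  using V_closed(1,2) by (auto simp: M_def)

lemma M_mult: assumes "x \<in> M" "y \<in> V" shows "x * y \<in> M" "y * x \<in> M"
proof -
  show 1: "x * y \<in> M"
  proof (rule ccontr)
    assume n: "x * y \<notin> M"
    have "x * y \<in> V" using assms M_subset by (simp add: V_closed)
    hence "inverse (x * y) \<in> V" "x * y \<noteq> 0" using n unit_inverse by blast+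
    moreover have "inverse (x * y) * y = inverse x" using calculation by (simp add: field_simps)
    ultimately have "inverse x \<in> V" "x \<noteq> 0" using V_closed(4)[OF _ assms(2), of "inverse (x * y)"] by (metis, metis mult_zero_left)
    thus False using assms(1) by (simp add: M_def)
  qed
  thus "y * x \<in> M" by (simp add: mult.commute)
qed

lemma M_prime:
  assumes "x \<in> V" "y \<in> V" "x * y \<in> M" shows "x \<in> M \<or> y \<in> M"
proof (rule ccontr)
  assume "\<not> (x \<in> M \<or> y \<in> M)"
  hence u: "inverse x \<in> V" "inverse y \<in> V" "x \<noteq> 0" "y \<noteq> 0" using unit_inverse assms(1,2) by blast+
  have "(x * y) * (inverse x * inverse y) \<in> M" by (rule M_mult(1)[OF assms(3) V_closed(4)[OF u(1,2)]])
  moreover have "(x * y) * (inverse x * inverse y) = 1" using u by (simp add: field_simps)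
  ultimately show False using one_notin_M by simp
qed

lemma M_power: "x \<in> V \<Longrightarrow> x ^ n \<in> M \<Longrightarrow> x \<in> M"
  by (induction n) (use M_prime[of x] one_notin_M V_closed(7) in auto)

text \<open>One of the two quotients lies in \<open>V\<close>, so the sum is a multiple in
  \<open>V\<close> of one of the summands.\<close>

lemma M_add: assumes "x \<in> M" "y \<in> M" shows "x + y \<in> M"
proof (cases "x = 0 \<or> y = 0")
  case False
  have "x / y \<in> V \<or> y / x \<in> V" using V_total[of "x / y"] by auto
  thus ?thesis
  proof
    assume "x / y \<in> V"
    hence "y * (x / y + 1) \<in> M" using M_mult[OF assms(2)] V_closed(1,6) by blast
    thus ?thesis using False by (simp add: field_simps)
  next
    assume "y / x \<in> V"
    hence "x * (y / x + 1) \<in> M" using M_mult[OF assms(1)] V_closed(1,6) by blast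
    thus ?thesis using False by (simp add: field_simps)
  qed
qed (use assms in auto)

lemma M_uminus: "x \<in> M \<Longrightarrow> - x \<in> M"
  using M_mult(1)[of x "-1"] V_closed(1,5) by auto

lemma M_diff: "x \<in> M \<Longrightarrow> y \<in> M \<Longrightarrow> x - y \<in> M"
  using M_add[of x "-y"] M_uminus by simp

lemma M_sum: "(\<And>i. i \<in> I \<Longrightarrow> f i \<in> M) \<Longrightarrow> (\<Sum>i\<in>I. f i) \<in> M"
  by (induction I rule: infinite_finite_induct) (auto simp: zero_in_M M_add)

lemma P_in_M: "P \<in> M"
  using V_closed(11) p_inv by (simp add: M_def)

lemma of_int_in_M_iff: "of_int n \<in> M \<longleftrightarrow> int p dvd n"
proof
  assume "int p dvd n"
  then obtain k where "n = int p * k" ..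
  thus "of_int n \<in> M" using M_mult(1)[OF P_in_M V_closed(10)[of k]] by simp
next
  assume n: "of_int n \<in> M"
  show "int p dvd n"
  proof (rule ccontr)
    assume "\<not> int p dvd n"
    hence "coprime (int p) n" using prime_p by (simp add: prime_imp_coprime)
    then obtain a b where "a * int p + b * n = 1" by (metis bezout_int coprime_iff_gcd_eq_1)
    hence "of_int (a * int p + b * n) = (1 :: 'a)" by simp
    moreover have "of_int (a * int p + b * n) \<in> M"
      using M_add[OF M_mult(2)[OF P_in_M V_closed(10)[of a]] M_mult(2)[OF n V_closed(10)[of b]]] by simp
    ultimately show False using one_notin_M by simp
  qed
qed

lemma of_rat_in_V:
  assumes "of_rat q \<in> V"
  obtains a b where "q = of_int a / of_int b" "\<not> int p dvd b" "b \<noteq> 0"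
proof -
  obtain a b where ab: "quotient_of q = (a, b)" by fastforce
  have q: "q = of_int a / of_int b" using quotient_of_div[OF ab] .
  have b: "b > 0" and cop: "coprime a b" using quotient_of_denom_pos[OF ab] quotient_of_coprime[OF ab] by auto
  have "\<not> int p dvd b"
  proof
    assume pb: "int p dvd b"
    have "of_int a = of_int b * (of_rat q :: 'a)" using q b by (simp add: of_rat_divide)
    also have "\<dots> \<in> M" using of_int_in_M_iff pb assms M_mult by blast
    finally have "int p dvd a" using of_int_in_M_iff by blast
    hence "int p dvd 1" using cop pb by (metis coprime_def)
    thus False using prime_p by simp
  qed
  thus ?thesis using that q b by blast
qed

text \<open>This divisibility plays the part of the comparison of values, v(a) at most v(b); it is
  total because \<open>V\<close> is a valuation ring.\<close>

definition vdvd :: "'a \<Rightarrow> 'a \<Rightarrow> bool" where "vdvd a b \<longleftrightarrow> (\<exists>v\<in>V. b = a * v)"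

lemma vdvd_iff: "a \<noteq> 0 \<Longrightarrow> vdvd a b \<longleftrightarrow> b / a \<in> V"
  unfolding vdvd_def by (metis nonzero_mult_div_cancel_left times_divide_eq_right)

lemma vdvd_refl: "vdvd a a" and vdvd_0: "vdvd a 0" and vdvd_1: "vdvd 1 b \<longleftrightarrow> b \<in> V"
  using V_closed(1,2) by (auto simp: vdvd_def intro: bexI[of _ 1] bexI[of _ 0])

lemma vdvd_mult_right: "vdvd a b \<Longrightarrow> v \<in> V \<Longrightarrow> vdvd a (b * v)"
  unfolding vdvd_def using V_closed(4) by (metis mult.assoc)

lemma vdvd_mult_left: "vdvd a b \<Longrightarrow> v \<in> V \<Longrightarrow> vdvd a (v * b)"
  using vdvd_mult_right by (metis mult.commute)

lemma vdvd_trans: "vdvd a b \<Longrightarrow> vdvd b c \<Longrightarrow> vdvd a c"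
  unfolding vdvd_def using V_closed(4) by (metis mult.assoc)

lemma vdvd_mult: "vdvd a b \<Longrightarrow> vdvd c e \<Longrightarrow> vdvd (a * c) (b * e)"
proof -
  assume "vdvd a b" "vdvd c e"
  then obtain v w where "v \<in> V" "w \<in> V" "b = a * v" "e = c * w" by (auto simp: vdvd_def)
  thus ?thesis using V_closed(4)[of v w] by (auto simp: vdvd_def intro!: bexI[of _ "v * w"])
qed

lemma vdvd_power: "vdvd a b \<Longrightarrow> vdvd (a ^ n) (b ^ n)"
  by (induction n) (auto simp: vdvd_refl vdvd_mult)

lemma vdvd_add: "vdvd a b \<Longrightarrow> vdvd a c \<Longrightarrow> vdvd a (b + c)"
  unfolding vdvd_def using V_closed(6) by (metis distrib_left)

lemma vdvd_diff: "vdvd a b \<Longrightarrow> vdvd a c \<Longrightarrow> vdvd a (b - c)"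
  unfolding vdvd_def using V_closed(3) by (metis right_diff_distrib)

lemma vdvd_sum: "(\<And>i. i \<in> I \<Longrightarrow> vdvd a (f i)) \<Longrightarrow> vdvd a (\<Sum>i\<in>I. f i)"
  by (induction I rule: infinite_finite_induct) (auto simp: vdvd_0 vdvd_add)

lemma vdvd_total: "vdvd a b \<or> vdvd b a"
proof (cases "a = 0 \<or> b = 0")
  case False
  thus ?thesis using V_total[of "b / a"] by (auto simp: vdvd_iff)
qed (auto simp: vdvd_0)

lemma vdvd_power_le: "a \<in> V \<Longrightarrow> m \<le> n \<Longrightarrow> vdvd (a ^ m) (a ^ n)"
  unfolding vdvd_def using V_closed(7) by (metis le_add_diff_inverse power_add)

lemma vdvd_cancel: "c \<noteq> 0 \<Longrightarrow> vdvd (c * a) (c * b) \<longleftrightarrow> vdvd a b"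
  unfolding vdvd_def by (metis mult.assoc mult_left_cancel)

lemma not_vdvd: "\<not> vdvd a b \<Longrightarrow> a / b \<in> M \<and> b \<noteq> 0"
proof -
  assume n: "\<not> vdvd a b"
  have b: "b \<noteq> 0" using n vdvd_0 by auto
  moreover have "a / b \<in> V" using vdvd_total[of a b] n b by (auto simp: vdvd_iff)
  moreover have "a = 0 \<or> b / a \<notin> V" using n by (auto simp: vdvd_iff)
  ultimately show ?thesis by (auto simp: M_def)
qed

lemma M_vdvd: "a \<in> M \<Longrightarrow> vdvd a b \<Longrightarrow> b \<in> M"
  using M_mult by (auto simp: vdvd_def)

text \<open>Rank one in usable form. The exponent depends on the element;
  \<open>uniform_nilpotence\<close> removes this dependence for differences of congruent
  embeddings.\<close>

lemma M_nilpotent: "x \<in> M \<Longrightarrow> \<exists>n. vdvd P (x ^ n)"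
proof -
  assume x: "x \<in> M"
  show ?thesis
  proof (cases "x = 0")
    case True thus ?thesis by (intro exI[of _ 1]) (auto simp: vdvd_0)
  next
    case False
    thus ?thesis using x V_rank1[of x] P_nonzero by (auto simp: M_def vdvd_iff)
  qed
qed

lemma integral_closed:
  assumes "x ^ Suc n = (\<Sum>i\<le>n. a i * x ^ i)" "\<And>i. a i \<in> V" shows "x \<in> V"
proof (rule ccontr)
  assume x: "x \<notin> V"
  have x0: "x \<noteq> 0" using x V_closed(2) by auto
  have "x = x ^ Suc n * inverse x ^ n" using x0 by (simp add: power_inverse)
  also have "\<dots> = (\<Sum>i\<le>n. a i * inverse x ^ (n - i))" unfolding assms(1) sum_distrib_right
    using x0 by (intro sum.cong) (auto simp: power_diff field_simps)
  also have "\<dots> \<in> V" using V_total[OF x] assms(2) by (intro V_closed(8)) (simp add: V_closed)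
  finally show False using x by blast
qed

text \<open>The element, if it lies in \<open>V\<close>, divides a nonzero integer, and the part of
  that integer prime to p is a unit of \<open>V\<close>.\<close>

lemma algebraic_dvd_P_power:
  assumes alg: "algebraic x" and x0: "x \<noteq> 0" shows "\<exists>n. vdvd x (P ^ n)"
proof (cases "inverse x \<in> V")
  case True
  thus ?thesis using x0 by (intro exI[of _ 0]) (auto simp: vdvd_iff divide_inverse)
next
  case False
  hence xV: "x \<in> V" using V_total[of "inverse x"] by auto
  obtain c q where c0: "c \<noteq> 0" and q: "\<And>i. Polynomial.coeff q i \<in> \<int>" "of_int c = x * poly q x"
    by (rule algebraic_divides_integer[OF alg x0]) blast
  have "poly q x \<in> V" unfolding poly_altdef
  proof (intro V_closed(8) V_closed(4) V_closed(7)[OF xV])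
    fix i show "Polynomial.coeff q i \<in> V" using q(1)[of i] V_closed(10) by (metis Ints_cases)
  qed
  hence xc: "vdvd x (of_int c)" unfolding vdvd_def using q(2) by blast
  obtain n u where nu: "c = int p ^ n * u" "\<not> int p dvd u"
    using multiplicity_decompose'[of c "int p"] c0 prime_p by (metis not_prime_unit prime_nat_int_transfer)
  have "of_int u \<notin> M" using nu(2) of_int_in_M_iff by blast
  hence "inverse (of_int u) \<in> V" "of_int u \<noteq> (0::'a)" using unit_inverse V_closed(10) by blast+
  hence "vdvd x (P ^ n)" using vdvd_mult_right[OF xc, of "inverse (of_int u)"] nu(1) by (simp add: mult.assoc)
  thus ?thesis by blast
qed

lemma frobenius_diff:
  assumes "a \<in> V" "b \<in> V"
  shows "\<exists>c\<in>V. a ^ p - b ^ p = (a - b) ^ p + P * (a - b) * c"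
proof -
  define z where "z = a - b"
  have zV: "z \<in> V" using assms V_closed(3) by (simp add: z_def)
  have p2: "p \<ge> 2" using prime_p prime_ge_2_nat by blast
  define c where "c = (\<Sum>k=1..<p. of_nat ((p choose k) div p) * b ^ (p - k) * z ^ (k - 1))"
  have "a ^ p = (z + b) ^ p" by (simp add: z_def)
  also have "\<dots> = (\<Sum>k\<le>p. of_nat (p choose k) * z ^ k * b ^ (p - k))" by (rule binomial_ring)
  also have "{..p} = insert 0 (insert p {1..<p})" by auto
  also have "(\<Sum>k\<in>\<dots>. of_nat (p choose k) * z ^ k * b ^ (p - k))
      = b ^ p + (z ^ p + (\<Sum>k=1..<p. of_nat (p choose k) * z ^ k * b ^ (p - k)))" using p2 by simp
  also have "(\<Sum>k=1..<p. of_nat (p choose k) * z ^ k * b ^ (p - k)) = P * z * c"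
    unfolding c_def sum_distrib_left
  proof (rule sum.cong)
    fix k assume k: "k \<in> {1..<p}"
    have "p dvd (p choose k)" using k prime_p by (intro dvd_choose_prime) auto
    hence "of_nat (p choose k) = P * (of_nat ((p choose k) div p) :: 'a)"
      by (metis dvd_mult_div_cancel of_nat_mult)
    moreover have "z ^ k = z * z ^ (k - 1)" using k by (metis One_nat_def Suc_le_D atLeastLessThan_iff diff_Suc_1 power_Suc)
    ultimately show "of_nat (p choose k) * z ^ k * b ^ (p - k)
      = P * z * (of_nat ((p choose k) div p) * b ^ (p - k) * z ^ (k - 1))" by (simp add: mult_ac)
  qed simp
  finally have "a ^ p - b ^ p = z ^ p + P * z * c" by simp
  moreover have "c \<in> V" unfolding c_def using zV assms by (intro V_closed(8)) (simp add: V_closed)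
  ultimately show ?thesis unfolding z_def by blast
qed

text \<open>Let z_i be the difference of the p^i-th powers, so that z_(i+1) = z_i^p + p z_i c.
  Modulo p, z_i is a multiple of z_0^(i+1), hence z_n is divisible by p; from then on every step
  gains a factor p.\<close>

lemma frobenius_congruence:
  assumes ab: "a \<in> V" "b \<in> V" and n: "vdvd P ((a - b) ^ n)"
  shows "vdvd (P ^ Suc k) (a ^ (p ^ (n + k)) - b ^ (p ^ (n + k)))"
proof -
  define z where "z i = a ^ (p ^ i) - b ^ (p ^ i)" for i
  have zV: "z i \<in> V" for i using ab by (simp add: z_def V_closed)
  have step: "\<exists>c\<in>V. z (Suc i) = z i ^ p + P * z i * c" for i
    using frobenius_diff[OF V_closed(7)[OF ab(1), of "p ^ i"] V_closed(7)[OF ab(2), of "p ^ i"]]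
    by (simp add: z_def power_mult[symmetric] mult.commute)
  have p2: "p \<ge> 2" using prime_p prime_ge_2_nat by blast
  have A: "\<exists>u\<in>V. vdvd P (z i - z 0 ^ Suc i * u)" for i
  proof (induction i)
    case 0 show ?case using V_closed(1) by (intro bexI[of _ 1]) (auto simp: vdvd_0)
  next
    case (Suc i)
    then obtain u where u: "u \<in> V" "vdvd P (z i - z 0 ^ Suc i * u)" by blast
    obtain c where c: "c \<in> V" "z (Suc i) = z i ^ p + P * z i * c" using step by blast
    let ?y = "z 0 ^ Suc i * u"
    have yV: "?y \<in> V" using u zV by (simp add: V_closed)
    have "z i ^ p - ?y ^ p = (z i - ?y) * (\<Sum>j<p. ?y ^ (p - Suc j) * z i ^ j)" by (rule power_diff_sumr2)
    moreover have "(\<Sum>j<p. ?y ^ (p - Suc j) * z i ^ j) \<in> V" using yV zV by (intro V_closed(8)) (simp add: V_closed)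
    ultimately have 1: "vdvd P (z i ^ p - ?y ^ p)" using vdvd_mult_right[OF u(2)] by simp
    \<comment> \<open>The exponent p (i + 1) is at least i + 2 because p is at least 2; the surplus
      goes into the cofactor.\<close>
    have "Suc (Suc i) \<le> Suc i * 2" by simp
    also have "\<dots> \<le> Suc i * p" using p2 by (rule mult_le_mono2)
    finally have "Suc i * p = Suc (Suc i) + (Suc i * p - Suc (Suc i))" by simp
    hence "?y ^ p = z 0 ^ Suc (Suc i) * (z 0 ^ (Suc i * p - Suc (Suc i)) * u ^ p)"
      unfolding power_mult_distrib power_mult[symmetric] by (metis (no_types) mult.assoc power_add)
    moreover have "vdvd P (P * z i * c)" using c(1) zV V_closed(4) by (auto simp: vdvd_def mult.assoc)
    hence "vdvd P (z i ^ p - ?y ^ p + P * z i * c)" using vdvd_add[OF 1] by blast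
    hence "vdvd P (z (Suc i) - ?y ^ p)" unfolding c(2) by (simp add: algebra_simps)
    ultimately have "vdvd P (z (Suc i) - z 0 ^ Suc (Suc i) * (z 0 ^ (Suc i * p - Suc (Suc i)) * u ^ p))" by simp
    moreover have "z 0 ^ (Suc i * p - Suc (Suc i)) * u ^ p \<in> V" using zV u by (simp add: V_closed)
    ultimately show ?case by blast
  qed
  have B: "vdvd (P ^ Suc k) (z (n + k))" for k
  proof (induction k)
    case 0
    obtain u where u: "u \<in> V" "vdvd P (z n - z 0 ^ Suc n * u)" using A by blast
    have "vdvd P (z 0 ^ n * (z 0 * u))" using n u(1) V_closed(4)[OF zV[of 0] u(1)] by (intro vdvd_mult_right) (simp_all add: z_def)
    hence "vdvd P (z n - z 0 ^ Suc n * u + z 0 ^ n * (z 0 * u))" using vdvd_add[OF u(2)] by blast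
    thus ?case by (simp add: algebra_simps)
  next
    case (Suc k)
    obtain c where c: "c \<in> V" "z (Suc (n + k)) = z (n + k) ^ p + P * z (n + k) * c" using step by blast
    obtain w where w: "w \<in> V" "z (n + k) = P ^ Suc k * w" using Suc by (auto simp: vdvd_def)
    have "z (n + k) ^ p = (P ^ Suc k * w) ^ 2 * z (n + k) ^ (p - 2)"
      using p2 w(2) by (metis le_add_diff_inverse power_add)
    also have "\<dots> = P ^ Suc (Suc k) * (P ^ k * w ^ 2 * z (n + k) ^ (p - 2))"
      by (simp add: power2_eq_square power_add[symmetric] mult_ac)
    finally have "vdvd (P ^ Suc (Suc k)) (z (n + k) ^ p)"
      unfolding vdvd_def using w(1) zV by (intro bexI[of _ "P ^ k * w ^ 2 * z (n + k) ^ (p - 2)"]) (simp_all add: V_closed)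
    moreover have "P * z (n + k) * c = P ^ Suc (Suc k) * (w * c)" using w(2) by (simp add: mult_ac)
    hence "vdvd (P ^ Suc (Suc k)) (P * z (n + k) * c)"
      unfolding vdvd_def using w(1) c(1) by (intro bexI[of _ "w * c"]) (simp_all add: V_closed)
    ultimately show ?case using c(2) vdvd_add by simp
  qed
  show ?thesis using B[of k] by (simp add: z_def)
qed

end

subsection \<open>Primes of a number field above p\<close>

lemma algebraic_intI_sum:
  fixes x :: "'a::field_char_0"
  assumes "x ^ n + (\<Sum>i<n. of_int (c i) * x ^ i) = 0"
  shows "algebraic_int x"
proof -
  define q :: "'a poly" where "q = Polynomial.monom 1 n + (\<Sum>i<n. Polynomial.monom (of_int (c i)) i)"
  have cq: "Polynomial.coeff q i = (if i = n then 1 else if i < n then of_int (c i) else 0)" for i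
    by (simp add: q_def coeff_sum)
  have "Polynomial.degree q = n"
    by (intro antisym degree_le le_degree) (auto simp: cq)
  hence "Polynomial.lead_coeff q = 1" by (simp add: cq)
  moreover have "\<forall>i. Polynomial.coeff q i \<in> \<int>" by (simp add: cq)
  moreover have "poly q x = 0" using assms by (simp add: q_def poly_monom poly_sum)
  ultimately show ?thesis by (rule algebraic_int.intros)
qed

lemma coeff_prod_linear_mem:
  assumes V: "vsubring V" and "\<And>i. i \<in> A \<Longrightarrow> a i \<in> V"
  shows "Polynomial.coeff (\<Prod>i\<in>A. [:- a i, 1:]) n \<in> V"
  using assms(2)
proof (induction A arbitrary: n rule: infinite_finite_induct)
  case (insert j A)
  have c: "Polynomial.coeff ([:- u, 1:] * p) n = - u * Polynomial.coeff p n + (case n of 0 \<Rightarrow> 0 | Suc m \<Rightarrow> Polynomial.coeff p m)"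
    for u :: "'z::comm_ring_1" and p n
    by (simp add: coeff_pCons split: nat.splits)
  show ?case unfolding prod.insert[OF insert(1,2)] c
    using insert.IH[of n] insert.IH[of "n - 1"] insert.prems
    by (cases n) (auto simp: vsubringD[OF V] simp del: mult_minus_left)
qed (auto simp: vsubringD[OF V] coeff_1)

text \<open>That the algebraic integers of \<open>'k\<close> form a ring is part of the locale; in
  the theorem it is supplied by the hypothesis that \<open>\<nn>\<close> is an ideal of
  \<open>ring_of_integers\<close>.\<close>

locale local_fld = number_fld ty + valuation p V
  for ty :: "'k::field_char_0 itself" and p :: nat and V :: "rat alg_closure set" +
  assumes ring_O: "ring (ring_of_integers :: 'k ring)"
begin

abbreviation AI :: "'k set" where "AI \<equiv> {x. algebraic_int x}"

lemma O_closed: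
  shows "0 \<in> AI" "1 \<in> AI" "x \<in> AI \<Longrightarrow> y \<in> AI \<Longrightarrow> x + y \<in> AI" "x \<in> AI \<Longrightarrow> y \<in> AI \<Longrightarrow> x * y \<in> AI"
    "x \<in> AI \<Longrightarrow> - x \<in> AI" "x \<in> AI \<Longrightarrow> y \<in> AI \<Longrightarrow> x - y \<in> AI" "of_int i \<in> AI" "of_nat n \<in> AI"
proof -
  interpret R: ring "ring_of_integers :: 'k ring" by (rule ring_O)
  have sel: "carrier (ring_of_integers :: 'k ring) = AI" "x \<oplus>\<^bsub>ring_of_integers\<^esub> y = x + y"
    "x \<otimes>\<^bsub>ring_of_integers\<^esub> y = x * y" for x y :: 'k
    by (simp_all add: ring_of_integers_def ring_of_type_algebra_def)
  show i: "of_int i \<in> AI" for i by (simp add: int_imp_algebraic_int)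
  show "0 \<in> AI" "1 \<in> AI" using i[of 0] i[of 1] by simp_all
  show "of_nat n \<in> AI" using i[of "int n"] by simp
  show a: "x \<in> AI \<Longrightarrow> y \<in> AI \<Longrightarrow> x + y \<in> AI" for x y using R.a_closed[of x y] unfolding sel .
  show "x \<in> AI \<Longrightarrow> y \<in> AI \<Longrightarrow> x * y \<in> AI" using R.m_closed[of x y] unfolding sel .
  show m: "x \<in> AI \<Longrightarrow> - x \<in> AI" for x by simp
  show "x \<in> AI \<Longrightarrow> y \<in> AI \<Longrightarrow> x - y \<in> AI" using a[of x "-y"] m[of y] by simp
qed

lemma O_sum: "(\<And>i. i \<in> I \<Longrightarrow> f i \<in> AI) \<Longrightarrow> (\<Sum>i\<in>I. f i) \<in> AI"
  by (induction I rule: infinite_finite_induct) (use O_closed in auto)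

lemma O_power: "x \<in> AI \<Longrightarrow> x ^ n \<in> AI"
  by (induction n) (use O_closed in auto)

lemma emb_O: assumes s: "\<sigma> \<in> Sig" and x: "x \<in> AI" shows "\<sigma> x \<in> V"
proof -
  obtain q where q: "Polynomial.lead_coeff q = 1" "\<forall>i. Polynomial.coeff q i \<in> \<int>" "poly q x = 0"
    using x by (auto elim!: algebraic_int.cases)
  have "Polynomial.degree q \<noteq> 0"
  proof
    assume "Polynomial.degree q = 0"
    then obtain c where "q = [:c:]" by (rule degree_eq_zeroE)
    thus False using q(1,3) by simp
  qed
  then obtain n where n: "Polynomial.degree q = Suc n" using not0_implies_Suc by blast
  have "0 = \<sigma> (\<Sum>i\<le>Suc n. Polynomial.coeff q i * x ^ i)"
    using q(3) n unfolding poly_altdef by (simp add: embedding_simps[OF s])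
  also have "\<dots> = (\<Sum>i\<le>n. \<sigma> (Polynomial.coeff q i) * \<sigma> x ^ i) + \<sigma> x ^ Suc n"
    using q(1) n by (simp add: embedding_simps[OF s] embedding_sum[OF s])
  finally have "\<sigma> x ^ Suc n = (\<Sum>i\<le>n. - \<sigma> (Polynomial.coeff q i) * \<sigma> x ^ i)"
    by (simp add: sum_negf eq_neg_iff_add_eq_0 add.commute)
  moreover have "- \<sigma> (Polynomial.coeff q i) \<in> V" for i
  proof -
    obtain c where "Polynomial.coeff q i = of_int c" using q(2) by (metis Ints_cases)
    thus ?thesis using V_closed(5,10) by (simp add: embedding_simps[OF s])
  qed
  ultimately show ?thesis by (rule integral_closed)
qed

text \<open>The characteristic polynomial has rational coefficients that lie in \<open>V\<close>, so
  their denominators are prime to p. Multiplying \<open>x\<close> by a common denominator makes it a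
  root of a monic integer polynomial. The condition on all \<open>\<sigma>\<close> says that
  \<open>x\<close> is integral at every prime above p.\<close>

lemma clear_denominator:
  assumes x: "\<And>\<sigma>. \<sigma> \<in> Sig \<Longrightarrow> \<sigma> x \<in> V"
  obtains s :: int where "\<not> int p dvd s" "of_int s * x \<in> AI"
proof -
  obtain f where f: "map_poly of_rat f = (\<Prod>\<sigma>\<in>Sig. [:- \<sigma> x, 1:])" "rpoly f x = 0" using charpoly by blast
  define n where "n = Polynomial.degree f"
  have "Polynomial.lead_coeff (map_poly of_rat f :: rat alg_closure poly) = 1"
    unfolding f(1) lead_coeff_prod by simp
  hence lc: "Polynomial.coeff f n = 1" by (simp add: n_def)
  have "\<exists>b a. \<not> int p dvd b \<and> of_int b * Polynomial.coeff f i = of_int a" for i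
  proof -
    have "of_rat (Polynomial.coeff f i) = Polynomial.coeff (map_poly of_rat f :: rat alg_closure poly) i"
      by (simp add: coeff_map_poly)
    also have "\<dots> \<in> V" unfolding f(1) by (rule coeff_prod_linear_mem[OF V x])
    finally obtain a b where "Polynomial.coeff f i = of_int a / of_int b" "\<not> int p dvd b" "b \<noteq> 0"
      by (rule of_rat_in_V)
    thus ?thesis by (intro exI[of _ b] exI[of _ a]) auto
  qed
  then obtain b a where b: "\<And>i. \<not> int p dvd b i" and ba: "\<And>i. of_int (b i) * Polynomial.coeff f i = of_int (a i)"
    by metis
  define s where "s = (\<Prod>i\<le>n. b i)"
  have ps: "\<not> int p dvd s" unfolding s_def using b prime_p by (subst prime_dvd_prod_iff) auto
  have "\<exists>c. of_int s * Polynomial.coeff f i = of_int c" if "i \<le> n" for i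
  proof -
    have "s = b i * (\<Prod>j\<in>{..n} - {i}. b j)" unfolding s_def using that by (simp add: prod.remove)
    hence "of_int s * Polynomial.coeff f i = of_int (a i * (\<Prod>j\<in>{..n} - {i}. b j))" using ba[of i] by simp
    thus ?thesis by blast
  qed
  then obtain c where c: "\<And>i. i \<le> n \<Longrightarrow> of_int s * Polynomial.coeff f i = of_int (c i)" by metis
  have ck: "of_int s * of_rat (Polynomial.coeff f i) = (of_int (c i) :: 'k)" if "i \<le> n" for i
    using arg_cong[OF c[OF that], of "of_rat :: rat \<Rightarrow> 'k"] by (simp add: of_rat_mult)
  have "0 = of_int s ^ n * rpoly f x" using f(2) by simp
  also have "\<dots> = (\<Sum>i<n. of_int s ^ n * (of_rat (Polynomial.coeff f i) * x ^ i)) + of_int s ^ n * x ^ n"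
    unfolding rpoly_altdef n_def[symmetric] using lc
    by (simp add: lessThan_Suc_atMost[symmetric] sum_distrib_left distrib_left)
  also have "(\<Sum>i<n. of_int s ^ n * (of_rat (Polynomial.coeff f i) * x ^ i))
     = (\<Sum>i<n. of_int (s ^ (n - Suc i) * c i) * (of_int s * x) ^ i)"
  proof (rule sum.cong)
    fix i assume i: "i \<in> {..<n}"
    have "(of_int s :: 'k) ^ (n - Suc i + Suc i) = of_int s ^ (n - Suc i) * of_int s * of_int s ^ i"
      unfolding power_add by (simp add: mult.assoc)
    moreover have "n - Suc i + Suc i = n" using i by simp
    ultimately have "(of_int s :: 'k) ^ n = of_int s ^ (n - Suc i) * of_int s * of_int s ^ i" by metis
    thus "of_int s ^ n * (of_rat (Polynomial.coeff f i) * x ^ i) = of_int (s ^ (n - Suc i) * c i) * (of_int s * x) ^ i"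
      using ck[of i, symmetric] i by (simp add: power_mult_distrib mult_ac)
  qed simp
  finally have "algebraic_int (of_int s * x)"
    by (intro algebraic_intI_sum[of _ n "\<lambda>i. s ^ (n - Suc i) * c i"]) (simp add: power_mult_distrib add.commute)
  thus ?thesis using that ps by blast
qed

text \<open>If \<open>c\<^sub>0 + c\<^sub>1 x + \<dots> + c\<^sub>d x\<^sup>d = 0\<close> with integers not all divisible by \<open>p\<close>, then every
  \<open>b\<^sub>j = c\<^sub>j + c\<^sub>j\<^sub>+\<^sub>1 x + \<dots>\<close> as well as \<open>x b\<^sub>j\<close> lies in every valuation ring, and for the largest \<open>j\<close>
  with \<open>p\<close> not dividing \<open>c\<^sub>j\<close> it is a unit at \<open>\<sigma>\<close>.\<close>

lemma localization:
  assumes s: "\<sigma> \<in> Sig" and x: "\<sigma> x \<in> V"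
  obtains a b where "a \<in> AI" "b \<in> AI" "\<sigma> b \<notin> M" "x * b = a"
proof (cases "x = 0")
  case True
  show ?thesis by (rule that[of 0 1]) (use True O_closed one_notin_M in \<open>auto simp: embedding_simps[OF s]\<close>)
next
  case x0: False
  have "\<not> (\<forall>c i. (\<Sum>i\<in>{..d}. of_int (c i) * x ^ i) = 0 \<longrightarrow> i \<in> {..d} \<longrightarrow> int p dvd c i)"
    using rank_bound[of "int p" "{..d}" "\<lambda>i. x ^ i"] prime_gt_1_nat[OF prime_p] by auto
  then obtain c i0 where c: "(\<Sum>i\<le>d. of_int (c i) * x ^ i) = 0" and i0: "i0 \<le> d" "\<not> int p dvd c i0" by auto
  define j where "j = Max {i. i \<le> d \<and> \<not> int p dvd c i}"
  have "finite {i. i \<le> d \<and> \<not> int p dvd c i}" "{i. i \<le> d \<and> \<not> int p dvd c i} \<noteq> {}" using i0 by auto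
  from Max_in[OF this] have j: "j \<le> d" "\<not> int p dvd c j" unfolding j_def by blast+
  have jmax: "int p dvd c i" if "i \<le> d" "i > j" for i
  proof (rule ccontr)
    assume "\<not> int p dvd c i"
    hence "i \<le> j" unfolding j_def using that by (intro Max_ge) auto
    thus False using that by simp
  qed
  define b where "b = (\<Sum>i=j..d. of_int (c i) * x ^ (i - j))"
  have split: "(\<Sum>i=j..d. of_int (c i) * x ^ i) = - (\<Sum>i<j. of_int (c i) * x ^ i)"
  proof -
    have "{..d} = {..<j} \<union> {j..d}" using j by auto
    hence "(\<Sum>i\<le>d. of_int (c i) * x ^ i) = (\<Sum>i<j. of_int (c i) * x ^ i) + (\<Sum>i=j..d. of_int (c i) * x ^ i)"
      by (simp add: sum.union_disjoint ivl_disj_int)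
    thus ?thesis using c by (simp add: eq_neg_iff_add_eq_0 add.commute)
  qed
  \<comment> \<open>The relation rewrites \<open>b\<close> in powers of 1/x; this form shows
    integrality at the embeddings that send x outside \<open>V\<close>.\<close>
  have bx: "b = - (\<Sum>i<j. of_int (c i) * inverse x ^ (j - i))"
  proof -
    have "b * x ^ j = (\<Sum>i=j..d. of_int (c i) * x ^ i)" unfolding b_def sum_distrib_right
      by (intro sum.cong) (auto simp: mult.assoc power_add[symmetric])
    also have "\<dots> = - (\<Sum>i<j. of_int (c i) * x ^ i)" by (rule split)
    also have "\<dots> = - (\<Sum>i<j. of_int (c i) * inverse x ^ (j - i)) * x ^ j"
      unfolding mult_minus_left sum_distrib_right using x0
      by (intro arg_cong[of _ _ uminus] sum.cong) (auto simp: power_diff field_simps)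
    finally show ?thesis using x0 by (subst (asm) mult_right_cancel) auto
  qed
  have mem: "\<tau> b \<in> V \<and> \<tau> (x * b) \<in> V" if t: "\<tau> \<in> Sig" for \<tau>
  proof (cases "\<tau> x \<in> V")
    case True
    have "\<tau> b \<in> V" unfolding b_def embedding_sum[OF t] embedding_simps[OF t]
      using True by (intro V_closed(8) V_closed(4,7,10))
    thus ?thesis using True V_closed(4) by (simp add: embedding_simps[OF t])
  next
    case False
    have y: "inverse (\<tau> x) \<in> V" using V_total[OF False] .
    have "\<tau> b \<in> V" unfolding bx embedding_sum[OF t] embedding_simps[OF t]
      using y by (intro V_closed(5) V_closed(8) V_closed(4,7,10))
    moreover have "x * b = - (\<Sum>i<j. of_int (c i) * inverse x ^ (j - Suc i))"
      unfolding bx mult_minus_right sum_distrib_left using x0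
      by (intro arg_cong[of _ _ uminus] sum.cong) (auto simp: Suc_diff_Suc[symmetric] field_simps)
    hence "\<tau> (x * b) = - (\<Sum>i<j. of_int (c i) * inverse (\<tau> x) ^ (j - Suc i))"
      by (simp only: embedding_sum[OF t] embedding_simps(4,5,7,10,11)[OF t])
    hence "\<tau> (x * b) \<in> V"
      using y by (simp only:) (intro V_closed(5) V_closed(8) V_closed(4,7,10))
    ultimately show ?thesis by blast
  qed
  have "\<sigma> b \<notin> M"
  proof
    assume bM: "\<sigma> b \<in> M"
    have "{j..d} = insert j {j<..d}" using j by auto
    hence eqb: "\<sigma> b = of_int (c j) + (\<Sum>i\<in>{j<..d}. of_int (c i) * \<sigma> x ^ (i - j))"
      by (simp add: b_def embedding_sum[OF s] embedding_simps[OF s])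
    have SM: "(\<Sum>i\<in>{j<..d}. of_int (c i) * \<sigma> x ^ (i - j)) \<in> M"
      using jmax of_int_in_M_iff by (intro M_sum M_mult V_closed(7)[OF x]) auto
    have "of_int (c j) \<in> M" using M_diff[OF bM SM] unfolding eqb by simp
    thus False using j(2) of_int_in_M_iff by blast
  qed
  \<comment> \<open>\<open>b\<close> and \<open>x * b\<close> are so far only integral above p; the
    factors \<open>s1\<close> and \<open>s2\<close> that make them integers of the field are prime
    to p, hence units of \<open>V\<close>.\<close>
  moreover obtain s1 :: int where s1: "\<not> int p dvd s1" "of_int s1 * b \<in> AI" using clear_denominator[of b] mem by blast
  obtain s2 :: int where s2: "\<not> int p dvd s2" "of_int s2 * (x * b) \<in> AI" using clear_denominator[of "x * b"] mem by blast
  have u: "of_int s1 \<notin> M" "of_int s2 \<notin> M" using s1 s2 of_int_in_M_iff by blast+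
  ultimately have "\<sigma> (of_int s2 * (of_int s1 * b)) \<notin> M"
    using M_prime[of "of_int s1" "\<sigma> b"] M_prime[of "of_int s2" "of_int s1 * \<sigma> b"] mem[OF s] V_closed(4,10)
    by (auto simp: embedding_simps[OF s])
  moreover have "of_int s1 * (of_int s2 * (x * b)) \<in> AI" "of_int s2 * (of_int s1 * b) \<in> AI"
    using s1 s2 O_closed(4,7) by blast+
  ultimately show ?thesis by (intro that[of "of_int s1 * (of_int s2 * (x * b))" "of_int s2 * (of_int s1 * b)"]) (auto simp: mult_ac)
qed

text \<open>A set of integers that is independent modulo \<open>J\<close> over the field with p
  elements has at most d members by \<open>rank_bound\<close>, so a largest one exists, and by
  maximality it spans. Independence and spanning are expressed with integer coefficients, without
  the quotient; \<open>J\<close> will be the ideal generated by p or a prime.\<close>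

lemma residue_basis:
  assumes J_add: "\<And>x y. x \<in> J \<Longrightarrow> y \<in> J \<Longrightarrow> x + y \<in> J" and J_mult: "\<And>x y. x \<in> J \<Longrightarrow> y \<in> AI \<Longrightarrow> y * x \<in> J"
    and J_p: "of_nat p \<in> J"
  obtains Y where "finite Y" "Y \<subseteq> AI" 
    "\<And>c y. (\<Sum>y\<in>Y. of_int (c y) * y) \<in> J \<Longrightarrow> y \<in> Y \<Longrightarrow> int p dvd c y"
    "\<And>x. x \<in> AI \<Longrightarrow> \<exists>c. x - (\<Sum>y\<in>Y. of_int (c y) * y) \<in> J"
proof -
  define indep where "indep Y \<longleftrightarrow> finite Y \<and> Y \<subseteq> AI \<and> (\<forall>c. (\<Sum>y\<in>Y. of_int (c y) * y) \<in> J \<longrightarrow> (\<forall>y\<in>Y. int p dvd c y))"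
    for Y :: "'k set"
  have J0: "0 \<in> J" using J_mult[OF J_p O_closed(1)] by simp
  have J_uminus: "- x \<in> J" if "x \<in> J" for x using J_mult[OF that, of "-1"] O_closed(5)[OF O_closed(2)] by simp
  have p1: "int p > 1" using prime_gt_1_nat[OF prime_p] by simp
  have bound: "card Y \<le> d" if "indep Y" for Y
    by (rule rank_bound[OF p1, of Y "\<lambda>y. y"]) (use that J0 in \<open>auto simp: indep_def\<close>)
  have "indep {}" by (simp add: indep_def)
  then obtain Y where Y: "indep Y" and max: "\<And>Z. indep Z \<Longrightarrow> card Z \<le> card Y"
    using ex_has_greatest_nat[of indep "{}" card "Suc d"] bound by (metis le_imp_less_Suc)
  have fY: "finite Y" "Y \<subseteq> AI" and Yi: "\<And>c y. (\<Sum>y\<in>Y. of_int (c y) * y) \<in> J \<Longrightarrow> y \<in> Y \<Longrightarrow> int p dvd c y"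
    using Y by (auto simp: indep_def)
  have pJ: "of_int a * z \<in> J" if az: "int p dvd a" "z \<in> AI" for a z
  proof -
    obtain k where "a = int p * k" using az(1) ..
    hence "of_int a * z = (of_int k * z) * of_nat p" by simp
    also have "\<dots> \<in> J" by (rule J_mult[OF J_p]) (rule O_closed(4)[OF O_closed(7) az(2)])
    finally show ?thesis .
  qed
  have "\<exists>c. x - (\<Sum>y\<in>Y. of_int (c y) * y) \<in> J" if x: "x \<in> AI" for x
  proof (cases "x \<in> Y")
    case True
    have "(\<Sum>y\<in>Y. of_int (if y = x then 1 else 0) * y) = x"
      using True fY(1) by (simp add: if_distrib[of of_int] if_distrib[of "\<lambda>u. u * _"] cong: if_cong)
    thus ?thesis using J0 by (metis diff_self)
  next
    case False
    have "\<not> indep (insert x Y)" using max[of "insert x Y"] False fY by auto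
    then obtain c y0 where c: "(\<Sum>y\<in>insert x Y. of_int (c y) * y) \<in> J" and y0: "y0 \<in> insert x Y" "\<not> int p dvd c y0"
      using fY x by (auto simp: indep_def)
    have sum: "of_int (c x) * x + (\<Sum>y\<in>Y. of_int (c y) * y) \<in> J" using c False fY by simp
    have "\<not> int p dvd c x"
    proof
      assume px: "int p dvd c x"
      have "(\<Sum>y\<in>Y. of_int (c y) * y) = of_int (c x) * x + (\<Sum>y\<in>Y. of_int (c y) * y) + - (of_int (c x) * x)" by simp
      also have "\<dots> \<in> J" by (rule J_add[OF sum J_uminus[OF pJ[OF px x]]])
      finally show False using Yi px y0 by blast
    qed
    hence "coprime (int p) (c x)" using prime_p by (simp add: prime_imp_coprime)
    \<comment> \<open>\<open>b\<close> inverts the coefficient of x modulo p; multiplying the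
      relation by it expresses x modulo \<open>J\<close>.\<close>
    then obtain a b where ab: "a * int p + b * c x = 1" by (metis bezout_int coprime_iff_gcd_eq_1)
    define s where "s = (\<Sum>y\<in>Y. of_int (c y) * y)"
    have one: "of_int b * of_int (c x) = (1 - of_int a * of_nat p :: 'k)"
      using arg_cong[OF ab, of "of_int :: int \<Rightarrow> 'k"] by (simp add: algebra_simps)
    have "of_int b * (of_int (c x) * x + s) + of_int (int p * a) * x \<in> J"
      using J_add[OF J_mult[OF sum O_closed(7)[of b]] pJ[of "int p * a", OF _ x]] by (simp add: s_def)
    also have "of_int b * (of_int (c x) * x + s) + of_int (int p * a) * x = x + of_int b * s"
      unfolding distrib_left mult.assoc[symmetric] one by (simp add: algebra_simps)
    also have "\<dots> = x - (\<Sum>y\<in>Y. of_int (- b * c y) * y)"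
      by (simp add: s_def sum_distrib_left sum_negf mult.assoc)
    finally show ?thesis by (intro exI[of _ "\<lambda>y. - b * c y"])
  qed
  with that fY Yi show ?thesis by blast
qed

text \<open>Reducing the coefficients modulo p leaves only finitely many combinations of a residue
  basis.\<close>

lemma finite_mod_p:
  obtains B where "finite B" "B \<subseteq> AI" "\<And>x. x \<in> AI \<Longrightarrow> \<exists>b\<in>B. \<exists>y\<in>AI. x - b = of_nat p * y"
proof -
  let ?J = "(\<lambda>y. of_nat p * y) ` AI"
  have "\<exists>Y. finite Y \<and> Y \<subseteq> AI \<and> (\<forall>x\<in>AI. \<exists>c. x - (\<Sum>y\<in>Y. of_int (c y) * y) \<in> ?J)"
  proof (rule residue_basis[of ?J])
    show "x + y \<in> ?J" if xy: "x \<in> ?J" "y \<in> ?J" for x y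
    proof -
      obtain u v where uv: "x = of_nat p * u" "y = of_nat p * v" "u \<in> AI" "v \<in> AI" using xy by blast
      hence "x + y = of_nat p * (u + v)" by (simp add: distrib_left)
      thus ?thesis using O_closed(3)[OF uv(3,4)] by blast
    qed
    show "y * x \<in> ?J" if xy: "x \<in> ?J" "y \<in> AI" for x y
    proof -
      obtain u where u: "x = of_nat p * u" "u \<in> AI" using xy by blast
      hence "y * x = of_nat p * (y * u)" by simp
      thus ?thesis using O_closed(4)[OF xy(2) u(2)] by blast
    qed
    show "of_nat p \<in> ?J" using O_closed(2) by (metis imageI mult.right_neutral)
  next
    fix Y :: "'k set"
    assume Y: "finite Y" "Y \<subseteq> AI" "\<And>x. x \<in> AI \<Longrightarrow> \<exists>c. x - (\<Sum>y\<in>Y. of_int (c y) * y) \<in> ?J"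
    show "\<exists>Y. finite Y \<and> Y \<subseteq> AI \<and> (\<forall>x\<in>AI. \<exists>c. x - (\<Sum>y\<in>Y. of_int (c y) * y) \<in> ?J)"
      by (intro exI[of _ Y] conjI ballI Y)
  qed
  then obtain Y where Y: "finite Y" "Y \<subseteq> AI" "\<And>x. x \<in> AI \<Longrightarrow> \<exists>c. x - (\<Sum>y\<in>Y. of_int (c y) * y) \<in> ?J" by blast
  define B where "B = (\<lambda>c. \<Sum>y\<in>Y. of_int (c y) * y) ` (Y \<rightarrow>\<^sub>E {0..<int p})"
  have YO: "(\<Sum>y\<in>Y. of_int (c y) * y) \<in> AI" for c
    by (rule O_sum) (use O_closed(4,7) Y(2) in blast)
  show ?thesis
  proof (rule that[of B])
    show "finite B" unfolding B_def using Y(1) by (intro finite_imageI finite_PiE) auto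
    show "B \<subseteq> AI" unfolding B_def using YO by blast
    fix x assume "x \<in> AI"
    then obtain c z where c: "x - (\<Sum>y\<in>Y. of_int (c y) * y) = of_nat p * z" and z: "z \<in> AI" using Y(3) by blast
    define c' where "c' = restrict (\<lambda>y. c y mod int p) Y"
    have "(\<Sum>y\<in>Y. of_int (c y) * y) = (\<Sum>y\<in>Y. of_int (c' y) * y + of_nat p * (of_int (c y div int p) * y))"
    proof (rule sum.cong)
      fix y assume y: "y \<in> Y"
      have "(of_int (c y) :: 'k) = of_int (int p * (c y div int p) + c' y)" using y by (simp add: c'_def)
      thus "of_int (c y) * y = of_int (c' y) * y + of_nat p * (of_int (c y div int p) * y)" by (simp add: algebra_simps)
    qed simp
    hence "x - (\<Sum>y\<in>Y. of_int (c' y) * y) = of_nat p * (z + (\<Sum>y\<in>Y. of_int (c y div int p) * y))"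
      using c by (simp add: sum.distrib sum_distrib_left algebra_simps)
    moreover have "c' \<in> Y \<rightarrow>\<^sub>E {0..<int p}" using prime_gt_0_nat[OF prime_p] by (auto simp: c'_def)
    ultimately show "\<exists>b\<in>B. \<exists>y\<in>AI. x - b = of_nat p * y"
      unfolding B_def using O_closed(3)[OF z YO[of "\<lambda>y. c y div int p"]] by blast
  qed
qed

lemma periodic_mod_p:
  assumes "\<And>i::nat. f i \<in> AI" obtains i j y where "i < j" "y \<in> AI" "f i - f j = of_nat p * y"
proof -
  obtain B where B: "finite B" "B \<subseteq> AI" "\<And>x. x \<in> AI \<Longrightarrow> \<exists>b\<in>B. \<exists>y\<in>AI. x - b = of_nat p * y" by (rule finite_mod_p) blast
  have "\<forall>i. \<exists>b. b \<in> B \<and> (\<exists>y\<in>AI. f i - b = of_nat p * y)" using B(3) assms by blast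
  then obtain g where g: "\<And>i. g i \<in> B" "\<And>i. \<exists>y\<in>AI. f i - g i = of_nat p * y" by metis
  have "\<not> inj g" using B(1) g(1) by (metis finite_imageD finite_subset image_subsetI infinite_UNIV_nat)
  then obtain i j where ij: "i \<noteq> j" "g i = g j" by (auto simp: inj_def)
  obtain i j where ij: "i < j" "g i = g j" using ij by (metis nat_neq_iff)
  obtain y z where yz: "y \<in> AI" "z \<in> AI" "f i - g i = of_nat p * y" "f j - g j = of_nat p * z" using g(2) by blast
  have "f i - f j = (f i - g i) - (f j - g j)" using ij by simp
  also have "\<dots> = of_nat p * (y - z)" unfolding yz by (simp add: algebra_simps)
  finally show ?thesis using that[OF ij(1) O_closed(6)[OF yz(1,2)]] by blast
qed

section \<open>Primes cut out by the embeddings, and their uniformizers\<close>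

definition pid :: "('k \<Rightarrow> rat alg_closure) \<Rightarrow> 'k set" where
  "pid \<sigma> = {x \<in> AI. \<sigma> x \<in> M}"

lemma pid_p: "\<sigma> \<in> Sig \<Longrightarrow> of_nat p * y \<in> pid \<sigma>" if "y \<in> AI"
  using that emb_O[of \<sigma> y] M_mult[OF P_in_M] O_closed(4,8) by (simp add: pid_def embedding_simps)

context
  fixes \<sigma> \<tau> assumes s: "\<sigma> \<in> Sig" and t: "\<tau> \<in> Sig" and eq: "pid \<sigma> = pid \<tau>"
begin

text \<open>By \<open>localization\<close> the elements sent into \<open>V\<close> are the fractions
  of integers with denominator outside \<open>pid \<sigma>\<close>, so they depend on the prime
  only. Hence data found for one embedding hold for all those above the same prime.\<close>

lemma pid_eq_V: assumes "\<sigma> x \<in> V" shows "\<tau> x \<in> V"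
proof -
  obtain a b where ab: "a \<in> AI" "b \<in> AI" "\<sigma> b \<notin> M" "x * b = a" by (rule localization[OF s assms])
  have "b \<notin> pid \<tau>" using ab eq by (auto simp: pid_def)
  hence b: "\<tau> b \<notin> M" using ab by (auto simp: pid_def)
  have "\<tau> x * \<tau> b = \<tau> a" using ab(4) by (simp add: embedding_simps[OF t, symmetric])
  hence "\<tau> x = \<tau> a * inverse (\<tau> b)" using unit_inverse(2)[OF b] by (simp add: field_simps)
  thus ?thesis using V_closed(4)[OF emb_O[OF t ab(1)] unit_inverse(1)[OF emb_O[OF t ab(2)] b]] by simp
qed

lemma pid_eq_M: assumes "\<sigma> x \<in> M" shows "\<tau> x \<in> M"
proof -
  obtain a b where ab: "a \<in> AI" "b \<in> AI" "\<sigma> b \<notin> M" "x * b = a" by (rule localization[OF s M_subset[OF assms]])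
  have "b \<notin> pid \<tau>" using ab eq by (auto simp: pid_def)
  hence b: "\<tau> b \<notin> M" using ab by (auto simp: pid_def)
  have "\<sigma> x * \<sigma> b = \<sigma> a" using ab(4) by (simp add: embedding_simps[OF s, symmetric])
  hence "\<sigma> a \<in> M" using M_mult(1)[OF assms emb_O[OF s ab(2)]] by simp
  hence a: "\<tau> a \<in> M" using ab(1) eq by (auto simp: pid_def)
  have "\<tau> x * \<tau> b = \<tau> a" using ab(4) by (simp add: embedding_simps[OF t, symmetric])
  hence "\<tau> x = \<tau> a * inverse (\<tau> b)" using unit_inverse(2)[OF b] by (simp add: field_simps)
  thus ?thesis using M_mult(1)[OF a unit_inverse(1)[OF emb_O[OF t ab(2)] b]] by simp
qed

end

text \<open>The values of y_0 = p, y_1, ... strictly decrease. In an integer relation between y_1,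
  ..., y_(d+1) with a coefficient prime to p, the last such term has strictly the least value: the
  earlier ones have larger value, and terms with coefficient divisible by p have at least the value
  of p. So the family contradicts \<open>rank_bound\<close>; this is what makes the valuation
  induced on \<open>'k\<close> discrete.\<close>

lemma no_long_chain:
  assumes s: "\<sigma> \<in> Sig" and y0: "y 0 = of_nat p"
    and y: "\<And>i. i \<le> d \<Longrightarrow> y (Suc i) \<noteq> 0 \<and> \<sigma> (y i / y (Suc i)) \<in> M"
    and yV: "\<And>i. i \<le> Suc d \<Longrightarrow> \<sigma> (y i) \<in> V"
  shows False
proof -
  have p1: "int p > 1" using prime_gt_1_nat[OF prime_p] by simp
  have ynz: "y i \<noteq> 0" if "i \<le> Suc d" for i using that y y0 prime_gt_0_nat[OF prime_p] by (cases i) auto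
  have lt: "\<sigma> (y i / y j) \<in> M" if "i < j" "j \<le> Suc d" for i j
    using that
  proof (induction j)
    case (Suc j)
    have step: "\<sigma> (y j / y (Suc j)) \<in> M" using y Suc.prems by simp
    show ?case
    proof (cases "i = j")
      case False
      hence "\<sigma> (y i / y j) \<in> M" using Suc by simp
      hence "\<sigma> (y i / y j) * \<sigma> (y j / y (Suc j)) \<in> M" using M_mult(1) M_subset[OF step] by blast
      thus ?thesis using ynz[of j] Suc.prems by (simp add: embedding_simps[OF s] )
    qed (use step in simp)
  qed simp
  have "card {1..Suc d} \<le> d"
  proof (rule rank_bound[OF p1, of _ y])
    fix c i assume c: "(\<Sum>i\<in>{1..Suc d}. of_int (c i) * y i) = 0" and i: "i \<in> {1..Suc d}"
    show "int p dvd c i"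
    proof (rule ccontr)
      assume ni: "\<not> int p dvd c i"
      let ?S = "{i \<in> {1..Suc d}. \<not> int p dvd c i}"
      define j where "j = Max ?S"
      have "j \<in> ?S" unfolding j_def by (rule Max_in) (use i ni in auto)
      hence j: "1 \<le> j" "j \<le> Suc d" "\<not> int p dvd c j" by auto
      have jmax: "int p dvd c i" if "i \<in> {1..Suc d}" "i > j" for i
      proof (rule ccontr)
        assume "\<not> int p dvd c i"
        hence "i \<le> j" unfolding j_def using that by (intro Max_ge) auto
        thus False using that by simp
      qed
      have t: "\<sigma> (of_int (c i) * y i / y j) \<in> M" if "i \<in> {1..Suc d} - {j}" for i
      proof (cases "i < j")
        case True
        hence "of_int (c i) * \<sigma> (y i / y j) \<in> M" using lt[of i j] j M_mult(2) V_closed(10) by blast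
        thus ?thesis by (simp add: embedding_simps[OF s])
      next
        case False
        hence "int p dvd c i" using jmax that by auto
        then obtain k where k: "c i = int p * k" ..
        have "\<sigma> (y 0 / y j) * (of_int k * \<sigma> (y i)) \<in> M"
          using lt[of 0 j] j yV[of i] that by (intro M_mult(1) V_closed(4,10)) auto
        thus ?thesis by (simp add: embedding_simps[OF s] k y0 mult_ac)
      qed
      have fin: "finite {1..Suc d}" "j \<in> {1..Suc d}" using j by auto
      have "of_int (c j) * y j = - (\<Sum>i\<in>{1..Suc d} - {j}. of_int (c i) * y i)"
        using c sum.remove[OF fin, of "\<lambda>i. of_int (c i) * y i"] by (simp add: eq_neg_iff_add_eq_0)
      hence "of_int (c j) = - (\<Sum>i\<in>{1..Suc d} - {j}. of_int (c i) * y i) / y j"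
        using ynz[OF j(2)] by (simp add: field_simps)
      hence "of_int (c j) = - (\<Sum>i\<in>{1..Suc d} - {j}. of_int (c i) * y i / y j)"
        by (simp add: sum_divide_distrib)
      from arg_cong[OF this, of \<sigma>] have "of_int (c j) = - (\<Sum>i\<in>{1..Suc d} - {j}. \<sigma> (of_int (c i) * y i / y j))"
        by (simp only: embedding_simps(5,11)[OF s] embedding_sum[OF s])
      also have "\<dots> \<in> M" by (intro M_uminus M_sum t)
      finally show False using of_int_in_M_iff j(3) by blast
    qed
  qed simp
  thus False by simp
qed

text \<open>If no element generated the maximal ideal at \<open>\<sigma>\<close>, one could pass
  from p to elements of ever smaller positive value, against \<open>no_long_chain\<close>. The same
  lemma bounds the power of the uniformizer that divides p; the largest exponent is the ramification
  index.\<close>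

lemma uniformizer_exists:
  assumes s: "\<sigma> \<in> Sig"
  shows "\<exists>w e. w \<in> AI \<and> w \<noteq> 0 \<and> \<sigma> w \<in> M \<and> (\<forall>y. \<sigma> y \<in> M \<longrightarrow> \<sigma> (y / w) \<in> V) \<and>
    e \<ge> 1 \<and> \<sigma> (of_nat p / w ^ e) \<in> V \<and> \<sigma> (of_nat p / w ^ e) \<notin> M"
proof -
  let ?g = "\<lambda>w. w \<noteq> 0 \<and> \<sigma> w \<in> M"
  have pg: "?g (of_nat p)" using P_in_M prime_gt_0_nat[OF prime_p] by (simp add: embedding_simps[OF s])
  have "\<exists>w. ?g w \<and> (\<forall>y. \<sigma> y \<in> M \<longrightarrow> \<sigma> (y / w) \<in> V)"
  proof (rule ccontr)
    assume "\<not> ?thesis"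
    hence "\<forall>w. \<exists>y. ?g w \<longrightarrow> \<sigma> y \<in> M \<and> \<sigma> (y / w) \<notin> V" by blast
    then obtain h where h: "\<And>w. ?g w \<Longrightarrow> \<sigma> (h w) \<in> M \<and> \<sigma> (h w / w) \<notin> V" by metis
    have hg: "?g (h w) \<and> \<sigma> (w / h w) \<in> M" if w: "?g w" for w
    proof -
      have "\<not> vdvd (\<sigma> w) (\<sigma> (h w))" using h[OF w] w by (simp add: vdvd_iff embedding_simps[OF s])
      from not_vdvd[OF this] show ?thesis using h[OF w] by (simp add: embedding_simps[OF s])
    qed
    have it: "?g ((h ^^ i) (of_nat p))" for i by (induction i) (use pg hg in auto)
    show False
    proof (rule no_long_chain[OF s, of "\<lambda>i. (h ^^ i) (of_nat p)"])
      show "(h ^^ Suc i) (of_nat p) \<noteq> 0 \<and> \<sigma> ((h ^^ i) (of_nat p) / (h ^^ Suc i) (of_nat p)) \<in> M" for i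
        using hg[OF it[of i]] by simp
      show "\<sigma> ((h ^^ i) (of_nat p)) \<in> V" for i using it[of i] M_subset by blast
    qed simp
  qed
  then obtain w0 where w0: "?g w0" "\<And>y. \<sigma> y \<in> M \<Longrightarrow> \<sigma> (y / w0) \<in> V" by blast
  obtain w b where wb: "w \<in> AI" "b \<in> AI" "\<sigma> b \<notin> M" "w0 * b = w"
    using localization[OF s M_subset] w0(1) by blast
  have b0: "b \<noteq> 0" using wb(3) zero_in_M by (auto simp: embedding_simps[OF s])
  have "\<sigma> w0 * \<sigma> b \<in> M" using M_mult(1) w0(1) emb_O[OF s wb(2)] by blast
  hence w: "?g w" using w0(1) b0 wb(4) by (auto simp: embedding_simps(4)[OF s, symmetric])
  have wdiv: "\<sigma> (y / w) \<in> V" if "\<sigma> y \<in> M" for y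
  proof -
    have "\<sigma> (y / w0) * inverse (\<sigma> b) \<in> V"
      using w0(2)[OF that] unit_inverse(1)[OF emb_O[OF s wb(2)] wb(3)] V_closed(4) by blast
    moreover have "y / w0 * inverse b = y / w" using wb(4) by (auto simp: field_simps)
    ultimately show ?thesis by (metis embedding_simps(4,7)[OF s])
  qed
  let ?E = "\<lambda>n. \<sigma> (of_nat p / w ^ n) \<in> V"
  have wV: "\<sigma> (w ^ n) \<in> V" for n using emb_O[OF s O_power[OF wb(1)]] .
  have bd: "n \<le> Suc d" if n: "?E n" for n
  proof (rule ccontr)
    assume "\<not> n \<le> Suc d"
    hence n2: "n \<ge> Suc (Suc d)" by simp
    \<comment> \<open>The chain p, w^(d+1), w^d, ..., w; its first quotient lies in the maximal
      ideal because even w^(d+2) divides p.\<close>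
    define y where "y i = (if i = 0 then of_nat p else w ^ (Suc (Suc d) - i))" for i
    show False
    proof (rule no_long_chain[OF s, of y])
      show "y 0 = of_nat p" by (simp add: y_def)
      show "\<sigma> (y i) \<in> V" for i using wV V_closed(11) by (simp add: y_def embedding_simps[OF s])
      fix i assume i: "i \<le> d"
      have "\<sigma> (y i / y (Suc i)) \<in> M"
      proof (cases "i = 0")
        case True
        have "of_nat p / w ^ Suc d = w * (w ^ (n - Suc (Suc d)) * (of_nat p / w ^ n))"
        proof -
          have "w ^ n = w ^ Suc d * (w * w ^ (n - Suc (Suc d)))"
            using n2 by (metis le_add_diff_inverse mult.assoc power_Suc power_Suc2 power_add)
          thus ?thesis using w by (simp add: field_simps)
        qed
        moreover have "\<sigma> w * (\<sigma> (w ^ (n - Suc (Suc d))) * \<sigma> (of_nat p / w ^ n)) \<in> M"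
          using M_mult(1) w V_closed(4)[OF wV n] by blast
        ultimately have "\<sigma> (of_nat p / w ^ Suc d) \<in> M" by (simp only: embedding_simps(4)[OF s])
        thus ?thesis using True by (simp add: y_def)
      next
        case False
        have "Suc (Suc d) - i = Suc (Suc (Suc d) - Suc i)" using i by simp
        hence "y i / y (Suc i) = w" using w False by (simp add: y_def)
        thus ?thesis using w by simp
      qed
      thus "y (Suc i) \<noteq> 0 \<and> \<sigma> (y i / y (Suc i)) \<in> M" using w by (simp add: y_def)
    qed
  qed
  have E1: "?E 1" using wdiv[of "of_nat p"] P_in_M by (simp add: embedding_simps[OF s])
  define e where "e = Max {n. ?E n}"
  have fin: "finite {n. ?E n}" using bd finite_nat_set_iff_bounded_le by blast
  have "{n. ?E n} \<noteq> {}" using E1 by blast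
  from Max_in[OF fin this] have Ee: "?E e" unfolding e_def by (rule CollectD)
  have e1: "e \<ge> 1" using Max_ge[OF fin, of 1] E1 by (simp add: e_def)
  have "\<sigma> (of_nat p / w ^ e) \<notin> M"
  proof
    assume "\<sigma> (of_nat p / w ^ e) \<in> M"
    hence "?E (Suc e)" using wdiv[of "of_nat p / w ^ e"] by (simp add: field_simps)
    thus False using Max_ge[OF fin, of "Suc e"] by (simp add: e_def)
  qed
  thus ?thesis using wb(1) w wdiv e1 Ee by (intro exI[of _ w] exI[of _ e]) blast
qed

end

section \<open>Relations between homomorphisms into the valuation ring\<close>

lemma underdetermined_system:
  fixes a :: "'r \<Rightarrow> 'j \<Rightarrow> 'l::field"
  assumes "finite R" "finite J" "card R < card J"
  shows "\<exists>l. (\<exists>j\<in>J. l j \<noteq> 0) \<and> (\<forall>r\<in>R. (\<Sum>j\<in>J. l j * a r j) = 0)"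
  using assms
proof (induction R arbitrary: J a rule: finite_induct)
  case empty
  then obtain j where "j \<in> J" by fastforce
  thus ?case by (intro exI[of _ "\<lambda>_. 1"]) auto
next
  case (insert r R)
  show ?case
  proof (cases "\<forall>j\<in>J. a r j = 0")
    case True
    have "card R < card J" using insert by simp
    from insert.IH[OF insert.prems(1) this, of a] True show ?thesis by auto
  next
    case False
    then obtain j0 where j0: "j0 \<in> J" "a r j0 \<noteq> 0" by blast
    define J' where "J' = J - {j0}"
    have "finite J'" "card R < card J'" using insert j0 by (auto simp: J'_def)
    from insert.IH[OF this, of "\<lambda>s j. a s j - a s j0 * a r j / a r j0"] obtain l
      where l: "\<exists>j\<in>J'. l j \<noteq> 0" "\<And>s. s \<in> R \<Longrightarrow> (\<Sum>j\<in>J'. l j * (a s j - a s j0 * a r j / a r j0)) = 0" by blast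
    define l' where "l' j = (if j = j0 then - (\<Sum>j\<in>J'. l j * a r j) / a r j0 else l j)" for j
    have sum: "(\<Sum>j\<in>J. l' j * a s j) = l' j0 * a s j0 + (\<Sum>j\<in>J'. l j * a s j)" for s
      using insert.prems(1) j0(1) by (simp add: sum.remove[of J j0] J'_def l'_def)
    have "(\<Sum>j\<in>J. l' j * a r j) = 0" unfolding sum using j0 by (simp add: l'_def)
    moreover have "(\<Sum>j\<in>J. l' j * a s j) = 0" if "s \<in> R" for s
    proof -
      have "0 = (\<Sum>j\<in>J'. l j * a s j - (a s j0 / a r j0) * (l j * a r j))"
        using l(2)[OF that] by (simp add: algebra_simps)
      also have "\<dots> = (\<Sum>j\<in>J'. l j * a s j) - (a s j0 / a r j0) * (\<Sum>j\<in>J'. l j * a r j)"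
        by (simp add: sum_subtractf sum_distrib_left)
      finally show ?thesis unfolding sum by (simp add: l'_def)
    qed
    moreover have "\<exists>j\<in>J. l' j \<noteq> 0" using l(1) by (auto simp: l'_def J'_def)
    ultimately show ?thesis by blast
  qed
qed

context valuation
begin

lemma vdvd_minimum:
  assumes "finite J" "J \<noteq> {}" shows "\<exists>i\<in>J. \<forall>j\<in>J. vdvd (l i) (l j)"
  using assms
proof (induction J rule: finite_ne_induct)
  case (singleton x) thus ?case by (simp add: vdvd_refl)
next
  case (insert x J)
  then obtain i where i: "i \<in> J" "\<forall>j\<in>J. vdvd (l i) (l j)" by blast
  show ?case
  proof (cases "vdvd (l i) (l x)")
    case True thus ?thesis using i by blast
  next
    case False
    hence "vdvd (l x) (l i)" using vdvd_total by blast
    hence "\<forall>j\<in>insert x J. vdvd (l x) (l j)" using i(2) vdvd_trans vdvd_refl by blast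
    thus ?thesis by blast
  qed
qed

text \<open>Dividing a nonzero solution by its coefficient of least value puts all coefficients into
  \<open>V\<close> and makes one of them 1, so that the relation survives reduction modulo the
  maximal ideal.\<close>

lemma primitive_solution:
  assumes "finite R" "finite J" "card R < card J"
  obtains l i where "i \<in> J" "l i = 1" "\<And>j. j \<in> J \<Longrightarrow> l j \<in> V" "\<And>r. r \<in> R \<Longrightarrow> (\<Sum>j\<in>J. l j * a r j) = 0"
proof -
  obtain l where l: "\<exists>j\<in>J. l j \<noteq> 0" "\<And>r. r \<in> R \<Longrightarrow> (\<Sum>j\<in>J. l j * a r j) = 0"
    using underdetermined_system[OF assms] by blast
  obtain i where i: "i \<in> J" "\<And>j. j \<in> J \<Longrightarrow> vdvd (l i) (l j)"
    using vdvd_minimum[OF assms(2), of l] l(1) by blast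
  have li: "l i \<noteq> 0" using l(1) i(2) by (auto simp: vdvd_def)
  show ?thesis
  proof (rule that[of i "\<lambda>j. l j / l i"])
    show "l j / l i \<in> V" if "j \<in> J" for j using i(2)[OF that] li by (simp add: vdvd_iff)
    fix r assume "r \<in> R"
    thus "(\<Sum>j\<in>J. l j / l i * a r j) = 0" using l(2)[of r] by (simp add: sum_divide_distrib[symmetric])
  qed (use i li in auto)
qed

text \<open>Replacing \<open>\<Lambda>(x)\<close> by \<open>\<Lambda>(y x) - t(y) \<Lambda>(x)\<close> eliminates the homomorphism \<open>t\<close> from a linear
  combination \<open>\<Lambda>\<close> of homomorphisms.\<close>

lemma independence_of_homs:
  fixes A :: "'k::monoid_mult set" and s :: "'k \<Rightarrow> 'a" and I :: "'a set"
  assumes "finite T"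
    and A: "\<And>x y. x \<in> A \<Longrightarrow> y \<in> A \<Longrightarrow> x * y \<in> A" "\<And>t. t \<in> T \<Longrightarrow> y t \<in> A"
    and hom: "\<And>t x y. t \<in> insert s T \<Longrightarrow> x \<in> A \<Longrightarrow> y \<in> A \<Longrightarrow> t (x * y) = t x * t y"
    and tV: "\<And>t x. t \<in> T \<Longrightarrow> x \<in> A \<Longrightarrow> t x \<in> V"
    and I: "\<And>x y. x \<in> I \<Longrightarrow> y \<in> I \<Longrightarrow> x - y \<in> I" "\<And>x v. x \<in> I \<Longrightarrow> v \<in> V \<Longrightarrow> v * x \<in> I"
    and rel: "\<And>x. x \<in> A \<Longrightarrow> m * s x + (\<Sum>t\<in>T. l t * t x) \<in> I"
    and x: "x \<in> A"
  shows "m * (\<Prod>t\<in>T. s (y t) - t (y t)) * s x \<in> I"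
  using assms(1) A(2) hom tV rel x
proof (induction T arbitrary: m l x rule: finite_induct)
  case empty
  thus ?case by simp
next
  case (insert u T)
  have yu: "y u \<in> A" using insert.prems(1) by simp
  have *: "(m * (s (y u) - u (y u))) * s z + (\<Sum>t\<in>T. (l t * (t (y u) - u (y u))) * t z) \<in> I" if z: "z \<in> A" for z
  proof -
    have hm: "t (y u * z) = t (y u) * t z" if "t \<in> insert s (insert u T)" for t
      using insert.prems(2)[OF that yu z] .
    have 1: "m * s (y u * z) + (\<Sum>t\<in>insert u T. l t * t (y u * z)) \<in> I"
      by (rule insert.prems(4)) (rule A(1)[OF yu z])
    have 2: "u (y u) * (m * s z + (\<Sum>t\<in>insert u T. l t * t z)) \<in> I"
      by (rule I(2)[OF insert.prems(4)[OF z]]) (use insert.prems(3) yu in blast)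
    have "(\<Sum>t\<in>T. l t * t (y u * z)) = (\<Sum>t\<in>T. l t * (t (y u) * t z))"
      using hm by (intro sum.cong) auto
    hence "m * s (y u * z) + (\<Sum>t\<in>insert u T. l t * t (y u * z)) - u (y u) * (m * s z + (\<Sum>t\<in>insert u T. l t * t z))
      = (m * (s (y u) - u (y u))) * s z + (\<Sum>t\<in>T. l t * (t (y u) * t z)) - u (y u) * (\<Sum>t\<in>T. l t * t z)"
      using hm insert.hyps by (simp add: algebra_simps)
    also have "\<dots> = (m * (s (y u) - u (y u))) * s z +
      ((\<Sum>t\<in>T. l t * (t (y u) * t z)) - u (y u) * (\<Sum>t\<in>T. l t * t z))" by (rule add_diff_eq[symmetric])
    also have "(\<Sum>t\<in>T. l t * (t (y u) * t z)) - u (y u) * (\<Sum>t\<in>T. l t * t z)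
      = (\<Sum>t\<in>T. (l t * (t (y u) - u (y u))) * t z)"
      unfolding sum_distrib_left sum_subtractf[symmetric] by (intro sum.cong) (simp_all add: algebra_simps)
    finally show ?thesis using I(1)[OF 1 2] by metis
  qed
  have "m * (s (y u) - u (y u)) * (\<Prod>t\<in>T. s (y t) - t (y t)) * s x \<in> I"
    by (rule insert.IH) (use insert.prems * in auto)
  thus ?case using insert.hyps by (simp add: mult.assoc)
qed

lemma power_diff_M: assumes "a \<in> V" "b \<in> V" "a - b \<in> M" shows "a ^ n - b ^ n \<in> M"
proof -
  have "a ^ n - b ^ n = (a - b) * (\<Sum>i<n. b ^ (n - Suc i) * a ^ i)" by (rule power_diff_sumr2)
  also have "\<dots> \<in> M" by (intro M_mult(1)[OF assms(3)] V_closed(8) V_closed(4,7) assms)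
  finally show ?thesis .
qed

text \<open>In the residue field a^p - b^p equals (a - b)^p, and a field has no nilpotent
  elements.\<close>

lemma frobenius_inj_M:
  assumes "a \<in> V" "b \<in> V" "a ^ (p ^ n) - b ^ (p ^ n) \<in> M" shows "a - b \<in> M"
  using assms
proof (induction n arbitrary: a b)
  case (Suc n)
  have "(a ^ p) ^ (p ^ n) - (b ^ p) ^ (p ^ n) \<in> M" using Suc.prems(3) by (simp add: power_mult[symmetric])
  hence ab: "a ^ p - b ^ p \<in> M" using Suc.IH[of "a ^ p" "b ^ p"] Suc.prems(1,2) V_closed(7) by blast
  obtain c where c: "c \<in> V" "a ^ p - b ^ p = (a - b) ^ p + P * (a - b) * c"
    using frobenius_diff[OF Suc.prems(1,2)] by blast
  have dV: "a - b \<in> V" using Suc.prems V_closed(3) by blast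
  have "P * ((a - b) * c) \<in> M" by (intro M_mult(1)[OF P_in_M] V_closed(4) dV c)
  from M_diff[OF ab this] have "(a - b) ^ p \<in> M" unfolding c(2) by (simp add: mult.assoc)
  thus ?case using M_power[OF dV] by blast
qed simp

end

section \<open>Finite residue fields and Chinese remainders\<close>

context local_fld
begin

lemma pid_subset: "x \<in> pid \<sigma> \<Longrightarrow> x \<in> AI" and pid_M: "x \<in> pid \<sigma> \<Longrightarrow> \<sigma> x \<in> M"
  by (auto simp: pid_def)

lemma pid_diff: "\<sigma> \<in> Sig \<Longrightarrow> x \<in> pid \<sigma> \<Longrightarrow> y \<in> pid \<sigma> \<Longrightarrow> x - y \<in> pid \<sigma>"
  and pid_add: "\<sigma> \<in> Sig \<Longrightarrow> x \<in> pid \<sigma> \<Longrightarrow> y \<in> pid \<sigma> \<Longrightarrow> x + y \<in> pid \<sigma>"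
  and pid_mult: "\<sigma> \<in> Sig \<Longrightarrow> x \<in> pid \<sigma> \<Longrightarrow> z \<in> AI \<Longrightarrow> z * x \<in> pid \<sigma>"
  and pid_prime: "\<sigma> \<in> Sig \<Longrightarrow> a \<in> AI \<Longrightarrow> b \<in> AI \<Longrightarrow> a * b \<in> pid \<sigma> \<Longrightarrow> a \<in> pid \<sigma> \<or> b \<in> pid \<sigma>"
  and one_notin_pid: "\<sigma> \<in> Sig \<Longrightarrow> 1 \<notin> pid \<sigma>"
  and p_in_pid: "\<sigma> \<in> Sig \<Longrightarrow> of_nat p \<in> pid \<sigma>"
  unfolding pid_def using O_closed M_diff M_add M_mult M_prime emb_O one_notin_M P_in_M
  by (auto simp: embedding_simps)

text \<open>Powers of \<open>a\<close> are periodic modulo p; since the prime contains p and not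
  \<open>a\<close>, the common factor cancels. In effect \<open>a ^ (n - 1)\<close> inverts
  \<open>a\<close> in the finite residue field.\<close>

lemma pid_power_one: 
  assumes s: "\<sigma> \<in> Sig" and a: "a \<in> AI" "a \<notin> pid \<sigma>"
  obtains n where "n \<ge> 1" "1 - a ^ n \<in> pid \<sigma>"
proof -
  obtain i j y where ij: "i < j" "y \<in> AI" "a ^ i - a ^ j = of_nat p * y"
    using periodic_mod_p[of "\<lambda>i. a ^ i"] O_power[OF a(1)] by blast
  have "a ^ i * (1 - a ^ (j - i)) = a ^ i - a ^ j" using ij(1) by (simp add: right_diff_distrib power_add[symmetric])
  hence "a ^ i * (1 - a ^ (j - i)) \<in> pid \<sigma>" using pid_p[OF ij(2) s] ij(3) by simp
  moreover have ai: "a ^ i \<in> AI" "1 - a ^ (j - i) \<in> AI" using O_power[OF a(1)] O_closed(6)[OF O_closed(2)] by blast+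
  moreover have "a ^ i \<notin> pid \<sigma>"
  proof
    assume "a ^ i \<in> pid \<sigma>"
    hence "\<sigma> a ^ i \<in> M" by (simp add: pid_def embedding_simps[OF s])
    hence "\<sigma> a \<in> M" using M_power emb_O[OF s a(1)] by blast
    thus False using a by (simp add: pid_def)
  qed
  ultimately have "1 - a ^ (j - i) \<in> pid \<sigma>" using pid_prime[OF s] by blast
  thus ?thesis using ij(1) by (intro that[of "j - i"]) auto
qed

text \<open>An element that lies in exactly one of the two primes has a power congruent to 1 modulo
  the other; that power, or 1 minus it, is the required \<open>c\<close>.\<close>

lemma crt_pair:
  assumes s: "\<sigma> \<in> Sig" and t: "\<tau> \<in> Sig" and ne: "pid \<tau> \<noteq> pid \<sigma>"
  shows "\<exists>c\<in>AI. 1 - c \<in> pid \<sigma> \<and> c \<in> pid \<tau>"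
proof -
  have pw: "x ^ n \<in> pid \<rho>" if "\<rho> \<in> Sig" "x \<in> pid \<rho>" "n \<ge> 1" for \<rho> x n
  proof -
    have "x ^ n = x ^ (n - 1) * x" using that(3) by (metis One_nat_def Suc_le_D diff_Suc_1 power_Suc2)
    also have "\<dots> \<in> pid \<rho>" by (rule pid_mult[OF that(1,2) O_power[OF pid_subset[OF that(2)]]])
    finally show ?thesis .
  qed
  consider x where "x \<in> pid \<tau>" "x \<notin> pid \<sigma>" | x where "x \<in> pid \<sigma>" "x \<notin> pid \<tau>" using ne by blast
  thus ?thesis
  proof cases
    case (1 x)
    have xO: "x \<in> AI" using 1(1) by (rule pid_subset)
    obtain n where n: "n \<ge> 1" "1 - x ^ n \<in> pid \<sigma>" by (rule pid_power_one[OF s xO 1(2)])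
    show ?thesis using n(2) pw[OF t 1(1) n(1)] O_power[OF xO] by blast
  next
    case (2 x)
    have xO: "x \<in> AI" using 2(1) by (rule pid_subset)
    obtain n where n: "n \<ge> 1" "1 - x ^ n \<in> pid \<tau>" by (rule pid_power_one[OF t xO 2(2)])
    show ?thesis using n(2) pw[OF s 2(1) n(1)] pid_subset[OF n(2)] by (intro bexI[of _ "1 - x ^ n"]) auto
  qed
qed

lemma pid_one_minus_mult:
  assumes s: "\<sigma> \<in> Sig" and "1 - a \<in> pid \<sigma>" "1 - b \<in> pid \<sigma>" "b \<in> AI" shows "1 - a * b \<in> pid \<sigma>"
proof -
  have "1 - a * b = (1 - b) + b * (1 - a)" by (simp add: algebra_simps)
  thus ?thesis using pid_add[OF s assms(3) pid_mult[OF s assms(2,4)]] by metis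
qed

lemma crt:
  assumes s: "\<sigma> \<in> Sig"
  obtains c where "c \<in> AI" "1 - c \<in> pid \<sigma>" "\<And>\<tau>. \<tau> \<in> Sig \<Longrightarrow> pid \<tau> \<noteq> pid \<sigma> \<Longrightarrow> vdvd P (\<tau> c)"
proof -
  have "\<exists>c\<in>AI. 1 - c \<in> pid \<sigma> \<and> (\<forall>\<tau>\<in>T. pid \<tau> \<noteq> pid \<sigma> \<longrightarrow> vdvd P (\<tau> c))" if "finite T" "T \<subseteq> Sig" for T
    using that
  proof (induction T rule: finite_induct)
    case empty
    have "1 - 1 \<in> pid \<sigma>" using pid_diff[OF s p_in_pid[OF s] p_in_pid[OF s]] by simp
    thus ?case using O_closed(2) by blast
  next
    case (insert \<tau> T)
    then obtain c where c: "c \<in> AI" "1 - c \<in> pid \<sigma>" "\<forall>\<tau>\<in>T. pid \<tau> \<noteq> pid \<sigma> \<longrightarrow> vdvd P (\<tau> c)" by blast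
    have t: "\<tau> \<in> Sig" using insert by blast
    show ?case
    proof (cases "pid \<tau> = pid \<sigma>")
      case True
      thus ?thesis using c by blast
    next
      case False
      obtain b where b: "b \<in> AI" "1 - b \<in> pid \<sigma>" "b \<in> pid \<tau>" using crt_pair[OF s t False] by blast
      \<comment> \<open>Taking a power turns membership in the prime into divisibility by p, the
        form needed where terms of order below the ramification index are compared.\<close>
      obtain n where n: "vdvd P (\<tau> b ^ n)" using M_nilpotent[OF pid_M[OF b(3)]] by blast
      have bn: "b ^ n \<in> AI" by (rule O_power[OF b(1)])
      have "1 - b ^ k \<in> pid \<sigma>" for k
      proof (induction k)
        case 0 show ?case using pid_diff[OF s p_in_pid[OF s] p_in_pid[OF s]] by simp
      next
        case (Suc k) show ?case using pid_one_minus_mult[OF s b(2) Suc O_power[OF b(1)]] by simp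
      qed
      hence "1 - c * b ^ n \<in> pid \<sigma>" using pid_one_minus_mult[OF s c(2)] bn by blast
      moreover have "vdvd P (\<rho> (c * b ^ n))" if "\<rho> \<in> insert \<tau> T" "pid \<rho> \<noteq> pid \<sigma>" for \<rho>
      proof (cases "\<rho> = \<tau>")
        case True
        have "vdvd P (\<tau> c * \<tau> b ^ n)" using vdvd_mult_left[OF n emb_O[OF t c(1)]] .
        thus ?thesis using True by (simp add: embedding_simps[OF t])
      next
        case False
        hence r: "\<rho> \<in> T" "\<rho> \<in> Sig" using that insert.prems by auto
        have "vdvd P (\<rho> c * \<rho> (b ^ n))" using c(3) r that(2) emb_O[OF r(2) bn] by (intro vdvd_mult_right) auto
        thus ?thesis by (simp add: embedding_simps[OF r(2)])
      qed
      ultimately show ?thesis using O_closed(4)[OF c(1) bn] by blast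
    qed
  qed
  from this[OF finite_Sig subset_refl] show ?thesis using that by blast
qed

text \<open>A denominator outside the prime is replaced by the power that inverts it in the residue
  field.\<close>

lemma residue_lift:
  assumes s: "\<sigma> \<in> Sig" and x: "\<sigma> x \<in> V" shows "\<exists>y\<in>AI. \<sigma> (x - y) \<in> M"
proof -
  obtain a b where ab: "a \<in> AI" "b \<in> AI" "\<sigma> b \<notin> M" "x * b = a" by (rule localization[OF s x])
  have "b \<notin> pid \<sigma>" using ab by (simp add: pid_def)
  then obtain n where n: "n \<ge> 1" "1 - b ^ n \<in> pid \<sigma>" by (rule pid_power_one[OF s ab(2)])
  have "x - a * b ^ (n - 1) = x * (1 - b ^ n)"
    using n(1) ab(4) by (cases n) (auto simp: algebra_simps)
  hence "\<sigma> (x - a * b ^ (n - 1)) = \<sigma> x * \<sigma> (1 - b ^ n)" by (simp add: embedding_simps(4)[OF s])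
  also have "\<dots> \<in> M" by (rule M_mult(2)[OF pid_M[OF n(2)] x])
  finally show ?thesis using O_closed(4)[OF ab(1) O_power[OF ab(2)]] by blast
qed

text \<open>Periodicity of the p^i-th powers and injectivity of Frobenius make \<open>y\<close>
  congruent to its p^m-th power for some positive m. Iterating n times, \<open>y\<close> is
  congruent to its p^(m n)-th power, which is also a p^n-th power.\<close>

lemma frobenius_surj:
  assumes s: "\<sigma> \<in> Sig" and y: "y \<in> AI" shows "\<exists>z\<in>AI. y - z ^ (p ^ n) \<in> pid \<sigma>"
proof -
  obtain i j u where ij: "i < j" "u \<in> AI" "y ^ (p ^ i) - y ^ (p ^ j) = of_nat p * u"
    using periodic_mod_p[of "\<lambda>i. y ^ (p ^ i)"] O_power[OF y] by blast
  define m where "m = j - i"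
  have m: "m \<ge> 1" using ij by (simp add: m_def)
  have yV: "\<sigma> y ^ k \<in> V" for k using emb_O[OF s y] V_closed(7) by blast
  have "\<sigma> (y ^ (p ^ i) - y ^ (p ^ j)) \<in> M" using pid_M[OF pid_p[OF ij(2) s]] ij(3) by simp
  moreover have "p ^ j = p ^ m * p ^ i" using ij(1) by (simp add: m_def power_add[symmetric])
  ultimately have "\<sigma> y ^ (p ^ i) - (\<sigma> y ^ (p ^ m)) ^ (p ^ i) \<in> M"
    by (simp add: embedding_simps[OF s] power_mult[symmetric])
  hence base: "\<sigma> y - \<sigma> y ^ (p ^ m) \<in> M" by (rule frobenius_inj_M[OF emb_O[OF s y] yV])
  have all: "\<sigma> y - \<sigma> y ^ (p ^ (m * k)) \<in> M" for k
  proof (induction k)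
    case (Suc k)
    have "\<sigma> y ^ (p ^ m) - (\<sigma> y ^ (p ^ (m * k))) ^ (p ^ m) \<in> M"
      by (rule power_diff_M[OF emb_O[OF s y] yV Suc])
    from M_add[OF base this] show ?case by (simp add: power_mult[symmetric] power_add mult.commute)
  qed (simp add: zero_in_M)
  have "p ^ (m * n) = p ^ (m * n - n) * p ^ n" using m by (simp add: power_add[symmetric])
  hence "\<sigma> (y - (y ^ (p ^ (m * n - n))) ^ (p ^ n)) \<in> M"
    using all[of n] by (simp add: embedding_simps[OF s] power_mult[symmetric])
  moreover have "y - (y ^ (p ^ (m * n - n))) ^ (p ^ n) \<in> AI" by (intro O_closed(6)[OF y] O_power y)
  ultimately show ?thesis using O_power[OF y] by (intro bexI[of _ "y ^ (p ^ (m * n - n))"]) (auto simp: pid_def)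
qed

text \<open>\<open>w\<close> is a uniformizer at \<open>Q\<close>, \<open>e\<close> the ramification index, and \<open>Y\<close> lifts a basis of the residue field.\<close>

definition pdata :: "'k set \<Rightarrow> 'k \<Rightarrow> nat \<Rightarrow> 'k set \<Rightarrow> bool" where
  "pdata Q w e Y \<longleftrightarrow> w \<in> AI \<and> w \<noteq> 0 \<and> e \<ge> 1 \<and> finite Y \<and> Y \<subseteq> AI \<and>
     (\<forall>c. (\<Sum>y\<in>Y. of_int (c y) * y) \<in> Q \<longrightarrow> (\<forall>y\<in>Y. int p dvd c y)) \<and>
     (\<forall>x\<in>AI. \<exists>c. x - (\<Sum>y\<in>Y. of_int (c y) * y) \<in> Q) \<and>
     (\<forall>\<sigma>\<in>Sig. pid \<sigma> = Q \<longrightarrow> \<sigma> w \<in> M \<and> (\<forall>y. \<sigma> y \<in> M \<longrightarrow> \<sigma> (y / w) \<in> V) \<and>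
        \<sigma> (of_nat p / w ^ e) \<in> V \<and> \<sigma> (of_nat p / w ^ e) \<notin> M)"

lemma pdata_exists:
  assumes s: "\<sigma> \<in> Sig" shows "\<exists>w e Y. pdata (pid \<sigma>) w e Y"
proof -
  obtain w e where w: "w \<in> AI" "w \<noteq> 0" "\<sigma> w \<in> M" "\<And>y. \<sigma> y \<in> M \<Longrightarrow> \<sigma> (y / w) \<in> V"
    "e \<ge> 1" "\<sigma> (of_nat p / w ^ e) \<in> V" "\<sigma> (of_nat p / w ^ e) \<notin> M"
    using uniformizer_exists[OF s] by blast
  obtain Y where Y: "finite Y" "Y \<subseteq> AI" 
    "\<And>c y. (\<Sum>y\<in>Y. of_int (c y) * y) \<in> pid \<sigma> \<Longrightarrow> y \<in> Y \<Longrightarrow> int p dvd c y"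
    "\<And>x. x \<in> AI \<Longrightarrow> \<exists>c. x - (\<Sum>y\<in>Y. of_int (c y) * y) \<in> pid \<sigma>"
    by (rule residue_basis[of "pid \<sigma>", OF pid_add[OF s] pid_mult[OF s] p_in_pid[OF s]]) blast+
  have "\<tau> w \<in> M \<and> (\<forall>y. \<tau> y \<in> M \<longrightarrow> \<tau> (y / w) \<in> V) \<and> \<tau> (of_nat p / w ^ e) \<in> V \<and> \<tau> (of_nat p / w ^ e) \<notin> M"
    if t: "\<tau> \<in> Sig" "pid \<tau> = pid \<sigma>" for \<tau>
    using w pid_eq_V[OF s t(1) t(2)[symmetric]] pid_eq_M[OF s t(1) t(2)[symmetric]] pid_eq_M[OF t(1) s t(2)] by blast
  thus ?thesis unfolding pdata_def using w(1,2,5) Y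
    by (intro exI[of _ w] exI[of _ e] exI[of _ Y]) simp
qed

definition Primes :: "'k set set" where "Primes = pid ` Sig"

text \<open>The choice is attached to the prime, not to an embedding, so that all embeddings above
  \<open>Q\<close> share one uniformizer and one residue basis.\<close>

definition pdat :: "'k set \<Rightarrow> 'k \<times> nat \<times> 'k set" where
  "pdat Q = (SOME (w, e, Y). pdata Q w e Y)"

definition ww :: "'k set \<Rightarrow> 'k" where "ww Q = fst (pdat Q)"
definition ee :: "'k set \<Rightarrow> nat" where "ee Q = fst (snd (pdat Q))"
definition YY :: "'k set \<Rightarrow> 'k set" where "YY Q = snd (snd (pdat Q))"
definition ff :: "'k set \<Rightarrow> nat" where "ff Q = card (YY Q)"

lemma finite_Primes: "finite Primes"
  using finite_Sig by (simp add: Primes_def)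

lemma pdata_chosen: assumes "\<sigma> \<in> Sig" shows "pdata (pid \<sigma>) (ww (pid \<sigma>)) (ee (pid \<sigma>)) (YY (pid \<sigma>))"
proof -
  obtain w e Y where "pdata (pid \<sigma>) w e Y" using pdata_exists[OF assms] by blast
  hence "case (w, e, Y) of (w, e, Y) \<Rightarrow> pdata (pid \<sigma>) w e Y" by simp
  from someI[of "\<lambda>(w, e, Y). pdata (pid \<sigma>) w e Y", OF this]
  show ?thesis unfolding ww_def ee_def YY_def pdat_def by (simp add: case_prod_beta)
qed

context
  fixes \<sigma> assumes s: "\<sigma> \<in> Sig"
begin

lemma uniformizer:
  shows "ww (pid \<sigma>) \<in> AI" "ww (pid \<sigma>) \<noteq> 0" "ee (pid \<sigma>) \<ge> 1" "\<sigma> (ww (pid \<sigma>)) \<in> M"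
    "\<sigma> y \<in> M \<Longrightarrow> \<sigma> (y / ww (pid \<sigma>)) \<in> V" "\<sigma> (of_nat p / ww (pid \<sigma>) ^ ee (pid \<sigma>)) \<in> V"
    "\<sigma> (of_nat p / ww (pid \<sigma>) ^ ee (pid \<sigma>)) \<notin> M"
  using pdata_chosen[OF s] s unfolding pdata_def by blast+

lemma residues:
  shows "finite (YY (pid \<sigma>))" "YY (pid \<sigma>) \<subseteq> AI"
    "(\<Sum>y\<in>YY (pid \<sigma>). of_int (c y) * y) \<in> pid \<sigma> \<Longrightarrow> y \<in> YY (pid \<sigma>) \<Longrightarrow> int p dvd c y"
    "x \<in> AI \<Longrightarrow> \<exists>c. x - (\<Sum>y\<in>YY (pid \<sigma>). of_int (c y) * y) \<in> pid \<sigma>"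
  using pdata_chosen[OF s] unfolding pdata_def by blast+

lemma uniformizer_vdvd: "vdvd (\<sigma> (ww (pid \<sigma>)) ^ ee (pid \<sigma>)) P" "vdvd P (\<sigma> (ww (pid \<sigma>)) ^ ee (pid \<sigma>))"
proof -
  let ?w = "\<sigma> (ww (pid \<sigma>))"
  have w0: "?w \<noteq> 0" using uniformizer(2) by (simp add: embedding_simps[OF s])
  have u: "P / ?w ^ ee (pid \<sigma>) \<in> V" "P / ?w ^ ee (pid \<sigma>) \<notin> M"
    using uniformizer(6,7) by (simp_all add: embedding_simps[OF s])
  show "vdvd (?w ^ ee (pid \<sigma>)) P" using u(1) w0 by (simp add: vdvd_iff)
  show "vdvd P (?w ^ ee (pid \<sigma>))" using unit_inverse(1)[OF u] P_nonzero by (simp add: vdvd_iff)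
qed

lemma digit_step:
  assumes x: "\<sigma> x \<in> V" and D: "\<And>y. y \<in> AI \<Longrightarrow> \<exists>z. D z \<and> z \<in> AI \<and> y - z \<in> pid \<sigma>"
  shows "\<exists>z. D z \<and> z \<in> AI \<and> \<sigma> ((x - z) / ww (pid \<sigma>)) \<in> V"
proof -
  obtain y where y: "y \<in> AI" "\<sigma> (x - y) \<in> M" using residue_lift[OF s x] by blast
  obtain z where z: "D z" "z \<in> AI" "y - z \<in> pid \<sigma>" using D[OF y(1)] by blast
  have "\<sigma> (x - z) = \<sigma> (x - y) + \<sigma> (y - z)" by (simp add: embedding_simps[OF s])
  also have "\<dots> \<in> M" by (rule M_add[OF y(2) pid_M[OF z(3)]])
  finally show ?thesis using z uniformizer(5) by blast
qed

text \<open>The digits may be restricted by any property \<open>D\<close> that is met in every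
  residue class. It is used with integer combinations of the residue basis, with such combinations
  with coefficients below p, and with p^N-th powers. The remainder \<open>r\<close> is only claimed
  to be integral at \<open>\<sigma>\<close>.\<close>

lemma digit_expansion:
  assumes x: "\<sigma> x \<in> V" and D: "\<And>y. y \<in> AI \<Longrightarrow> \<exists>z. D z \<and> z \<in> AI \<and> y - z \<in> pid \<sigma>"
  shows "\<exists>z r. (\<forall>j. D (z j) \<and> z j \<in> AI) \<and> \<sigma> r \<in> V \<and>
    x = (\<Sum>j<n. z j * ww (pid \<sigma>) ^ j) + ww (pid \<sigma>) ^ n * r"
proof (induction n)
  case 0
  obtain z0 where "D z0" "z0 \<in> AI" using D[OF O_closed(1)] by blast
  thus ?case using x by (intro exI[of _ "\<lambda>_. z0"] exI[of _ x]) auto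
next
  case (Suc n)
  let ?w = "ww (pid \<sigma>)"
  obtain z r where zr: "\<forall>j. D (z j) \<and> z j \<in> AI" "\<sigma> r \<in> V" "x = (\<Sum>j<n. z j * ?w ^ j) + ?w ^ n * r"
    using Suc by blast
  obtain u where u: "D u" "u \<in> AI" "\<sigma> ((r - u) / ?w) \<in> V" using digit_step[OF zr(2) D] by blast
  define z' where "z' = z(n := u)"
  have "(\<Sum>j<n. z' j * ?w ^ j) = (\<Sum>j<n. z j * ?w ^ j)" by (intro sum.cong) (auto simp: z'_def)
  hence "x = (\<Sum>j<Suc n. z' j * ?w ^ j) + ?w ^ Suc n * ((r - u) / ?w)"
    using zr(3) uniformizer(2) by (simp add: z'_def field_simps)
  moreover have "\<forall>j. D (z' j) \<and> z' j \<in> AI" using zr(1) u by (simp add: z'_def)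
  ultimately show ?case using u(3) by blast
qed

end

end

context valuation
begin

lemma not_all_P_powers_vdvd: assumes "algebraic z" "z \<noteq> 0" shows "\<exists>n. \<not> vdvd (P ^ n) z"
proof -
  obtain n where n: "vdvd z (P ^ n)" using algebraic_dvd_P_power[OF assms] by blast
  have "\<not> vdvd (P ^ Suc n) z"
  proof
    assume "vdvd (P ^ Suc n) z"
    hence "vdvd (P ^ Suc n) (P ^ n)" using n vdvd_trans by blast
    then obtain v where v: "v \<in> V" "P ^ n = P ^ Suc n * v" by (auto simp: vdvd_def)
    hence "P * v = 1" using P_nonzero by simp
    hence "inverse P = v" by (rule inverse_unique)
    thus False using v(1) p_inv by simp
  qed
  thus ?thesis by blast
qed

lemma prod_notin_M:
  assumes "finite T" "\<And>t. t \<in> T \<Longrightarrow> f t \<in> V" "\<And>t. t \<in> T \<Longrightarrow> f t \<notin> M"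
  shows "(\<Prod>t\<in>T. f t) \<notin> M"
  using assms
proof (induction T rule: finite_induct)
  case (insert t T)
  have "(\<Prod>t\<in>T. f t) \<in> V" using insert by (intro V_closed(9)) auto
  thus ?case using insert M_prime[of "f t" "\<Prod>t\<in>T. f t"] by auto
qed (simp add: one_notin_M)

end

section \<open>Counting embeddings and classes above a prime\<close>

context local_fld
begin

definition above :: "'k set \<Rightarrow> ('k \<Rightarrow> rat alg_closure) set" where
  "above Q = {\<sigma> \<in> Sig. pid \<sigma> = Q}"

definition congr :: "('k \<Rightarrow> rat alg_closure) \<Rightarrow> ('k \<Rightarrow> rat alg_closure) \<Rightarrow> bool" where
  "congr \<sigma> \<tau> \<longleftrightarrow> (\<forall>x\<in>AI. \<sigma> x - \<tau> x \<in> M)"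

definition Cl :: "('k \<Rightarrow> rat alg_closure) \<Rightarrow> ('k \<Rightarrow> rat alg_closure) set" where
  "Cl \<sigma> = {\<tau> \<in> Sig. congr \<sigma> \<tau>}"

lemma congr_refl: "congr \<sigma> \<sigma>" and congr_sym: "congr \<sigma> \<tau> \<Longrightarrow> congr \<tau> \<sigma>"
  and congr_trans: "congr \<sigma> \<tau> \<Longrightarrow> congr \<tau> \<rho> \<Longrightarrow> congr \<sigma> \<rho>"
proof -
  show "congr \<sigma> \<sigma>" by (simp add: congr_def zero_in_M)
  show "congr \<sigma> \<tau> \<Longrightarrow> congr \<tau> \<sigma>" unfolding congr_def using M_uminus by (metis minus_diff_eq)
  show "congr \<sigma> \<tau> \<Longrightarrow> congr \<tau> \<rho> \<Longrightarrow> congr \<sigma> \<rho>"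
    unfolding congr_def
  proof
    fix x assume h: "\<forall>x\<in>AI. \<sigma> x - \<tau> x \<in> M" "\<forall>x\<in>AI. \<tau> x - \<rho> x \<in> M" "x \<in> AI"
    have "(\<sigma> x - \<tau> x) + (\<tau> x - \<rho> x) \<in> M" using h by (intro M_add) blast+
    thus "\<sigma> x - \<rho> x \<in> M" by simp
  qed
qed

lemma Cl_eq_iff: "\<tau> \<in> Sig \<Longrightarrow> Cl \<sigma> = Cl \<tau> \<longleftrightarrow> congr \<sigma> \<tau>"
proof
  assume t: "\<tau> \<in> Sig"
  show "congr \<sigma> \<tau>" if "Cl \<sigma> = Cl \<tau>" using that t congr_refl[of \<tau>] by (auto simp: Cl_def)
  show "Cl \<sigma> = Cl \<tau>" if "congr \<sigma> \<tau>"
    unfolding Cl_def using that congr_sym[OF that] congr_trans by blast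
qed

lemma congr_pid: assumes "congr \<sigma> \<tau>" shows "pid \<sigma> = pid \<tau>"
proof -
  have "x \<in> pid t" if c: "congr s t" "x \<in> pid s" for s t x
  proof -
    have "s x \<in> M" "s x - t x \<in> M" "x \<in> AI" using c by (auto simp: pid_def congr_def)
    hence "t x \<in> M" "x \<in> AI" using M_diff[of "s x" "s x - t x"] by simp_all
    thus ?thesis by (simp add: pid_def)
  qed
  thus ?thesis using assms congr_sym by blast
qed

lemma above_finite: "finite (above Q)" and above_Sig: "above Q \<subseteq> Sig"
  using finite_Sig by (auto simp: above_def)

lemma linear_combination:
  fixes l :: "('k \<Rightarrow> rat alg_closure) \<Rightarrow> rat alg_closure"
  assumes "J \<subseteq> Sig" defines "\<Lambda> \<equiv> \<lambda>x. \<Sum>j\<in>J. l j * j x"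
  shows "\<Lambda> (x + y) = \<Lambda> x + \<Lambda> y" "\<Lambda> (of_int c * x) = of_int c * \<Lambda> x" "\<Lambda> (\<Sum>i\<in>I. f i) = (\<Sum>i\<in>I. \<Lambda> (f i))"
proof -
  have e: "j (x + y) = j x + j y" "j (of_int c * x) = of_int c * j x" "j 0 = 0" if "j \<in> J" for j x y c
    using that assms(1) by (auto simp: embedding_simps)
  show a: "\<Lambda> (x + y) = \<Lambda> x + \<Lambda> y" for x y
    unfolding \<Lambda>_def sum.distrib[symmetric] by (intro sum.cong) (auto simp: e distrib_left)
  show "\<Lambda> (of_int c * x) = of_int c * \<Lambda> x"
    unfolding \<Lambda>_def sum_distrib_left by (intro sum.cong) (auto simp: e)
  have "\<Lambda> 0 = 0" unfolding \<Lambda>_def by (simp add: e)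
  thus "\<Lambda> (\<Sum>i\<in>I. f i) = (\<Sum>i\<in>I. \<Lambda> (f i))"
    by (induction I rule: infinite_finite_induct) (auto simp: a)
qed

text \<open>A separating element becomes integral at \<open>\<rho>\<close> after multiplication by a
  power of p.\<close>

lemma distinguish:
  assumes s: "\<sigma> \<in> Sig" and t: "\<tau> \<in> Sig" and ne: "\<sigma> \<noteq> \<tau>" and r: "\<rho> \<in> Sig"
  shows "\<exists>y. \<rho> y \<in> V \<and> \<sigma> y \<noteq> \<tau> y"
proof -
  obtain y where y: "\<sigma> y \<noteq> \<tau> y" using ne by blast
  hence "y \<noteq> 0" using s t by (auto simp: embedding_simps)
  hence r0: "\<rho> y \<noteq> 0" using r by (simp add: embedding_simps)
  obtain n where "vdvd (inverse (\<rho> y)) (P ^ n)"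
    using algebraic_dvd_P_power[OF algebraic_qbar, of "inverse (\<rho> y)"] r0 by auto
  hence "\<rho> (of_nat p ^ n * y) \<in> V" using r0 by (simp add: vdvd_iff embedding_simps[OF r] field_simps)
  moreover have "\<sigma> (of_nat p ^ n * y) \<noteq> \<tau> (of_nat p ^ n * y)"
    using y P_nonzero by (simp add: embedding_simps[OF s] embedding_simps[OF t])
  ultimately show ?thesis by blast
qed

text \<open>A primitive relation that kills all \<open>u w\<^sup>b\<close> with \<open>u\<close> in the residue basis and \<open>b < e\<close> is divisible by every
  power of \<open>p\<close> on the local ring, which contradicts the independence of the embeddings.\<close>

lemma card_above_le:
  assumes s: "\<sigma> \<in> Sig" shows "card (above (pid \<sigma>)) \<le> ee (pid \<sigma>) * ff (pid \<sigma>)"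
proof (rule ccontr)
  define Q w e Y J where "Q = pid \<sigma>" and "w = ww Q" and "e = ee Q" and "Y = YY Q" and "J = above Q"
  note uni = uniformizer[OF s, folded Q_def, folded w_def e_def]
  note res = residues[OF s, folded Q_def, folded Y_def]
  assume "\<not> card (above (pid \<sigma>)) \<le> ee (pid \<sigma>) * ff (pid \<sigma>)"
  hence c: "card (Y \<times> {..<e}) < card J"
    by (simp add: Y_def e_def J_def Q_def ff_def card_cartesian_product mult.commute)
  have fJ: "finite J" "J \<subseteq> Sig" unfolding J_def using above_finite above_Sig by auto
  have fR: "finite (Y \<times> {..<e})" using res(1) by simp
  obtain l i where i: "i \<in> J" "l i = 1" and lV: "\<And>j. j \<in> J \<Longrightarrow> l j \<in> V"
    and l: "\<And>r. r \<in> Y \<times> {..<e} \<Longrightarrow> (\<Sum>j\<in>J. l j * (case r of (u, b) \<Rightarrow> j (u * w ^ b))) = 0"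
    by (rule primitive_solution[OF fR fJ(1) c, of "\<lambda>r j. case r of (u, b) \<Rightarrow> j (u * w ^ b)"]) blast
  define \<Lambda> where "\<Lambda> x = (\<Sum>j\<in>J. l j * j x)" for x
  note lin = linear_combination[OF fJ(2), of l, folded \<Lambda>_def]
  have jV: "j x \<in> V" if "j \<in> J" "\<sigma> x \<in> V" for j x
    using pid_eq_V[OF s, of j x] that by (auto simp: J_def above_def Q_def)
  have zero: "\<Lambda> (u * w ^ b) = 0" if "u \<in> Y" "b < e" for u b
    using l[of "(u, b)"] that by (simp add: \<Lambda>_def)
  have small: "vdvd (P ^ n) (\<Lambda> x)" if "\<sigma> x \<in> V" for n x
    using that
  proof (induction n arbitrary: x)
    case 0
    have "\<Lambda> x \<in> V" unfolding \<Lambda>_def using lV jV[OF _ 0] by (intro V_closed(8) V_closed(4)) auto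
    thus ?case by (simp add: vdvd_1)
  next
    case (Suc n)
    define D where "D z \<longleftrightarrow> (\<exists>c. z = (\<Sum>y\<in>Y. of_int (c y) * y))" for z
    have Dex: "\<exists>z. D z \<and> z \<in> AI \<and> y - z \<in> pid \<sigma>" if yA: "y \<in> AI" for y
    proof -
      obtain c where "y - (\<Sum>y\<in>Y. of_int (c y) * y) \<in> Q" using res(4)[OF yA] by blast
      moreover have "(\<Sum>y\<in>Y. of_int (c y) * y) \<in> AI" by (rule O_sum) (use O_closed(4,7) res(2) in blast)
      ultimately show ?thesis unfolding D_def Q_def by blast
    qed
    have "\<exists>z r. (\<forall>j. D (z j) \<and> z j \<in> AI) \<and> \<sigma> r \<in> V \<and> x = (\<Sum>j<e. z j * w ^ j) + w ^ e * r"
      unfolding w_def Q_def by (rule digit_expansion[OF s Suc.prems Dex])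
    then obtain z r
      where zA: "\<forall>j. D (z j) \<and> z j \<in> AI" and r: "\<sigma> r \<in> V" and x: "x = (\<Sum>j<e. z j * w ^ j) + w ^ e * r"
      by (elim exE conjE) (rule that)
    have z: "D (z j)" for j using zA by blast
    have z0: "\<Lambda> (z b * w ^ b) = 0" if "b < e" for b
    proof -
      obtain c where c: "z b = (\<Sum>y\<in>Y. of_int (c y) * y)" using z[of b] by (auto simp: D_def)
      have "z b * w ^ b = (\<Sum>y\<in>Y. of_int (c y) * (y * w ^ b))" unfolding c sum_distrib_right by (simp add: mult.assoc)
      hence "\<Lambda> (z b * w ^ b) = (\<Sum>y\<in>Y. of_int (c y) * \<Lambda> (y * w ^ b))" by (simp only: lin)
      thus ?thesis using zero that by simp
    qed
    have p0: "(of_nat p :: 'k) \<noteq> 0" using prime_gt_0_nat[OF prime_p] by simp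
    \<comment> \<open>At \<open>\<sigma>\<close> the elements p and w^e have the same value, so
      \<open>t\<close> is again integral there and the induction hypothesis applies to it.\<close>
    define t where "t = w ^ e / of_nat p * r"
    have "\<sigma> w ^ e / P \<in> V" using uniformizer_vdvd(2)[OF s] P_nonzero by (simp add: vdvd_iff w_def e_def Q_def)
    from V_closed(4)[OF this r] have "\<sigma> t \<in> V" by (simp add: t_def embedding_simps[OF s])
    hence t: "vdvd (P ^ n) (\<Lambda> t)" by (rule Suc.IH)
    have "w ^ e * r = of_int (int p) * t" using p0 by (simp add: t_def)
    hence "\<Lambda> (w ^ e * r) = of_int (int p) * \<Lambda> t" by (simp only: lin)
    hence "\<Lambda> x = P * \<Lambda> t" unfolding x by (simp add: lin z0)
    thus ?case using vdvd_mult[OF vdvd_refl[of P] t] by simp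
  qed
  define T where "T = J - {i}"
  have iS: "i \<in> Sig" using i fJ by blast
  have "\<exists>y. \<sigma> y \<in> V \<and> i y \<noteq> t y" if "t \<in> T" for t
    using distinguish[OF iS _ _ s, of t] that fJ(2) by (auto simp: T_def)
  then obtain y where y: "\<And>t. t \<in> T \<Longrightarrow> \<sigma> (y t) \<in> V" "\<And>t. t \<in> T \<Longrightarrow> i (y t) \<noteq> t (y t)" by metis
  define D where "D = (\<Prod>t\<in>T. i (y t) - t (y t))"
  have "vdvd (P ^ n) D" for n
  proof -
    have "1 * (\<Prod>t\<in>T. i (y t) - t (y t)) * i 1 \<in> {z. vdvd (P ^ n) z}"
    proof (rule independence_of_homs[where A = "{x. \<sigma> x \<in> V}" and l = l])
      show "finite T" using fJ by (simp add: T_def)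
      show "x * y \<in> {x. \<sigma> x \<in> V}" if "x \<in> {x. \<sigma> x \<in> V}" "y \<in> {x. \<sigma> x \<in> V}" for x y
        using that V_closed(4) by (simp add: embedding_simps[OF s])
      show "y t \<in> {x. \<sigma> x \<in> V}" if "t \<in> T" for t using y(1)[OF that] by simp
      show "t (x * y) = t x * t y" if "t \<in> insert i T" for t x y
        using that fJ(2) iS by (auto simp: T_def embedding_simps)
      show "t x \<in> V" if "t \<in> T" "x \<in> {x. \<sigma> x \<in> V}" for t x using jV[of t x] that by (auto simp: T_def)
      show "x - y \<in> {z. vdvd (P ^ n) z}" if "x \<in> {z. vdvd (P ^ n) z}" "y \<in> {z. vdvd (P ^ n) z}" for x y
        using that vdvd_diff by simp
      show "v * x \<in> {z. vdvd (P ^ n) z}" if "x \<in> {z. vdvd (P ^ n) z}" "v \<in> V" for x v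
        using that vdvd_mult_left by simp
      show "1 \<in> {x. \<sigma> x \<in> V}" using V_closed(1) by (simp add: embedding_simps[OF s])
      fix x assume "x \<in> {x. \<sigma> x \<in> V}"
      hence "vdvd (P ^ n) (\<Lambda> x)" using small by simp
      moreover have "\<Lambda> x = 1 * i x + (\<Sum>t\<in>T. l t * t x)"
        unfolding \<Lambda>_def T_def using fJ(1) i by (simp add: sum.remove)
      ultimately show "1 * i x + (\<Sum>t\<in>T. l t * t x) \<in> {z. vdvd (P ^ n) z}" by simp
    qed
    thus ?thesis by (simp add: D_def embedding_simps[OF iS])
  qed
  moreover have "D \<noteq> 0" unfolding D_def using fJ y(2) by (simp add: T_def)
  ultimately show False using not_all_P_powers_vdvd[OF algebraic_qbar] by blast
qed

text \<open>The same argument modulo the maximal ideal: only the residue basis has to be killed.\<close>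

lemma card_classes_le:
  assumes s: "\<sigma> \<in> Sig" shows "card (Cl ` above (pid \<sigma>)) \<le> ff (pid \<sigma>)"
proof (rule ccontr)
  define Q Y where "Q = pid \<sigma>" and "Y = YY Q"
  note res = residues[OF s, folded Q_def, folded Y_def]
  \<comment> \<open>One representative per class: \<open>\<Lambda>\<close> is controlled only modulo
    the maximal ideal, where congruent embeddings coincide.\<close>
  obtain J where J: "J \<subseteq> above Q" "inj_on Cl J" "Cl ` J = Cl ` above Q"
    by (metis subset_image_inj subset_refl)
  have fJ: "finite J" "J \<subseteq> Sig" using J(1) above_finite above_Sig finite_subset by blast+
  assume "\<not> card (Cl ` above (pid \<sigma>)) \<le> ff (pid \<sigma>)"
  hence c: "card Y < card J" using card_image[OF J(2)] J(3) by (simp add: Y_def Q_def ff_def)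
  obtain l i where i: "i \<in> J" "l i = 1" and lV: "\<And>j. j \<in> J \<Longrightarrow> l j \<in> V"
    and l: "\<And>r. r \<in> Y \<Longrightarrow> (\<Sum>j\<in>J. l j * j r) = 0"
    by (rule primitive_solution[OF res(1) fJ(1) c, of "\<lambda>r j. j r"]) blast
  define \<Lambda> where "\<Lambda> x = (\<Sum>j\<in>J. l j * j x)" for x
  note lin = linear_combination[OF fJ(2), of l, folded \<Lambda>_def]
  have small: "\<Lambda> x \<in> M" if x: "x \<in> AI" for x
  proof -
    obtain c where c: "x - (\<Sum>y\<in>Y. of_int (c y) * y) \<in> Q" using res(4)[OF x] by blast
    define x' where "x' = x - (\<Sum>y\<in>Y. of_int (c y) * y)"
    have "x = (\<Sum>y\<in>Y. of_int (c y) * y) + x'" by (simp add: x'_def)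
    hence "\<Lambda> x = (\<Sum>y\<in>Y. of_int (c y) * \<Lambda> y) + \<Lambda> x'" by (simp only: lin)
    also have "\<dots> = \<Lambda> x'" using l by (simp add: \<Lambda>_def)
    also have "\<dots> \<in> M" unfolding \<Lambda>_def
    proof (intro M_sum M_mult(2) lV)
      fix j assume "j \<in> J"
      hence "pid j = Q" using J(1) by (auto simp: above_def)
      thus "j x' \<in> M" using c by (auto simp: pid_def x'_def)
    qed
    finally show ?thesis .
  qed
  define T where "T = J - {i}"
  have iS: "i \<in> Sig" using i fJ by blast
  have "\<exists>y\<in>AI. i y - t y \<notin> M" if t: "t \<in> T" for t
  proof -
    have "Cl i \<noteq> Cl t" using J(2) i t by (auto simp: inj_on_def T_def)
    hence "\<not> congr i t" using Cl_eq_iff[of t i] t fJ(2) by (auto simp: T_def)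
    thus ?thesis by (auto simp: congr_def)
  qed
  then obtain y where y: "\<And>t. t \<in> T \<Longrightarrow> y t \<in> AI" "\<And>t. t \<in> T \<Longrightarrow> i (y t) - t (y t) \<notin> M" by metis
  have "1 * (\<Prod>t\<in>T. i (y t) - t (y t)) * i 1 \<in> M"
  proof (rule independence_of_homs[where A = AI and l = l])
    show "finite T" using fJ by (simp add: T_def)
    show "x * y \<in> AI" if "x \<in> AI" "y \<in> AI" for x y using that by (rule O_closed(4))
    show "y t \<in> AI" if "t \<in> T" for t using y(1)[OF that] .
    show "t (x * y) = t x * t y" if "t \<in> insert i T" for t x y
      using that fJ(2) iS by (auto simp: T_def embedding_simps)
    show "t x \<in> V" if "t \<in> T" "x \<in> AI" for t x using emb_O[of t x] that fJ(2) by (auto simp: T_def)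
    show "1 \<in> AI" by (rule O_closed(2))
    fix x assume "x \<in> AI"
    hence "\<Lambda> x \<in> M" using small by simp
    moreover have "\<Lambda> x = 1 * i x + (\<Sum>t\<in>T. l t * t x)"
      unfolding \<Lambda>_def T_def using fJ(1) i by (simp add: sum.remove)
    ultimately show "1 * i x + (\<Sum>t\<in>T. l t * t x) \<in> M" by simp
  qed (use M_diff M_mult in auto)
  moreover have "(\<Prod>t\<in>T. i (y t) - t (y t)) \<notin> M"
  proof (rule prod_notin_M)
    show "finite T" using fJ by (simp add: T_def)
    fix t assume t: "t \<in> T"
    hence "t \<in> Sig" using fJ(2) by (auto simp: T_def)
    thus "i (y t) - t (y t) \<in> V" using V_closed(3) emb_O[OF iS y(1)[OF t]] emb_O[OF _ y(1)[OF t]] by blast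
  qed (use y in auto)
  ultimately show False by (simp add: embedding_simps[OF iS])
qed

text \<open>The elements \<open>c\<^sub>Q u w\<^sub>Q\<^sup>b\<close>, with \<open>c\<^sub>Q\<close> congruent to \<open>1\<close> modulo \<open>Q\<close> and divisible by \<open>p\<close> at the
  other primes, are linearly independent over the rationals.\<close>

lemma sum_ef_le: "(\<Sum>Q\<in>Primes. ee Q * ff Q) \<le> d"
proof -
  define I where "I = (SIGMA Q:Primes. YY Q \<times> {..<ee Q})"
  have rep: "\<exists>\<sigma>. \<sigma> \<in> Sig \<and> pid \<sigma> = Q" if "Q \<in> Primes" for Q using that by (auto simp: Primes_def)
  have fY: "finite (YY Q)" if Q: "Q \<in> Primes" for Q using rep[OF Q] residues(1) by blast
  have fI: "finite I" unfolding I_def using finite_Primes fY by (intro finite_SigmaI) auto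
  have "\<exists>c. c \<in> AI \<and> 1 - c \<in> Q \<and> (\<forall>\<tau>\<in>Sig. pid \<tau> \<noteq> Q \<longrightarrow> vdvd P (\<tau> c))" if Q: "Q \<in> Primes" for Q
    using rep[OF Q] crt by metis
  then obtain cc where cc: "\<And>Q. Q \<in> Primes \<Longrightarrow> cc Q \<in> AI" "\<And>Q. Q \<in> Primes \<Longrightarrow> 1 - cc Q \<in> Q"
    "\<And>Q \<tau>. Q \<in> Primes \<Longrightarrow> \<tau> \<in> Sig \<Longrightarrow> pid \<tau> \<noteq> Q \<Longrightarrow> vdvd P (\<tau> (cc Q))" by metis
  define v where "v = (\<lambda>(Q, u, b). cc Q * (u * ww Q ^ b))"
  have p1: "int p > 1" using prime_gt_1_nat[OF prime_p] by simp
  have "card I \<le> d"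
  proof (rule rank_bound[OF p1 fI, of v])
    fix q :: "'k set \<times> 'k \<times> nat \<Rightarrow> int" and i0 :: "'k set \<times> 'k \<times> nat"
    assume rel: "(\<Sum>i\<in>I. of_int (q i) * v i) = 0" and i0: "i0 \<in> I"
    show "int p dvd q i0"
    proof (rule ccontr)
      assume n0: "\<not> int p dvd q i0"
      obtain Q u0 b1 where i0': "i0 = (Q, u0, b1)" by (cases i0)
      have Q: "Q \<in> Primes" using i0 i0' by (simp add: I_def)
      obtain \<sigma> where s: "\<sigma> \<in> Sig" and Qs: "pid \<sigma> = Q" using rep[OF Q] by blast
      define w e Y where "w = ww Q" and "e = ee Q" and "Y = YY Q"
      note uni = uniformizer[OF s, unfolded Qs, folded w_def e_def]
      note res = residues[OF s, unfolded Qs, folded Y_def]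
      \<comment> \<open>At a prime \<open>Q\<close> where a coefficient is prime to p, the least
        exponent \<open>b\<close> carrying one is isolated; every other term turns out to be
        divisible by the (b + 1)-st power of the uniformizer.\<close>
      define bad where "bad b \<longleftrightarrow> b < e \<and> (\<exists>u\<in>Y. \<not> int p dvd q (Q, u, b))" for b
      have "bad b1" using i0 i0' n0 by (auto simp: bad_def I_def e_def Y_def)
      define b where "b = (LEAST b. bad b)"
      have b: "bad b" unfolding b_def using \<open>bad b1\<close> by (rule LeastI)
      have bmin: "\<not> bad b'" if "b' < b" for b' using that not_less_Least by (auto simp: b_def)
      have be: "b < e" using b by (simp add: bad_def)
      define W where "W = \<sigma> w"
      have W0: "W \<noteq> 0" using uni(2) by (simp add: W_def embedding_simps[OF s])
      have WV: "W \<in> V" using M_subset[OF uni(4)] by (simp add: W_def)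
      have WM: "W \<in> M" using uni(4) by (simp add: W_def)
      \<comment> \<open>Here \<open>b < e\<close> is used: p itself is divisible by the (b + 1)-st
        power, which disposes of the coefficients divisible by p and of the other primes.\<close>
      have PW: "vdvd (W ^ Suc b) P"
      proof -
        have "vdvd (W ^ Suc b) (W ^ e)" by (rule vdvd_power_le[OF WV]) (use be in simp)
        moreover have "vdvd (W ^ e) P" using uniformizer_vdvd(1)[OF s] by (simp add: Qs W_def w_def e_def)
        ultimately show ?thesis using vdvd_trans by blast
      qed
      let ?t = "\<lambda>i. of_int (q i) * \<sigma> (v i)"
      define I0 where "I0 = (\<lambda>u. (Q, u, b)) ` Y"
      have I0I: "I0 \<subseteq> I" using Q be by (auto simp: I0_def I_def Y_def e_def)
      have intV: "of_int z \<in> V" for z using V_closed(10) .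
      have small: "vdvd (W ^ Suc b) (?t i)" if i: "i \<in> I - I0" for i
      proof -
        obtain Q' u b' where i': "i = (Q', u, b')" by (cases i)
        have Q': "Q' \<in> Primes" and u: "u \<in> YY Q'" and b': "b' < ee Q'" using i i' by (auto simp: I_def)
        obtain \<sigma>' where s': "\<sigma>' \<in> Sig" "pid \<sigma>' = Q'" using rep[OF Q'] by blast
        have uO: "u \<in> AI" using residues(2)[OF s'(1)] u s'(2) by blast
        have wO: "ww Q' \<in> AI" using uniformizer(1)[OF s'(1)] s'(2) by simp
        have restV: "\<sigma> (u * ww Q' ^ b') \<in> V" by (rule emb_O[OF s]) (intro O_closed(4) O_power uO wO)
        have cV: "\<sigma> (cc Q') \<in> V" by (rule emb_O[OF s cc(1)[OF Q']])
        have vi: "\<sigma> (v i) = \<sigma> (cc Q') * \<sigma> (u * ww Q' ^ b')" by (simp add: v_def i' embedding_simps[OF s])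
        show ?thesis
        proof (cases "Q' = Q")
          case False
          have "vdvd P (\<sigma> (cc Q'))" using cc(3)[OF Q' s] False Qs by simp
          hence "vdvd P (?t i)" unfolding vi by (intro vdvd_mult_left vdvd_mult_right restV intV)
          thus ?thesis using PW vdvd_trans by blast
        next
          case True
          have uY: "u \<in> Y" using u True by (simp add: Y_def)
          have "b' \<noteq> b" using i i' True uY by (auto simp: I0_def)
          show ?thesis
          proof (cases "b' < b")
            case True
            hence "int p dvd q i" using bmin[OF True] b' \<open>Q' = Q\<close> uY i' by (auto simp: bad_def e_def)
            then obtain k where "q i = int p * k" ..
            hence "?t i = P * (of_int k * \<sigma> (v i))" by simp
            moreover have "of_int k * \<sigma> (v i) \<in> V" unfolding vi by (intro V_closed(4) intV cV restV)
            ultimately have "vdvd P (?t i)" by (auto simp: vdvd_def)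
            thus ?thesis using PW vdvd_trans by blast
          next
            case False
            hence "Suc b \<le> b'" using \<open>b' \<noteq> b\<close> by simp
            hence "vdvd (W ^ Suc b) (W ^ b')" by (rule vdvd_power_le[OF WV])
            hence "vdvd (W ^ Suc b) (of_int (q i) * (\<sigma> (cc Q') * (\<sigma> u * W ^ b')))"
              by (intro vdvd_mult_left intV cV emb_O[OF s uO])
            thus ?thesis unfolding vi using \<open>Q' = Q\<close> by (simp add: embedding_simps[OF s] W_def w_def)
          qed
        qed
      qed
      define S where "S = (\<Sum>u\<in>Y. of_int (q (Q, u, b)) * u)"
      have "0 = \<sigma> (\<Sum>i\<in>I. of_int (q i) * v i)" using rel by (simp add: embedding_simps[OF s])
      also have "\<dots> = (\<Sum>i\<in>I. ?t i)" by (simp add: embedding_sum[OF s] embedding_simps[OF s])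
      also have "\<dots> = (\<Sum>i\<in>I - I0. ?t i) + (\<Sum>i\<in>I0. ?t i)" by (rule sum.subset_diff[OF I0I fI])
      also have "(\<Sum>i\<in>I0. ?t i) = (\<Sum>u\<in>Y. ?t (Q, u, b))"
        unfolding I0_def by (subst sum.reindex) (auto simp: inj_on_def)
      also have "\<dots> = W ^ b * (\<sigma> (cc Q) * \<sigma> S)"
        unfolding S_def embedding_sum[OF s] sum_distrib_left
        by (intro sum.cong) (auto simp: v_def W_def w_def embedding_simps[OF s])
      finally have eq: "W ^ b * (\<sigma> (cc Q) * \<sigma> S) = - (\<Sum>i\<in>I - I0. ?t i)" by (simp add: eq_neg_iff_add_eq_0 add.commute)
      have "vdvd (W ^ Suc b) (0 - (\<Sum>i\<in>I - I0. ?t i))" by (intro vdvd_diff vdvd_0 vdvd_sum small)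
      hence "vdvd (W ^ b * W) (W ^ b * (\<sigma> (cc Q) * \<sigma> S))" unfolding eq by (simp add: mult.commute)
      hence "vdvd W (\<sigma> (cc Q) * \<sigma> S)" using W0 by (simp add: vdvd_cancel)
      hence "\<sigma> (cc Q) * \<sigma> S \<in> M" using M_vdvd[OF WM] by blast
      moreover have SO: "S \<in> AI" unfolding S_def by (rule O_sum) (use O_closed(4,7) res(2) in blast)
      ultimately have "cc Q * S \<in> pid \<sigma>" using O_closed(4)[OF cc(1)[OF Q] SO] by (simp add: pid_def embedding_simps[OF s])
      hence "cc Q \<in> pid \<sigma> \<or> S \<in> pid \<sigma>" using pid_prime[OF s cc(1)[OF Q] SO] by blast
      moreover have "cc Q \<notin> pid \<sigma>"
      proof
        assume "cc Q \<in> pid \<sigma>"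
        hence "(1 - cc Q) + cc Q \<in> pid \<sigma>" using pid_add[OF s] cc(2)[OF Q] Qs by blast
        thus False using one_notin_pid[OF s] by simp
      qed
      ultimately have "S \<in> Q" using Qs by simp
      hence "\<forall>u\<in>Y. int p dvd q (Q, u, b)" using res(3)[of "\<lambda>u. q (Q, u, b)"] unfolding S_def by blast
      thus False using b by (simp add: bad_def)
    qed
  qed
  moreover have "card I = (\<Sum>Q\<in>Primes. ee Q * ff Q)"
    unfolding I_def using finite_Primes fY by (subst card_SigmaI) (auto simp: ff_def mult.commute)
  ultimately show ?thesis by simp
qed

lemma sum_card_above: "(\<Sum>Q\<in>Primes. card (above Q)) = d"
proof -
  have "card Sig = (\<Sum>Q\<in>Primes. card {\<sigma> \<in> Sig. pid \<sigma> = Q})"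
    using sum.group[OF finite_Sig finite_Primes, of pid "\<lambda>_. 1::nat"] by (simp add: Primes_def)
  thus ?thesis using card_Sig by (simp add: above_def)
qed

text \<open>Each prime has at most e f embeddings above it, the numbers e f add up to at most d, and
  all d embeddings lie above some prime; so equality holds throughout.\<close>

lemma card_above: assumes Q: "Q \<in> Primes" shows "card (above Q) = ee Q * ff Q"
proof (rule ccontr)
  have le: "card (above R) \<le> ee R * ff R" if "R \<in> Primes" for R
    using that card_above_le by (auto simp: Primes_def)
  assume "card (above Q) \<noteq> ee Q * ff Q"
  hence "card (above Q) < ee Q * ff Q" using le[OF Q] by simp
  hence "(\<Sum>Q\<in>Primes. card (above Q)) < (\<Sum>Q\<in>Primes. ee Q * ff Q)"
    using finite_Primes le Q by (intro sum_strict_mono_ex1) auto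
  thus False using sum_ef_le sum_card_above by simp
qed

end

subsection \<open>Valuations of determinants of embeddings\<close>

text \<open>Induction on the maximum, which is at least the number of smaller elements.\<close>

lemma choose_two_le_sum:
  assumes "finite (S::nat set)" shows "card S choose 2 \<le> \<Sum>S"
  using assms
proof (induction S rule: finite_linorder_max_induct)
  case (insert b A)
  have "A \<subseteq> {..<b}" using insert by auto
  hence "card A \<le> b" using card_mono[of "{..<b}" A] by simp
  moreover have "b \<notin> A" using insert by auto
  ultimately show ?case using insert by (simp add: numeral_2_eq_2)
qed (simp add: numeral_2_eq_2)

lemma choose_two_le_sum_inj:
  assumes "finite I" "inj_on (f :: 'i \<Rightarrow> nat) I" shows "card I choose 2 \<le> (\<Sum>i\<in>I. f i)"
  using choose_two_le_sum[of "f ` I"] assms by (simp add: card_image sum.reindex)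

context valuation
begin

text \<open>\<open>vge E n z\<close> says that \<open>z\<close> has valuation at least \<open>n / E\<close>, where \<open>p\<close> has valuation \<open>1\<close>.\<close>

definition vge :: "nat \<Rightarrow> nat \<Rightarrow> 'a \<Rightarrow> bool" where "vge E n z \<longleftrightarrow> vdvd (P ^ n) (z ^ E)"

lemma vge_mult: "vge E n z \<Longrightarrow> vge E m w \<Longrightarrow> vge E (n + m) (z * w)"
  unfolding vge_def power_add power_mult_distrib by (rule vdvd_mult)

lemma vge_V: "z \<in> V \<Longrightarrow> vge E 0 z"
  by (simp add: vge_def vdvd_1 V_closed)

lemma vge_V_mult: "v \<in> V \<Longrightarrow> vge E n z \<Longrightarrow> vge E n (v * z)"
  using vge_mult[OF vge_V, of v E n z] by simp

lemma vge_0: "E \<ge> 1 \<Longrightarrow> vge E n 0"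
  by (simp add: vge_def vdvd_0 zero_power)

lemma vge_mono: "vge E n z \<Longrightarrow> m \<le> n \<Longrightarrow> vge E m z"
  unfolding vge_def using vdvd_power_le[OF V_closed(11)] vdvd_trans by blast

lemma vge_add: assumes "vge E n z" "vge E n w" shows "vge E n (z + w)"
proof -
  have *: "vge E n (a + b)" if ab: "vge E n a" "vdvd a b" for a b
  proof -
    obtain v where v: "v \<in> V" "b = a * v" using ab(2) by (auto simp: vdvd_def)
    have "vge E n ((1 + v) * a)" by (rule vge_V_mult[OF V_closed(6)[OF V_closed(1) v(1)] ab(1)])
    thus ?thesis using v(2) by (simp add: algebra_simps)
  qed
  show ?thesis using vdvd_total[of z w] *[OF assms(1)] *[OF assms(2), of z] by (auto simp: add.commute)
qed

lemma vge_sum: "E \<ge> 1 \<Longrightarrow> (\<And>i. i \<in> I \<Longrightarrow> vge E n (f i)) \<Longrightarrow> vge E n (\<Sum>i\<in>I. f i)"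
  by (induction I rule: infinite_finite_induct) (auto simp: vge_0 vge_add)

lemma vge_prod: "(\<And>i. i \<in> I \<Longrightarrow> vge E (n i) (f i)) \<Longrightarrow> vge E (\<Sum>i\<in>I. n i) (\<Prod>i\<in>I. f i)"
  by (induction I rule: infinite_finite_induct) (auto simp: vge_V V_closed(1) vge_mult)

lemma vge_power: "vge E n z \<Longrightarrow> vge E (k * n) (z ^ k)"
  by (induction k) (auto simp: vge_V V_closed(1) vge_mult)

lemma vge_vdvd: "vdvd (P ^ n) z \<Longrightarrow> vge E (n * E) z"
  unfolding vge_def power_mult by (rule vdvd_power)

lemma prod_congruent:
  assumes "\<And>i. i \<in> I \<Longrightarrow> f i \<in> V" "\<And>i. i \<in> I \<Longrightarrow> g i \<in> V" "\<And>i. i \<in> I \<Longrightarrow> vdvd a (f i - g i)"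
  shows "vdvd a ((\<Prod>i\<in>I. f i) - (\<Prod>i\<in>I. g i))"
  using assms
proof (induction I rule: infinite_finite_induct)
  case (insert i I)
  have gV: "(\<Prod>i\<in>I. g i) \<in> V" using insert.prems by (intro V_closed(9)) auto
  have IH: "vdvd a ((\<Prod>i\<in>I. f i) - (\<Prod>i\<in>I. g i))" using insert by auto
  have "f i * (\<Prod>i\<in>I. f i) - g i * (\<Prod>i\<in>I. g i)
      = f i * ((\<Prod>i\<in>I. f i) - (\<Prod>i\<in>I. g i)) + (f i - g i) * (\<Prod>i\<in>I. g i)" by (simp add: algebra_simps)
  moreover have "vdvd a \<dots>"
    using insert.prems by (intro vdvd_add vdvd_mult_left[OF IH] vdvd_mult_right[OF _ gV]) auto
  ultimately show ?case using insert.hyps by simp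
qed (auto simp: vdvd_0)

lemma signof_V: "(signof q :: 'a) \<in> V"
  using V_closed(1,5) by (cases q rule: sign_cases) simp_all

lemma det_congruent:
  assumes "A \<in> carrier_mat n n" "B \<in> carrier_mat n n"
    and "\<And>i j. i < n \<Longrightarrow> j < n \<Longrightarrow> A $$ (i, j) \<in> V \<and> B $$ (i, j) \<in> V \<and> vdvd a (A $$ (i, j) - B $$ (i, j))"
  shows "vdvd a (det A - det B)"
proof -
  have "det A - det B = (\<Sum>q | q permutes {0..<n}. signof q *
    ((\<Prod>i = 0..<n. A $$ (i, q i)) - (\<Prod>i = 0..<n. B $$ (i, q i))))"
    unfolding det_def'[OF assms(1)] det_def'[OF assms(2)] by (simp add: sum_subtractf right_diff_distrib)
  also have "vdvd a \<dots>"
  proof (intro vdvd_sum vdvd_mult_left signof_V prod_congruent)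
    fix q i assume q: "q \<in> {q. q permutes {0..<n}}" and i: "i \<in> {0..<n}"
    have "q i < n" using q i permutes_in_image[of q "{0..<n}" i] by auto
    thus "A $$ (i, q i) \<in> V" "B $$ (i, q i) \<in> V" "vdvd a (A $$ (i, q i) - B $$ (i, q i))"
      using assms(3) i by auto
  qed
  finally show ?thesis .
qed

lemma det_in_V:
  assumes "A \<in> carrier_mat n n" "\<And>i j. i < n \<Longrightarrow> j < n \<Longrightarrow> A $$ (i, j) \<in> V" shows "det A \<in> V"
  unfolding det_def'[OF assms(1)]
proof (intro V_closed(8) V_closed(4) signof_V V_closed(9))
  fix q i assume q: "q \<in> {q. q permutes {0..<n}}" and i: "i \<in> {0..<n}"
  have "q i < n" using q i permutes_in_image[of q "{0..<n}" i] by auto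
  thus "A $$ (i, q i) \<in> V" using assms(2) i by auto
qed

end

text \<open>\<open>f\<close> selects one power from each row. The factor \<open>s i ^ f i\<close> is
  common to the row and comes out of the determinant.\<close>

lemma det_rows_power_sum:
  fixes a :: "nat \<Rightarrow> nat \<Rightarrow> nat \<Rightarrow> 'a::comm_ring_1"
  shows "det (mat n n (\<lambda>(i, k). \<Sum>j<L. a i k j * s i ^ j)) =
    (\<Sum>f\<in>{0..<n} \<rightarrow>\<^sub>E {..<L}. (\<Prod>i=0..<n. s i ^ f i) * det (mat n n (\<lambda>(i, k). a i k (f i))))"
proof -
  have in_range: "q i < n" if "q permutes {0..<n}" "i < n" for q and i :: nat
    using that permutes_in_image[of q "{0..<n}" i] by auto
  have "det (mat n n (\<lambda>(i, k). \<Sum>j<L. a i k j * s i ^ j)) =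
    (\<Sum>q | q permutes {0..<n}. signof q * (\<Prod>i=0..<n. \<Sum>j<L. a i (q i) j * s i ^ j))"
    by (subst det_def'[of _ n]) (auto intro!: sum.cong prod.cong simp: in_range)
  also have "\<dots> = (\<Sum>q | q permutes {0..<n}. \<Sum>f\<in>{0..<n} \<rightarrow>\<^sub>E {..<L}.
      (\<Prod>i=0..<n. s i ^ f i) * (signof q * (\<Prod>i=0..<n. a i (q i) (f i))))"
  proof (intro sum.cong refl)
    fix q :: "nat \<Rightarrow> nat"
    have "(\<Prod>i=0..<n. \<Sum>j<L. a i (q i) j * s i ^ j) = (\<Sum>f\<in>{0..<n} \<rightarrow>\<^sub>E {..<L}. \<Prod>i=0..<n. a i (q i) (f i) * s i ^ f i)"
      by (rule prod_sum_PiE) auto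
    thus "signof q * (\<Prod>i=0..<n. \<Sum>j<L. a i (q i) j * s i ^ j) = (\<Sum>f\<in>{0..<n} \<rightarrow>\<^sub>E {..<L}.
      (\<Prod>i=0..<n. s i ^ f i) * (signof q * (\<Prod>i=0..<n. a i (q i) (f i))))"
      by (simp add: sum_distrib_left prod.distrib mult_ac)
  qed
  also have "\<dots> = (\<Sum>f\<in>{0..<n} \<rightarrow>\<^sub>E {..<L}. (\<Prod>i=0..<n. s i ^ f i) *
      (\<Sum>q | q permutes {0..<n}. signof q * (\<Prod>i=0..<n. a i (q i) (f i))))"
    by (subst sum.swap) (simp add: sum_distrib_left)
  also have "\<dots> = (\<Sum>f\<in>{0..<n} \<rightarrow>\<^sub>E {..<L}. (\<Prod>i=0..<n. s i ^ f i) * det (mat n n (\<lambda>(i, k). a i k (f i))))"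
    by (intro sum.cong refl arg_cong2[of _ _ _ _ times], subst det_def'[of _ n])
      (auto intro!: sum.cong prod.cong simp: in_range)
  finally show ?thesis .
qed

section \<open>Class weights and the value of a determinant\<close>

context local_fld
begin

text \<open>A common multiple of the ramification indices: values are counted in units of
  1/\<open>EE\<close>, and \<open>rr Q\<close> is the value of the uniformizer at \<open>Q\<close>
  in these units, an integer.\<close>

definition EE :: nat where "EE = (\<Prod>Q\<in>Primes. ee Q)"

definition rr :: "'k set \<Rightarrow> nat" where "rr Q = EE div ee Q"

lemma ee_pos: "Q \<in> Primes \<Longrightarrow> ee Q \<ge> 1"
  using uniformizer(3) by (auto simp: Primes_def)

lemma EE_pos: "EE \<ge> 1"
proof -
  have "EE > 0" unfolding EE_def using ee_pos by (intro prod_pos) force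
  thus ?thesis by simp
qed

lemma rr_ee: "Q \<in> Primes \<Longrightarrow> rr Q * ee Q = EE"
  unfolding rr_def EE_def using finite_Primes by (intro dvd_div_mult_self dvd_prodI) auto

lemma pid_Primes: "\<sigma> \<in> Sig \<Longrightarrow> pid \<sigma> \<in> Primes"
  by (simp add: Primes_def)

lemma vge_uniformizer:
  assumes s: "\<sigma> \<in> Sig" shows "vge EE (rr (pid \<sigma>)) (\<sigma> (ww (pid \<sigma>)))"
proof -
  have "vdvd (P ^ rr (pid \<sigma>)) ((\<sigma> (ww (pid \<sigma>)) ^ ee (pid \<sigma>)) ^ rr (pid \<sigma>))"
    by (rule vdvd_power[OF uniformizer_vdvd(2)[OF s]])
  thus ?thesis unfolding vge_def power_mult[symmetric] using rr_ee[OF pid_Primes[OF s]] by (simp add: mult.commute)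
qed

text \<open>The choice is made from the class as a set, so congruent embeddings have the same
  representative.\<close>

definition rep :: "('k \<Rightarrow> rat alg_closure) \<Rightarrow> ('k \<Rightarrow> rat alg_closure)" where
  "rep \<sigma> = (SOME \<tau>. \<tau> \<in> Cl \<sigma>)"

lemma rep: "\<sigma> \<in> Sig \<Longrightarrow> rep \<sigma> \<in> Sig" "\<sigma> \<in> Sig \<Longrightarrow> congr \<sigma> (rep \<sigma>)"
proof -
  have "rep \<sigma> \<in> Cl \<sigma>" if "\<sigma> \<in> Sig"
    unfolding rep_def by (rule someI[of _ \<sigma>]) (use that congr_refl in \<open>simp add: Cl_def\<close>)
  thus "\<sigma> \<in> Sig \<Longrightarrow> rep \<sigma> \<in> Sig" "\<sigma> \<in> Sig \<Longrightarrow> congr \<sigma> (rep \<sigma>)" by (auto simp: Cl_def)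
qed

definition rc :: "('k \<Rightarrow> rat alg_closure) set \<Rightarrow> nat" where
  "rc C = rr (pid (SOME \<tau>. \<tau> \<in> C))"

lemma rc_Cl: "\<sigma> \<in> Sig \<Longrightarrow> rc (Cl \<sigma>) = rr (pid \<sigma>)"
  using congr_pid[OF rep(2), of \<sigma>] by (simp add: rc_def rep_def)

text \<open>\<open>M_nilpotent\<close> gives an exponent for each element; finitely many residues
  modulo p and finitely many embeddings make it uniform. Uniformity matters because the exponent p^N
  of the digits is fixed before the digits are chosen.\<close>

lemma uniform_nilpotence:
  obtains n where "\<And>\<sigma> z. \<sigma> \<in> Sig \<Longrightarrow> z \<in> AI \<Longrightarrow> vdvd P ((\<sigma> z - rep \<sigma> z) ^ n)"
proof -
  obtain B where B: "finite B" "B \<subseteq> AI" "\<And>x. x \<in> AI \<Longrightarrow> \<exists>b\<in>B. \<exists>y\<in>AI. x - b = of_nat p * y" by (rule finite_mod_p) blast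
  have dV: "\<sigma> z - rep \<sigma> z \<in> V" if "\<sigma> \<in> Sig" "z \<in> AI" for \<sigma> z
    using emb_O[OF that] emb_O[OF rep(1)[OF that(1)] that(2)] V_closed(3) by blast
  have "\<exists>n. vdvd P ((\<sigma> b - rep \<sigma> b) ^ n)" if "\<sigma> \<in> Sig" "b \<in> B" for \<sigma> b
    using M_nilpotent rep(2)[OF that(1)] that(2) B(2) unfolding congr_def by blast
  then obtain n where n: "\<And>\<sigma> b. \<sigma> \<in> Sig \<Longrightarrow> b \<in> B \<Longrightarrow> vdvd P ((\<sigma> b - rep \<sigma> b) ^ n \<sigma> b)" by metis
  define m where "m = (\<Sum>\<sigma>\<in>Sig. \<Sum>b\<in>B. n \<sigma> b)"
  have nm: "n \<sigma> b \<le> m" if "\<sigma> \<in> Sig" "b \<in> B" for \<sigma> b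
  proof -
    have "n \<sigma> b \<le> (\<Sum>b\<in>B. n \<sigma> b)" using B(1) that by (intro member_le_sum) auto
    also have "\<dots> \<le> m" unfolding m_def using finite_Sig that by (intro member_le_sum) auto
    finally show ?thesis .
  qed
  have "vdvd P ((\<sigma> z - rep \<sigma> z) ^ m)" if s: "\<sigma> \<in> Sig" and z: "z \<in> AI" for \<sigma> z
  proof -
    obtain b y where b: "b \<in> B" "y \<in> AI" "z - b = of_nat p * y" using B(3)[OF z] by blast
    have bA: "b \<in> AI" using b B by blast
    note r = rep(1)[OF s]
    let ?a = "\<sigma> z - rep \<sigma> z" and ?b = "\<sigma> b - rep \<sigma> b"
    have zb: "z = b + of_nat p * y" using b(3) by (simp add: algebra_simps)
    have ab: "?a - ?b = P * (\<sigma> y - rep \<sigma> y)"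
      unfolding zb by (simp add: embedding_simps[OF s] embedding_simps[OF r] algebra_simps)
    have "?a ^ m - ?b ^ m = (?a - ?b) * (\<Sum>i<m. ?b ^ (m - Suc i) * ?a ^ i)" by (rule power_diff_sumr2)
    also have "\<dots> = P * ((\<sigma> y - rep \<sigma> y) * (\<Sum>i<m. ?b ^ (m - Suc i) * ?a ^ i))" unfolding ab by (simp add: mult.assoc)
    finally have 1: "vdvd P (?a ^ m - ?b ^ m)"
      using V_closed(4)[OF dV[OF s b(2)] V_closed(8)[of "{..<m}" "\<lambda>i. ?b ^ (m - Suc i) * ?a ^ i"]]
        V_closed(4,7) dV[OF s bA] dV[OF s z] unfolding vdvd_def by blast
    have "vdvd P (?b ^ n \<sigma> b * ?b ^ (m - n \<sigma> b))"
      by (rule vdvd_mult_right[OF n[OF s b(1)] V_closed(7)[OF dV[OF s bA]]])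
    hence "vdvd P (?b ^ m)" using nm[OF s b(1)] by (simp add: power_add[symmetric])
    from vdvd_add[OF 1 this] show ?thesis by simp
  qed
  thus ?thesis by (rule that)
qed

text \<open>The digits of the expansion in powers of the uniformizer are taken to be \<open>p\<^sup>N\<close>-th powers: modulo \<open>p\<^sup>K\<close> the
  value of an embedding at such a power depends only on the residue class of the embedding.\<close>

lemma class_approximation:
  obtains L a where "\<And>\<sigma> x j. \<sigma> \<in> Sig \<Longrightarrow> a \<sigma> x j \<in> V"
    "\<And>\<sigma> x. \<sigma> \<in> Sig \<Longrightarrow> (\<And>\<tau>. \<tau> \<in> Sig \<Longrightarrow> \<tau> x \<in> V) \<Longrightarrow>
       vdvd (P ^ K) (\<sigma> x - (\<Sum>j<L. a \<sigma> x j * \<sigma> (ww (pid \<sigma>)) ^ j))"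
    "\<And>\<sigma> \<tau> x j. \<sigma> \<in> Sig \<Longrightarrow> \<tau> \<in> Sig \<Longrightarrow> Cl \<sigma> = Cl \<tau> \<Longrightarrow> a \<sigma> x j = a \<tau> x j"
proof -
  obtain n where n: "\<And>\<sigma> z. \<sigma> \<in> Sig \<Longrightarrow> z \<in> AI \<Longrightarrow> vdvd P ((\<sigma> z - rep \<sigma> z) ^ n)" by (rule uniform_nilpotence) blast
  \<comment> \<open>\<open>N\<close> is an exponent for which \<open>frobenius_congruence\<close>
    reaches the modulus p^K; \<open>L\<close> is long enough for the L-th power of every uniformizer
    to be divisible by p^K, since no ramification index exceeds \<open>EE\<close>.\<close>
  define N L where "N = n + K" and "L = K * EE"
  define D where "D z \<longleftrightarrow> (\<exists>u\<in>AI. z = u ^ (p ^ N))" for z :: 'k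
  have Dcong: "vdvd (P ^ K) (\<sigma> z - rep \<sigma> z)" if s: "\<sigma> \<in> Sig" and z: "D z" for \<sigma> z
  proof -
    obtain u where u: "u \<in> AI" "z = u ^ (p ^ N)" using z by (auto simp: D_def)
    have "vdvd (P ^ Suc K) (\<sigma> u ^ (p ^ (n + K)) - rep \<sigma> u ^ (p ^ (n + K)))"
      by (rule frobenius_congruence[OF emb_O[OF s u(1)] emb_O[OF rep(1)[OF s] u(1)] n[OF s u(1)]])
    moreover have "vdvd (P ^ K) (P ^ Suc K)" by (rule vdvd_power_le[OF V_closed(11)]) simp
    ultimately have "vdvd (P ^ K) (\<sigma> u ^ (p ^ (n + K)) - rep \<sigma> u ^ (p ^ (n + K)))" using vdvd_trans by blast
    thus ?thesis using u(2) by (simp add: embedding_simps[OF s] embedding_simps[OF rep(1)[OF s]] N_def)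
  qed
  \<comment> \<open>The digits depend on the prime and on \<open>x\<close> only, so that all
    embeddings of a class use the same ones. For an \<open>x\<close> that is not integral at every
    embedding, any digits of the right form are accepted, which keeps the choice total.\<close>
  define good where "good Q x z \<longleftrightarrow> (\<forall>j. D (z j) \<and> z j \<in> AI) \<and> ((\<forall>\<tau>\<in>Sig. \<tau> x \<in> V) \<longrightarrow>
      (\<forall>\<sigma>\<in>Sig. pid \<sigma> = Q \<longrightarrow> vdvd (P ^ K) (\<sigma> x - (\<Sum>j<L. \<sigma> (z j) * \<sigma> (ww Q) ^ j))))" for Q x z
  have ex: "\<exists>z. good Q x z" if Q: "Q \<in> Primes" for Q x
  proof -
    obtain s0 where s0: "s0 \<in> Sig" "pid s0 = Q" using Q by (auto simp: Primes_def)
    have Dex: "\<exists>z. D z \<and> z \<in> AI \<and> y - z \<in> pid s0" if "y \<in> AI" for y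
    proof -
      have "\<exists>z\<in>AI. y - z ^ (p ^ N) \<in> pid s0" by (rule frobenius_surj[OF s0(1) that])
      thus ?thesis using O_power unfolding D_def by blast
    qed
    show ?thesis
    proof (cases "\<forall>\<tau>\<in>Sig. \<tau> x \<in> V")
      case False
      have "D 0" unfolding D_def using O_closed(1) prime_gt_0_nat[OF prime_p] by (intro bexI[of _ 0]) (auto simp: zero_power)
      thus ?thesis using False O_closed(1) by (intro exI[of _ "\<lambda>_. 0"]) (auto simp: good_def)
    next
      case True
      have "\<exists>z r. (\<forall>j. D (z j) \<and> z j \<in> AI) \<and> s0 r \<in> V \<and> x = (\<Sum>j<L. z j * ww (pid s0) ^ j) + ww (pid s0) ^ L * r"
        by (rule digit_expansion[OF s0(1) _ Dex]) (use True s0 in auto)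
      then obtain z r where z: "\<forall>j. D (z j) \<and> z j \<in> AI" and r: "s0 r \<in> V"
        and x: "x = (\<Sum>j<L. z j * ww Q ^ j) + ww Q ^ L * r" unfolding s0(2) by (elim exE conjE) (rule that)
      have "vdvd (P ^ K) (\<sigma> x - (\<Sum>j<L. \<sigma> (z j) * \<sigma> (ww Q) ^ j))" if s: "\<sigma> \<in> Sig" and sQ: "pid \<sigma> = Q" for \<sigma>
      proof -
        have rV: "\<sigma> r \<in> V" by (rule pid_eq_V[OF s0(1) s _ r]) (use s0 sQ in simp)
        have "\<sigma> x = (\<Sum>j<L. \<sigma> (z j) * \<sigma> (ww Q) ^ j) + \<sigma> (ww Q) ^ L * \<sigma> r"
          by (subst x) (simp add: embedding_simps[OF s] embedding_sum[OF s])
        hence "\<sigma> x - (\<Sum>j<L. \<sigma> (z j) * \<sigma> (ww Q) ^ j) = \<sigma> (ww Q) ^ L * \<sigma> r" by simp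
        moreover have "vdvd (P ^ K) (\<sigma> (ww Q) ^ L * \<sigma> r)"
        proof (rule vdvd_mult_right[OF _ rV])
          have "vdvd (P ^ K) ((\<sigma> (ww Q) ^ ee Q) ^ K)" using vdvd_power[OF uniformizer_vdvd(2)[OF s]] sQ by simp
          moreover have "ee Q * K \<le> L"
            using rr_ee[OF Q] EE_pos unfolding L_def by (cases "rr Q") (auto simp: algebra_simps)
          hence "vdvd (\<sigma> (ww Q) ^ (ee Q * K)) (\<sigma> (ww Q) ^ L)"
            using M_subset[OF uniformizer(4)[OF s]] sQ by (intro vdvd_power_le) auto
          ultimately show "vdvd (P ^ K) (\<sigma> (ww Q) ^ L)" unfolding power_mult[symmetric] using vdvd_trans by blast
        qed
        ultimately show ?thesis by simp
      qed
      hence "good Q x z" using z unfolding good_def by simp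
      thus ?thesis by (rule exI[of "good Q x"])
    qed
  qed
  define z where "z Q x = (SOME z. good Q x z)" for Q x
  have "good Q x (z Q x)" if "Q \<in> Primes" for Q x unfolding z_def by (rule someI_ex[OF ex[OF that]])
  hence z: "Q \<in> Primes \<Longrightarrow> D (z Q x j)" "Q \<in> Primes \<Longrightarrow> z Q x j \<in> AI"
    "Q \<in> Primes \<Longrightarrow> (\<forall>\<tau>\<in>Sig. \<tau> x \<in> V) \<Longrightarrow> \<sigma> \<in> Sig \<Longrightarrow> pid \<sigma> = Q \<Longrightarrow>
      vdvd (P ^ K) (\<sigma> x - (\<Sum>j<L. \<sigma> (z Q x j) * \<sigma> (ww Q) ^ j))" for Q x j \<sigma>
    unfolding good_def by simp_all
  \<comment> \<open>Evaluating the digits at the representative makes the coefficients exactly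
    constant on classes, at the cost of an error divisible by p^K.\<close>
  define a where "a \<sigma> x j = rep \<sigma> (z (pid \<sigma>) x j)" for \<sigma> x j
  show ?thesis
  proof (rule that[of a L])
    show "a \<sigma> x j \<in> V" if "\<sigma> \<in> Sig" for \<sigma> x j
      unfolding a_def by (rule emb_O[OF rep(1)[OF that] z(2)[OF pid_Primes[OF that]]])
    show "a \<sigma> x j = a \<tau> x j" if "\<sigma> \<in> Sig" "\<tau> \<in> Sig" "Cl \<sigma> = Cl \<tau>" for \<sigma> \<tau> x j
      using that congr_pid[of \<sigma> \<tau>] Cl_eq_iff[of \<tau> \<sigma>] by (simp add: a_def rep_def)
    fix \<sigma> x assume s: "\<sigma> \<in> Sig" and xV: "\<And>\<tau>. \<tau> \<in> Sig \<Longrightarrow> \<tau> x \<in> V"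
    let ?w = "\<sigma> (ww (pid \<sigma>))" and ?z = "z (pid \<sigma>) x"
    have wV: "?w ^ j \<in> V" for j using M_subset[OF uniformizer(4)[OF s]] V_closed(7) by blast
    have 1: "vdvd (P ^ K) (\<sigma> x - (\<Sum>j<L. \<sigma> (?z j) * ?w ^ j))"
      using xV by (intro z(3)[OF pid_Primes[OF s] _ s refl]) simp
    have "vdvd (P ^ K) (\<Sum>j<L. (\<sigma> (?z j) - rep \<sigma> (?z j)) * ?w ^ j)"
      by (intro vdvd_sum vdvd_mult_right[OF _ wV] Dcong[OF s] z(1) pid_Primes[OF s])
    from vdvd_add[OF 1 this] show "vdvd (P ^ K) (\<sigma> x - (\<Sum>j<L. a \<sigma> x j * ?w ^ j))"
      by (simp add: a_def left_diff_distrib sum_subtractf)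
  qed
qed

text \<open>In units of 1/\<open>EE\<close>: 0 + 1 + ... + (t - 1) times the value of the
  uniformizer, summed over the classes, where t counts the members of \<open>T\<close> in a
  class.\<close>

definition class_weight :: "('k \<Rightarrow> rat alg_closure) set \<Rightarrow> nat" where
  "class_weight T = (\<Sum>C\<in>Cl ` Sig. rc C * (card {\<tau> \<in> T. Cl \<tau> = C} choose 2))"

lemma class_weight_le:
  assumes ts: "distinct ts" "set ts \<subseteq> Sig" and n: "length ts = n"
    and inj: "\<And>i j. i < n \<Longrightarrow> j < n \<Longrightarrow> i \<noteq> j \<Longrightarrow> Cl (ts ! i) = Cl (ts ! j) \<Longrightarrow> f i \<noteq> f j"
  shows "class_weight (set ts) \<le> (\<Sum>i=0..<n. f i * rr (pid (ts ! i)))"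
proof -
  have tsS: "ts ! i \<in> Sig" if "i < n" for i using that ts(2) n by (metis nth_mem subsetD)
  have "(\<Sum>i=0..<n. f i * rr (pid (ts ! i))) = (\<Sum>C\<in>Cl ` Sig. \<Sum>i | i \<in> {0..<n} \<and> Cl (ts ! i) = C. f i * rr (pid (ts ! i)))"
    by (rule sum.group[symmetric]) (use finite_Sig tsS in auto)
  also have "\<dots> \<ge> class_weight (set ts)" unfolding class_weight_def
  proof (rule sum_mono)
    fix C assume "C \<in> Cl ` Sig"
    let ?I = "{i. i \<in> {0..<n} \<and> Cl (ts ! i) = C}"
    have "bij_betw ((!) ts) ?I {\<tau> \<in> set ts. Cl \<tau> = C}"
      unfolding bij_betw_def
    proof
      show "inj_on ((!) ts) ?I" using ts(1) n by (auto simp: inj_on_def nth_eq_iff_index_eq)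
      show "(!) ts ` ?I = {\<tau> \<in> set ts. Cl \<tau> = C}" using n by (force simp: in_set_conv_nth)
    qed
    from bij_betw_same_card[OF this] have "card {\<tau> \<in> set ts. Cl \<tau> = C} = card ?I" by simp
    moreover have "card ?I choose 2 \<le> (\<Sum>i\<in>?I. f i)"
    proof (rule choose_two_le_sum_inj)
      show "inj_on f ?I"
      proof (rule inj_onI, rule ccontr)
        fix i j assume "i \<in> ?I" "j \<in> ?I" "f i = f j" "i \<noteq> j"
        thus False using inj[of i j] by simp
      qed
    qed simp
    ultimately have "rc C * (card {\<tau> \<in> set ts. Cl \<tau> = C} choose 2) \<le> rc C * (\<Sum>i\<in>?I. f i)"
      by (simp only: mult_le_mono2)
    also have "\<dots> = (\<Sum>i\<in>?I. f i * rr (pid (ts ! i)))"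
      unfolding sum_distrib_left using rc_Cl tsS by (intro sum.cong) auto
    finally show "rc C * (card {\<tau> \<in> set ts. Cl \<tau> = C} choose 2) \<le> (\<Sum>i\<in>?I. f i * rr (pid (ts ! i)))" .
  qed
  finally show ?thesis .
qed

text \<open>In the multilinear expansion of the determinant along the power series of its rows, terms with
  equal exponents in two rows of the same class vanish.\<close>

theorem vge_det:
  assumes ts: "distinct ts" "set ts \<subseteq> Sig" and len: "length ts = length xs"
    and xs: "\<And>x \<sigma>. x \<in> set xs \<Longrightarrow> \<sigma> \<in> Sig \<Longrightarrow> \<sigma> x \<in> V"
  shows "vge EE (class_weight (set ts)) (det (embedding_matrix ts xs))"
proof -
  define n where "n = length ts"
  define K where "K = class_weight (set ts)"
  obtain L a where a: "\<And>\<sigma> x j. \<sigma> \<in> Sig \<Longrightarrow> a \<sigma> x j \<in> V"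
    "\<And>\<sigma> x. \<sigma> \<in> Sig \<Longrightarrow> (\<And>\<tau>. \<tau> \<in> Sig \<Longrightarrow> \<tau> x \<in> V) \<Longrightarrow>
       vdvd (P ^ K) (\<sigma> x - (\<Sum>j<L. a \<sigma> x j * \<sigma> (ww (pid \<sigma>)) ^ j))"
    "\<And>\<sigma> \<tau> x j. \<sigma> \<in> Sig \<Longrightarrow> \<tau> \<in> Sig \<Longrightarrow> Cl \<sigma> = Cl \<tau> \<Longrightarrow> a \<sigma> x j = a \<tau> x j"
    by (rule class_approximation[of K]) blast
  have tsS: "ts ! i \<in> Sig" if "i < n" for i using that ts(2) n_def by (metis nth_mem subsetD)
  have xsm: "xs ! i \<in> set xs" if "i < n" for i using that len n_def by simp
  define s where "s i = (ts ! i) (ww (pid (ts ! i)))" for i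
  have sV: "s i \<in> V" if "i < n" for i using M_subset[OF uniformizer(4)[OF tsS[OF that]]] by (simp add: s_def)
  define b where "b i k j = a (ts ! i) (xs ! k) j" for i k j
  have bV: "b i k j \<in> V" if "i < n" for i k j using a(1)[OF tsS[OF that]] by (simp add: b_def)
  define B where "B = mat n n (\<lambda>(i, k). \<Sum>j<L. b i k j * s i ^ j)"
  have A: "embedding_matrix ts xs \<in> carrier_mat n n" using len by (simp add: embedding_matrix_def n_def)
  have "vdvd (P ^ K) (det (embedding_matrix ts xs) - det B)"
  proof (rule det_congruent[OF A])
    show "B \<in> carrier_mat n n" by (simp add: B_def)
    fix i k assume ik: "i < n" "k < n"
    have "embedding_matrix ts xs $$ (i, k) = (ts ! i) (xs ! k)" using ik len by (simp add: embedding_matrix_def n_def)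
    moreover have "B $$ (i, k) = (\<Sum>j<L. b i k j * s i ^ j)" using ik by (simp add: B_def)
    moreover have "(\<Sum>j<L. b i k j * s i ^ j) \<in> V" by (intro V_closed(8) V_closed(4,7) bV sV ik)
    ultimately show "embedding_matrix ts xs $$ (i, k) \<in> V \<and> B $$ (i, k) \<in> V \<and>
        vdvd (P ^ K) (embedding_matrix ts xs $$ (i, k) - B $$ (i, k))"
      using a(2)[OF tsS[OF ik(1)] xs[OF xsm[OF ik(2)]]] xs[OF xsm[OF ik(2)] tsS[OF ik(1)]] by (simp add: b_def s_def)
  qed
  hence "vge EE (K * EE) (det (embedding_matrix ts xs) - det B)" by (rule vge_vdvd)
  \<comment> \<open>The approximation modulo p^K is more than precise enough: p^K has value K times
    \<open>EE\<close> in these units.\<close>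
  hence diff: "vge EE K (det (embedding_matrix ts xs) - det B)"
    by (rule vge_mono) (use EE_pos in simp)
  have "vge EE K (det B)" unfolding B_def det_rows_power_sum
  proof (rule vge_sum[OF EE_pos])
    fix f assume "f \<in> {0..<n} \<rightarrow>\<^sub>E {..<L}"
    let ?D = "mat n n (\<lambda>(i, k). b i k (f i))"
    show "vge EE K ((\<Prod>i=0..<n. s i ^ f i) * det ?D)"
    proof (cases "\<exists>i j. i < n \<and> j < n \<and> i \<noteq> j \<and> Cl (ts ! i) = Cl (ts ! j) \<and> f i = f j")
      case True
      then obtain i j where ij: "i < n" "j < n" "i \<noteq> j" "Cl (ts ! i) = Cl (ts ! j)" "f i = f j" by blast
      have "row ?D i = row ?D j"
        using ij a(3)[OF tsS[OF ij(1)] tsS[OF ij(2)] ij(4)] by (intro eq_vecI) (auto simp: b_def)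
      hence "det ?D = 0" using ij by (intro det_identical_rows[of ?D n i j]) auto
      thus ?thesis using vge_0[OF EE_pos] by simp
    next
      case False
      have "vge EE (\<Sum>i=0..<n. f i * rr (pid (ts ! i))) (\<Prod>i=0..<n. s i ^ f i)"
        by (intro vge_prod vge_power) (use vge_uniformizer tsS in \<open>simp add: s_def\<close>)
      moreover have "K \<le> (\<Sum>i=0..<n. f i * rr (pid (ts ! i)))"
        unfolding K_def by (rule class_weight_le[OF ts n_def[symmetric]]) (use False in blast)
      ultimately have "vge EE K (\<Prod>i=0..<n. s i ^ f i)" using vge_mono by blast
      moreover have "det ?D \<in> V" by (rule det_in_V[of _ n]) (auto simp: bV)
      ultimately show ?thesis using vge_V_mult by (metis mult.commute)
    qed
  qed
  from vge_add[OF diff this] show ?thesis by (simp add: K_def)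
qed

end

subsection \<open>Inertia degrees\<close>

abbreviation (input) OI :: "'k::field_char_0 ring" where "OI \<equiv> ring_of_integers"

lemma OI_sel:
  "carrier (OI :: 'k::field_char_0 ring) = {x. algebraic_int x}" "x \<oplus>\<^bsub>OI\<^esub> y = x + y" "x \<otimes>\<^bsub>OI\<^esub> y = x * y"
  "\<zero>\<^bsub>OI\<^esub> = 0" "\<one>\<^bsub>OI\<^esub> = 1" for x y :: "'k::field_char_0"
  by (simp_all add: ring_of_integers_def ring_of_type_algebra_def)

lemma OI_coset: "I +>\<^bsub>OI\<^esub> (x::'k::field_char_0) = (\<lambda>h. h + x) ` I"
  unfolding a_r_coset_def' OI_sel by auto

lemma OI_ideal:
  assumes "ideal I (OI :: 'k::field_char_0 ring)"
  shows "I \<subseteq> {x. algebraic_int x}" "0 \<in> I" "\<And>x y. x \<in> I \<Longrightarrow> y \<in> I \<Longrightarrow> x + y \<in> I"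
    "\<And>x y. algebraic_int x \<Longrightarrow> y \<in> I \<Longrightarrow> x * y \<in> I"
proof -
  interpret ideal I "OI :: 'k ring" by (rule assms)
  show "I \<subseteq> {x. algebraic_int x}" using a_subset by (simp add: OI_sel)
  show "0 \<in> I" using additive_subgroup.zero_closed[OF is_additive_subgroup] by (simp add: OI_sel)
  show "x + y \<in> I" if "x \<in> I" "y \<in> I" for x y
    using additive_subgroup.a_closed[OF is_additive_subgroup that] by (simp add: OI_sel)
  show "x * y \<in> I" if "algebraic_int x" "y \<in> I" for x y
    using I_l_closed[OF that(2), of x] that(1) by (simp add: OI_sel)
qed

lemma OI_coset_eq_iff:
  assumes "ideal I (OI :: 'k::field_char_0 ring)"
  shows "I +>\<^bsub>OI\<^esub> x = I +>\<^bsub>OI\<^esub> y \<longleftrightarrow> x - y \<in> I"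
proof -
  note z = OI_ideal(2)[OF assms] and a = OI_ideal(3)[OF assms]
  have m: "- u \<in> I" if "u \<in> I" for u
    using OI_ideal(4)[OF assms, of "- 1" u] that by simp
  show ?thesis unfolding OI_coset
  proof
    assume e: "(\<lambda>h. h + x) ` I = (\<lambda>h. h + y) ` I"
    have "0 + x \<in> (\<lambda>h. h + x) ` I" using z by (rule imageI)
    hence "x \<in> (\<lambda>h. h + y) ` I" using e by simp
    thus "x - y \<in> I" by auto
  next
    assume d: "x - y \<in> I"
    show "(\<lambda>h. h + x) ` I = (\<lambda>h. h + y) ` I"
    proof (intro equalityI subsetI; elim imageE)
      fix t h assume h: "t = h + x" "h \<in> I"
      have "t = (h + (x - y)) + y" using h by simp
      thus "t \<in> (\<lambda>h. h + y) ` I" using a[OF h(2) d] by blast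
    next
      fix t h assume h: "t = h + y" "h \<in> I"
      have "t = (h + - (x - y)) + x" using h by simp
      thus "t \<in> (\<lambda>h. h + x) ` I" using a[OF h(2) m[OF d]] by blast
    qed
  qed
qed

context local_fld
begin

lemma cring_OI: "cring (OI :: 'k ring)"
proof -
  interpret ring "OI :: 'k ring" by (rule ring_O)
  show ?thesis by unfold_locales (simp add: OI_sel)
qed

lemma pid_primeideal:
  assumes s: "\<sigma> \<in> Sig" shows "primeideal (pid \<sigma>) OI"
proof -
  interpret cring "OI :: 'k ring" by (rule cring_OI)
  have sub: "pid \<sigma> \<subseteq> AI" using pid_subset by blast
  have "subgroup (pid \<sigma>) (add_monoid OI)"
  proof (rule add.subgroupI)
    show "pid \<sigma> \<subseteq> carrier OI" using sub by (simp add: OI_sel)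
    show "pid \<sigma> \<noteq> {}" using p_in_pid[OF s] by blast
    show "\<ominus>\<^bsub>OI\<^esub> a \<in> pid \<sigma>" if a: "a \<in> pid \<sigma>" for a
    proof -
      have "- 1 * a \<in> pid \<sigma>" by (rule pid_mult[OF s a]) simp
      moreover have "\<ominus>\<^bsub>OI\<^esub> a = - a"
        by (rule minus_equality) (use sub a in \<open>auto simp: OI_sel\<close>)
      ultimately show ?thesis by simp
    qed
    show "a \<oplus>\<^bsub>OI\<^esub> b \<in> pid \<sigma>" if "a \<in> pid \<sigma>" "b \<in> pid \<sigma>" for a b
      using pid_add[OF s that] by (simp add: OI_sel)
  qed
  hence I: "ideal (pid \<sigma>) OI"
    by (intro idealI[OF ring_O]) (use pid_mult[OF s] in \<open>auto simp: OI_sel mult.commute\<close>)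
  show ?thesis
  proof (intro primeideal.intro primeideal_axioms.intro I cring_OI)
    show "carrier OI \<noteq> pid \<sigma>" using one_notin_pid[OF s] O_closed(2) unfolding OI_sel by metis
    show "a \<in> pid \<sigma> \<or> b \<in> pid \<sigma>" if "a \<in> carrier OI" "b \<in> carrier OI" "a \<otimes>\<^bsub>OI\<^esub> b \<in> pid \<sigma>" for a b
      using pid_prime[OF s, of a b] that unfolding OI_sel by blast
  qed
qed

text \<open>The residue basis becomes a basis of the quotient field over the image of the integers,
  once combinations of cosets are read as cosets of integer combinations.\<close>

lemma inertia_degree_pid:
  assumes s: "\<sigma> \<in> Sig" shows "inertia_degree (pid \<sigma>) = ff (pid \<sigma>)"
proof -
  define Q where "Q = pid \<sigma>"
  define F where "F = OI Quot Q"
  define co where "co x = Q +>\<^bsub>OI\<^esub> x" for x :: 'k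
  define K where "K = range (\<lambda>z::int. co (of_int z))"
  note res = residues[OF s, folded Q_def]
  interpret O: primeideal Q "OI :: 'k ring" unfolding Q_def by (rule pid_primeideal[OF s])
  have idl: "ideal Q OI" by (rule O.ideal_axioms)
  note co_eq = OI_coset_eq_iff[OF idl, folded co_def]
  have mul: "co x \<otimes>\<^bsub>F\<^esub> co y = co (x * y)" if "x \<in> AI" "y \<in> AI" for x y
    using O.rcoset_mult_add[of x y] that by (simp add: F_def FactRing_def co_def OI_sel)
  have add: "co x \<oplus>\<^bsub>F\<^esub> co y = co (x + y)" if "x \<in> AI" "y \<in> AI" for x y
    using O.a_rcos_sum[of x y] that by (simp add: F_def FactRing_def co_def OI_sel)
  have zero: "\<zero>\<^bsub>F\<^esub> = co 0" by (simp add: F_def FactRing_def co_def OI_coset)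
  have one: "\<one>\<^bsub>F\<^esub> = co 1" by (simp add: F_def FactRing_def co_def OI_sel)
  have carr: "carrier F = co ` AI" by (auto simp: F_def FactRing_def A_RCOSETS_def' co_def OI_sel)
  interpret F: domain F unfolding F_def by (rule O.quotient_is_domain)
  have invF: "\<exists>y\<in>carrier F. x \<otimes>\<^bsub>F\<^esub> y = \<one>\<^bsub>F\<^esub>" if x: "x \<in> carrier F" "x \<noteq> \<zero>\<^bsub>F\<^esub>" for x
  proof -
    obtain a where a: "a \<in> AI" "x = co a" using x(1) carr by blast
    have "a \<notin> Q" using x(2) co_eq[of a 0] a(2) zero by auto
    then obtain n where n: "n \<ge> 1" "1 - a ^ n \<in> Q" using pid_power_one[OF s a(1)] unfolding Q_def by metis
    have "x \<otimes>\<^bsub>F\<^esub> co (a ^ (n - 1)) = co (a * a ^ (n - 1))" unfolding a(2) by (rule mul[OF a(1) O_power[OF a(1)]])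
    also have "\<dots> = co (a ^ n)" using n(1) by (metis One_nat_def Suc_le_D diff_Suc_1 power_Suc)
    also have "\<dots> = \<one>\<^bsub>F\<^esub>" unfolding one using co_eq[of 1 "a ^ n"] n(2) by simp
    finally show ?thesis using carr O_power[OF a(1)] by blast
  qed
  have "field F"
    by (rule F.cring_fieldI2) (use F.zero_not_one invF in auto)
  then interpret F: field F .
  have Kcarr: "K \<subseteq> carrier F" unfolding K_def carr using O_closed(7) by blast
  have subK: "subfield K F"
  proof (rule F.subfieldI')
    show "subring K F"
    proof (rule F.subringI[OF Kcarr])
      show "\<one>\<^bsub>F\<^esub> \<in> K" unfolding one K_def by (rule range_eqI[of _ _ 1]) simp
      fix h assume "h \<in> K"
      then obtain z where z: "h = co (of_int z)" by (auto simp: K_def)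
      have "\<ominus>\<^bsub>F\<^esub> h = co (of_int (- z))"
        by (rule F.minus_equality) (use z add[OF O_closed(7) O_closed(7), of "- z" z] zero Kcarr \<open>h \<in> K\<close> carr O_closed(7) in auto)
      thus "\<ominus>\<^bsub>F\<^esub> h \<in> K" unfolding K_def by (rule range_eqI)
      fix h' assume "h' \<in> K"
      then obtain z' where z': "h' = co (of_int z')" by (auto simp: K_def)
      have "h \<otimes>\<^bsub>F\<^esub> h' = co (of_int (z * z'))" unfolding z z' using mul[OF O_closed(7) O_closed(7)] by simp
      thus "h \<otimes>\<^bsub>F\<^esub> h' \<in> K" unfolding K_def by (rule range_eqI)
      have "h \<oplus>\<^bsub>F\<^esub> h' = co (of_int (z + z'))" unfolding z z' using add[OF O_closed(7) O_closed(7)] by simp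
      thus "h \<oplus>\<^bsub>F\<^esub> h' \<in> K" unfolding K_def by (rule range_eqI)
    qed
    fix k assume k: "k \<in> K - {\<zero>\<^bsub>F\<^esub>}"
    then obtain z where z: "k = co (of_int z)" by (auto simp: K_def)
    have "\<not> int p dvd z"
    proof
      assume "int p dvd z"
      then obtain m where "z = int p * m" ..
      hence "of_int z \<in> Q" using pid_mult[OF s p_in_pid[OF s] O_closed(7)[of m]] by (simp add: Q_def mult.commute)
      thus False using k z zero co_eq[of "of_int z" 0] by auto
    qed
    hence "coprime (int p) z" using prime_p by (simp add: prime_imp_coprime)
    then obtain a b where ab: "a * int p + b * z = 1" by (metis bezout_int coprime_iff_gcd_eq_1)
    have "co (of_int z) \<otimes>\<^bsub>F\<^esub> co (of_int b) = co (of_int (b * z))"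
      using mul[OF O_closed(7) O_closed(7)] by (simp add: mult.commute)
    also have "\<dots> = \<one>\<^bsub>F\<^esub>"
    proof -
      have "1 - of_int (b * z) = (of_int a * of_nat p :: 'k)"
        using arg_cong[OF ab, of "of_int :: int \<Rightarrow> 'k"] by (simp add: algebra_simps)
      hence "1 - of_int (b * z) \<in> Q" using pid_mult[OF s p_in_pid[OF s] O_closed(7)[of a]] by (simp add: Q_def)
      thus ?thesis unfolding one using co_eq by metis
    qed
    finally have "inv\<^bsub>F\<^esub> k = co (of_int b)" unfolding z
      by (intro F.comm_inv_char) (use carr O_closed(7) in auto)
    thus "inv\<^bsub>F\<^esub> k \<in> K" unfolding K_def by (rule range_eqI)
  qed
  have comb: "F.combine (map (\<lambda>z. co (of_int z)) zs) (map co us) = co (\<Sum>(z, u)\<leftarrow>zip zs us. of_int z * u)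
      \<and> (\<Sum>(z, u)\<leftarrow>zip zs us. of_int z * u) \<in> AI"
    if "set us \<subseteq> AI" for zs :: "int list" and us
    using that
  proof (induction us arbitrary: zs)
    case Nil
    thus ?case using O_closed(1) by (simp add: zero)
  next
    case (Cons u us)
    show ?case
    proof (cases zs)
      case Nil
      thus ?thesis using O_closed(1) by (simp add: zero)
    next
      case (Cons z zs')
      have u: "u \<in> AI" "of_int z * u \<in> AI" using Cons.prems O_closed(4,7) by auto
      have IH: "F.combine (map (\<lambda>z. co (of_int z)) zs') (map co us) = co (\<Sum>(z, u)\<leftarrow>zip zs' us. of_int z * u)"
        "(\<Sum>(z, u)\<leftarrow>zip zs' us. of_int z * u) \<in> AI" using Cons.IH[of zs'] Cons.prems by auto
      show ?thesis unfolding Cons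
        using mul[OF O_closed(7)[of z] u(1)] add[OF u(2) IH(2)] IH O_closed(3)[OF u(2) IH(2)] by simp
    qed
  qed
  have Ks_int: "\<exists>zs. Ks = map (\<lambda>z. co (of_int z)) zs" if "set Ks \<subseteq> K" for Ks
    using that by (induction Ks) (auto simp: K_def, metis list.simps(9))
  \<comment> \<open>Coefficients listed along a distinct list of basis elements are turned into a
    function of the element, the form in which \<open>residues\<close> speaks of them.\<close>
  have rel: "\<exists>c. zs = map c us" if "length zs = length us" "distinct us" for zs :: "int list" and us :: "'k list"
    using map_of_zip_nth[OF that(1)[symmetric] that(2)] that(1)
    by (intro exI[of _ "\<lambda>u. the (map_of (zip us zs) u)"] nth_equalityI) auto
  have sum: "(\<Sum>(z, u)\<leftarrow>zip (map c us) us. of_int z * u) = (\<Sum>u\<in>set us. of_int (c u) * u)"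
    if "distinct us" for c and us :: "'k list"
    using that by (induction us) auto
  have ind: "F.independent K (map co us)" if "distinct us" "set us \<subseteq> YY Q" for us
    using that
  proof (induction us)
    case (Cons u us)
    have usA: "set us \<subseteq> AI" "u \<in> AI" using Cons.prems res(2) by auto
    have "co u \<notin> F.Span K (map co us)"
    proof
      assume "co u \<in> F.Span K (map co us)"
      moreover have "set (map co us) \<subseteq> carrier F" using usA(1) carr by auto
      ultimately obtain Ks where Ks: "set Ks \<subseteq> K" "length Ks = length (map co us)" "co u = F.combine Ks (map co us)"
        using F.Span_mem_iff_length_version[OF subK] by blast
      obtain zs where zs: "Ks = map (\<lambda>z. co (of_int z)) zs" using Ks_int[OF Ks(1)] by blast
      obtain c where c: "zs = map c us" using rel[of zs us] Ks(2) Cons.prems(1) by (auto simp: zs)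
      have "co u = co (\<Sum>v\<in>set us. of_int (c v) * v)"
        using Ks(3) comb[OF usA(1), of zs] sum[of us c] Cons.prems(1) unfolding zs c by simp
      hence d: "u - (\<Sum>v\<in>set us. of_int (c v) * v) \<in> Q" by (simp add: co_eq)
      \<comment> \<open>Coefficient 1 at \<open>u\<close> and the negated combination at the others:
        independence modulo p would force p to divide 1.\<close>
      define c' where "c' v = (if v = u then 1 else if v \<in> set us then - c v else 0)" for v
      have "(\<Sum>v\<in>YY Q. of_int (c' v) * v) = (\<Sum>v\<in>insert u (set us). of_int (c' v) * v)"
        using res(1) Cons.prems(2) by (intro sum.mono_neutral_right) (auto simp: c'_def)
      also have "\<dots> = u + (\<Sum>v\<in>set us. of_int (c' v) * v)" using Cons.prems(1) by (simp add: c'_def)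
      also have "(\<Sum>v\<in>set us. of_int (c' v) * v) = (\<Sum>v\<in>set us. - (of_int (c v) * v))"
        using Cons.prems(1) by (intro sum.cong) (auto simp: c'_def)
      finally have "(\<Sum>v\<in>YY Q. of_int (c' v) * v) \<in> Q" using d by (simp add: sum_negf)
      hence "int p dvd c' u" by (rule res(3)) (use Cons.prems in auto)
      thus False using prime_p by (simp add: c'_def)
    qed
    moreover have "co u \<in> carrier F" using carr usA(2) by blast
    ultimately show ?case using Cons by (auto intro: F.li_Cons)
  qed auto
  obtain us where us: "set us = YY Q" "distinct us" using finite_distinct_list[OF res(1)] by blast
  have "F.Span K (map co us) = carrier F"
  proof
    have sc: "set (map co us) \<subseteq> carrier F" using us(1) res(2) carr by auto
    show "F.Span K (map co us) \<subseteq> carrier F" using F.Span_in_carrier[OF Kcarr sc] .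
    show "carrier F \<subseteq> F.Span K (map co us)"
    proof
      fix x assume "x \<in> carrier F"
      then obtain a where a: "a \<in> AI" "x = co a" using carr by blast
      obtain c where c: "a - (\<Sum>y\<in>YY Q. of_int (c y) * y) \<in> Q" using res(4)[OF a(1)] by blast
      have "x = F.combine (map (\<lambda>z. co (of_int z)) (map c us)) (map co us)"
        using comb[of us "map c us"] sum[OF us(2), of c] us(1) res(2) c by (simp add: a(2) co_eq)
      moreover have "set (map (\<lambda>z. co (of_int z)) (map c us)) \<subseteq> K" by (auto simp: K_def)
      ultimately show "x \<in> F.Span K (map co us)"
        using F.Span_mem_iff_length_version[OF subK sc] by (metis length_map)
    qed
  qed
  hence "F.dimension (length (map co us)) K (carrier F)" by (intro F.dimensionI[OF subK]) (use ind us in auto)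
  hence "F.dim K (carrier F) = length us" using F.dimI[OF subK] by (simp add: over_def)
  moreover have "length us = ff Q" using us distinct_card unfolding ff_def by metis
  ultimately show ?thesis by (simp add: inertia_degree_def Let_def F_def K_def co_def Q_def)
qed

text \<open>A prime containing p is a union of classes modulo p, hence determined by which of the
  finitely many representatives it contains. Finiteness keeps \<open>inertia_sum\<close> from
  collapsing to a sum over an infinite set, which is 0.\<close>

lemma finite_primes_above: "finite (primes_above p :: 'k set set)"
proof -
  obtain B where B: "finite B" "B \<subseteq> AI" "\<And>x. x \<in> AI \<Longrightarrow> \<exists>b\<in>B. \<exists>y\<in>AI. x - b = of_nat p * y" by (rule finite_mod_p) blast
  have sub: "P1 \<subseteq> P2" if P: "P1 \<in> primes_above p" "P2 \<in> primes_above p" "P1 \<inter> B = P2 \<inter> B" for P1 P2 :: "'k set"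
  proof
    interpret P1: primeideal P1 OI using P(1) by (simp add: primes_above_def)
    interpret P2: primeideal P2 OI using P(2) by (simp add: primes_above_def)
    have pP: "of_nat p * y \<in> P1" "of_nat p * y \<in> P2" if "y \<in> AI" for y
      using P1.I_r_closed[of "of_nat p" y] P2.I_r_closed[of "of_nat p" y] P(1,2) that by (simp_all add: OI_sel primes_above_def)
    fix x assume x: "x \<in> P1"
    have xA: "x \<in> AI" using P1.a_subset x by (auto simp: OI_sel)
    obtain b y where b: "b \<in> B" "y \<in> AI" "x - b = of_nat p * y" using B(3)[OF xA] by blast
    have "- y \<in> AI" using b(2) by simp
    from OI_ideal(3)[OF P1.ideal_axioms x pP(1)[OF this]] have "b \<in> P1" using b(3) by (simp add: OI_sel algebra_simps)
    hence "b \<in> P2" using P(3) b(1) by blast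
    from OI_ideal(3)[OF P2.ideal_axioms this pP(2)[OF b(2)]] show "x \<in> P2" using b(3) by (simp add: OI_sel algebra_simps)
  qed
  have "inj_on (\<lambda>Q. Q \<inter> B) (primes_above p :: 'k set set)" using sub by (intro inj_onI equalityI) blast+
  moreover have "(\<lambda>Q. Q \<inter> B) ` (primes_above p :: 'k set set) \<subseteq> Pow B" by blast
  ultimately show ?thesis using B(1) by (meson finite_Pow_iff inj_on_finite)
qed

text \<open>Enlarging the inertia sum only lowers the exponent d - f_p of the tame discriminant, so
  an inequality in this direction is what the primes coming from embeddings have to provide.\<close>

lemma sum_ff_le_inertia_sum: "(\<Sum>Q\<in>Primes. ff Q) \<le> inertia_sum ty p"
proof -
  have "Primes \<subseteq> (primes_above p :: 'k set set)"
    using pid_primeideal p_in_pid by (auto simp: Primes_def primes_above_def)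
  hence "(\<Sum>Q\<in>Primes. inertia_degree Q) \<le> (\<Sum>Q\<in>(primes_above p :: 'k set set). inertia_degree Q)"
    by (rule sum_mono2[OF finite_primes_above]) simp_all
  moreover have "(\<Sum>Q\<in>Primes. inertia_degree Q) = (\<Sum>Q\<in>Primes. ff Q)"
    by (intro sum.cong) (auto simp: Primes_def inertia_degree_pid)
  ultimately show ?thesis by (simp add: inertia_sum_def)
qed

end

subsection \<open>The index of an ideal\<close>

lemma OI_ideal_sum:
  assumes I: "ideal I (OI :: 'k::field_char_0 ring)"
  shows "(\<And>i. i \<in> A \<Longrightarrow> f i \<in> I) \<Longrightarrow> (\<Sum>i\<in>A. f i) \<in> I"
  by (induction A rule: infinite_finite_induct) (auto intro: OI_ideal[OF I])

lemma (in number_fld) local_fldI: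
  assumes "ring (OI :: 'k ring)" "valuation p (V :: rat alg_closure set)" shows "local_fld ty p V"
  by (intro local_fld.intro local_fld_axioms.intro assms number_fld_axioms)

text \<open>Induction on the prime factors of \<open>s\<close>: representatives modulo p and modulo
  the remaining factor combine to b + p c. Every p is treated with a valuation ring of its
  own.\<close>

lemma (in number_fld) finite_mod_nat:
  assumes R: "ring (OI :: 'k ring)" and s: "s > 0"
  shows "\<exists>B. finite B \<and> B \<subseteq> {x. algebraic_int x} \<and>
    (\<forall>x::'k. algebraic_int x \<longrightarrow> (\<exists>b\<in>B. \<exists>y. algebraic_int y \<and> x - b = of_nat s * y))"
  using s
proof (induction s rule: prime_divisors_induct)
  case zero thus ?case by simp
next
  case (unit s)
  thus ?case by (intro exI[of _ "{0}"]) auto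
next
  case (factor p s)
  obtain V :: "rat alg_closure set" where V: "valuation p V" using valuation_exists[OF factor(1)] by blast
  interpret local_fld ty p V by (rule local_fldI[OF R V])
  obtain B where B: "finite B" "B \<subseteq> AI" "\<And>x. x \<in> AI \<Longrightarrow> \<exists>b\<in>B. \<exists>y\<in>AI. x - b = of_nat p * y"
    by (rule finite_mod_p) blast
  obtain C where C: "finite C" "C \<subseteq> AI" "\<And>x. x \<in> AI \<Longrightarrow> \<exists>b\<in>C. \<exists>y\<in>AI. x - b = of_nat s * y"
    using factor by auto
  have "\<exists>b\<in>(\<lambda>(b, c). b + of_nat p * c) ` (B \<times> C). \<exists>y\<in>AI. x - b = of_nat (p * s) * y" if x: "x \<in> AI" for x
  proof -
    obtain b y where b: "b \<in> B" "y \<in> AI" "x - b = of_nat p * y" using B(3)[OF x] by blast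
    obtain c z where c: "c \<in> C" "z \<in> AI" "y - c = of_nat s * z" using C(3)[OF b(2)] by blast
    have "x - (b + of_nat p * c) = of_nat p * (y - c)" using b(3) by (simp add: algebra_simps)
    hence "x - (b + of_nat p * c) = of_nat (p * s) * z" using c(3) by simp
    thus ?thesis using b(1) c(1,2) by force
  qed
  moreover have "(\<lambda>(b, c). b + of_nat p * c) ` (B \<times> C) \<subseteq> AI"
    using B(2) C(2) by (auto intro!: O_closed(3,4,8)[simplified])
  ultimately show ?case using B(1) C(1)
    by (intro exI[of _ "(\<lambda>(b, c). b + of_nat p * c) ` (B \<times> C)"]) auto
qed

text \<open>A nonzero ideal contains a positive integer, modulo which there are finitely many
  residues.\<close>

lemma (in number_fld) finite_cosets:
  assumes I: "ideal I (OI :: 'k ring)" and I0: "I \<noteq> {0}"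
  shows "finite (a_rcosets\<^bsub>OI\<^esub> I)"
proof -
  note R = ideal.axioms(2)[OF I]
  \<comment> \<open>The prime 2 is arbitrary; the interpretation gives access to the closure
    properties of the integers.\<close>
  obtain V :: "rat alg_closure set" where V: "valuation 2 V" using valuation_exists[OF two_is_prime_nat] by blast
  interpret local_fld ty 2 V by (rule local_fldI[OF R V])
  obtain x where x: "x \<in> I" "x \<noteq> 0" using I0 OI_ideal(2)[OF I] by blast
  have xA: "x \<in> AI" using x(1) OI_ideal(1)[OF I] by blast
  obtain c q where c: "c \<noteq> 0" "\<And>i. Polynomial.coeff q i \<in> \<int>" "of_int c = x * poly q x"
    by (rule algebraic_divides_integer[OF algebraic_elem x(2)]) blast
  have "poly q x \<in> AI" unfolding poly_altdef
  proof (intro O_sum O_closed(4) O_power xA)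
    show "Polynomial.coeff q i \<in> AI" for i using c(2)[of i] O_closed(7) by (metis Ints_cases)
  qed
  hence "of_int c \<in> I" using OI_ideal(4)[OF I _ x(1), of "poly q x"] by (simp add: c(3) mult.commute)
  hence "of_int (sgn c) * of_int c \<in> I" using OI_ideal(4)[OF I, of "of_int (sgn c)"] by simp
  hence cI: "of_nat (nat \<bar>c\<bar>) \<in> I"
    by (metis abs_sgn mult.commute of_int_mult abs_ge_zero of_nat_nat)
  obtain B where B: "finite B" "\<And>x. x \<in> AI \<Longrightarrow> \<exists>b\<in>B. \<exists>y\<in>AI. x - b = of_nat (nat \<bar>c\<bar>) * y"
    using finite_mod_nat[OF R, of "nat \<bar>c\<bar>"] c(1) by auto
  have "a_rcosets\<^bsub>OI\<^esub> I \<subseteq> (\<lambda>b. I +>\<^bsub>OI\<^esub> b) ` B"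
  proof
    fix K assume "K \<in> a_rcosets\<^bsub>OI\<^esub> I"
    then obtain x where x: "x \<in> AI" "K = I +>\<^bsub>OI\<^esub> x" by (auto simp: A_RCOSETS_def' OI_sel)
    obtain b y where b: "b \<in> B" "y \<in> AI" "x - b = of_nat (nat \<bar>c\<bar>) * y" using B(2)[OF x(1)] by blast
    have "x - b \<in> I" using OI_ideal(4)[OF I, of y, OF _ cI] b(2,3) by (simp add: mult.commute)
    thus "K \<in> (\<lambda>b. I +>\<^bsub>OI\<^esub> b) ` B" using x(2) b(1) OI_coset_eq_iff[OF I] by blast
  qed
  thus ?thesis using B(1) finite_subset by blast
qed

lemma (in number_fld) ideal_index_pos:
  assumes I: "ideal I (OI :: 'k ring)" and I0: "I \<noteq> {0}" shows "ideal_index I > 0"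
proof -
  have "I +>\<^bsub>OI\<^esub> 0 \<in> a_rcosets\<^bsub>OI\<^esub> I" by (auto simp: A_RCOSETS_def' OI_sel)
  thus ?thesis unfolding ideal_index_def using finite_cosets[OF assms] card_gt_0_iff by blast
qed

section \<open>Orders at the primes above p and the p-part of the index\<close>

context local_fld
begin

text \<open>If arbitrarily high powers of the uniformizer divided \<open>x\<close>, so would all
  powers of p; hence there is a largest exponent.\<close>

lemma order_exists:
  assumes s: "\<sigma> \<in> Sig" and x: "x \<in> AI" "x \<noteq> 0"
  obtains n where "\<sigma> (x / ww (pid \<sigma>) ^ n) \<in> V" "\<sigma> (x / ww (pid \<sigma>) ^ n) \<notin> M"
proof -
  let ?w = "ww (pid \<sigma>)" let ?e = "ee (pid \<sigma>)"
  let ?R = "\<lambda>n. \<sigma> (x / ?w ^ n) \<in> V"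
  note emb = embedding_simps[OF s]
  have w0: "\<sigma> ?w \<noteq> 0" and wV: "\<sigma> ?w \<in> V" using uniformizer(1,2)[OF s] emb emb_O[OF s] by auto
  obtain N where N: "\<not> vdvd (P ^ N) (\<sigma> x)"
    using not_all_P_powers_vdvd[OF algebraic_qbar, of "\<sigma> x"] x(2) emb by blast
  have bound: "n \<le> ?e * N" if n: "?R n" for n
  proof (rule ccontr)
    assume "\<not> n \<le> ?e * N"
    hence "vdvd (\<sigma> ?w ^ (?e * N)) (\<sigma> ?w ^ n)" by (intro vdvd_power_le[OF wV]) simp
    moreover have "vdvd (P ^ N) (\<sigma> ?w ^ (?e * N))"
      unfolding power_mult by (rule vdvd_power[OF uniformizer_vdvd(2)[OF s]])
    moreover have "vdvd (\<sigma> ?w ^ n) (\<sigma> x)" using n w0 by (simp add: vdvd_iff emb)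
    ultimately show False using N vdvd_trans by blast
  qed
  have R0: "?R 0" using emb_O[OF s x(1)] by simp
  define n where "n = (GREATEST n. ?R n)"
  have n: "?R n" unfolding n_def by (rule GreatestI_nat[of ?R, OF R0 bound])
  have "\<not> ?R (Suc n)" using Greatest_le_nat[of ?R, OF _ bound, of "Suc n"] unfolding n_def by auto
  hence "\<sigma> (x / ?w ^ n) \<notin> M" using uniformizer(5)[OF s, of "x / ?w ^ n"] by (auto simp: mult.commute)
  thus ?thesis using that n by blast
qed

lemma ideal_order:
  assumes I: "ideal I (OI :: 'k ring)" and I0: "I \<noteq> {0}" and Q: "Q \<in> Primes"
  shows "\<exists>n y. y \<in> I \<and> (\<forall>\<sigma>\<in>Sig. pid \<sigma> = Q \<longrightarrow> \<sigma> (y / ww Q ^ n) \<in> V \<and> \<sigma> (y / ww Q ^ n) \<notin> M \<and>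
    (\<forall>x\<in>I. \<sigma> (x / ww Q ^ n) \<in> V))"
proof -
  obtain \<sigma> where s: "\<sigma> \<in> Sig" "Q = pid \<sigma>" using Q by (auto simp: Primes_def)
  note emb = embedding_simps[OF s(1)]
  let ?R = "\<lambda>n. \<exists>y\<in>I. \<sigma> (y / ww Q ^ n) \<in> V \<and> \<sigma> (y / ww Q ^ n) \<notin> M"
  have IA: "x \<in> AI" if "x \<in> I" for x using that OI_ideal(1)[OF I] by blast
  obtain x where x: "x \<in> I" "x \<noteq> 0" using I0 OI_ideal(2)[OF I] by blast
  have "\<exists>n. ?R n" using order_exists[OF s(1) IA[OF x(1)] x(2)] x(1) s(2) by metis
  then obtain n where n: "?R n" "\<And>m. ?R m \<Longrightarrow> n \<le> m" using exists_least_iff[of ?R] not_less by blast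
  obtain y where y: "y \<in> I" "\<sigma> (y / ww Q ^ n) \<in> V" "\<sigma> (y / ww Q ^ n) \<notin> M" using n(1) by blast
  have w: "\<sigma> (ww Q) \<in> V" "\<sigma> (ww Q) \<noteq> 0" using uniformizer(1,2)[OF s(1)] emb(8) emb_O[OF s(1)] s(2) by auto
  have all: "\<sigma> (x / ww Q ^ n) \<in> V" if x: "x \<in> I" for x
  proof (cases "x = 0")
    case True thus ?thesis using V_closed(2) emb(2) by simp
  next
    case False
    obtain m where m: "\<sigma> (x / ww Q ^ m) \<in> V" "\<sigma> (x / ww Q ^ m) \<notin> M"
      using order_exists[OF s(1) IA[OF x] False] s(2) by metis
    hence "n \<le> m" using n(2) x by blast
    hence "ww Q ^ m = ww Q ^ (m - n) * ww Q ^ n" by (simp flip: power_add)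
    hence "x / ww Q ^ n = x / ww Q ^ m * ww Q ^ (m - n)" using w(2) emb(8) by (simp add: field_simps)
    thus ?thesis using V_closed(4)[OF m(1) V_closed(7)[OF w(1), of "m - n"]] by (simp add: emb)
  qed
  show ?thesis
  proof (intro exI[of _ n] exI[of _ y] conjI ballI impI y(1))
    fix \<tau> assume t: "\<tau> \<in> Sig" "pid \<tau> = Q"
    have eq: "pid \<sigma> = pid \<tau>" using t(2) s(2) by simp
    show "\<tau> (y / ww Q ^ n) \<in> V" by (rule pid_eq_V[OF s(1) t(1) eq y(2)])
    show "\<tau> (y / ww Q ^ n) \<notin> M" using pid_eq_M[OF t(1) s(1) eq[symmetric]] y(3) by blast
    show "\<tau> (x / ww Q ^ n) \<in> V" if "x \<in> I" for x by (rule pid_eq_V[OF s(1) t(1) eq all[OF that]])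
  qed
qed

text \<open>The generator is glued from local ones by the Chinese remainder theorem.\<close>

lemma ideal_locally_principal:
  assumes I: "ideal I (OI :: 'k ring)" and I0: "I \<noteq> {0}"
  obtains y n where "y \<in> I" "y \<noteq> 0"
    "\<And>\<sigma>. \<sigma> \<in> Sig \<Longrightarrow> \<sigma> (y / ww (pid \<sigma>) ^ n (pid \<sigma>)) \<in> V \<and> \<sigma> (y / ww (pid \<sigma>) ^ n (pid \<sigma>)) \<notin> M"
    "\<And>x \<sigma>. x \<in> I \<Longrightarrow> \<sigma> \<in> Sig \<Longrightarrow> \<sigma> (x / y) \<in> V"
proof -
  let ?R = "\<lambda>Q n y. y \<in> I \<and> (\<forall>\<sigma>\<in>Sig. pid \<sigma> = Q \<longrightarrow> \<sigma> (y / ww Q ^ n) \<in> V \<and> \<sigma> (y / ww Q ^ n) \<notin> M \<and>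
    (\<forall>x\<in>I. \<sigma> (x / ww Q ^ n) \<in> V))"
  define n where "n Q = (SOME n. \<exists>y. ?R Q n y)" for Q
  define b where "b Q = (SOME y. ?R Q (n Q) y)" for Q
  have b: "?R Q (n Q) (b Q)" if Q: "Q \<in> Primes" for Q
    unfolding b_def by (rule someI_ex, unfold n_def, rule someI_ex, rule ideal_order[OF I I0 Q])
  let ?C = "\<lambda>Q c. c \<in> AI \<and> (\<forall>\<sigma>\<in>Sig. (pid \<sigma> = Q \<longrightarrow> 1 - c \<in> Q) \<and> (pid \<sigma> \<noteq> Q \<longrightarrow> vdvd P (\<sigma> c)))"
  define c where "c Q = (SOME c. ?C Q c)" for Q
  have c: "?C Q (c Q)" if Q: "Q \<in> Primes" for Q
    unfolding c_def
  proof (rule someI_ex)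
    obtain \<sigma> where s: "\<sigma> \<in> Sig" "Q = pid \<sigma>" using Q by (auto simp: Primes_def)
    obtain c where "c \<in> AI" "1 - c \<in> pid \<sigma>" "\<And>\<tau>. \<tau> \<in> Sig \<Longrightarrow> pid \<tau> \<noteq> pid \<sigma> \<Longrightarrow> vdvd P (\<tau> c)"
      by (rule crt[OF s(1)]) blast
    thus "\<exists>c. ?C Q c" using s(2) by (intro exI[of _ c]) auto
  qed
  define y where "y = (\<Sum>Q\<in>Primes. c Q * b Q)"
  have yI: "y \<in> I" unfolding y_def
    by (intro OI_ideal_sum[OF I] OI_ideal(4)[OF I]) (use b c in auto)
  have unit: "\<sigma> (y / ww (pid \<sigma>) ^ n (pid \<sigma>)) \<in> V \<and> \<sigma> (y / ww (pid \<sigma>) ^ n (pid \<sigma>)) \<notin> M" if s: "\<sigma> \<in> Sig" for \<sigma>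
  proof -
    note emb = embedding_simps[OF s]
    let ?Q = "pid \<sigma>" let ?w = "ww ?Q ^ n ?Q"
    note Q = pid_Primes[OF s]
    have "y / ?w = c ?Q * (b ?Q / ?w) + (\<Sum>Q\<in>Primes - {?Q}. c Q * (b Q / ?w))"
      unfolding y_def by (subst sum.remove[OF finite_Primes Q]) (simp add: add_divide_distrib sum_divide_distrib)
    hence "\<sigma> (y / ?w) = \<sigma> (c ?Q) * \<sigma> (b ?Q / ?w) + (\<Sum>Q\<in>Primes - {?Q}. \<sigma> (c Q) * \<sigma> (b Q / ?w))"
      by (simp only: emb(3,4) embedding_sum[OF s])
    \<comment> \<open>\<open>b R\<close> belongs to \<open>I\<close>, so its order at the present
      prime is at least \<open>n ?Q\<close>; the factor \<open>c R\<close> then pushes the term into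
      the maximal ideal.\<close>
    moreover have "(\<Sum>Q\<in>Primes - {?Q}. \<sigma> (c Q) * \<sigma> (b Q / ?w)) \<in> M"
    proof (intro M_sum M_mult(1))
      fix R assume R: "R \<in> Primes - {?Q}"
      have "vdvd P (\<sigma> (c R))" using c[of R] R s by auto
      thus "\<sigma> (c R) \<in> M" using M_vdvd[OF P_in_M] by blast
      show "\<sigma> (b R / ?w) \<in> V" using b[of R] b[OF Q] R s by blast
    qed
    moreover have "\<sigma> (c ?Q) * \<sigma> (b ?Q / ?w) \<in> V" "\<sigma> (c ?Q) * \<sigma> (b ?Q / ?w) \<notin> M"
    proof -
      have 1: "\<sigma> (c ?Q) \<in> V" using c[OF Q] emb_O[OF s] by blast
      have 2: "\<sigma> (b ?Q / ?w) \<in> V" "\<sigma> (b ?Q / ?w) \<notin> M" using b[OF Q] s by blast+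
      have "1 - \<sigma> (c ?Q) \<in> M" using c[OF Q] s pid_M[of "1 - c ?Q" \<sigma>] emb by auto
      hence "\<sigma> (c ?Q) \<notin> M" using M_add[of "1 - \<sigma> (c ?Q)" "\<sigma> (c ?Q)"] one_notin_M by auto
      thus "\<sigma> (c ?Q) * \<sigma> (b ?Q / ?w) \<notin> M" using M_prime[OF 1 2(1)] 2(2) by blast
      show "\<sigma> (c ?Q) * \<sigma> (b ?Q / ?w) \<in> V" by (rule V_closed(4)[OF 1 2(1)])
    qed
    ultimately show ?thesis
      using M_diff[of "\<sigma> (y / ?w)" "\<Sum>Q\<in>Primes - {?Q}. \<sigma> (c Q) * \<sigma> (b Q / ?w)"] V_closed(6) M_subset by auto
  qed
  obtain \<sigma>0 where s0: "\<sigma>0 \<in> Sig" using card_Sig d_pos by (metis card.empty less_irrefl equals0I)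
  have y0: "y \<noteq> 0" using unit[OF s0] zero_in_M embedding_simps(2)[OF s0] by auto
  have quot: "\<sigma> (x / y) \<in> V" if x: "x \<in> I" and s: "\<sigma> \<in> Sig" for x \<sigma>
  proof -
    note emb = embedding_simps[OF s]
    let ?w = "ww (pid \<sigma>) ^ n (pid \<sigma>)"
    have w0: "?w \<noteq> 0" using uniformizer(2)[OF s] by simp
    have 1: "\<sigma> (x / ?w) \<in> V" using b[OF pid_Primes[OF s]] s x by blast
    have 2: "inverse (\<sigma> (y / ?w)) \<in> V" using unit[OF s] unit_inverse(1) by blast
    have "x / y = x / ?w * inverse (y / ?w)" using w0 by simp
    hence "\<sigma> (x / y) = \<sigma> (x / ?w) * inverse (\<sigma> (y / ?w))" by (simp only: emb(4,7))
    thus "\<sigma> (x / y) \<in> V" using V_closed(4)[OF 1 2] by simp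
  qed
  show ?thesis by (rule that[of y n]) (fact yI y0 unit quot)+
qed

text \<open>Coefficients below p and extensional functions make the digit patterns a finite set of
  exactly p^(n f) elements, which \<open>multiplicity_ideal_index_le\<close> counts.\<close>

lemma digits_exist:
  assumes Q: "Q \<in> Primes" and x: "x \<in> AI"
  shows "\<exists>c \<in> {..<n} \<rightarrow>\<^sub>E (YY Q \<rightarrow>\<^sub>E {..<p}). \<forall>\<sigma>\<in>Sig. pid \<sigma> = Q \<longrightarrow>
    \<sigma> ((x - (\<Sum>j<n. (\<Sum>u\<in>YY Q. of_nat (c j u) * u) * ww Q ^ j)) / ww Q ^ n) \<in> V"
proof -
  obtain \<sigma> where s: "\<sigma> \<in> Sig" "Q = pid \<sigma>" using Q by (auto simp: Primes_def)
  note res = residues[OF s(1), folded s(2)]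
  let ?val = "\<lambda>c :: 'k \<Rightarrow> nat. \<Sum>u\<in>YY Q. of_nat (c u) * u"
  let ?D = "\<lambda>z. \<exists>c \<in> YY Q \<rightarrow>\<^sub>E {..<p}. z = ?val c"
  have D: "\<exists>z. ?D z \<and> z \<in> AI \<and> y - z \<in> pid \<sigma>" if y: "y \<in> AI" for y
  proof -
    obtain c where c: "y - (\<Sum>u\<in>YY Q. of_int (c u) * u) \<in> Q" using res(4)[OF y] by blast
    define b where "b = restrict (\<lambda>u. nat (c u mod int p)) (YY Q)"
    have p0: "int p > 0" using prime_p prime_gt_0_nat by simp
    have b: "b \<in> YY Q \<rightarrow>\<^sub>E {..<p}" using p0 by (auto simp: b_def nat_less_iff)
    have "(of_nat (b u) :: 'k) = of_int (c u) - of_nat p * of_int (c u div int p)" if "u \<in> YY Q" for u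
    proof -
      have "int (b u) = c u - int p * (c u div int p)" using that p0 by (simp add: b_def minus_mult_div_eq_mod)
      from arg_cong[OF this, of "of_int :: int \<Rightarrow> 'k"] show ?thesis by simp
    qed
    hence "?val b = (\<Sum>u\<in>YY Q. of_int (c u) * u - of_nat p * (of_int (c u div int p) * u))"
      by (intro sum.cong) (simp_all add: left_diff_distrib mult.assoc)
    also have "\<dots> = (\<Sum>u\<in>YY Q. of_int (c u) * u) - of_nat p * (\<Sum>u\<in>YY Q. of_int (c u div int p) * u)"
      by (simp add: sum_subtractf sum_distrib_left)
    finally have eq: "y - ?val b = (y - (\<Sum>u\<in>YY Q. of_int (c u) * u)) + of_nat p * (\<Sum>u\<in>YY Q. of_int (c u div int p) * u)"
      by simp
    have "(\<Sum>u\<in>YY Q. of_int (c u div int p) * u) \<in> AI" using res(2) by (intro O_sum O_closed(4,7)) auto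
    hence "y - ?val b \<in> pid \<sigma>" unfolding eq using pid_add[OF s(1) _ pid_p[OF _ s(1)]] c s(2) by blast
    moreover have "?val b \<in> AI" using res(2) by (intro O_sum O_closed(4,8)) auto
    ultimately show ?thesis using b by blast
  qed
  note exp = digit_expansion[OF s(1), where D = ?D and n = n and x = x, OF emb_O[OF s(1) x] D, folded s(2)]
  have "\<exists>z r. (\<forall>j. ?D (z j) \<and> z j \<in> AI) \<and> \<sigma> r \<in> V \<and> x = (\<Sum>j<n. z j * ww Q ^ j) + ww Q ^ n * r"
    by (rule exp)
  then obtain z r where "(\<forall>j. ?D (z j) \<and> z j \<in> AI) \<and> \<sigma> r \<in> V \<and> x = (\<Sum>j<n. z j * ww Q ^ j) + ww Q ^ n * r"
    by (elim exE)
  hence zr: "\<And>j. ?D (z j)" "\<sigma> r \<in> V" "x = (\<Sum>j<n. z j * ww Q ^ j) + ww Q ^ n * r" by simp_all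
  define c where "c j = (SOME c. c \<in> YY Q \<rightarrow>\<^sub>E {..<p} \<and> z j = ?val c)" for j
  have c: "c j \<in> YY Q \<rightarrow>\<^sub>E {..<p} \<and> z j = ?val (c j)" for j
  proof -
    have "\<exists>c. c \<in> YY Q \<rightarrow>\<^sub>E {..<p} \<and> z j = ?val c" using zr(1)[of j] by (simp only: Bex_def)
    thus ?thesis unfolding c_def by (rule someI_ex)
  qed
  have "(\<Sum>j<n. ?val (restrict c {..<n} j) * ww Q ^ j) = (\<Sum>j<n. z j * ww Q ^ j)"
    using c by (intro sum.cong) auto
  hence "(x - (\<Sum>j<n. ?val (restrict c {..<n} j) * ww Q ^ j)) / ww Q ^ n = r"
    using zr(3) uniformizer(2)[OF s(1)] s(2) by simp
  moreover have "\<tau> r \<in> V" if "\<tau> \<in> Sig" "pid \<tau> = Q" for \<tau>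
    by (rule pid_eq_V[OF s(1) that(1) _ zr(2)]) (use that(2) s(2) in simp)
  ultimately show ?thesis using c by (intro bexI[of _ "restrict c {..<n}"]) auto
qed

text \<open>\<open>R\<close> represents a Sylow subgroup of the quotient by \<open>I\<close>.\<close>

lemma power_torsion_subset:
  assumes I: "ideal I (OI :: 'k ring)" and I0: "I \<noteq> {0}"
  obtains R where "R \<subseteq> AI" "card R = p ^ multiplicity p (ideal_index I)"
    "\<And>x y. x \<in> R \<Longrightarrow> y \<in> R \<Longrightarrow> x - y \<in> I \<Longrightarrow> x = y"
    "\<And>x y. x \<in> R \<Longrightarrow> y \<in> R \<Longrightarrow> of_nat (card R) * (x - y) \<in> I"
proof -
  interpret I: ideal I "OI :: 'k ring" by (rule I)
  define co where "co x = I +>\<^bsub>OI\<^esub> x" for x :: 'k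
  note co_eq = OI_coset_eq_iff[OF I, folded co_def]
  define A where "A = add_monoid (OI Quot I)"
  interpret F: ring "OI Quot I" by (rule I.quotient_is_ring)
  have gA: "group A" unfolding A_def by (rule F.add.is_group)
  interpret A: group A by (rule gA)
  have carr: "carrier A = co ` AI" by (auto simp: A_def FactRing_def A_RCOSETS_def' co_def OI_sel)
  have add: "co x \<otimes>\<^bsub>A\<^esub> co y = co (x + y)" if "x \<in> AI" "y \<in> AI" for x y
    using I.a_rcos_sum[of x y] that by (simp add: A_def FactRing_def co_def OI_sel)
  have one: "\<one>\<^bsub>A\<^esub> = co 0" by (simp add: A_def FactRing_def co_def OI_coset)
  have pow: "co x [^]\<^bsub>A\<^esub> k = co (of_nat k * x)" if x: "x \<in> AI" for x and k :: nat
  proof (induction k)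
    case (Suc k)
    thus ?case using add[OF O_closed(4)[OF O_closed(8) x] x, of k] by (simp add: distrib_right add.commute)
  qed (simp add: one)
  have ord: "Coset.order A = ideal_index I"
    by (simp add: Coset.order_def A_def FactRing_def ideal_index_def)
  let ?r = "multiplicity p (ideal_index I)"
  obtain m where m: "ideal_index I = p ^ ?r * m" using multiplicity_dvd by (metis dvdE)
  have "finite (carrier A)" using finite_cosets[OF I I0] by (simp add: A_def FactRing_def)
  then obtain H where H: "subgroup H A" "card H = p ^ ?r"
    using sylow_thm[OF prime_p gA, of ?r m] ord m by metis
  have gH: "group (A\<lparr>carrier := H\<rparr>)" by (rule subgroup.subgroup_is_group[OF H(1) gA])
  define rp where "rp h = (SOME x. x \<in> AI \<and> co x = h)" for h
  have rp: "rp h \<in> AI \<and> co (rp h) = h" if "h \<in> H" for h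
  proof -
    have "h \<in> co ` AI" using that subgroup.subset[OF H(1)] unfolding carr by (rule rev_subsetD)
    hence "\<exists>x. x \<in> AI \<and> co x = h" by (auto simp del: mem_Collect_eq)
    thus ?thesis unfolding rp_def by (rule someI_ex)
  qed
  have inj: "inj_on rp H" by (rule inj_onI) (metis rp)
  have cR: "card (rp ` H) = p ^ ?r" using card_image[OF inj] H(2) by simp
  show ?thesis
  proof (rule that[of "rp ` H"])
    show "rp ` H \<subseteq> AI" using rp by blast
    show "card (rp ` H) = p ^ ?r" by (rule cR)
    fix x y assume "x \<in> rp ` H" "y \<in> rp ` H"
    then obtain h k where hk: "h \<in> H" "k \<in> H" "x = rp h" "y = rp k" by blast
    have xy: "x \<in> AI" "y \<in> AI" "co x = h" "co y = k" using rp hk by auto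
    show "x = y" if "x - y \<in> I" using that xy hk co_eq[of x y] by simp
    have ny: "- y \<in> AI" by (rule O_closed(5)[OF xy(2)])
    have "inv\<^bsub>A\<^esub> k = co (- y)"
      by (rule A.inv_equality) (use add[OF ny xy(2)] xy ny carr one in auto)
    hence "co (- y) \<in> H" using subgroup.m_inv_closed[OF H(1) hk(2)] by simp
    hence "h \<otimes>\<^bsub>A\<^esub> co (- y) \<in> H" by (rule subgroup.m_closed[OF H(1) hk(1)])
    hence dH: "co (x - y) \<in> H" using add[OF xy(1) ny] xy(3) by simp
    have "co (x - y) [^]\<^bsub>A\<^esub> card H = \<one>\<^bsub>A\<^esub>"
      using group.pow_order_eq_1[OF gH, of "co (x - y)"] dH A.nat_pow_consistent[of "co (x - y)" "card H" H] by (simp add: Coset.order_def)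
    hence "co (of_nat (card H) * (x - y)) = co 0" using pow[OF O_closed(6)[OF xy(1,2)]] one by simp
    thus "of_nat (card (rp ` H)) * (x - y) \<in> I" using card_image[OF inj] co_eq[of "of_nat (card H) * (x - y)" 0] by simp
  qed
qed

text \<open>Elements whose expansions agree up to the order \<open>n\<close> at every prime above \<open>p\<close> differ by an element of \<open>I\<close>,
  up to a factor prime to \<open>p\<close>.\<close>

lemma multiplicity_ideal_index_le:
  assumes I: "ideal I (OI :: 'k ring)" and I0: "I \<noteq> {0}" and y: "y \<in> I" "y \<noteq> 0"
    and n: "\<And>\<sigma>. \<sigma> \<in> Sig \<Longrightarrow> \<sigma> (y / ww (pid \<sigma>) ^ n (pid \<sigma>)) \<in> V \<and> \<sigma> (y / ww (pid \<sigma>) ^ n (pid \<sigma>)) \<notin> M"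
  shows "multiplicity p (ideal_index I) \<le> (\<Sum>Q\<in>Primes. n Q * ff Q)"
proof -
  obtain R where R: "R \<subseteq> AI" "card R = p ^ multiplicity p (ideal_index I)"
    "\<And>x y. x \<in> R \<Longrightarrow> y \<in> R \<Longrightarrow> x - y \<in> I \<Longrightarrow> x = y"
    "\<And>x y. x \<in> R \<Longrightarrow> y \<in> R \<Longrightarrow> of_nat (card R) * (x - y) \<in> I"
    by (rule power_torsion_subset[OF I I0]) blast
  let ?C = "\<lambda>Q. {..<n Q} \<rightarrow>\<^sub>E (YY Q \<rightarrow>\<^sub>E {..<p})"
  let ?v = "\<lambda>Q c. \<Sum>j<n Q. (\<Sum>u\<in>YY Q. of_nat (c j u) * u) * ww Q ^ j"
  let ?P = "\<lambda>x Q c. c \<in> ?C Q \<and> (\<forall>\<sigma>\<in>Sig. pid \<sigma> = Q \<longrightarrow> \<sigma> ((x - ?v Q c) / ww Q ^ n Q) \<in> V)"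
  define dig where "dig x = (\<lambda>Q\<in>Primes. SOME c. ?P x Q c)" for x
  have dig: "?P x Q (dig x Q)" if x: "x \<in> AI" and Q: "Q \<in> Primes" for x Q
  proof -
    have "\<exists>c. ?P x Q c" using digits_exist[OF Q x, of "n Q"] by (simp only: Bex_def)
    hence "?P x Q (SOME c. ?P x Q c)" by (rule someI_ex)
    thus ?thesis using Q by (simp add: dig_def)
  qed
  have inj: "inj_on dig R"
  proof (rule inj_onI)
    fix x x' assume x: "x \<in> R" "x' \<in> R" and eq: "dig x = dig x'"
    have V: "\<sigma> ((x - x') / y) \<in> V" if s: "\<sigma> \<in> Sig" for \<sigma>
    proof -
      note emb = embedding_simps[OF s]
      let ?Q = "pid \<sigma>" let ?w = "ww ?Q ^ n ?Q"
      note Q = pid_Primes[OF s]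
      have "\<sigma> ((x - ?v ?Q (dig x ?Q)) / ?w) \<in> V" "\<sigma> ((x' - ?v ?Q (dig x' ?Q)) / ?w) \<in> V"
        using dig[OF _ Q, of x] dig[OF _ Q, of x'] x R(1) s by blast+
      from V_closed(3)[OF this] have "\<sigma> ((x - ?v ?Q (dig x ?Q)) / ?w - (x' - ?v ?Q (dig x' ?Q)) / ?w) \<in> V"
        by (simp only: emb(6))
      moreover have "(x - ?v ?Q (dig x ?Q)) / ?w - (x' - ?v ?Q (dig x' ?Q)) / ?w = (x - x') / ?w"
        unfolding eq by (simp add: diff_divide_distrib)
      ultimately have 1: "\<sigma> ((x - x') / ?w) \<in> V" by metis
      have 2: "inverse (\<sigma> (y / ?w)) \<in> V" using n[OF s] unit_inverse(1) by blast
      have "(x - x') / y = (x - x') / ?w * inverse (y / ?w)" using uniformizer(2)[OF s] by simp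
      hence "\<sigma> ((x - x') / y) = \<sigma> ((x - x') / ?w) * inverse (\<sigma> (y / ?w))" by (simp only: emb(4,7))
      thus ?thesis using V_closed(4)[OF 1 2] by simp
    qed
    obtain s :: int where s: "\<not> int p dvd s" "of_int s * ((x - x') / y) \<in> AI"
      using clear_denominator[of "(x - x') / y"] V by blast
    have "algebraic_int (of_int s * ((x - x') / y))" using s(2) by simp
    from OI_ideal(4)[OF I this y(1)] have 1: "of_int s * (x - x') \<in> I" using y(2) by simp
    \<comment> \<open>The difference times \<open>s\<close> lies in \<open>I\<close> by the
      comparison of digits, and times \<open>card R\<close> because \<open>R\<close> represents a
      group of that order, a power of p. The two factors are coprime, so the difference itself lies
      in \<open>I\<close>.\<close>
    have "coprime (int p) s" using s(1) prime_p by (simp add: prime_imp_coprime)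
    hence "coprime (int (card R)) s" unfolding R(2) by simp
    then obtain a b where ab: "a * int (card R) + b * s = 1" by (metis bezout_int coprime_iff_gcd_eq_1)
    have "x - x' = of_int (a * int (card R) + b * s) * (x - x')" by (simp add: ab)
    also have "\<dots> = of_int a * (of_nat (card R) * (x - x')) + of_int b * (of_int s * (x - x'))"
      by (simp add: algebra_simps)
    also have "\<dots> \<in> I"
      by (intro OI_ideal(3)[OF I] OI_ideal(4)[OF I] R(4) x 1) simp_all
    finally show "x = x'" by (rule R(3)[OF x])
  qed
  have fY: "finite (YY Q)" if "Q \<in> Primes" for Q using that residues(1) by (auto simp: Primes_def)
  have "finite (Pi\<^sub>E Primes ?C)" by (intro finite_PiE finite_Primes finite_lessThan fY)
  moreover have "dig ` R \<subseteq> Pi\<^sub>E Primes ?C"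
  proof (rule image_subsetI, rule PiE_I)
    show "dig x Q \<in> ?C Q" if "x \<in> R" "Q \<in> Primes" for x Q
      using dig[of x Q] R(1) that by blast
    show "dig x Q = undefined" if "Q \<notin> Primes" for x Q using that by (simp add: dig_def)
  qed
  ultimately have "card R \<le> card (Pi\<^sub>E Primes ?C)" using card_inj_on_le[OF inj] by blast
  also have "\<dots> = (\<Prod>Q\<in>Primes. (p ^ ff Q) ^ n Q)"
    using fY by (simp add: card_PiE finite_Primes card_funcsetE ff_def)
  also have "\<dots> = p ^ (\<Sum>Q\<in>Primes. n Q * ff Q)" by (simp add: power_sum flip: power_mult) (simp add: mult.commute)
  finally have "p ^ multiplicity p (ideal_index I) \<le> p ^ (\<Sum>Q\<in>Primes. n Q * ff Q)" unfolding R(2) .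
  thus ?thesis using power_le_imp_le_exp prime_gt_1_nat[OF prime_p] by blast
qed

end

subsection \<open>Averaging over the Galois group\<close>

lemma card_Collect_of_bool: "finite A \<Longrightarrow> card {x \<in> A. P x} = (\<Sum>x\<in>A. of_bool (P x))"
  unfolding card_eq_sum of_bool_def by (rule sum.inter_filter)

lemma int_choose_two: "2 * int (t choose 2) = int t * (int t - 1)"
  by (induction t) (simp_all add: numeral_2_eq_2 algebra_simps)

text \<open>The chord of the parabola through \<open>e - 1\<close> and \<open>e\<close> lies below it at all integers.\<close>

lemma choose_two_chord: "(int e - 1) * (2 * int t - int e) \<le> 2 * int (t choose 2)"
proof -
  define k where "k = int t - int e"
  have "0 \<le> k * (k + 1)" by (cases "k \<ge> 0") (auto intro: mult_nonneg_nonneg mult_nonpos_nonpos)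
  moreover have "int t * (int t - 1) - (int e - 1) * (2 * int t - int e) = k * (k + 1)"
    by (simp add: k_def algebra_simps)
  ultimately show ?thesis unfolding int_choose_two by linarith
qed

context number_fld
begin

text \<open>By transitivity each embedding in \<open>S\<close> is carried to each embedding by the
  same number of group elements, the order of the group over d; interchanging the sums gives the
  average.\<close>

lemma sum_act:
  assumes S: "S \<subseteq> Sig"
  shows "d * (\<Sum>g\<in>G. \<Sum>\<sigma>\<in>act g S. (\<phi> \<sigma> :: nat)) = card S * card G * (\<Sum>\<tau>\<in>Sig. \<phi> \<tau>)"
proof -
  have fS: "finite S" using S finite_Sig finite_subset by blast
  have 1: "(\<Sum>\<sigma>\<in>act g S. \<phi> \<sigma>) = (\<Sum>\<sigma>\<in>S. \<phi> (g \<circ> \<sigma>))" if g: "g \<in> G" for g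
    unfolding act_def by (simp add: sum.reindex[OF card_act(3)[OF g S]])
  have 2: "d * (\<Sum>g\<in>G. \<phi> (g \<circ> \<sigma>)) = card G * (\<Sum>\<tau>\<in>Sig. \<phi> \<tau>)" if s: "\<sigma> \<in> S" for \<sigma>
  proof -
    have "(\<Sum>g\<in>G. \<phi> (g \<circ> \<sigma>)) = (\<Sum>\<tau>\<in>Sig. \<Sum>g | g \<in> G \<and> g \<circ> \<sigma> = \<tau>. \<phi> (g \<circ> \<sigma>))"
      by (rule sum.group[symmetric]) (use finite_G finite_Sig gal_comp_embedding[OF galD(1)] s S in auto)
    also have "\<dots> = (\<Sum>\<tau>\<in>Sig. card {g \<in> G. g \<circ> \<sigma> = \<tau>} * \<phi> \<tau>)" by (intro sum.cong) auto
    finally have "d * (\<Sum>g\<in>G. \<phi> (g \<circ> \<sigma>)) = (\<Sum>\<tau>\<in>Sig. (card {g \<in> G. g \<circ> \<sigma> = \<tau>} * d) * \<phi> \<tau>)"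
      by (simp add: sum_distrib_left ac_simps)
    also have "\<dots> = (\<Sum>\<tau>\<in>Sig. card G * \<phi> \<tau>)"
      using s S by (intro sum.cong refl) (simp only: gal_count subsetD)
    finally show ?thesis by (simp add: sum_distrib_left)
  qed
  have "d * (\<Sum>g\<in>G. \<Sum>\<sigma>\<in>act g S. \<phi> \<sigma>) = d * (\<Sum>g\<in>G. \<Sum>\<sigma>\<in>S. \<phi> (g \<circ> \<sigma>))" using 1 by simp
  also have "\<dots> = d * (\<Sum>\<sigma>\<in>S. \<Sum>g\<in>G. \<phi> (g \<circ> \<sigma>))" by (subst sum.swap) simp
  also have "\<dots> = (\<Sum>\<sigma>\<in>S. card G * (\<Sum>\<tau>\<in>Sig. \<phi> \<tau>))" using 2 by (simp add: sum_distrib_left)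
  finally show ?thesis by simp
qed

text \<open>\<open>card T choose 2\<close> is the number of 2-element subsets of \<open>T\<close>,
  and 2-homogeneity carries each such pair to each other one equally often.\<close>

lemma sum_act_pairs:
  assumes th: "two_homogeneous ty" and S: "S \<subseteq> Sig" and U: "U \<subseteq> Sig"
  shows "(d choose 2) * (\<Sum>g\<in>G. card (act g S \<inter> U) choose 2) = (card S choose 2) * card G * (card U choose 2)"
proof -
  let ?pr = "\<lambda>T :: ('k \<Rightarrow> rat alg_closure) set. {A. A \<subseteq> T \<and> card A = 2}"
  have fin: "finite T" if "T \<subseteq> Sig" for T using that finite_Sig finite_subset by blast
  have fpr: "finite (?pr T)" if "T \<subseteq> Sig" for T using fin[OF that] by simp
  have 1: "card (act g S \<inter> U) choose 2 = (\<Sum>B\<in>?pr U. \<Sum>A\<in>?pr S. of_bool (act g A = B))" if g: "g \<in> G" for g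
  proof -
    have inj: "inj_on (\<lambda>\<sigma>. g \<circ> \<sigma>) S" by (rule card_act(3)[OF g S])
    have injA: "inj_on (act g) {A. A \<subseteq> S}"
      unfolding act_def using inj_on_image_Pow[OF inj] by (simp add: Pow_def)
    have "?pr (act g S \<inter> U) = act g ` {A \<in> ?pr S. act g A \<in> ?pr U}"
    proof (intro equalityI subsetI)
      fix B assume B: "B \<in> ?pr (act g S \<inter> U)"
      then obtain A where A: "A \<subseteq> S" "B = act g A" unfolding act_def by (auto simp: subset_image_iff)
      have "card A = 2" using B A card_act(1)[OF g, of A] S by auto
      thus "B \<in> act g ` {A \<in> ?pr S. act g A \<in> ?pr U}" using A B by auto
    next
      fix B assume "B \<in> act g ` {A \<in> ?pr S. act g A \<in> ?pr U}"
      thus "B \<in> ?pr (act g S \<inter> U)" unfolding act_def by auto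
    qed
    hence "card (?pr (act g S \<inter> U)) = card {A \<in> ?pr S. act g A \<in> ?pr U}"
      using card_image[OF inj_on_subset[OF injA], of "{A \<in> ?pr S. act g A \<in> ?pr U}"] by auto
    also have "\<dots> = (\<Sum>A\<in>?pr S. of_bool (act g A \<in> ?pr U))" by (rule card_Collect_of_bool[OF fpr[OF S]])
    also have "\<dots> = (\<Sum>A\<in>?pr S. \<Sum>B\<in>?pr U. of_bool (act g A = B))"
  proof (intro sum.cong refl)
    fix A
    have "(\<Sum>B\<in>?pr U. of_bool (act g A = B)) = (\<Sum>B\<in>?pr U. if act g A = B then 1 else 0)"
      by (intro sum.cong) simp_all
    thus "of_bool (act g A \<in> ?pr U) = (\<Sum>B\<in>?pr U. of_bool (act g A = B))"
      by (simp only: sum.delta'[OF fpr[OF U]] of_bool_def)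
  qed
    also have "\<dots> = (\<Sum>B\<in>?pr U. \<Sum>A\<in>?pr S. of_bool (act g A = B))" by (rule sum.swap)
    finally show ?thesis using n_subsets[of "act g S \<inter> U" 2] fin[OF U] by simp
  qed
  have "(\<Sum>g\<in>G. card (act g S \<inter> U) choose 2) = (\<Sum>g\<in>G. \<Sum>B\<in>?pr U. \<Sum>A\<in>?pr S. of_bool (act g A = B))"
    using 1 by simp
  also have "\<dots> = (\<Sum>B\<in>?pr U. \<Sum>g\<in>G. \<Sum>A\<in>?pr S. of_bool (act g A = B))" by (rule sum.swap)
  also have "\<dots> = (\<Sum>B\<in>?pr U. \<Sum>A\<in>?pr S. \<Sum>g\<in>G. of_bool (act g A = B))" by (intro sum.cong refl sum.swap)
  also have "\<dots> = (\<Sum>B\<in>?pr U. \<Sum>A\<in>?pr S. card {g \<in> G. act g A = B})"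
    by (intro sum.cong refl) (rule card_Collect_of_bool[OF finite_G, symmetric])
  finally have "(d choose 2) * (\<Sum>g\<in>G. card (act g S \<inter> U) choose 2) =
      (\<Sum>B\<in>?pr U. \<Sum>A\<in>?pr S. card {g \<in> G. act g A = B} * (d choose 2))"
    by (simp add: sum_distrib_left mult.commute)
  also have "\<dots> = (\<Sum>B\<in>?pr U. \<Sum>A\<in>?pr S. card G)"
  proof (intro sum.cong refl)
    fix A B assume "A \<in> ?pr S" "B \<in> ?pr U"
    thus "card {g \<in> G. act g A = B} * (d choose 2) = card G" using gal_count_pairs[OF th, of A B] S U by auto
  qed
  finally show ?thesis using n_subsets[OF fin[OF S], of 2] n_subsets[OF fin[OF U], of 2] by simp
qed

end

section \<open>Lower bounds for the average class weight\<close>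

context local_fld
begin

lemma sum_above: "(\<Sum>\<sigma>\<in>Sig. \<phi> (pid \<sigma>)) = (\<Sum>Q\<in>Primes. ee Q * ff Q * (\<phi> Q :: nat))"
proof -
  have "(\<Sum>\<sigma>\<in>Sig. \<phi> (pid \<sigma>)) = (\<Sum>Q\<in>Primes. \<Sum>\<sigma> | \<sigma> \<in> Sig \<and> pid \<sigma> = Q. \<phi> (pid \<sigma>))"
    by (rule sum.group[symmetric]) (auto simp: finite_Sig finite_Primes Primes_def)
  also have "\<dots> = (\<Sum>Q\<in>Primes. card (above Q) * \<phi> Q)" by (intro sum.cong) (auto simp: above_def)
  finally show ?thesis using card_above by simp
qed

lemma sum_ef: "(\<Sum>Q\<in>Primes. ee Q * ff Q) = d"
  using sum_above[of "\<lambda>_. 1"] card_Sig by simp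

text \<open>\<open>choose_two_chord\<close> is summed over the classes above \<open>Q\<close>. The
  sizes add up to the number of members of \<open>T\<close> above \<open>Q\<close>, and the number
  of classes, at most f, enters with the nonpositive factor -(e - 1) e, so it may be replaced by
  f.\<close>

lemma class_weight_ge:
  assumes T: "T \<subseteq> Sig"
  shows "(\<Sum>Q\<in>Primes. int (rr Q) * (int (ee Q) - 1) * (2 * int (card {\<tau> \<in> T. pid \<tau> = Q}) - int (ee Q * ff Q)))
    \<le> 2 * int (class_weight T)"
proof -
  define t where "t C = card {\<tau> \<in> T. Cl \<tau> = C}" for C
  define q where "q C = pid (SOME \<tau>. \<tau> \<in> C)" for C
  have fT: "finite T" using T finite_Sig finite_subset by blast
  have q: "q (Cl \<sigma>) = pid \<sigma>" if "\<sigma> \<in> Sig" for \<sigma>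
    using congr_pid[OF rep(2)[OF that]] by (simp add: q_def rep_def)
  have cls: "{C \<in> Cl ` Sig. q C = Q} = Cl ` above Q" for Q using q by (auto simp: above_def)
  have le: "int (rr Q) * (int (ee Q) - 1) * (2 * int (card {\<tau> \<in> T. pid \<tau> = Q}) - int (ee Q * ff Q))
    \<le> (\<Sum>C\<in>Cl ` above Q. int (rr Q) * (2 * int (t C choose 2)))" if Q: "Q \<in> Primes" for Q
  proof -
    have e: "0 \<le> int (ee Q) - 1" using ee_pos[OF Q] by simp
    have fC: "finite (Cl ` above Q)" using above_finite by simp
    have "card {\<tau> \<in> T. pid \<tau> = Q} = (\<Sum>C\<in>Cl ` above Q. t C)"
    proof -
      have "card {\<tau> \<in> T. pid \<tau> = Q} = (\<Sum>\<tau> | \<tau> \<in> T \<and> pid \<tau> = Q. 1)" by simp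
      also have "\<dots> = (\<Sum>C\<in>Cl ` above Q. \<Sum>\<tau> | \<tau> \<in> {\<tau> \<in> T. pid \<tau> = Q} \<and> Cl \<tau> = C. 1)"
        by (rule sum.group[symmetric]) (use fT fC T in \<open>auto simp: above_def\<close>)
      also have "\<dots> = (\<Sum>C\<in>Cl ` above Q. t C)"
      proof (intro sum.cong refl)
        fix C assume C: "C \<in> Cl ` above Q"
        have "{\<tau> \<in> {\<tau> \<in> T. pid \<tau> = Q}. Cl \<tau> = C} = {\<tau> \<in> T. Cl \<tau> = C}"
        proof (intro equalityI subsetI)
          fix \<tau> assume \<tau>: "\<tau> \<in> {\<tau> \<in> T. Cl \<tau> = C}"
          obtain \<sigma> where "\<sigma> \<in> Sig" "pid \<sigma> = Q" "C = Cl \<sigma>" using C by (auto simp: above_def)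
          hence "pid \<tau> = Q" using q[of \<tau>] q[of \<sigma>] T \<tau> by auto
          with \<tau> show "\<tau> \<in> {\<tau> \<in> {\<tau> \<in> T. pid \<tau> = Q}. Cl \<tau> = C}" by blast
        qed auto
        thus "(\<Sum>\<tau> | \<tau> \<in> {\<tau> \<in> T. pid \<tau> = Q} \<and> Cl \<tau> = C. 1) = t C" by (simp add: t_def)
      qed
      finally show ?thesis .
    qed
    hence sum_t: "int (card {\<tau> \<in> T. pid \<tau> = Q}) = (\<Sum>C\<in>Cl ` above Q. int (t C))" by simp
    obtain \<sigma> where "\<sigma> \<in> Sig" "Q = pid \<sigma>" using Q by (auto simp: Primes_def)
    hence "int (ee Q) * int (card (Cl ` above Q)) \<le> int (ee Q * ff Q)"
      unfolding of_nat_mult using card_classes_le by (intro mult_left_mono) auto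
    hence "(int (ee Q) - 1) * (2 * int (card {\<tau> \<in> T. pid \<tau> = Q}) - int (ee Q * ff Q))
      \<le> (int (ee Q) - 1) * (2 * int (card {\<tau> \<in> T. pid \<tau> = Q}) - int (ee Q) * int (card (Cl ` above Q)))"
      using e by (intro mult_left_mono) auto
    also have "\<dots> = (\<Sum>C\<in>Cl ` above Q. (int (ee Q) - 1) * (2 * int (t C) - int (ee Q)))"
      unfolding sum_t by (simp add: sum_distrib_left[symmetric] sum_subtractf)
    also have "\<dots> \<le> (\<Sum>C\<in>Cl ` above Q. 2 * int (t C choose 2))" by (intro sum_mono choose_two_chord)
    finally have "int (rr Q) * ((int (ee Q) - 1) * (2 * int (card {\<tau> \<in> T. pid \<tau> = Q}) - int (ee Q * ff Q)))
      \<le> int (rr Q) * (\<Sum>C\<in>Cl ` above Q. 2 * int (t C choose 2))" by (intro mult_left_mono) auto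
    thus ?thesis by (simp only: sum_distrib_left mult.assoc)
  qed
  have "2 * int (class_weight T) = (\<Sum>C\<in>Cl ` Sig. int (rr (q C)) * (2 * int (t C choose 2)))"
    by (simp add: class_weight_def rc_def q_def t_def sum_distrib_left ac_simps)
  also have "\<dots> = (\<Sum>Q\<in>Primes. \<Sum>C | C \<in> Cl ` Sig \<and> q C = Q. int (rr (q C)) * (2 * int (t C choose 2)))"
    by (rule sum.group[symmetric]) (use finite_Sig finite_Primes q pid_Primes in auto)
  also have "\<dots> = (\<Sum>Q\<in>Primes. \<Sum>C | C \<in> Cl ` Sig \<and> q C = Q. int (rr Q) * (2 * int (t C choose 2)))"
    by (intro sum.cong refl) auto
  also have "\<dots> = (\<Sum>Q\<in>Primes. \<Sum>C\<in>Cl ` above Q. int (rr Q) * (2 * int (t C choose 2)))"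
    unfolding cls ..
  finally show ?thesis using sum_mono[of Primes, OF le] by simp
qed

text \<open>Because \<open>rr Q * ee Q = EE\<close>, each prime contributes \<open>EE\<close> times
  e f - f, and the e f add up to d; this is where the tame exponent comes from.\<close>

lemma sum_weight: "(\<Sum>Q\<in>Primes. int (rr Q) * (int (ee Q) - 1) * int (ee Q * ff Q)) = int EE * (int d - int (\<Sum>Q\<in>Primes. ff Q))"
proof -
  have "int (rr Q) * (int (ee Q) - 1) * int (ee Q * ff Q) = int EE * (int (ee Q * ff Q) - int (ff Q))" if "Q \<in> Primes" for Q
    unfolding rr_ee[OF that, symmetric] by (simp add: algebra_simps)
  hence "(\<Sum>Q\<in>Primes. int (rr Q) * (int (ee Q) - 1) * int (ee Q * ff Q)) =
      (\<Sum>Q\<in>Primes. int EE * (int (ee Q * ff Q) - int (ff Q)))" by (intro sum.cong) auto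
  also have "\<dots> = int EE * (int (\<Sum>Q\<in>Primes. ee Q * ff Q) - int (\<Sum>Q\<in>Primes. ff Q))"
    by (simp add: sum_distrib_left sum_subtractf right_diff_distrib)
  finally show ?thesis unfolding sum_ef .
qed

lemma sum_ff_le: "(\<Sum>Q\<in>Primes. ff Q) \<le> d"
  unfolding sum_ef[symmetric] by (intro sum_mono) (use ee_pos in simp)

text \<open>The bound of \<open>class_weight_ge\<close> is linear in the counts, and these average
  to e f times \<open>card S\<close> over d. The truncated difference \<open>2 * card S - d\<close>
  produces the maximum with 0 in the theorem: in the truncated case the left side is 0.\<close>

lemma sum_class_weight_ge:
  assumes S: "S \<subseteq> Sig" and c: "card G = d * c"
  shows "EE * (c * (2 * card S - d) * (d - (\<Sum>Q\<in>Primes. ff Q))) \<le> 2 * (\<Sum>g\<in>G. class_weight (act g S))"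
proof -
  define t where "t g Q = card {\<tau> \<in> act g S. pid \<tau> = Q}" for g Q
  let ?F = "\<Sum>Q\<in>Primes. ff Q"
  have sum_t: "(\<Sum>g\<in>G. int (t g Q)) = int (c * card S) * int (ee Q * ff Q)" if Q: "Q \<in> Primes" for Q
  proof -
    have "t g Q = (\<Sum>\<tau>\<in>act g S. of_bool (pid \<tau> = Q))" if g: "g \<in> G" for g
    proof -
      have "finite (act g S)" using card_act(2)[OF g S] finite_Sig finite_subset by blast
      thus ?thesis unfolding t_def by (rule card_Collect_of_bool)
    qed
    hence "d * (\<Sum>g\<in>G. t g Q) = card S * card G * (\<Sum>\<tau>\<in>Sig. of_bool (pid \<tau> = Q))"
      using sum_act[OF S, of "\<lambda>\<tau>. of_bool (pid \<tau> = Q)"] by simp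
    also have "(\<Sum>\<tau>\<in>Sig. of_bool (pid \<tau> = Q)) = ee Q * ff Q"
      unfolding card_above[OF Q, symmetric] above_def by (rule card_Collect_of_bool[OF finite_Sig, symmetric])
    finally have "(\<Sum>g\<in>G. t g Q) = c * card S * (ee Q * ff Q)" using c d_pos by simp
    from arg_cong[OF this, of int] show ?thesis by simp
  qed
  have "2 * int (\<Sum>g\<in>G. class_weight (act g S)) \<ge>
      (\<Sum>g\<in>G. \<Sum>Q\<in>Primes. int (rr Q) * (int (ee Q) - 1) * (2 * int (t g Q) - int (ee Q * ff Q)))"
    unfolding of_nat_sum sum_distrib_left t_def using S by (intro sum_mono class_weight_ge card_act(2)) 
  also have "(\<Sum>g\<in>G. \<Sum>Q\<in>Primes. int (rr Q) * (int (ee Q) - 1) * (2 * int (t g Q) - int (ee Q * ff Q))) =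
      (\<Sum>Q\<in>Primes. \<Sum>g\<in>G. int (rr Q) * (int (ee Q) - 1) * (2 * int (t g Q) - int (ee Q * ff Q)))" by (rule sum.swap)
  also have "\<dots> = (\<Sum>Q\<in>Primes. (int c * (2 * int (card S) - int d)) * (int (rr Q) * (int (ee Q) - 1) * int (ee Q * ff Q)))"
  proof (intro sum.cong refl)
    fix Q assume Q: "Q \<in> Primes"
    have "(\<Sum>g\<in>G. 2 * int (t g Q) - int (ee Q * ff Q)) = 2 * (\<Sum>g\<in>G. int (t g Q)) - int (card G) * int (ee Q * ff Q)"
      by (simp add: sum_subtractf sum_distrib_left)
    also have "\<dots> = int c * (2 * int (card S) - int d) * int (ee Q * ff Q)"
      unfolding sum_t[OF Q] c by (simp add: algebra_simps)
    finally show "(\<Sum>g\<in>G. int (rr Q) * (int (ee Q) - 1) * (2 * int (t g Q) - int (ee Q * ff Q))) =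
      (int c * (2 * int (card S) - int d)) * (int (rr Q) * (int (ee Q) - 1) * int (ee Q * ff Q))"
      by (simp add: sum_distrib_left[symmetric] ac_simps)
  qed
  also have "\<dots> = int c * (2 * int (card S) - int d) * (int EE * (int d - int ?F))"
    unfolding sum_distrib_left[symmetric] sum_weight ..
  finally have ge: "int c * (2 * int (card S) - int d) * (int EE * (int d - int ?F)) \<le> 2 * int (\<Sum>g\<in>G. class_weight (act g S))" .
  show ?thesis
  proof (cases "d \<le> 2 * card S")
    case True
    have "int (EE * (c * (2 * card S - d) * (d - ?F))) = int c * (2 * int (card S) - int d) * (int EE * (int d - int ?F))"
      using True sum_ff_le by (simp add: of_nat_diff)
    thus ?thesis using ge by linarith
  qed simp
qed

text \<open>By 2-homogeneity the average weight of g S is the weight of the full set of embeddings,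
  scaled by the proportion of pairs. For the full set the count above \<open>Q\<close> is e f, so
  the linear bound becomes (e - 1) e f.\<close>

lemma sum_class_weight_ge_two_homogeneous:
  assumes th: "two_homogeneous ty" and S: "S \<subseteq> Sig" and d2: "d \<ge> 2" and c: "card G = c * (d choose 2)"
  shows "EE * (c * (card S choose 2) * (d - (\<Sum>Q\<in>Primes. ff Q))) \<le> 2 * (\<Sum>g\<in>G. class_weight (act g S))"
proof -
  let ?F = "\<Sum>Q\<in>Primes. ff Q"
  let ?U = "\<lambda>C. {\<tau> \<in> Sig. Cl \<tau> = C}"
  have U: "{\<tau> \<in> act g S. Cl \<tau> = C} = act g S \<inter> ?U C" if "g \<in> G" for g C using card_act(2)[OF that S] by blast
  have "(d choose 2) * (\<Sum>g\<in>G. class_weight (act g S)) =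
      (\<Sum>C\<in>Cl ` Sig. rc C * ((d choose 2) * (\<Sum>g\<in>G. card (act g S \<inter> ?U C) choose 2)))"
    unfolding class_weight_def using U by (subst sum.swap) (simp add: sum_distrib_left ac_simps)
  also have "\<dots> = (\<Sum>C\<in>Cl ` Sig. rc C * ((card S choose 2) * card G * (card (?U C) choose 2)))"
    by (intro sum.cong refl) (simp add: sum_act_pairs[OF th S])
  also have "\<dots> = (d choose 2) * (c * (card S choose 2) * class_weight Sig)"
    unfolding class_weight_def c by (simp add: sum_distrib_left ac_simps)
  finally have 1: "(\<Sum>g\<in>G. class_weight (act g S)) = c * (card S choose 2) * class_weight Sig"
    using d2 by simp
  have "int EE * (int d - int ?F) = (\<Sum>Q\<in>Primes. int (rr Q) * (int (ee Q) - 1) * (2 * int (card {\<tau> \<in> Sig. pid \<tau> = Q}) - int (ee Q * ff Q)))"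
    unfolding sum_weight[symmetric] using card_above by (intro sum.cong refl) (simp add: above_def)
  also have "\<dots> \<le> 2 * int (class_weight Sig)" by (rule class_weight_ge) simp
  also have "int EE * (int d - int ?F) = int (EE * (d - ?F))" using sum_ff_le by (simp add: of_nat_diff)
  finally have "EE * (d - ?F) \<le> 2 * class_weight Sig" by linarith
  from mult_left_mono[OF this, of "c * (card S choose 2)"] show ?thesis unfolding 1 by (simp add: ac_simps)
qed

end

subsection \<open>Divisibility of the norm of a determinant\<close>

context valuation
begin

lemma power_in_V: assumes "u ^ n \<in> V" "n \<ge> 1" shows "u \<in> V"
proof (rule ccontr)
  assume u: "u \<notin> V"
  obtain k where k: "n = Suc k" using assms(2) by (cases n) auto
  have "u ^ n * inverse u ^ k \<in> V" using V_closed(4)[OF assms(1) V_closed(7)[OF V_total[OF u], of k]] .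
  moreover have "u \<noteq> 0" using u V_closed(2) by auto
  hence "u ^ n * inverse u ^ k = u" by (simp add: k power_inverse)
  ultimately show False using u by simp
qed

text \<open>An element with a positive power in \<open>V\<close> lies in \<open>V\<close>, so the
  common denominator \<open>E\<close> can be removed from an inequality of values.\<close>

lemma vge_imp_vdvd: assumes "vge E (E * k) z" "E \<ge> 1" shows "vdvd (P ^ k) z"
proof -
  have "z ^ E / P ^ (E * k) \<in> V" using assms(1) P_nonzero by (simp add: vge_def vdvd_iff)
  hence "(z / P ^ k) ^ E \<in> V" by (simp add: power_divide mult.commute flip: power_mult)
  thus ?thesis using power_in_V[OF _ assms(2)] P_nonzero by (simp add: vdvd_iff)
qed

lemma vdvd_of_int: assumes "vdvd (P ^ k) (of_int N)" shows "int p ^ k dvd N"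
proof (cases "N = 0")
  case False
  obtain n u where nu: "N = int p ^ n * u" "\<not> int p dvd u"
    using multiplicity_decompose'[of N "int p"] False prime_p by (metis not_prime_unit prime_nat_int_transfer)
  have "k \<le> n"
  proof (rule ccontr)
    assume "\<not> k \<le> n"
    hence k: "P ^ k = P ^ n * (P * P ^ (k - n - 1))" by (simp flip: power_Suc power_add)
    have "vdvd (P ^ n * (P * P ^ (k - n - 1))) (P ^ n * of_int u)" using assms k nu(1) by simp
    hence "vdvd (P * P ^ (k - n - 1)) (of_int u)" using P_nonzero by (simp add: vdvd_cancel)
    hence "of_int u \<in> M" using M_vdvd[OF M_mult(1)[OF P_in_M V_closed(7)[OF V_closed(11)]]] by blast
    thus False using nu(2) of_int_in_M_iff by blast
  qed
  thus ?thesis unfolding nu(1) using le_imp_power_dvd by (metis dvd_mult2)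
qed simp

end

lemma rat_in_Ints:
  fixes q :: rat
  assumes "\<And>p. prime p \<Longrightarrow> \<exists>a b. q = of_int a / of_int b \<and> b \<noteq> 0 \<and> \<not> int p dvd b"
  shows "q \<in> \<int>"
proof -
  obtain a b where ab: "quotient_of q = (a, b)" by fastforce
  have b: "b > 0" "coprime a b" "q = of_int a / of_int b"
    using ab quotient_of_denom_pos quotient_of_coprime quotient_of_div by blast+
  have "b = 1"
  proof (rule ccontr)
    assume "b \<noteq> 1"
    hence "nat b \<noteq> 1" using b(1) by auto
    then obtain p where p: "prime p" "p dvd nat b" using prime_factor_nat by blast
    hence pb: "int p dvd b" using b(1) by (metis int_dvd_int_iff less_le nat_0_le)
    obtain c e where ce: "q = of_int c / of_int e" "e \<noteq> 0" "\<not> int p dvd e" using assms[OF p(1)] by blast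
    have "rat_of_int (a * e) = of_int (c * b)" using ce(1,2) b by (simp add: field_simps)
    hence "a * e = c * b" by (simp only: of_int_eq_iff)
    hence "int p dvd a * e" using pb by simp
    hence "int p dvd a" using ce(3) p(1) by (metis prime_dvd_mult_iff prime_nat_int_transfer)
    thus False using pb b(2) p(1) by (metis coprime_common_divisor not_prime_unit prime_nat_int_transfer)
  qed
  thus ?thesis using b(3) by simp
qed

lemma det_scale_rows:
  fixes b :: "nat \<Rightarrow> nat \<Rightarrow> 'a::comm_ring_1"
  shows "det (mat n n (\<lambda>(i, j). c i * b i j)) = (\<Prod>i = 0..<n. c i) * det (mat n n (\<lambda>(i, j). b i j))"
proof -
  have "(\<Prod>i = 0..<n. mat n n (\<lambda>(i, j). c i * b i j) $$ (i, q i)) =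
    (\<Prod>i = 0..<n. c i) * (\<Prod>i = 0..<n. mat n n (\<lambda>(i, j). b i j) $$ (i, q i))" if "q permutes {0..<n}" for q
    unfolding prod.distrib[symmetric] using permutes_in_image[OF that] by (intro prod.cong refl) simp
  hence "(\<Sum>q | q permutes {0..<n}. signof q * (\<Prod>i = 0..<n. mat n n (\<lambda>(i, j). c i * b i j) $$ (i, q i))) =
    (\<Prod>i = 0..<n. c i) * (\<Sum>q | q permutes {0..<n}. signof q * (\<Prod>i = 0..<n. mat n n (\<lambda>(i, j). b i j) $$ (i, q i)))"
    unfolding sum_distrib_left by (intro sum.cong refl) (simp only: mem_Collect_eq mult.left_commute)
  thus ?thesis by (simp only: det_def'[OF mat_carrier])
qed

context number_fld
begin

lemma gal_det:
  assumes g: "g \<in> G" and ts: "set ts \<subseteq> Sig" and len: "length ts = length xs"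
  shows "det (embedding_matrix ts xs) \<in> Kc"
    and "det (embedding_matrix (map (\<lambda>\<sigma>. g \<circ> \<sigma>) ts) xs) = g (det (embedding_matrix ts xs))"
proof -
  note h = galD(1)[OF g] and K = subfld_Kc
  let ?n = "length ts"
  have e: "(ts ! i) x \<in> Kc" if "i < ?n" for i x using embedding_in_Kc ts nth_mem[OF that] by blast
  have sg: "(signof q :: rat alg_closure) \<in> Kc \<and> g (signof q) = signof q" for q :: "nat \<Rightarrow> nat"
    by (cases q rule: sign_cases) (simp_all add: emb_on_simps[OF K h] subfldD[OF K])
  have det: "det (embedding_matrix ss xs) = (\<Sum>q | q permutes {0..<?n}. signof q * (\<Prod>i = 0..<?n. (ss ! i) (xs ! q i)))"
    if "length ss = ?n" for ss :: "('k \<Rightarrow> rat alg_closure) list"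
  proof -
    have "det (embedding_matrix ss xs) = (\<Sum>q | q permutes {0..<?n}. signof q * (\<Prod>i = 0..<?n. embedding_matrix ss xs $$ (i, q i)))"
      using that len by (intro det_def') (simp add: embedding_matrix_def)
    also have "\<dots> = (\<Sum>q | q permutes {0..<?n}. signof q * (\<Prod>i = 0..<?n. (ss ! i) (xs ! q i)))"
      using that len permutes_in_image by (intro sum.cong prod.cong arg_cong2[where f = times] refl) (fastforce simp: embedding_matrix_def)
    finally show ?thesis .
  qed
  have t: "(\<Prod>i = 0..<?n. (ts ! i) (xs ! q i)) \<in> Kc" for q by (rule subfld_prod[OF K]) (simp add: e)
  have st: "signof q * (\<Prod>i = 0..<?n. (ts ! i) (xs ! q i)) \<in> Kc" for q using sg t subfldD(4)[OF K] by blast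
  show "det (embedding_matrix ts xs) \<in> Kc" unfolding det[OF refl] by (rule subfld_sum[OF K st])
  have "g (det (embedding_matrix ts xs)) = (\<Sum>q | q permutes {0..<?n}. g (signof q * (\<Prod>i = 0..<?n. (ts ! i) (xs ! q i))))"
    unfolding det[OF refl] by (rule emb_on_sum[OF K h st])
  also have "\<dots> = (\<Sum>q | q permutes {0..<?n}. signof q * (\<Prod>i = 0..<?n. g ((ts ! i) (xs ! q i))))"
  proof (intro sum.cong refl)
    fix q
    have "g (signof q * (\<Prod>i = 0..<?n. (ts ! i) (xs ! q i))) = signof q * g (\<Prod>i = 0..<?n. (ts ! i) (xs ! q i))"
      using emb_on_simps(4)[OF K h] sg t by metis
    also have "g (\<Prod>i = 0..<?n. (ts ! i) (xs ! q i)) = (\<Prod>i = 0..<?n. g ((ts ! i) (xs ! q i)))"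
      by (rule emb_on_prod[OF K h]) (simp add: e)
    finally show "g (signof q * (\<Prod>i = 0..<?n. (ts ! i) (xs ! q i))) = signof q * (\<Prod>i = 0..<?n. g ((ts ! i) (xs ! q i)))" .
  qed
  also have "\<dots> = det (embedding_matrix (map (\<lambda>\<sigma>. g \<circ> \<sigma>) ts) xs)" by (subst det) simp_all
  finally show "det (embedding_matrix (map (\<lambda>\<sigma>. g \<circ> \<sigma>) ts) xs) = g (det (embedding_matrix ts xs))" ..
qed

lemma act_list:
  assumes g: "g \<in> G" and ts: "distinct ts" "set ts \<subseteq> Sig"
  shows "distinct (map (\<lambda>\<sigma>. g \<circ> \<sigma>) ts)" "set (map (\<lambda>\<sigma>. g \<circ> \<sigma>) ts) = act g (set ts)"
  using card_act(3)[OF g ts(2)] ts(1) by (simp_all add: distinct_map act_def)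

lemma det_sq_act:
  assumes g: "g \<in> G" and ts: "distinct ts" "set ts \<subseteq> Sig" and xs: "distinct xs" "length ts = length xs"
  shows "det_sq (act g (set ts)) (set xs) = (det (embedding_matrix (map (\<lambda>\<sigma>. g \<circ> \<sigma>) ts) xs))\<^sup>2"
  using det_sq_eq[of "map (\<lambda>\<sigma>. g \<circ> \<sigma>) ts" xs] act_list[OF g ts] xs by simp

text \<open>Applying \<open>g\<close> to the rows is applying \<open>g\<close> to the determinant,
  so the product is the square of the norm of one determinant, a rational number. The matrix entries
  are integral, so it lies in every \<open>V\<close>, and no prime divides its denominator.\<close>

lemma prod_det_sq_integer:
  assumes R: "ring (OI :: 'k ring)" and ts: "distinct ts" "set ts \<subseteq> Sig"
    and xs: "distinct xs" "length ts = length xs" "set xs \<subseteq> {x. algebraic_int x}"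
  obtains N :: int where "(\<Prod>g\<in>G. det_sq (act g (set ts)) (set xs)) = of_int N"
proof -
  let ?\<delta> = "det (embedding_matrix ts xs)"
  let ?N = "\<Prod>g\<in>G. det_sq (act g (set ts)) (set xs)"
  have "?N = (\<Prod>g\<in>G. g ?\<delta> ^ 2)"
    using gal_det(2)[OF _ ts(2) xs(2)] by (intro prod.cong refl) (simp add: det_sq_act[OF _ ts xs(1,2)])
  hence N: "?N = (\<Prod>g\<in>G. g ?\<delta>) ^ 2" by (simp add: prod_power_distrib)
  obtain g0 where "g0 \<in> G" using card_G_pos by (metis card.empty less_irrefl equals0I)
  then obtain q where "(\<Prod>g\<in>G. g ?\<delta>) = of_rat q" using gal_norm_rational[OF gal_det(1)[OF _ ts(2) xs(2)]] by blast
  hence q: "?N = of_rat (q\<^sup>2)" using N by (simp add: of_rat_power)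
  have "q\<^sup>2 \<in> \<int>"
  proof (rule rat_in_Ints)
    fix p :: nat assume "prime p"
    then obtain V :: "rat alg_closure set" where V: "valuation p V" using valuation_exists by blast
    interpret local_fld ty p V by (rule local_fldI[OF R V])
    have "?N \<in> V"
    proof (rule V_closed(9))
      fix g assume g: "g \<in> G"
      note l = act_list[OF g ts]
      have "det (embedding_matrix (map (\<lambda>\<sigma>. g \<circ> \<sigma>) ts) xs) \<in> V"
      proof (rule det_in_V[of _ "length ts"])
        fix i j assume ij: "i < length ts" "j < length ts"
        have "g \<circ> ts ! i \<in> Sig" using gal_comp_embedding[OF galD(1)[OF g]] ts(2) nth_mem[OF ij(1)] by blast
        moreover have "xs ! j \<in> AI" using xs(2,3) ij(2) by (metis nth_mem subsetD)
        ultimately have "(g \<circ> ts ! i) (xs ! j) \<in> V" by (rule emb_O)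
        thus "embedding_matrix (map (\<lambda>\<sigma>. g \<circ> \<sigma>) ts) xs $$ (i, j) \<in> V"
          using ij xs(2) by (simp add: embedding_matrix_def)
      qed (simp add: embedding_matrix_def xs(2))
      thus "det_sq (act g (set ts)) (set xs) \<in> V" unfolding det_sq_act[OF g ts xs(1,2)] by (rule V_closed(7))
    qed
    hence "of_rat (q\<^sup>2) \<in> V" using q by simp
    then obtain a b where "q\<^sup>2 = of_int a / of_int b" "\<not> int p dvd b" "b \<noteq> 0" by (rule of_rat_in_V)
    thus "\<exists>a b. q\<^sup>2 = of_int a / of_int b \<and> b \<noteq> 0 \<and> \<not> int p dvd b" by blast
  qed
  then obtain N where "q\<^sup>2 = of_int N" by (auto elim: Ints_cases)
  hence "?N = of_int N" using q by simp
  thus ?thesis using that by blast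
qed

end

section \<open>The bound at one prime and its assembly over all primes\<close>

context local_fld
begin

text \<open>Row \<open>\<sigma>\<close> is divided by \<open>\<sigma> y\<close>, whose value is at
  least n(Q) over e, that is \<open>n Q * rr Q\<close> in units of 1/\<open>EE\<close>; the
  remaining entries are integral at all embeddings, as \<open>vge_det\<close> requires.\<close>

lemma vge_det_ideal:
  assumes ts: "distinct ts" "set ts \<subseteq> Sig" and len: "length ts = length xs" and y: "y \<noteq> 0"
    and n: "\<And>\<sigma>. \<sigma> \<in> Sig \<Longrightarrow> \<sigma> (y / ww (pid \<sigma>) ^ n (pid \<sigma>)) \<in> V"
    and xs: "\<And>x \<sigma>. x \<in> set xs \<Longrightarrow> \<sigma> \<in> Sig \<Longrightarrow> \<sigma> (x / y) \<in> V"
  shows "vge EE ((\<Sum>\<sigma>\<in>set ts. n (pid \<sigma>) * rr (pid \<sigma>)) + class_weight (set ts)) (det (embedding_matrix ts xs))"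
proof -
  let ?n = "length ts" and ?xs = "map (\<lambda>x. x / y) xs"
  have y': "vge EE (n (pid \<sigma>) * rr (pid \<sigma>)) (\<sigma> y)" if s: "\<sigma> \<in> Sig" for \<sigma>
  proof -
    have "\<sigma> y = \<sigma> (y / ww (pid \<sigma>) ^ n (pid \<sigma>)) * \<sigma> (ww (pid \<sigma>)) ^ n (pid \<sigma>)"
      using uniformizer(2)[OF s] by (simp flip: embedding_simps(4,10)[OF s])
    thus ?thesis using vge_V_mult[OF n[OF s] vge_power[OF vge_uniformizer[OF s]]] by simp
  qed
  have tS: "ts ! i \<in> Sig" if "i < ?n" for i using ts(2) nth_mem[OF that] by blast
  have "embedding_matrix ts xs = mat ?n ?n (\<lambda>(i, j). (ts ! i) y * (ts ! i) (?xs ! j))"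
    by (rule eq_matI) (simp_all add: embedding_matrix_def len[symmetric] y flip: embedding_simps(4)[OF tS])
  moreover have "embedding_matrix ts ?xs = mat ?n ?n (\<lambda>(i, j). (ts ! i) (?xs ! j))"
    by (simp add: embedding_matrix_def len)
  ultimately have "det (embedding_matrix ts xs) = (\<Prod>i = 0..<?n. (ts ! i) y) * det (embedding_matrix ts ?xs)"
    by (simp add: det_scale_rows)
  also have "(\<Prod>i = 0..<?n. (ts ! i) y) = (\<Prod>\<sigma>\<in>set ts. \<sigma> y)"
    using prod.list_conv_set_nth[of "map (\<lambda>\<sigma>. \<sigma> y) ts"] prod.distinct_set_conv_list[OF ts(1), of "\<lambda>\<sigma>. \<sigma> y"] by simp
  finally have eq: "det (embedding_matrix ts xs) = (\<Prod>\<sigma>\<in>set ts. \<sigma> y) * det (embedding_matrix ts ?xs)" .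
  have "vge EE (class_weight (set ts)) (det (embedding_matrix ts ?xs))"
    by (rule vge_det[OF ts]) (use len xs in auto)
  moreover have "vge EE (\<Sum>\<sigma>\<in>set ts. n (pid \<sigma>) * rr (pid \<sigma>)) (\<Prod>\<sigma>\<in>set ts. \<sigma> y)"
    by (rule vge_prod) (use y' ts(2) in blast)
  ultimately show ?thesis unfolding eq by (simp add: vge_mult)
qed

text \<open>The exponents \<open>a\<close> and \<open>b\<close> are described by an inequality and
  an equation, so that both parts of the theorem can use the lemma. The factors 2 come from squaring
  the determinant.\<close>

lemma vdvd_prod_det_sq:
  assumes I: "ideal I (OI :: 'k ring)" "I \<noteq> {0}" and ts: "distinct ts" "set ts \<subseteq> Sig"
    and xs: "distinct xs" "length ts = length xs" "set xs \<subseteq> I"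
    and a: "EE * (a * (d - (\<Sum>Q\<in>Primes. ff Q))) \<le> 2 * (\<Sum>g\<in>G. class_weight (act g (set ts)))"
    and b: "2 * length ts * card G = b * d"
  shows "vdvd (P ^ (a * (d - inertia_sum ty p) + b * multiplicity p (ideal_index I)))
    (\<Prod>g\<in>G. det_sq (act g (set ts)) (set xs))"
proof -
  obtain y n where y: "y \<in> I" "y \<noteq> 0"
    "\<And>\<sigma>. \<sigma> \<in> Sig \<Longrightarrow> \<sigma> (y / ww (pid \<sigma>) ^ n (pid \<sigma>)) \<in> V \<and> \<sigma> (y / ww (pid \<sigma>) ^ n (pid \<sigma>)) \<notin> M"
    "\<And>x \<sigma>. x \<in> I \<Longrightarrow> \<sigma> \<in> Sig \<Longrightarrow> \<sigma> (x / y) \<in> V"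
    by (rule ideal_locally_principal[OF I]) blast
  let ?\<phi> = "\<lambda>\<sigma>. n (pid \<sigma>) * rr (pid \<sigma>)"
  let ?W = "\<lambda>g. (\<Sum>\<sigma>\<in>act g (set ts). ?\<phi> \<sigma>) + class_weight (act g (set ts))"
  let ?F = "\<Sum>Q\<in>Primes. ff Q" and ?N = "\<Sum>Q\<in>Primes. n Q * ff Q"
  let ?K = "a * (d - inertia_sum ty p) + b * multiplicity p (ideal_index I)"
  have "vge EE (\<Sum>g\<in>G. 2 * ?W g) (\<Prod>g\<in>G. det_sq (act g (set ts)) (set xs))"
  proof (rule vge_prod)
    fix g assume g: "g \<in> G"
    have "vge EE (?W g) (det (embedding_matrix (map (\<lambda>\<sigma>. g \<circ> \<sigma>) ts) xs))"
      unfolding act_list(2)[OF g ts, symmetric]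
    proof (rule vge_det_ideal[OF act_list(1)[OF g ts] _ _ y(2)])
      show "set (map (\<lambda>\<sigma>. g \<circ> \<sigma>) ts) \<subseteq> Sig" unfolding act_list(2)[OF g ts] by (rule card_act(2)[OF g ts(2)])
    qed (use xs y(3,4) in auto)
    thus "vge EE (2 * ?W g) (det_sq (act g (set ts)) (set xs))"
      unfolding det_sq_act[OF g ts xs(1,2)] by (rule vge_power)
  qed
  moreover have "EE * ?K \<le> (\<Sum>g\<in>G. 2 * ?W g)"
  proof -
    \<comment> \<open>The e f embeddings above \<open>Q\<close> contribute \<open>n Q * rr Q\<close>
      each; with \<open>rr Q * ee Q = EE\<close> this is \<open>EE\<close> times
      \<open>n Q * ff Q\<close>, the summand that bounds the exponent of p in the index.\<close>
    have "(\<Sum>\<sigma>\<in>Sig. ?\<phi> \<sigma>) = (\<Sum>Q\<in>Primes. ee Q * ff Q * (n Q * rr Q))" by (rule sum_above)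
    also have "\<dots> = (\<Sum>Q\<in>Primes. (rr Q * ee Q) * (n Q * ff Q))" by (simp add: ac_simps)
    also have "\<dots> = EE * ?N" by (simp add: rr_ee sum_distrib_left)
    finally have "d * (\<Sum>g\<in>G. \<Sum>\<sigma>\<in>act g (set ts). ?\<phi> \<sigma>) = length ts * card G * (EE * ?N)"
      using sum_act[OF ts(2), of ?\<phi>] distinct_card[OF ts(1)] by simp
    hence "d * (2 * (\<Sum>g\<in>G. \<Sum>\<sigma>\<in>act g (set ts). ?\<phi> \<sigma>)) = (2 * length ts * card G) * (EE * ?N)"
      by (simp only: mult.left_commute[of d 2] mult.assoc)
    hence "d * (2 * (\<Sum>g\<in>G. \<Sum>\<sigma>\<in>act g (set ts). ?\<phi> \<sigma>)) = d * (EE * (b * ?N))" unfolding b by (simp only: ac_simps)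
    hence 1: "2 * (\<Sum>g\<in>G. \<Sum>\<sigma>\<in>act g (set ts). ?\<phi> \<sigma>) = EE * (b * ?N)" using d_pos by simp
    have "multiplicity p (ideal_index I) \<le> ?N"
      by (rule multiplicity_ideal_index_le[OF I y(1,2)]) (fact y(3))
    hence "?K \<le> a * (d - ?F) + b * ?N" using sum_ff_le_inertia_sum
      by (intro add_mono mult_left_mono diff_le_mono2) auto
    hence "EE * ?K \<le> EE * (a * (d - ?F)) + EE * (b * ?N)" by (metis distrib_left mult_le_mono2)
    also have "\<dots> \<le> 2 * (\<Sum>g\<in>G. class_weight (act g (set ts))) + 2 * (\<Sum>g\<in>G. \<Sum>\<sigma>\<in>act g (set ts). ?\<phi> \<sigma>)"
      using a 1 by linarith
    finally show ?thesis by (simp add: sum.distrib sum_distrib_left distrib_left add.commute)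
  qed
  ultimately show ?thesis using vge_imp_vdvd[OF vge_mono EE_pos] by blast
qed

end

text \<open>If the index set of the product is infinite, the product is 1 and has multiplicity 0;
  the inequality covers this case too.\<close>

lemma (in number_fld) multiplicity_tame_discriminant_le:
  assumes "prime p" shows "multiplicity p (tame_discriminant ty) \<le> d - inertia_sum ty p"
proof -
  let ?A = "{p. prime p \<and> inertia_sum ty p \<noteq> d}"
  show ?thesis
  proof (cases "finite ?A")
    case True
    have "multiplicity p (\<Prod>p\<in>?A. p ^ (d - inertia_sum ty p)) = (if p \<in> ?A then d - inertia_sum ty p else 0)"
      by (rule multiplicity_prod_prime_powers[OF True _ assms]) blast
    thus ?thesis unfolding tame_discriminant_def by (cases "p \<in> ?A") (simp_all only: if_True if_False le_refl le0)
  next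
    case False
    hence "tame_discriminant ty = 1" unfolding tame_discriminant_def by (rule prod.infinite)
    thus ?thesis by simp
  qed
qed

lemma (in number_fld) tame_discriminant_pos: "tame_discriminant ty > 0"
  unfolding tame_discriminant_def by (intro prod_pos) (auto simp: prime_gt_0_nat)

text \<open>Multiplicities are compared prime by prime, each with a valuation ring of its own. The
  disjunction about \<open>a\<close> collects the exponents of both parts of the theorem;
  \<open>c\<close> is the group order divided by d or by the number of pairs of embeddings.\<close>

lemma (in number_fld) dvd_prod_det_sq:
  assumes I: "ideal I (OI :: 'k ring)" "I \<noteq> {0}" and ts: "distinct ts" "set ts \<subseteq> Sig"
    and xs: "distinct xs" "length ts = length xs" "set xs \<subseteq> I"
    and N: "(\<Prod>g\<in>G. det_sq (act g (set ts)) (set xs)) = of_int N"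
    and a: "card G = d * c \<and> a = c * (2 * length ts - d) \<or>
      two_homogeneous ty \<and> d \<ge> 2 \<and> card G = c * (d choose 2) \<and> a = c * (length ts choose 2)"
    and b: "2 * length ts * card G = b * d"
  shows "int (tame_discriminant ty ^ a * ideal_index I ^ b) dvd N"
proof (cases "N = 0")
  case False
  let ?D = "tame_discriminant ty ^ a * ideal_index I ^ b"
  note pos = tame_discriminant_pos ideal_index_pos[OF I]
  have "?D dvd nat \<bar>N\<bar>"
  proof (rule multiplicity_le_imp_dvd)
    show "?D \<noteq> 0" using pos by simp
    fix p :: nat assume p: "prime p"
    then obtain V :: "rat alg_closure set" where V: "valuation p V" using valuation_exists by blast
    interpret local_fld ty p V by (rule local_fldI[OF ideal.axioms(2)[OF I(1)] V])
    have "EE * (a * (d - (\<Sum>Q\<in>Primes. ff Q))) \<le> 2 * (\<Sum>g\<in>G. class_weight (act g (set ts)))"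
      using a sum_class_weight_ge[OF ts(2)] sum_class_weight_ge_two_homogeneous[OF _ ts(2)] distinct_card[OF ts(1)] by auto
    from vdvd_prod_det_sq[OF I ts xs this b]
    have "int p ^ (a * (d - inertia_sum ty p) + b * multiplicity p (ideal_index I)) dvd N"
      unfolding N by (rule vdvd_of_int)
    hence "int (p ^ (a * (d - inertia_sum ty p) + b * multiplicity p (ideal_index I))) dvd int (nat \<bar>N\<bar>)" by simp
    hence "p ^ (a * (d - inertia_sum ty p) + b * multiplicity p (ideal_index I)) dvd nat \<bar>N\<bar>"
      by (simp only: int_dvd_int_iff)
    hence le: "a * (d - inertia_sum ty p) + b * multiplicity p (ideal_index I) \<le> multiplicity p (nat \<bar>N\<bar>)"
      by (intro multiplicity_geI) (use False p not_prime_unit in auto)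
    have "multiplicity p ?D = a * multiplicity p (tame_discriminant ty) + b * multiplicity p (ideal_index I)"
      using p pos by (simp add: prime_elem_multiplicity_mult_distrib prime_elem_multiplicity_power_distrib)
    also have "\<dots> \<le> a * (d - inertia_sum ty p) + b * multiplicity p (ideal_index I)"
      using multiplicity_tame_discriminant_le[OF p] by simp
    finally show "multiplicity p ?D \<le> multiplicity p (nat \<bar>N\<bar>)" using le by linarith
  qed
  hence "int ?D dvd int (nat \<bar>N\<bar>)" by (simp only: int_dvd_int_iff)
  thus ?thesis by simp
qed simp

theorem theorem5:
  fixes \<nn> :: "'k::field_char_0 set"
    and X :: "'k set"
    and S :: "('k \<Rightarrow> rat alg_closure) set"
    and m d :: nat
  defines "d \<equiv> field_degree TYPE('k)"
  assumes "number_field TYPE('k)" and "d > 1"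
    and "ideal \<nn> ring_of_integers" and "\<nn> \<noteq> {0}"
    and "m \<in> {1..d}"
    and "X \<subseteq> \<nn>" and "finite X" and "card X = m"
    and "S \<subseteq> embeddings" and "finite S" and "card S = m"
  shows "\<exists>N::int.
    (\<Prod>g\<in>galois_group TYPE('k). det_sq (act g S) X) = of_int N \<and>
    (\<exists>a b::nat.
       real a = real (card (galois_group TYPE('k))) * max 0 (2 * real m / real d - 1) \<and>
       real b = real (card (galois_group TYPE('k))) * (2 * real m / real d) \<and>
       int (tame_discriminant TYPE('k) ^ a * ideal_index \<nn> ^ b) dvd N) \<and>
    (two_homogeneous TYPE('k) \<longrightarrow>
      (\<exists>a b::nat.
         real a = real (card (galois_group TYPE('k))) *
                    (real m * (real m - 1) / (real d * (real d - 1))) \<and>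
         real b = real (card (galois_group TYPE('k))) * (2 * real m / real d) \<and>
         int (tame_discriminant TYPE('k) ^ a * ideal_index \<nn> ^ b) dvd N))"
proof -
  interpret number_fld "TYPE('k)" by (rule number_fld.intro) fact
  let ?G = "galois_group TYPE('k)"
  note I = \<open>ideal \<nn> ring_of_integers\<close> \<open>\<nn> \<noteq> {0}\<close>
  have deg: "field_degree TYPE('k) = d" by (simp add: d_def)
  have d1: "d > 1" by fact
  obtain ts where ts: "distinct ts" "set ts = S" using finite_distinct_list[OF \<open>finite S\<close>] by blast
  obtain xs where xs: "distinct xs" "set xs = X" using finite_distinct_list[OF \<open>finite X\<close>] by blast
  have len: "length ts = m" "length xs = m"
    using ts xs distinct_card \<open>card S = m\<close> \<open>card X = m\<close> by metis+
  have sub: "set ts \<subseteq> Sig" "set xs \<subseteq> \<nn>" using ts xs \<open>S \<subseteq> embeddings\<close> \<open>X \<subseteq> \<nn>\<close> by simp_all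
  have len': "length ts = length xs" using len by simp
  obtain N where N: "(\<Prod>g\<in>?G. det_sq (act g (set ts)) (set xs)) = of_int N"
    using prod_det_sq_integer[OF ideal.axioms(2)[OF I(1)] ts(1) sub(1) xs(1) len'] sub(2) OI_ideal(1)[OF I(1)] by blast
  note dvd = dvd_prod_det_sq[OF I ts(1) sub(1) xs(1) len' sub(2) N, unfolded len deg]
  obtain \<sigma> where \<sigma>: "\<sigma> \<in> Sig" using card_Sig d_pos by (metis card.empty less_irrefl equals0I)
  \<comment> \<open>The order of the stabilizer of an embedding; writing the group order as d c
    turns the real exponents into the natural numbers c (2m - d), truncated at 0, and 2 m c.\<close>
  define c where "c = card {g \<in> ?G. g \<circ> \<sigma> = \<sigma>}"
  have c: "card ?G = d * c" using gal_count[OF \<sigma> \<sigma>] unfolding deg c_def by (simp only: mult.commute)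
  define b where "b = 2 * m * c"
  have b: "2 * m * card ?G = b * d" "real b = real (card ?G) * (2 * real m / real d)"
    using d1 by (simp_all add: b_def c)
  show ?thesis
  proof (intro exI[of _ N] conjI impI)
    show "(\<Prod>g\<in>?G. det_sq (act g S) X) = of_int N" using N ts xs by simp
    have "real (c * (2 * m - d)) = real (card ?G) * max 0 (2 * real m / real d - 1)"
      using d1 by (cases "d \<le> 2 * m") (simp_all add: c of_nat_diff max_def field_simps)
    thus "\<exists>a b. real a = real (card ?G) * max 0 (2 * real m / real d - 1) \<and>
       real b = real (card ?G) * (2 * real m / real d) \<and>
       int (tame_discriminant TYPE('k) ^ a * ideal_index \<nn> ^ b) dvd N"
      using dvd[of c "c * (2 * m - d)" b] b c by blast
  next
    assume th: "two_homogeneous TYPE('k)"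
    obtain A where A: "A \<subseteq> Sig" "card A = 2"
      using obtain_subset_with_card_n[of 2 Sig] d1 unfolding card_Sig deg by auto
    \<comment> \<open>The order of the setwise stabilizer of a pair of embeddings; the improved
      exponent is e times the number of pairs in an m-element set.\<close>
    define e where "e = card {g \<in> ?G. act g A = A}"
    have e: "card ?G = e * (d choose 2)" using gal_count_pairs[OF th A A] unfolding deg e_def by (rule sym)
    have two: "2 * real (t choose 2) = real t * (real t - 1)" for t
      using arg_cong[OF int_choose_two[of t], of real_of_int] by simp
    have "real (e * (m choose 2)) = real (card ?G) * (real m * (real m - 1) / (real d * (real d - 1)))"
      using d1 unfolding two[symmetric] e by simp
    thus "\<exists>a b. real a = real (card ?G) * (real m * (real m - 1) / (real d * (real d - 1))) \<and>
       real b = real (card ?G) * (2 * real m / real d) \<and>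
       int (tame_discriminant TYPE('k) ^ a * ideal_index \<nn> ^ b) dvd N"
      using dvd[of e "e * (m choose 2)" b] b e th d1 by (intro exI[of _ "e * (m choose 2)"] exI[of _ b]) simp
  qed
qed

end
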